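(* Let $(A^{(1)},\ldots,A^{(k)},\sigma)$ be a fully coisometric representation of a product system $E$ of $C^*$-correspondences over $\mathbb{N}^k$ on a finite dimensional Hilbert space $\mathcal{V}$, and let $(S^{(1)},\ldots,S^{(k)},\rho)$ be its unique minimal isometric dilation on a Hilbert space $\mathcal{H}$. Let $\mathfrak{A}$ be the unital algebra generated by $(A^{(1)},\ldots,A^{(k)},\sigma)$ and let $\mathfrak{S}$ be the unital WOT-closed algebra generated by $(S^{(1)},\ldots,S^{(k)},\rho)$. If $\mathcal{V}_1,\ldots,\mathcal{V}_l$ is a maximal set of pairwise orthogonal minimal $\mathfrak{A}^*$-invariant subspaces of $\mathcal{V}$, then $\hat{\mathcal{V}}=\mathcal{V}_1\oplus\cdots\oplus\mathcal{V}_l$ is the unique minimal cyclic coinvariant subspace of $\mathcal{V}$ and $\mathfrak{S}^*|_{\hat{\mathcal{V}}}$ is a $C^*$-algebra. Further, if $\mathbf{m}=(m_1,\ldots,m_k)\in\mathbb N^k$ with $m_i\neq0$ for $1\leq i\leq k$ and $\mathcal{W}_{\mathbf{m}}$ is the unique minimal cyclic coinvariant subspace for the representation $(S_{\mathbf{m}},\rho)$ of the $C^*$-correspondence $E(\mathbf m)$, then $\mathcal{W}_{\mathbf{m}}=\hat{\mathcal{V}}$.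
   Context: Conventions. All $C^*$-algebras and their representations on Hilbert spaces are unital; subspaces are closed; $\mathbb N=\{0,1,2,\dots\}$. A $C^*$-correspondence over $\mathcal A$ is a right Hilbert $C^*$-module over $\mathcal A$ with a left action of $\mathcal A$ by adjointable operators given by a $*$-homomorphism; tensor products are interior tensor products. A representation $(A,\sigma)$ of a $C^*$-correspondence $F$ over $\mathcal A$ on $\mathcal V$ is a completely contractive linear map $A:F\to\mathcal B(\mathcal V)$ and a unital representation $\sigma$ of $\mathcal A$ on $\mathcal V$ with $A(a\xi b)=\sigma(a)A(\xi)\sigma(b)$. $F\otimes_\sigma\mathcal V$ is the Hausdorff completion of the algebraic tensor product for $\langle\xi_1\otimes h_1,\xi_2\otimes h_2\rangle=\langle h_1,\sigma(\langle\xi_1,\xi_2\rangle)h_2\rangle$, and $\tilde A(\xi\otimes h)=A(\xi)h$ is a contraction $F\otimes_\sigma\mathcal V\to\mathcal V$. $(A,\sigma)$ is isometric if $A(\xi)^*A(\eta)=\sigma(\langle\xi,\eta\rangle)$ for all $\xi,\eta$, fully coisometric if $\tilde A\tilde A^*=I$. $\tilde A_m:F^m\otimes_\sigma\mathcal V\to\mathcal V$ is $\tilde A_m(\xi_1\otimes\cdots\otimes\xi_m\otimes h)=A(\xi_1)\cdots A(\xi_m)h$ ($F^m$ the $m$-fold tensor power, $F^0=\mathcal A$). A representation $(S,\rho)$ of $F$ on $\mathcal H\supseteq\mathcal V$ dilates $(A,\sigma)$ if $\mathcal V$ reduces $\rho$ with $\rho(a)|_{\mathcal V}=\sigma(a)$,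 $\mathcal V^\perp$ is invariant under all $S(\xi)$, and $P_{\mathcal V}S(\xi)|_{\mathcal V}=A(\xi)$. Product systems. A product system of $C^*$-correspondences over $\mathbb N^k$ (with coefficient algebra $\mathcal A$) is a semigroup $E$ with a semigroup homomorphism $p:E\to\mathbb N^k$ such that each $E(\mathbf n)=p^{-1}(\mathbf n)$ is a $C^*$-correspondence over $\mathcal A$, $E(\mathbf 0)=\mathcal A$, and multiplication $E(\mathbf n)\times E(\mathbf m)\to E(\mathbf n+\mathbf m)$ extends to an isomorphism $E(\mathbf n)\otimes E(\mathbf m)\cong E(\mathbf n+\mathbf m)$. With $\mathbf e_1,\dots,\mathbf e_k$ the standard generators, $E_i=E(\mathbf e_i)$; the isomorphisms $E_i\otimes E_j\cong E(\mathbf e_i+\mathbf e_j)\cong E_j\otimes E_i$ give isomorphisms $t_{i,j}:E_i\otimes E_j\to E_j\otimes E_i$ ($t_{i,i}$ is the identity). $E(\mathbf n)$ is identified with $E_1^{n_1}\otimes\cdots\otimes E_k^{n_k}$. A representation $(A^{(1)},\dots,A^{(k)},\sigma)$ of $E$ on $\mathcal V$ consists of representations $(A^{(i)},\sigma)$ of $E_i$ on $\mathcal V$ with $\tilde A^{(i)}(I_{E_i}\otimes\tilde A^{(j)})=\tilde A^{(j)}(I_{E_j}\otimes\tilde A^{(i)})(t_{i,j}\otimes I_{\mathcal V})$ for all $i,j$. It is isometric (fully coisometric) if each $(A^{(i)},\sigma)$ is. For $\mathbf n\in\mathbb N^k$, $\tilde A_{\mathbf n}=\tilde A^{(1)}_{n_1}(I_{E_1^{n_1}}\otimes\tilde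 A^{(2)}_{n_2})\cdots(I_{E_1^{n_1}}\otimes\cdots\otimes I_{E_{k-1}^{n_{k-1}}}\otimes\tilde A^{(k)}_{n_k}):E(\mathbf n)\otimes_\sigma\mathcal V\to\mathcal V$, and $(A_{\mathbf n},\sigma)$ is the representation of $E(\mathbf n)$ given by $A_{\mathbf n}(\xi)h=\tilde A_{\mathbf n}(\xi\otimes h)$; likewise $(S_{\mathbf n},\rho)$. A representation $(S^{(1)},\dots,S^{(k)},\rho)$ of $E$ on $\mathcal H\supseteq\mathcal V$ dilates $(A^{(1)},\dots,A^{(k)},\sigma)$ if each $(S^{(i)},\rho)$ dilates $(A^{(i)},\sigma)$; it is an isometric dilation if it is an isometric representation, and minimal if $\mathcal H=\bigvee_{\mathbf n\in\mathbb N^k}\tilde S_{\mathbf n}(E(\mathbf n)\otimes\mathcal V)$. Fully coisometric representations of $E$ have a minimal isometric dilation, unique up to unitary equivalence. The unital WOT-closed algebra generated by a representation of $E$ is the WOT-closure of the algebra generated by $I$, all $S^{(i)}(\xi_i)$ ($\xi_i\in E_i$, $1\le i\le k$) and all $\rho(a)$ ($a\in\mathcal A$); for a representation $(S,\rho)$ of one correspondence it is the WOT-closure of the algebra generated by $I$, all $S(\xi)$ and $\rho(a)$. A minimal $\mathfrak A^*$-invariant subspace is a non-zero one containing no proper non-zero $\mathfrak A^*$-invariant subspace. For an algebra $\mathfrak C$ acting on a Hilbert space $\mathcal X$, a minimal cyclic coinvariant subspace (for $\mathfrak C$) of $\mathcal X$ is a $\mathfrak C^*$-invariant subspace $\mathcal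 X'$ which is cyclic (closed span of $\mathfrak C\mathcal X'$ is $\mathcal X$) and has no proper $\mathfrak C^*$-invariant subspace which is cyclic for $\mathfrak C$. A minimal cyclic coinvariant subspace for a representation is one for the unital WOT-closed algebra it generates. In the statement, "minimal cyclic coinvariant subspace of $\mathcal V$" refers to $\mathfrak A$ acting on $\mathcal V$. (The representation $(S_{\mathbf m},\rho)$ has a unique minimal cyclic coinvariant subspace when all $m_i\ne0$.) *)

theory Defs
  imports "HOL-Analysis.Analysis"
begin

section \<open>Unital C*-algebras and complex Hilbert spaces\<close>

class scaleC =
  fixes scaleC :: "complex \<Rightarrow> 'a \<Rightarrow> 'a" (infixr "*\<^sub>C" 75)

class complex_vector = scaleC + real_vector +
  assumes scaleC_add_right: "c *\<^sub>C (x + y) = c *\<^sub>C x + c *\<^sub>C y"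
    and scaleC_add_left: "(c + d) *\<^sub>C x = c *\<^sub>C x + d *\<^sub>C x"
    and scaleC_scaleC: "c *\<^sub>C (d *\<^sub>C x) = (c * d) *\<^sub>C x"
    and scaleC_one: "1 *\<^sub>C x = x"
    and scaleR_scaleC: "r *\<^sub>R x = complex_of_real r *\<^sub>C x"

class complex_normed_vector = complex_vector + real_normed_vector +
  assumes norm_scaleC: "norm (c *\<^sub>C x) = cmod c * norm x"

text \<open>The superclass \<^class>\<open>monoid_mult\<close> provides the unit without
  imposing \<open>0 \<noteq> 1\<close>, so the zero algebra is allowed.\<close>

class unital_cstar_algebra =
  complex_normed_vector + real_normed_algebra + monoid_mult + complete_space +
  fixes star :: "'a \<Rightarrow> 'a"
  assumes mult_scaleC_left: "(c *\<^sub>C x) * y = c *\<^sub>C (x * y)"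
    and mult_scaleC_right: "x * (c *\<^sub>C y) = c *\<^sub>C (x * y)"
    and star_star: "star (star x) = x"
    and star_add: "star (x + y) = star x + star y"
    and star_scaleC: "star (c *\<^sub>C x) = cnj c *\<^sub>C star x"
    and star_mult: "star (x * y) = star y * star x"
    and cstar_identity: "norm (star x * x) = (norm x)\<^sup>2"

instantiation complex :: unital_cstar_algebra
begin

definition scaleC_complex :: "complex \<Rightarrow> complex \<Rightarrow> complex"
  where "scaleC_complex = (*)"

definition star_complex :: "complex \<Rightarrow> complex"
  where "star_complex = cnj"

instance
  by standard
    (auto simp: scaleC_complex_def star_complex_def algebra_simps scaleR_conv_of_real
      norm_mult power2_eq_square)

end

text \<open>Inner products are linear in the second variable, as for right Hilbert modules.\<close>

class chilbert_space = complex_normed_vector + complete_space +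
  fixes cinner :: "'a \<Rightarrow> 'a \<Rightarrow> complex"
  assumes cinner_commute: "cinner x y = cnj (cinner y x)"
    and cinner_add_right: "cinner x (y + z) = cinner x y + cinner x z"
    and cinner_scaleC_right: "cinner x (c *\<^sub>C y) = c * cinner x y"
    and cinner_ge_zero: "0 \<le> Re (cinner x x)"
    and norm_eq_sqrt_cinner: "norm x = sqrt (Re (cinner x x))"

definition csubspace :: "'h::complex_vector set \<Rightarrow> bool"
  where "csubspace = module.subspace scaleC"

definition cspan :: "'h::complex_vector set \<Rightarrow> 'h set"
  where "cspan = module.span scaleC"

definition closed_csubspace :: "'h::complex_normed_vector set \<Rightarrow> bool"
  where "closed_csubspace X \<longleftrightarrow> csubspace X \<and> closed X"

definition closed_cspan :: "'h::complex_normed_vector set \<Rightarrow> 'h set"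
  where "closed_cspan X = closure (cspan X)"

definition fin_dim :: "'h::complex_vector set \<Rightarrow> bool"
  where "fin_dim X \<longleftrightarrow> (\<exists>B. finite B \<and> X = cspan B)"

definition orth_compl :: "'h::chilbert_space set \<Rightarrow> 'h set"
  where "orth_compl X = {y. \<forall>x\<in>X. cinner x y = 0}"

definition proj :: "'h::chilbert_space set \<Rightarrow> 'h \<Rightarrow> 'h"
  where "proj X y = (THE x. x \<in> X \<and> y - x \<in> orth_compl X)"

text \<open>An operator on a closed subspace \<open>X\<close> of the ambient Hilbert space is represented by
  a function on the ambient type; only its values on \<open>X\<close> matter.\<close>

definition bounded_op :: "'h::chilbert_space set \<Rightarrow> ('h \<Rightarrow> 'h) \<Rightarrow> bool"
  where "bounded_op X T \<longleftrightarrow>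
    (\<forall>x\<in>X. T x \<in> X) \<and>
    (\<forall>x\<in>X. \<forall>y\<in>X. T (x + y) = T x + T y) \<and>
    (\<forall>x\<in>X. \<forall>c. T (c *\<^sub>C x) = c *\<^sub>C T x) \<and>
    (\<exists>K. \<forall>x\<in>X. norm (T x) \<le> K * norm x)"


section \<open>Hilbert C*-modules and C*-correspondences\<close>

text \<open>An \<open>('a,'b,'x) corr\<close> is a right Hilbert module over \<open>'b\<close> with a left action of \<open>'a\<close>.
  As \<open>'b\<close> is unital, scalar multiplication is the right action of the multiples of the unit.
  The same record is used for the (semi-inner-product) structures that are completed below.\<close>

record ('a, 'b, 'x) corr =
  car :: "'x set"
  zer :: 'x
  add :: "'x \<Rightarrow> 'x \<Rightarrow> 'x"
  ract :: "'x \<Rightarrow> 'b \<Rightarrow> 'x"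
  ip :: "'x \<Rightarrow> 'x \<Rightarrow> 'b"
  lact :: "'a \<Rightarrow> 'x \<Rightarrow> 'x"

definition mnorm :: "('a, 'b::unital_cstar_algebra, 'x) corr \<Rightarrow> 'x \<Rightarrow> real"
  where "mnorm M x = sqrt (norm (ip M x x))"

definition mdist :: "('a, 'b::unital_cstar_algebra, 'x) corr \<Rightarrow> 'x \<Rightarrow> 'x \<Rightarrow> real"
  where "mdist M x y = mnorm M (add M x (ract M y (- 1)))"

definition msum :: "('a, 'b, 'x) corr \<Rightarrow> 'x list \<Rightarrow> 'x"
  where "msum M xs = foldr (add M) xs (zer M)"

definition cauchy_seqs :: "('a, 'b::unital_cstar_algebra, 'x) corr \<Rightarrow> (nat \<Rightarrow> 'x) set"
  where "cauchy_seqs M = {u. (\<forall>n. u n \<in> car M) \<and>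
    (\<forall>e>0. \<exists>N. \<forall>m\<ge>N. \<forall>n\<ge>N. mdist M (u m) (u n) < e)}"

definition hilbert_module :: "('a, 'b::unital_cstar_algebra, 'x) corr \<Rightarrow> bool"
  where "hilbert_module M \<longleftrightarrow>
    zer M \<in> car M \<and>
    (\<forall>x\<in>car M. \<forall>y\<in>car M. add M x y \<in> car M) \<and>
    (\<forall>x\<in>car M. \<forall>y\<in>car M. \<forall>z\<in>car M. add M (add M x y) z = add M x (add M y z)) \<and>
    (\<forall>x\<in>car M. \<forall>y\<in>car M. add M x y = add M y x) \<and>
    (\<forall>x\<in>car M. add M (zer M) x = x) \<and>
    (\<forall>x\<in>car M. \<exists>y\<in>car M. add M x y = zer M) \<and>
    (\<forall>x\<in>car M. \<forall>b. ract M x b \<in> car M) \<and>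
    (\<forall>x\<in>car M. \<forall>b c. ract M x (b + c) = add M (ract M x b) (ract M x c)) \<and>
    (\<forall>x\<in>car M. \<forall>y\<in>car M. \<forall>b. ract M (add M x y) b = add M (ract M x b) (ract M y b)) \<and>
    (\<forall>x\<in>car M. \<forall>b c. ract M x (b * c) = ract M (ract M x b) c) \<and>
    (\<forall>x\<in>car M. ract M x 1 = x) \<and>
    (\<forall>x\<in>car M. \<forall>y\<in>car M. \<forall>z\<in>car M. ip M x (add M y z) = ip M x y + ip M x z) \<and>
    (\<forall>x\<in>car M. \<forall>y\<in>car M. \<forall>b. ip M x (ract M y b) = ip M x y * b) \<and>
    (\<forall>x\<in>car M. \<forall>y\<in>car M. ip M y x = star (ip M x y)) \<and>
    (\<forall>x\<in>car M. \<exists>b. ip M x x = star b * b) \<and>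
    (\<forall>x\<in>car M. ip M x x = 0 \<longrightarrow> x = zer M) \<and>
    (\<forall>u\<in>cauchy_seqs M. \<exists>x\<in>car M. (\<lambda>n. mdist M (u n) x) \<longlonglongrightarrow> 0)"

text \<open>The identity for \<open>ip M (lact M a x) y\<close> says that \<open>lact M a\<close> is adjointable with adjoint
  \<open>lact M (star a)\<close>; linearity of \<open>lact M a\<close> in the module variable is a consequence.\<close>

definition correspondence ::
    "('a::unital_cstar_algebra, 'b::unital_cstar_algebra, 'x) corr \<Rightarrow> bool"
  where "correspondence M \<longleftrightarrow> hilbert_module M \<and>
    (\<forall>a. \<forall>x\<in>car M. lact M a x \<in> car M) \<and>
    (\<forall>a b. \<forall>x\<in>car M. lact M (a + b) x = add M (lact M a x) (lact M b x)) \<and>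
    (\<forall>a c. \<forall>x\<in>car M. lact M (c *\<^sub>C a) x = ract M (lact M a x) (c *\<^sub>C 1)) \<and>
    (\<forall>a b. \<forall>x\<in>car M. lact M (a * b) x = lact M a (lact M b x)) \<and>
    (\<forall>a. \<forall>x\<in>car M. \<forall>y\<in>car M. ip M (lact M a x) y = ip M x (lact M (star a) y))"

definition correspondence_iso ::
    "('a, 'b, 'x) corr \<Rightarrow> ('a, 'b, 'y) corr \<Rightarrow> ('x \<Rightarrow> 'y) \<Rightarrow> bool"
  where "correspondence_iso M N U \<longleftrightarrow>
    bij_betw U (car M) (car N) \<and>
    (\<forall>x\<in>car M. \<forall>y\<in>car M. U (add M x y) = add N (U x) (U y)) \<and>
    (\<forall>x\<in>car M. \<forall>b. U (ract M x b) = ract N (U x) b) \<and>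
    (\<forall>x\<in>car M. \<forall>a. U (lact M a x) = lact N a (U x)) \<and>
    (\<forall>x\<in>car M. \<forall>y\<in>car M. ip N (U x) (U y) = ip M x y)"

definition alg_corr :: "('a::unital_cstar_algebra, 'a, 'a) corr"
  where "alg_corr = \<lparr>car = UNIV, zer = 0, add = (+), ract = (*),
    ip = (\<lambda>a b. star a * b), lact = (*)\<rparr>"

text \<open>A Hilbert space is a Hilbert module over the complex numbers; an action \<open>\<sigma>\<close> on it
  makes it a correspondence, so that \<open>F \<otimes>\<^sub>\<sigma> V\<close> is an instance of the interior tensor
  product.\<close>

definition hs_corr :: "'h::chilbert_space set \<Rightarrow> ('a \<Rightarrow> 'h \<Rightarrow> 'h) \<Rightarrow> ('a, complex, 'h) corr"
  where "hs_corr V \<sigma> = \<lparr>car = V, zer = 0, add = (+), ract = (\<lambda>x c. c *\<^sub>C x),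
    ip = cinner, lact = \<sigma>\<rparr>"

definition adj ::
    "('a, 'b, 'x) corr \<Rightarrow> ('c, 'b, 'y) corr \<Rightarrow> ('x \<Rightarrow> 'y) \<Rightarrow> 'y \<Rightarrow> 'x"
  where "adj M N T y = (THE z. z \<in> car M \<and> (\<forall>x\<in>car M. ip N (T x) y = ip M x z))"

definition adj_on :: "'h::chilbert_space set \<Rightarrow> ('h \<Rightarrow> 'h) \<Rightarrow> 'h \<Rightarrow> 'h"
  where "adj_on X T y = (THE z. z \<in> X \<and> (\<forall>x\<in>X. cinner (T x) y = cinner x z))"


section \<open>Interior tensor products\<close>

text \<open>Hausdorff completion with respect to a semi-inner product: Cauchy sequences modulo
  sequences at distance tending to 0.\<close>

definition cls :: "('a, 'b::unital_cstar_algebra, 'x) corr \<Rightarrow> (nat \<Rightarrow> 'x) \<Rightarrow> (nat \<Rightarrow> 'x) set"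
  where "cls M u = {v \<in> cauchy_seqs M. (\<lambda>n. mdist M (u n) (v n)) \<longlonglongrightarrow> 0}"

definition rep :: "(nat \<Rightarrow> 'x) set \<Rightarrow> nat \<Rightarrow> 'x"
  where "rep c = (SOME u. u \<in> c)"

definition completion ::
    "('a, 'b::unital_cstar_algebra, 'x) corr \<Rightarrow> ('a, 'b, (nat \<Rightarrow> 'x) set) corr"
  where "completion M = \<lparr>
    car = cls M ` cauchy_seqs M,
    zer = cls M (\<lambda>_. zer M),
    add = (\<lambda>c d. cls M (\<lambda>n. add M (rep c n) (rep d n))),
    ract = (\<lambda>c b. cls M (\<lambda>n. ract M (rep c n) b)),
    ip = (\<lambda>c d. lim (\<lambda>n. ip M (rep c n) (rep d n))),
    lact = (\<lambda>a c. cls M (\<lambda>n. lact M a (rep c n)))\<rparr>"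

text \<open>The list \<open>[(x\<^sub>1,y\<^sub>1),\<dots>,(x\<^sub>r,y\<^sub>r)]\<close> stands for the sum of the \<open>x\<^sub>i \<otimes> y\<^sub>i\<close>.  The relations of
  the algebraic tensor product need not be imposed: they hold up to vectors of seminorm 0,
  hence in the Hausdorff completion.\<close>

definition formal_tensor ::
    "('a, 'b, 'x) corr \<Rightarrow> ('b, 'c::unital_cstar_algebra, 'y) corr \<Rightarrow> ('a, 'c, ('x \<times> 'y) list) corr"
  where "formal_tensor M N = \<lparr>
    car = {us. set us \<subseteq> car M \<times> car N},
    zer = [],
    add = (@),
    ract = (\<lambda>us b. map (\<lambda>(x, y). (x, ract N y b)) us),
    ip = (\<lambda>us vs. \<Sum>(x, y)\<leftarrow>us. \<Sum>(x', y')\<leftarrow>vs. ip N y (lact N (ip M x x') y')),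
    lact = (\<lambda>a us. map (\<lambda>(x, y). (lact M a x, y)) us)\<rparr>"

type_synonym ('x, 'y) tens = "(nat \<Rightarrow> ('x \<times> 'y) list) set"

definition tensor ::
    "('a, 'b, 'x) corr \<Rightarrow> ('b, 'c::unital_cstar_algebra, 'y) corr \<Rightarrow> ('a, 'c, ('x, 'y) tens) corr"
    (infixr "\<otimes>\<^sub>m" 70)
  where "M \<otimes>\<^sub>m N = completion (formal_tensor M N)"

definition elem_tensor ::
    "('a, 'b, 'x) corr \<Rightarrow> ('b, 'c::unital_cstar_algebra, 'y) corr \<Rightarrow> 'x \<Rightarrow> 'y \<Rightarrow> ('x, 'y) tens"
  where "elem_tensor M N x y = cls (formal_tensor M N) (\<lambda>_. [(x, y)])"

text \<open>The closed subspace \<open>M \<otimes> W\<close> of \<open>M \<otimes> N\<close>, for \<open>W \<subseteq> N\<close>.\<close>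

definition subtensor ::
    "('a, 'b, 'x) corr \<Rightarrow> ('b, 'c::unital_cstar_algebra, 'y) corr \<Rightarrow> 'y set \<Rightarrow> ('x, 'y) tens set"
  where "subtensor M N W =
    {c \<in> car (M \<otimes>\<^sub>m N). \<exists>u\<in>c. \<forall>n. \<forall>(x, y)\<in>set (u n). y \<in> W}"

text \<open>\<open>lift X f\<close> is the continuous extension to a tensor product of the map sending
  the sum of the \<open>x\<^sub>i \<otimes> y\<^sub>i\<close> to the sum of the \<open>f x\<^sub>i y\<^sub>i\<close> in \<open>X\<close>.\<close>

definition lift ::
    "('a, 'b::unital_cstar_algebra, 'z) corr \<Rightarrow> ('x \<Rightarrow> 'y \<Rightarrow> 'z) \<Rightarrow> ('x, 'y) tens \<Rightarrow> 'z"
  where "lift X f c = (THE z. z \<in> car X \<and>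
    (\<forall>u\<in>c. (\<lambda>n. mdist X (msum X (map (\<lambda>(x, y). f x y) (u n))) z) \<longlonglongrightarrow> 0))"

text \<open>\<open>tensor_map M' N' f g\<close> is \<open>f \<otimes> g\<close> with codomain \<open>M' \<otimes> N'\<close>.\<close>

definition tensor_map ::
    "('a, 'b, 'x2) corr \<Rightarrow> ('b, 'c::unital_cstar_algebra, 'y2) corr \<Rightarrow>
     ('x1 \<Rightarrow> 'x2) \<Rightarrow> ('y1 \<Rightarrow> 'y2) \<Rightarrow> ('x1, 'y1) tens \<Rightarrow> ('x2, 'y2) tens"
  where "tensor_map M' N' f g = lift (M' \<otimes>\<^sub>m N') (\<lambda>x y. elem_tensor M' N' (f x) (g y))"

text \<open>The canonical identification of \<open>(L \<otimes> M) \<otimes> N\<close> with \<open>L \<otimes> (M \<otimes> N)\<close>.\<close>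

definition assoc ::
    "('a, 'b, 'x) corr \<Rightarrow> ('b, 'c::unital_cstar_algebra, 'y) corr \<Rightarrow>
     ('c, 'd::unital_cstar_algebra, 'z) corr \<Rightarrow>
     (('x, 'y) tens, 'z) tens \<Rightarrow> ('x, ('y, 'z) tens) tens"
  where "assoc L M N = lift (L \<otimes>\<^sub>m M \<otimes>\<^sub>m N)
    (\<lambda>c z. lift (L \<otimes>\<^sub>m M \<otimes>\<^sub>m N)
      (\<lambda>x y. elem_tensor L (M \<otimes>\<^sub>m N) x (elem_tensor M N y z)) c)"


section \<open>Representations of a C*-correspondence\<close>

text \<open>Norm of an \<open>n \<times> n\<close> matrix of maps \<open>X \<rightarrow> Y\<close>, as an operator from \<open>X\<^sup>n\<close> to \<open>Y\<^sup>n\<close>.\<close>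

definition column_norm ::
    "('a, 'b::unital_cstar_algebra, 'x) corr \<Rightarrow> nat \<Rightarrow> (nat \<Rightarrow> 'x) \<Rightarrow> real"
  where "column_norm X n x = sqrt (norm (\<Sum>i<n. ip X (x i) (x i)))"

definition matrix_norm ::
    "('a, 'b::unital_cstar_algebra, 'x) corr \<Rightarrow> ('c, 'b, 'y) corr \<Rightarrow> nat \<Rightarrow>
     (nat \<Rightarrow> nat \<Rightarrow> 'x \<Rightarrow> 'y) \<Rightarrow> real"
  where "matrix_norm X Y n T =
    Sup {column_norm Y n (\<lambda>i. msum Y (map (\<lambda>j. T i j (x j)) [0..<n])) | x.
      (\<forall>j<n. x j \<in> car X) \<and> column_norm X n x \<le> 1}"

text \<open>The operator space structure of \<open>F\<close> is the one inherited from the linking algebra: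
  \<open>\<xi> \<in> F\<close> is the operator \<open>a \<mapsto> \<xi>a\<close> from the coefficient algebra to \<open>F\<close>.\<close>

definition completely_contractive ::
    "('a::unital_cstar_algebra, 'a, 'x) corr \<Rightarrow> 'h::chilbert_space set \<Rightarrow>
     ('x \<Rightarrow> 'h \<Rightarrow> 'h) \<Rightarrow> ('a \<Rightarrow> 'h \<Rightarrow> 'h) \<Rightarrow> bool"
  where "completely_contractive F V A \<sigma> \<longleftrightarrow>
    (\<forall>n \<xi>. (\<forall>i<n. \<forall>j<n. \<xi> i j \<in> car F) \<longrightarrow>
      matrix_norm (hs_corr V \<sigma>) (hs_corr V \<sigma>) n (\<lambda>i j. A (\<xi> i j))
        \<le> matrix_norm alg_corr F n (\<lambda>i j. ract F (\<xi> i j)))"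

definition algebra_rep ::
    "'h::chilbert_space set \<Rightarrow> ('a::unital_cstar_algebra \<Rightarrow> 'h \<Rightarrow> 'h) \<Rightarrow> bool"
  where "algebra_rep V \<sigma> \<longleftrightarrow>
    (\<forall>a. bounded_op V (\<sigma> a)) \<and>
    (\<forall>a b. \<forall>h\<in>V. \<sigma> (a + b) h = \<sigma> a h + \<sigma> b h) \<and>
    (\<forall>a c. \<forall>h\<in>V. \<sigma> (c *\<^sub>C a) h = c *\<^sub>C \<sigma> a h) \<and>
    (\<forall>a b. \<forall>h\<in>V. \<sigma> (a * b) h = \<sigma> a (\<sigma> b h)) \<and>
    (\<forall>h\<in>V. \<sigma> 1 h = h) \<and>
    (\<forall>a. \<forall>h\<in>V. \<forall>k\<in>V. cinner (\<sigma> a h) k = cinner h (\<sigma> (star a) k))"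

definition representation ::
    "('a::unital_cstar_algebra, 'a, 'x) corr \<Rightarrow> 'h::chilbert_space set \<Rightarrow>
     ('x \<Rightarrow> 'h \<Rightarrow> 'h) \<Rightarrow> ('a \<Rightarrow> 'h \<Rightarrow> 'h) \<Rightarrow> bool"
  where "representation F V A \<sigma> \<longleftrightarrow>
    algebra_rep V \<sigma> \<and>
    (\<forall>\<xi>\<in>car F. bounded_op V (A \<xi>)) \<and>
    (\<forall>\<xi>\<in>car F. \<forall>\<eta>\<in>car F. \<forall>h\<in>V. A (add F \<xi> \<eta>) h = A \<xi> h + A \<eta> h) \<and>
    (\<forall>\<xi>\<in>car F. \<forall>c. \<forall>h\<in>V. A (ract F \<xi> (c *\<^sub>C 1)) h = c *\<^sub>C A \<xi> h) \<and>
    completely_contractive F V A \<sigma> \<and>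
    (\<forall>a b. \<forall>\<xi>\<in>car F. \<forall>h\<in>V. A (lact F a (ract F \<xi> b)) h = \<sigma> a (A \<xi> (\<sigma> b h)))"

definition tilde ::
    "'h::chilbert_space set \<Rightarrow> ('x \<Rightarrow> 'h \<Rightarrow> 'h) \<Rightarrow> ('a \<Rightarrow> 'h \<Rightarrow> 'h) \<Rightarrow> ('x, 'h) tens \<Rightarrow> 'h"
  where "tilde V A \<sigma> = lift (hs_corr V \<sigma>) A"

definition isometric_rep ::
    "('a::unital_cstar_algebra, 'a, 'x) corr \<Rightarrow> 'h::chilbert_space set \<Rightarrow>
     ('x \<Rightarrow> 'h \<Rightarrow> 'h) \<Rightarrow> ('a \<Rightarrow> 'h \<Rightarrow> 'h) \<Rightarrow> bool"
  where "isometric_rep F V A \<sigma> \<longleftrightarrow>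
    (\<forall>\<xi>\<in>car F. \<forall>\<eta>\<in>car F. \<forall>h\<in>V. adj_on V (A \<xi>) (A \<eta> h) = \<sigma> (ip F \<xi> \<eta>) h)"

definition fully_coisometric_rep ::
    "('a::unital_cstar_algebra, 'a, 'x) corr \<Rightarrow> 'h::chilbert_space set \<Rightarrow>
     ('x \<Rightarrow> 'h \<Rightarrow> 'h) \<Rightarrow> ('a \<Rightarrow> 'h \<Rightarrow> 'h) \<Rightarrow> bool"
  where "fully_coisometric_rep F V A \<sigma> \<longleftrightarrow>
    (\<forall>h\<in>V. tilde V A \<sigma> (adj (F \<otimes>\<^sub>m hs_corr V \<sigma>) (hs_corr V \<sigma>) (tilde V A \<sigma>) h) = h)"

text \<open>\<open>(S, \<rho>)\<close> acts on the whole ambient Hilbert space, of which \<open>V\<close> is a closed subspace.\<close>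

definition dilates ::
    "('a::unital_cstar_algebra, 'a, 'x) corr \<Rightarrow>
     ('x \<Rightarrow> 'h \<Rightarrow> 'h) \<Rightarrow> ('a \<Rightarrow> 'h \<Rightarrow> 'h) \<Rightarrow>
     'h::chilbert_space set \<Rightarrow> ('x \<Rightarrow> 'h \<Rightarrow> 'h) \<Rightarrow> ('a \<Rightarrow> 'h \<Rightarrow> 'h) \<Rightarrow> bool"
  where "dilates F S \<rho> V A \<sigma> \<longleftrightarrow>
    (\<forall>a. \<rho> a ` V \<subseteq> V \<and> \<rho> a ` orth_compl V \<subseteq> orth_compl V) \<and>
    (\<forall>a. \<forall>h\<in>V. \<rho> a h = \<sigma> a h) \<and>
    (\<forall>\<xi>\<in>car F. S \<xi> ` orth_compl V \<subseteq> orth_compl V) \<and>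
    (\<forall>\<xi>\<in>car F. \<forall>h\<in>V. proj V (S \<xi> h) = A \<xi> h)"


section \<open>Product systems over \<open>\<nat>\<^sup>k\<close> and their representations\<close>

text \<open>The index type \<open>'k\<close> has \<open>k\<close> elements and \<open>\<nat>\<^sup>k\<close> is \<open>(nat, 'k) vec\<close>, also written \<open>nat ^ 'k\<close>,
  with generators \<open>axis i 1\<close>.  The semigroup is the type \<open>'e\<close>; \<open>E n\<close> is the correspondence carried
  by the fibre of \<open>p\<close> over \<open>n\<close>; \<open>\<iota>\<close> identifies the coefficient algebra with \<open>E 0\<close>, its elements
  multiplying on either side through the module actions.\<close>

type_synonym ('k, 'a, 'e) fibres = "(nat, 'k) vec \<Rightarrow> ('a, 'a, 'e) corr"

definition mult_map ::
    "('k::finite, 'a::unital_cstar_algebra, 'e::semigroup_mult) fibres \<Rightarrow>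
     (nat, 'k) vec \<Rightarrow> (nat, 'k) vec \<Rightarrow> ('e, 'e) tens \<Rightarrow> 'e"
  where "mult_map E n m = lift (E (n + m)) (*)"

definition product_system ::
    "('e::semigroup_mult \<Rightarrow> (nat, 'k::finite) vec) \<Rightarrow>
     ('k, 'a::unital_cstar_algebra, 'e) fibres \<Rightarrow> ('a \<Rightarrow> 'e) \<Rightarrow> bool"
  where "product_system p E \<iota> \<longleftrightarrow>
    (\<forall>x y. p (x * y) = p x + p y) \<and>
    (\<forall>n. car (E n) = p -` {n}) \<and>
    (\<forall>n. correspondence (E n)) \<and>
    correspondence_iso alg_corr (E 0) \<iota> \<and>
    (\<forall>a x. \<iota> a * x = lact (E (p x)) a x) \<and>
    (\<forall>a x. x * \<iota> a = ract (E (p x)) x a) \<and>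
    (\<forall>n m. correspondence_iso (E n \<otimes>\<^sub>m E m) (E (n + m)) (mult_map E n m))"

abbreviation gen_fibre :: "('k::finite, 'a, 'e) fibres \<Rightarrow> 'k \<Rightarrow> ('a, 'a, 'e) corr"
  where "gen_fibre E i \<equiv> E (axis i 1)"

definition mult_inv ::
    "('k::finite, 'a::unital_cstar_algebra, 'e::semigroup_mult) fibres \<Rightarrow>
     (nat, 'k) vec \<Rightarrow> (nat, 'k) vec \<Rightarrow> 'e \<Rightarrow> ('e, 'e) tens"
  where "mult_inv E n m = inv_into (car (E n \<otimes>\<^sub>m E m)) (mult_map E n m)"

definition flip ::
    "('k::finite, 'a::unital_cstar_algebra, 'e::semigroup_mult) fibres \<Rightarrow>
     'k \<Rightarrow> 'k \<Rightarrow> ('e, 'e) tens \<Rightarrow> ('e, 'e) tens"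
  where "flip E i j c = mult_inv E (axis j 1) (axis i 1) (mult_map E (axis i 1) (axis j 1) c)"

definition ps_representation ::
    "('k::finite, 'a::unital_cstar_algebra, 'e::semigroup_mult) fibres \<Rightarrow>
     'h::chilbert_space set \<Rightarrow> ('k \<Rightarrow> 'e \<Rightarrow> 'h \<Rightarrow> 'h) \<Rightarrow> ('a \<Rightarrow> 'h \<Rightarrow> 'h) \<Rightarrow> bool"
  where "ps_representation E V A \<sigma> \<longleftrightarrow>
    (\<forall>i. representation (gen_fibre E i) V (A i) \<sigma>) \<and>
    (\<forall>i j. \<forall>w\<in>car ((gen_fibre E i \<otimes>\<^sub>m gen_fibre E j) \<otimes>\<^sub>m hs_corr V \<sigma>).
      tilde V (A i) \<sigma>
        (tensor_map (gen_fibre E i) (hs_corr V \<sigma>) id (tilde V (A j) \<sigma>)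
          (assoc (gen_fibre E i) (gen_fibre E j) (hs_corr V \<sigma>) w)) =
      tilde V (A j) \<sigma>
        (tensor_map (gen_fibre E j) (hs_corr V \<sigma>) id (tilde V (A i) \<sigma>)
          (assoc (gen_fibre E j) (gen_fibre E i) (hs_corr V \<sigma>)
            (tensor_map (gen_fibre E j \<otimes>\<^sub>m gen_fibre E i) (hs_corr V \<sigma>) (flip E i j) id w))))"

definition ps_isometric ::
    "('k::finite, 'a::unital_cstar_algebra, 'e::semigroup_mult) fibres \<Rightarrow>
     'h::chilbert_space set \<Rightarrow> ('k \<Rightarrow> 'e \<Rightarrow> 'h \<Rightarrow> 'h) \<Rightarrow> ('a \<Rightarrow> 'h \<Rightarrow> 'h) \<Rightarrow> bool"
  where "ps_isometric E V A \<sigma> \<longleftrightarrow> (\<forall>i. isometric_rep (gen_fibre E i) V (A i) \<sigma>)"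

definition ps_fully_coisometric ::
    "('k::finite, 'a::unital_cstar_algebra, 'e::semigroup_mult) fibres \<Rightarrow>
     'h::chilbert_space set \<Rightarrow> ('k \<Rightarrow> 'e \<Rightarrow> 'h \<Rightarrow> 'h) \<Rightarrow> ('a \<Rightarrow> 'h \<Rightarrow> 'h) \<Rightarrow> bool"
  where "ps_fully_coisometric E V A \<sigma> \<longleftrightarrow>
    (\<forall>i. fully_coisometric_rep (gen_fibre E i) V (A i) \<sigma>)"

text \<open>For a word \<open>w\<close> of generator indices, \<open>tilde_word E \<iota> V A \<sigma> w\<close> is the composite of the
  maps \<open>I \<otimes> \<dots> \<otimes> I \<otimes> tilde V (A i) \<sigma>\<close>, \<open>i\<close> running through \<open>w\<close>, regarded as a map on
  \<open>E (word_deg w) \<otimes> V\<close> by identifying \<open>E (word_deg w)\<close> with the tensor product of the \<open>E\<^sub>i\<close> along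
  \<open>w\<close>.  The word \<open>canonical_word n\<close> lists each index \<open>i\<close>, in increasing order, \<open>n $ i\<close> times.\<close>

definition word_deg :: "'k::finite list \<Rightarrow> (nat, 'k) vec"
  where "word_deg w = (\<Sum>i\<leftarrow>w. axis i 1)"

definition canonical_word :: "(nat, 'k::{finite, linorder}) vec \<Rightarrow> 'k list"
  where "canonical_word n = concat (map (\<lambda>i. replicate (n $ i) i) (sorted_list_of_set UNIV))"

primrec tilde_word ::
    "('k::finite, 'a::unital_cstar_algebra, 'e::semigroup_mult) fibres \<Rightarrow> ('a \<Rightarrow> 'e) \<Rightarrow>
     'h::chilbert_space set \<Rightarrow> ('k \<Rightarrow> 'e \<Rightarrow> 'h \<Rightarrow> 'h) \<Rightarrow> ('a \<Rightarrow> 'h \<Rightarrow> 'h) \<Rightarrow>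
     'k list \<Rightarrow> ('e, 'h) tens \<Rightarrow> 'h"
  where
    "tilde_word E \<iota> V A \<sigma> [] = tilde V (\<lambda>x. \<sigma> (inv \<iota> x)) \<sigma>"
  | "tilde_word E \<iota> V A \<sigma> (i # w) =
      tilde V (A i) \<sigma>
      \<circ> tensor_map (gen_fibre E i) (hs_corr V \<sigma>) id (tilde_word E \<iota> V A \<sigma> w)
      \<circ> assoc (gen_fibre E i) (E (word_deg w)) (hs_corr V \<sigma>)
      \<circ> tensor_map (gen_fibre E i \<otimes>\<^sub>m E (word_deg w)) (hs_corr V \<sigma>)
          (mult_inv E (axis i 1) (word_deg w)) id"

definition ps_tilde ::
    "('k::{finite, linorder}, 'a::unital_cstar_algebra, 'e::semigroup_mult) fibres \<Rightarrow> ('a \<Rightarrow> 'e) \<Rightarrow>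
     'h::chilbert_space set \<Rightarrow> ('k \<Rightarrow> 'e \<Rightarrow> 'h \<Rightarrow> 'h) \<Rightarrow> ('a \<Rightarrow> 'h \<Rightarrow> 'h) \<Rightarrow>
     (nat, 'k) vec \<Rightarrow> ('e, 'h) tens \<Rightarrow> 'h"
  where "ps_tilde E \<iota> V A \<sigma> n = tilde_word E \<iota> V A \<sigma> (canonical_word n)"

definition ps_rep_at ::
    "('k::{finite, linorder}, 'a::unital_cstar_algebra, 'e::semigroup_mult) fibres \<Rightarrow> ('a \<Rightarrow> 'e) \<Rightarrow>
     'h::chilbert_space set \<Rightarrow> ('k \<Rightarrow> 'e \<Rightarrow> 'h \<Rightarrow> 'h) \<Rightarrow> ('a \<Rightarrow> 'h \<Rightarrow> 'h) \<Rightarrow>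
     (nat, 'k) vec \<Rightarrow> 'e \<Rightarrow> 'h \<Rightarrow> 'h"
  where "ps_rep_at E \<iota> V A \<sigma> n \<xi> h =
    ps_tilde E \<iota> V A \<sigma> n (elem_tensor (E n) (hs_corr V \<sigma>) \<xi> h)"

definition ps_dilates ::
    "('k::finite, 'a::unital_cstar_algebra, 'e::semigroup_mult) fibres \<Rightarrow>
     ('k \<Rightarrow> 'e \<Rightarrow> 'h \<Rightarrow> 'h) \<Rightarrow> ('a \<Rightarrow> 'h \<Rightarrow> 'h) \<Rightarrow>
     'h::chilbert_space set \<Rightarrow> ('k \<Rightarrow> 'e \<Rightarrow> 'h \<Rightarrow> 'h) \<Rightarrow> ('a \<Rightarrow> 'h \<Rightarrow> 'h) \<Rightarrow> bool"
  where "ps_dilates E S \<rho> V A \<sigma> \<longleftrightarrow> (\<forall>i. dilates (gen_fibre E i) (S i) \<rho> V (A i) \<sigma>)"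

definition minimal_isometric_dilation ::
    "('k::{finite, linorder}, 'a::unital_cstar_algebra, 'e::semigroup_mult) fibres \<Rightarrow> ('a \<Rightarrow> 'e) \<Rightarrow>
     ('k \<Rightarrow> 'e \<Rightarrow> 'h \<Rightarrow> 'h) \<Rightarrow> ('a \<Rightarrow> 'h \<Rightarrow> 'h) \<Rightarrow>
     'h::chilbert_space set \<Rightarrow> ('k \<Rightarrow> 'e \<Rightarrow> 'h \<Rightarrow> 'h) \<Rightarrow> ('a \<Rightarrow> 'h \<Rightarrow> 'h) \<Rightarrow> bool"
  where "minimal_isometric_dilation E \<iota> S \<rho> V A \<sigma> \<longleftrightarrow>
    ps_representation E UNIV S \<rho> \<and>
    ps_isometric E UNIV S \<rho> \<and>
    ps_dilates E S \<rho> V A \<sigma> \<and>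
    closed_cspan (\<Union>n. ps_tilde E \<iota> UNIV S \<rho> n ` subtensor (E n) (hs_corr UNIV \<rho>) V) = UNIV"


section \<open>Operator algebras and coinvariant subspaces\<close>

inductive_set gen_alg :: "('h::complex_vector \<Rightarrow> 'h) set \<Rightarrow> ('h \<Rightarrow> 'h) set"
  for G :: "('h \<Rightarrow> 'h) set"
  where
    gen_id: "id \<in> gen_alg G"
  | gen_incl: "T \<in> G \<Longrightarrow> T \<in> gen_alg G"
  | gen_add: "S \<in> gen_alg G \<Longrightarrow> T \<in> gen_alg G \<Longrightarrow> (\<lambda>x. S x + T x) \<in> gen_alg G"
  | gen_scaleC: "T \<in> gen_alg G \<Longrightarrow> (\<lambda>x. c *\<^sub>C T x) \<in> gen_alg G"
  | gen_comp: "S \<in> gen_alg G \<Longrightarrow> T \<in> gen_alg G \<Longrightarrow> S \<circ> T \<in> gen_alg G"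

definition wot_closure :: "'h::chilbert_space set \<Rightarrow> ('h \<Rightarrow> 'h) set \<Rightarrow> ('h \<Rightarrow> 'h) set"
  where "wot_closure X C = {T. bounded_op X T \<and>
    (\<forall>F e. finite F \<and> F \<subseteq> X \<times> X \<and> 0 < e \<longrightarrow>
      (\<exists>T'\<in>C. \<forall>(x, y)\<in>F. cmod (cinner y (T x - T' x)) < e))}"

definition rep_gens ::
    "('a, 'a, 'x) corr \<Rightarrow> ('x \<Rightarrow> 'h \<Rightarrow> 'h) \<Rightarrow> ('a \<Rightarrow> 'h \<Rightarrow> 'h) \<Rightarrow> ('h \<Rightarrow> 'h) set"
  where "rep_gens F A \<sigma> = A ` car F \<union> range \<sigma>"

definition ps_gens ::
    "('k::finite, 'a, 'e) fibres \<Rightarrow> ('k \<Rightarrow> 'e \<Rightarrow> 'h \<Rightarrow> 'h) \<Rightarrow> ('a \<Rightarrow> 'h \<Rightarrow> 'h) \<Rightarrow> ('h \<Rightarrow> 'h) set"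
  where "ps_gens E A \<sigma> = (\<Union>i. A i ` car (gen_fibre E i)) \<union> range \<sigma>"

definition coinvariant :: "'h::chilbert_space set \<Rightarrow> ('h \<Rightarrow> 'h) set \<Rightarrow> 'h set \<Rightarrow> bool"
  where "coinvariant X C Y \<longleftrightarrow>
    closed_csubspace Y \<and> Y \<subseteq> X \<and> (\<forall>T\<in>C. adj_on X T ` Y \<subseteq> Y)"

definition minimal_coinvariant :: "'h::chilbert_space set \<Rightarrow> ('h \<Rightarrow> 'h) set \<Rightarrow> 'h set \<Rightarrow> bool"
  where "minimal_coinvariant X C Y \<longleftrightarrow>
    coinvariant X C Y \<and> Y \<noteq> {0} \<and>
    (\<forall>Z. coinvariant X C Z \<and> Z \<noteq> {0} \<and> Z \<subseteq> Y \<longrightarrow> Z = Y)"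

definition cyclic :: "'h::chilbert_space set \<Rightarrow> ('h \<Rightarrow> 'h) set \<Rightarrow> 'h set \<Rightarrow> bool"
  where "cyclic X C Y \<longleftrightarrow> closed_cspan (\<Union>T\<in>C. T ` Y) = X"

definition minimal_cyclic_coinvariant ::
    "'h::chilbert_space set \<Rightarrow> ('h \<Rightarrow> 'h) set \<Rightarrow> 'h set \<Rightarrow> bool"
  where "minimal_cyclic_coinvariant X C Y \<longleftrightarrow>
    coinvariant X C Y \<and> cyclic X C Y \<and>
    (\<forall>Z. coinvariant X C Z \<and> cyclic X C Z \<and> Z \<subseteq> Y \<longrightarrow> Z = Y)"

definition orthogonal_minimal_family ::
    "'h::chilbert_space set \<Rightarrow> ('h \<Rightarrow> 'h) set \<Rightarrow> 'h set set \<Rightarrow> bool"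
  where "orthogonal_minimal_family X C \<V> \<longleftrightarrow>
    (\<forall>Y\<in>\<V>. minimal_coinvariant X C Y) \<and>
    pairwise (\<lambda>Y Z. \<forall>y\<in>Y. \<forall>z\<in>Z. cinner y z = 0) \<V>"

definition maximal_orthogonal_minimal_family ::
    "'h::chilbert_space set \<Rightarrow> ('h \<Rightarrow> 'h) set \<Rightarrow> 'h set set \<Rightarrow> bool"
  where "maximal_orthogonal_minimal_family X C \<V> \<longleftrightarrow>
    orthogonal_minimal_family X C \<V> \<and>
    (\<forall>\<W>. orthogonal_minimal_family X C \<W> \<and> \<V> \<subseteq> \<W> \<longrightarrow> \<W> = \<V>)"

definition direct_sum :: "'h::chilbert_space set set \<Rightarrow> 'h set"
  where "direct_sum \<V> = {\<Sum>Y\<in>\<V>. v Y | v. \<forall>Y\<in>\<V>. v Y \<in> Y}"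

text \<open>Restrictions of operators are compared as functions undefined outside \<open>X\<close>, so that they
  are determined by their values on \<open>X\<close>.\<close>

definition cstar_algebra_on :: "'h::chilbert_space set \<Rightarrow> ('h \<Rightarrow> 'h) set \<Rightarrow> bool"
  where "cstar_algebra_on X C \<longleftrightarrow>
    (\<forall>T\<in>C. bounded_op X T \<and> T \<in> extensional X) \<and>
    restrict id X \<in> C \<and>
    (\<forall>S\<in>C. \<forall>T\<in>C. restrict (\<lambda>x. S x + T x) X \<in> C) \<and>
    (\<forall>T\<in>C. \<forall>c. restrict (\<lambda>x. c *\<^sub>C T x) X \<in> C) \<and>
    (\<forall>S\<in>C. \<forall>T\<in>C. restrict (S \<circ> T) X \<in> C) \<and>
    (\<forall>T\<in>C. restrict (adj_on X T) X \<in> C) \<and>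
    (\<forall>T. bounded_op X T \<and> T \<in> extensional X \<and>
      (\<forall>e>0. \<exists>T'\<in>C. \<forall>x\<in>X. norm (T x - T' x) \<le> e * norm x) \<longrightarrow> T \<in> C)"

end

theory Submission
  imports Defs "HOL-Computational_Algebra.Fundamental_Theorem_Algebra"
begin

text \<open>Everything is phrased through the maps sending a closed subspace \<open>W\<close> to the image \<open>step i W\<close> of
  \<open>E\<^sub>i \<otimes> W\<close> under the dilation; a \<open>\<rho>\<close>-reducing subspace \<open>Z\<close> is coinvariant iff \<open>Z \<subseteq> step i Z\<close> for all \<open>i\<close>.
  The space \<open>V\<close> is coinvariant by full coisometry and its translates exhaust the whole space by
  minimality, so all the maps are onto. As \<open>V\<close> is finite dimensional, the distance from a
  coinvariant \<open>Z\<close> to \<open>V\<close> is bounded below modulo \<open>Z \<inter> V\<close>, and the bound propagates along the translates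
  of \<open>V\<close>: a non-zero coinvariant subspace therefore meets \<open>V\<close>, and a cyclic one meets it in a cyclic
  subspace. Hence the minimal coinvariant subspaces of \<open>V\<close> lie in every cyclic coinvariant subspace.
  For \<open>E(m)\<close> with all \<open>m\<^sub>i \<noteq> 0\<close> the least cyclic coinvariant subspace turns out to be coinvariant for
  every \<open>E\<^sub>i\<close>, because the adjoint of each step map commutes with the others. Finally, the adjoints
  act on \<open>Vhat\<close> as an algebra all of whose invariant subspaces reduce, and on a finite-dimensional
  space such an algebra is self-adjoint by the density theorem.\<close>

subsection \<open>Positive elements of a C*-algebra\<close>

text \<open>Two obstacles lie below the operator theory. First, a C*-algebra is given by its norm
  axioms only, and the inner product on an interior tensor product is positive only because Gram
  matrices are; hence the elementary theory of positive elements, built here from square roots.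
  Second, the maps of the statement are definite descriptions on completions, so each has to be
  shown to exist; nearly all of them preserve inner products on elementary tensors, which settles
  existence and isometry at once. The distance bound survives a step for this reason: on Z the form
  ||z - P_U z||^2 - e^2 ||z - P_L z||^2 is positive and compatible with \<rho>, so Z with this form
  is a possibly degenerate correspondence, and positivity of its interior tensor product with F is
  the bound for \<open>step U\<close>. L is fixed by the step, so the constant e does not
  deteriorate. Words of generators replace multi-indices: translates commute, so any word containing
  every letter serves for the cyclic subspaces, and a letter can be moved to the front and
  cancelled.\<close>

instance unital_cstar_algebra \<subseteq> banach ..

lemma scaleC_zero_right [simp]: "c *\<^sub>C (0::'v::complex_vector) = 0"
  using scaleC_add_right[of c "0::'v" 0] by simp

lemma scaleC_zero_left [simp]: "0 *\<^sub>C (x::'v::complex_vector) = 0"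
  using scaleC_add_left[of 0 0 x] by simp

lemma scaleC_minus_right [simp]: "c *\<^sub>C (- x) = - (c *\<^sub>C (x::'v::complex_vector))"
  using scaleC_add_right[of c x "- x"] by (simp add: eq_neg_iff_add_eq_0 add.commute)

lemma scaleC_minus_left [simp]: "(- c) *\<^sub>C x = - (c *\<^sub>C (x::'v::complex_vector))"
  using scaleC_add_left[of c "- c" x] by (simp add: eq_neg_iff_add_eq_0 add.commute)

lemma scaleC_diff_right: "c *\<^sub>C (x - y) = c *\<^sub>C x - c *\<^sub>C (y::'v::complex_vector)"
  using scaleC_add_right[of c x "- y"] by simp

context
  fixes dummy :: "'a::unital_cstar_algebra"
begin

lemma star_zero [simp]: "star (0::'a) = 0"
  using star_add[of "0::'a" 0] by simp

lemma star_one [simp]: "star (1::'a) = 1"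
  by (metis mult.left_neutral star_mult star_star)

lemma star_minus [simp]: "star (- x) = - star (x::'a)"
  using star_add[of x "- x"] by (simp add: eq_neg_iff_add_eq_0 add.commute)

lemma star_diff: "star (x - y) = star x - star (y::'a)"
  using star_add[of x "- y"] by simp

lemma star_scaleR [simp]: "star (r *\<^sub>R x) = r *\<^sub>R star (x::'a)"
  by (simp add: scaleR_scaleC star_scaleC)

lemma star_sum: "star (sum f I) = (\<Sum>i\<in>I. star (f i :: 'a))"
  by (induction I rule: infinite_finite_induct) (auto simp: star_add)

lemma norm_star_le: "norm (x::'a) \<le> norm (star x)"
proof (cases "norm x = 0")
  case False
  have "norm x * norm x \<le> norm (star x) * norm x"
    using cstar_identity[of x] norm_mult_ineq[of "star x" x] by (simp add: power2_eq_square)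
  then show ?thesis using False by simp
qed simp

lemma norm_star [simp]: "norm (star (x::'a)) = norm x"
  using norm_star_le[of x] norm_star_le[of "star x"] by (simp add: star_star)

lemma norm_one_le: "norm (1::'a) \<le> 1"
proof (rule ccontr)
  assume a: "\<not> ?thesis"
  have "norm (1::'a) = norm (1::'a) * norm (1::'a)"
    using cstar_identity[of "1::'a"] by (simp add: power2_eq_square)
  then show False using a by auto
qed

lemma tendsto_star: "(u \<longlongrightarrow> (l::'a)) F \<Longrightarrow> ((\<lambda>n. star (u n)) \<longlongrightarrow> star l) F"
  unfolding tendsto_iff dist_norm by (simp flip: star_diff)

lemma norm_square_sa: "star (h::'a) = h \<Longrightarrow> norm (h * h) = (norm h)\<^sup>2"
  using cstar_identity[of h] by simp

end

section \<open>Square roots by a majorized iteration\<close>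

primrec sqrt_bound :: "nat \<Rightarrow> real" where
  "sqrt_bound 0 = 0"
| "sqrt_bound (Suc k) = (1 + (sqrt_bound k)\<^sup>2) / 2"

lemma sqrt_bound_range: "0 \<le> sqrt_bound k \<and> sqrt_bound k \<le> 1"
  by (induction k) (auto simp: power_le_one)

lemma sqrt_bound_mono: "sqrt_bound k \<le> sqrt_bound (Suc k)"
proof -
  have "0 \<le> (1 - sqrt_bound k)\<^sup>2" by simp
  then show ?thesis by (simp add: power2_eq_square algebra_simps)
qed

lemma sqrt_bound_incseq: "incseq sqrt_bound"
  using sqrt_bound_mono by (rule incseq_SucI)

lemma sqrt_bound_convergent: "convergent sqrt_bound"
proof -
  have "Bseq sqrt_bound"
    using sqrt_bound_range by (intro BseqI'[of _ 1]) auto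
  then show ?thesis using sqrt_bound_incseq
    by (simp add: Bseq_monoseq_convergent incseq_imp_monoseq)
qed

lemma sqrt_bound_step_tendsto_0: "(\<lambda>k. sqrt_bound (Suc k) - sqrt_bound k) \<longlonglongrightarrow> 0"
proof -
  obtain l where "sqrt_bound \<longlonglongrightarrow> l" using sqrt_bound_convergent convergent_def by blast
  from tendsto_diff[OF LIMSEQ_Suc[OF this] this] show ?thesis by simp
qed

text \<open>The iteration \<open>y \<mapsto> (r + y\<^sup>2)/2\<close> started at 0 converges to \<open>1 - sqrt (1 - r)\<close>.\<close>

primrec sqrt_iter :: "'a::unital_cstar_algebra \<Rightarrow> nat \<Rightarrow> 'a" where
  "sqrt_iter r 0 = 0"
| "sqrt_iter r (Suc k) = (1/2) *\<^sub>R (r + sqrt_iter r k * sqrt_iter r k)"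

text \<open>\<open>sqrt_bound\<close> is the same iteration for the scalar 1, so it majorizes both
  the iterates and their increments. The bounds on the increments telescope, so the argument reaches
  \<open>norm r = 1\<close>, where a contraction estimate would fail.\<close>

lemma sqrt_iter_bounds:
  assumes "norm r \<le> 1"
  shows "norm (sqrt_iter r k) \<le> sqrt_bound k \<and>
    norm (sqrt_iter r (Suc k) - sqrt_iter r k) \<le> sqrt_bound (Suc k) - sqrt_bound k"
proof (induction k)
  case 0
  then show ?case using assms by simp
next
  case (Suc k)
  let ?y = "sqrt_iter r" and ?s = sqrt_bound
  have "norm (?y (Suc k)) \<le> norm (?y k) + norm (?y (Suc k) - ?y k)"
    using norm_triangle_ineq[of "?y k" "?y (Suc k) - ?y k"] by simp
  then have 1: "norm (?y (Suc k)) \<le> ?s (Suc k)" using Suc by linarith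
  have "?y (Suc (Suc k)) - ?y (Suc k)
      = (1/2) *\<^sub>R (?y (Suc k) * ?y (Suc k) - ?y k * ?y k)"
    by (simp add: algebra_simps)
  \<comment> \<open>The difference of squares is factored with the order of the factors kept, so
    that no commutation has to be proved.\<close>
  also have "?y (Suc k) * ?y (Suc k) - ?y k * ?y k
      = (?y (Suc k) - ?y k) * ?y (Suc k) + ?y k * (?y (Suc k) - ?y k)"
    by (simp add: left_diff_distrib right_diff_distrib del: sqrt_iter.simps)
  also have "norm ((1/2) *\<^sub>R \<dots>) \<le> (1/2) * (norm (?y (Suc k) - ?y k) * norm (?y (Suc k))
      + norm (?y k) * norm (?y (Suc k) - ?y k))"
    unfolding norm_scaleR
    by (intro mult_mono order.trans[OF norm_triangle_ineq] add_mono norm_mult_ineq) auto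
  also have "\<dots> \<le> (1/2) * ((?s (Suc k) - ?s k) * ?s (Suc k) + ?s k * (?s (Suc k) - ?s k))"
    using Suc 1 sqrt_bound_range sqrt_bound_mono
    by (intro mult_mono add_mono) (auto simp del: sqrt_iter.simps sqrt_bound.simps)
  also have "\<dots> = ((?s (Suc k))\<^sup>2 - (?s k)\<^sup>2) / 2"
    by (simp add: power2_eq_square algebra_simps del: sqrt_bound.simps)
  also have "\<dots> = ?s (Suc (Suc k)) - ?s (Suc k)"
    unfolding sqrt_bound.simps(2)[of "Suc k"]
    by (subst (3) sqrt_bound.simps(2)) (simp add: field_simps del: sqrt_bound.simps)
  finally show ?case using 1 by blast
qed

lemma sqrt_iter_convergent:
  assumes "norm r \<le> 1"
  shows "convergent (sqrt_iter r)"
proof (rule Cauchy_convergent, rule metric_CauchyI)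
  fix e :: real assume "0 < e"
  have diff: "norm (sqrt_iter r (n + d) - sqrt_iter r n) \<le> sqrt_bound (n + d) - sqrt_bound n" for n d
  proof (induction d)
    case (Suc d)
    have "norm (sqrt_iter r (n + Suc d) - sqrt_iter r n)
        \<le> norm (sqrt_iter r (Suc (n + d)) - sqrt_iter r (n + d)) + norm (sqrt_iter r (n + d) - sqrt_iter r n)"
      using norm_triangle_ineq[of "sqrt_iter r (Suc (n + d)) - sqrt_iter r (n + d)"
          "sqrt_iter r (n + d) - sqrt_iter r n"] by (simp del: sqrt_iter.simps)
    then show ?case using Suc sqrt_iter_bounds[OF assms, of "n + d"]
      by (simp del: sqrt_iter.simps sqrt_bound.simps)
  qed simp
  have "Cauchy sqrt_bound" using sqrt_bound_convergent by (simp add: Cauchy_convergent_iff)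
  then obtain N where N: "\<And>m n. m \<ge> N \<Longrightarrow> n \<ge> N \<Longrightarrow> dist (sqrt_bound m) (sqrt_bound n) < e"
    using \<open>0 < e\<close> unfolding Cauchy_def by meson
  have "dist (sqrt_iter r m) (sqrt_iter r n) < e" if "m \<ge> N" "n \<ge> N" for m n
  proof (cases "m \<le> n")
    case True
    then show ?thesis using diff[of m "n - m"] N[OF that] by (simp add: dist_norm norm_minus_commute)
  next
    case False
    then show ?thesis using diff[of n "m - n"] N[OF that] by (simp add: dist_norm)
  qed
  then show "\<exists>N. \<forall>m\<ge>N. \<forall>n\<ge>N. dist (sqrt_iter r m) (sqrt_iter r n) < e" by blast
qed

text \<open>The limit y of the iteration satisfies 2y = r + y^2, which rearranges to (1 - y)^2 = 1 -
  r; so 1 - y is the root. The bound on \<open>1 - w\<close> is what later makes the root positive,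
  and commutation with everything that commutes with r passes from the iterates to the
  limit.\<close>

lemma cstar_sqrt:
  fixes r :: "'a::unital_cstar_algebra"
  assumes "star r = r" "norm r \<le> 1"
  shows "\<exists>w. star w = w \<and> w * w = 1 - r \<and> norm (1 - w) \<le> 1 \<and>
    (\<forall>z. z * r = r * z \<longrightarrow> z * w = w * z)"
proof -
  obtain y where y: "sqrt_iter r \<longlonglongrightarrow> y"
    using sqrt_iter_convergent[OF assms(2)] convergent_def by blast
  have "star (sqrt_iter r k) = sqrt_iter r k" for k
    by (induction k) (auto simp: star_add star_mult assms(1))
  then have "sqrt_iter r \<longlonglongrightarrow> star y" using tendsto_star[OF y] by simp
  then have sy: "star y = y" using y LIMSEQ_unique by blast
  have "(\<lambda>k. sqrt_iter r (Suc k)) \<longlonglongrightarrow> (1/2) *\<^sub>R (r + y * y)"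
    unfolding sqrt_iter.simps by (intro tendsto_intros y)
  then have "y = (1/2) *\<^sub>R (r + y * y)" using LIMSEQ_unique LIMSEQ_Suc[OF y] by blast
  then have "2 *\<^sub>R y = 2 *\<^sub>R ((1/2) *\<^sub>R (r + y * y))" by (rule arg_cong)
  also have "\<dots> = r + y * y" by simp
  finally have "2 *\<^sub>R y = r + y * y" .
  moreover have "(1 - y) * (1 - y) = 1 - 2 *\<^sub>R y + y * y" by (simp add: algebra_simps scaleR_2)
  ultimately have yr: "(1 - y) * (1 - y) = 1 - r" by simp
  have "norm (sqrt_iter r k) \<le> 1" for k
    using sqrt_iter_bounds[OF assms(2), of k] sqrt_bound_range[of k] by linarith
  then have ny: "norm y \<le> 1" using LIMSEQ_le_const2[OF tendsto_norm[OF y]] by blast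
  have com: "z * (1 - y) = (1 - y) * z" if "z * r = r * z" for z
  proof -
    have "z * sqrt_iter r k = sqrt_iter r k * z" for k
    proof (induction k)
      case (Suc k)
      have "z * (sqrt_iter r k * sqrt_iter r k) = sqrt_iter r k * sqrt_iter r k * z"
        using Suc by (metis mult.assoc)
      then show ?case using that by (simp add: algebra_simps)
    qed simp
    then have "z * y = y * z"
      using LIMSEQ_unique tendsto_mult_left[OF y, of z] tendsto_mult_right[OF y, of z] by simp
    then show ?thesis by (simp add: algebra_simps)
  qed
  show ?thesis
    by (intro exI[of _ "1 - y"] conjI allI impI com yr) (use ny sy in \<open>simp_all add: star_diff\<close>)
qed

text \<open>If w^2 = 1 - h^2 and w commutes with h, then \<open>u = h + \<i> *\<^sub>C w\<close>
  satisfies u^*u = 1. Since u^2 + u^*2 = 2(h^2 - w^2), four times 1 - h^2 is 2 minus this sum and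
  has norm at most 4.\<close>

lemma norm_one_minus_square_le:
  fixes h :: "'a::unital_cstar_algebra"
  assumes "star h = h" "norm h \<le> 1"
  shows "norm (1 - h * h) \<le> 1"
proof -
  have "norm (h * h) \<le> 1"
    using assms norm_square_sa[OF assms(1)] by (simp add: power_le_one)
  moreover have "star (h * h) = h * h" using assms(1) by (simp add: star_mult)
  ultimately obtain w where w: "star w = w" "w * w = 1 - h * h"
    "\<And>z. z * (h * h) = h * h * z \<Longrightarrow> z * w = w * z"
    using cstar_sqrt[of "h * h"] by blast
  have hw: "h * w = w * h" using w(3)[of h] by (simp add: mult.assoc)
  define u where "u = h + \<i> *\<^sub>C w"
  have su: "star u = h - \<i> *\<^sub>C w"
    by (simp add: u_def star_add star_scaleC w assms(1))
  have "star u * u = h * h + w * w"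
    unfolding su unfolding u_def
    by (simp add: algebra_simps mult_scaleC_left mult_scaleC_right scaleC_scaleC hw scaleC_one
      scaleC_diff_right)
  then have "norm (star u * u) = norm (1::'a)" using w(2) by simp
  then have "(norm u)\<^sup>2 \<le> 1" using norm_one_le[where 'a='a] by (simp add: cstar_identity)
  then have nu: "norm u \<le> 1" by (simp add: power_le_one_iff)
  have "u * u + star u * star u = 2 *\<^sub>R (h * h - w * w)"
    unfolding su unfolding u_def
    by (simp add: algebra_simps mult_scaleC_left mult_scaleC_right scaleC_scaleC scaleC_one scaleR_2
      scaleC_diff_right scaleC_add_right)
  then have "4 *\<^sub>R (1 - h * h) = 2 *\<^sub>R 1 - (u * u + star u * star u)"
    using w(2) scaleR_add_left[of 2 2 "1::'a"] scaleR_add_left[of 2 2 "h * h"]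
    by (simp add: algebra_simps)
  then have "norm (4 *\<^sub>R (1 - h * h)) \<le> norm (2 *\<^sub>R (1::'a)) + norm (u * u + star u * star u)"
    by (simp only: norm_triangle_ineq4)
  also have "\<dots> \<le> norm (2 *\<^sub>R (1::'a)) + (norm (u * u) + norm (star u * star u))"
    by (intro add_left_mono norm_triangle_ineq)
  also have "\<dots> \<le> 2 + (1 + 1)"
    using norm_one_le[where 'a='a] nu
    by (intro add_mono) (auto intro!: order.trans[OF norm_mult_ineq] mult_le_one)
  finally show ?thesis by simp
qed

text \<open>Positivity by the norm alone: for self-adjoint h the inequality says that the spectrum
  lies in [0, 2t]. \<open>cpos_sqrt\<close> and \<open>cpos_star_mult\<close> show that these are
  exactly the elements \<open>star a * a\<close>, with no spectrum ever defined.\<close>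

definition cpos :: "'a::unital_cstar_algebra \<Rightarrow> bool"
  where "cpos h \<longleftrightarrow> star h = h \<and> (\<exists>t\<ge>0. norm (t *\<^sub>R 1 - h) \<le> t)"

lemma cpos_selfadjoint: "cpos h \<Longrightarrow> star h = h"
  by (simp add: cpos_def)

text \<open>For norm 1 this is \<open>norm_one_minus_square_le\<close>; both sides are homogeneous
  of degree 2.\<close>

lemma cpos_square:
  fixes y :: "'a::unital_cstar_algebra"
  assumes "star y = y"
  shows "norm ((norm y)\<^sup>2 *\<^sub>R 1 - y * y) \<le> (norm y)\<^sup>2" "cpos (y * y)"
proof -
  show 1: "norm ((norm y)\<^sup>2 *\<^sub>R 1 - y * y) \<le> (norm y)\<^sup>2"
  proof (cases "y = 0")
    case False
    have "norm (1 - ((1 / norm y) *\<^sub>R y) * ((1 / norm y) *\<^sub>R y)) \<le> 1"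
      using assms False by (intro norm_one_minus_square_le) auto
    also have "1 - ((1 / norm y) *\<^sub>R y) * ((1 / norm y) *\<^sub>R y)
        = (1 / (norm y)\<^sup>2) *\<^sub>R ((norm y)\<^sup>2 *\<^sub>R 1 - y * y)"
      using False by (simp add: real_vector.scale_right_diff_distrib power2_eq_square)
    also have "norm \<dots> = (1 / (norm y)\<^sup>2) * norm ((norm y)\<^sup>2 *\<^sub>R 1 - y * y)" by simp
    finally show ?thesis using False by (simp add: field_simps del: scaleR_right_diff_distrib)
  qed simp
  then show "cpos (y * y)" unfolding cpos_def
    using assms by (auto simp: star_mult intro!: exI[of _ "(norm y)\<^sup>2"])
qed

text \<open>Dividing h by t turns the positivity condition into \<open>norm r \<le> 1\<close> for r
  = 1 - h/t, to which \<open>cstar_sqrt\<close> applies. The clause on commuting z is what later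
  allows products of roots to be rearranged.\<close>

lemma cpos_sqrt:
  assumes "cpos (h::'a::unital_cstar_algebra)"
  shows "\<exists>y. cpos y \<and> y * y = h \<and> (\<forall>z. z * h = h * z \<longrightarrow> z * y = y * z)"
proof -
  obtain t where t: "t \<ge> 0" "norm (t *\<^sub>R 1 - h) \<le> t" and sh: "star h = h"
    using assms by (auto simp: cpos_def)
  show ?thesis
  proof (cases "t = 0")
    case True
    then have "h = 0" using t by simp
    moreover have "cpos (0::'a)" by (auto simp: cpos_def intro!: exI[of _ 0])
    ultimately show ?thesis by (intro exI[of _ 0]) auto
  next
    case False
    define r where "r = 1 - (1/t) *\<^sub>R h"
    have r1: "star r = r" by (simp add: r_def star_diff sh)
    have "r = (1/t) *\<^sub>R (t *\<^sub>R 1 - h)" using False by (simp add: r_def real_vector.scale_right_diff_distrib)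
    then have r2: "norm r \<le> 1" using t False by simp
    obtain w where w: "star w = w" "w * w = 1 - r" "norm (1 - w) \<le> 1"
      "\<And>z. z * r = r * z \<Longrightarrow> z * w = w * z"
      using cstar_sqrt[OF r1 r2] by blast
    have "cpos (sqrt t *\<^sub>R w)"
    proof -
      have "norm (sqrt t *\<^sub>R 1 - sqrt t *\<^sub>R w) = sqrt t * norm (1 - w)"
        using t by (simp flip: real_vector.scale_right_diff_distrib)
      also have "\<dots> \<le> sqrt t" using w(3) t by (simp add: mult_left_le)
      finally show ?thesis unfolding cpos_def using w(1) t by (auto intro!: exI[of _ "sqrt t"])
    qed
    moreover have "(sqrt t *\<^sub>R w) * (sqrt t *\<^sub>R w) = h"
      using False t by (simp add: w(2) r_def)
    moreover have "z * (sqrt t *\<^sub>R w) = (sqrt t *\<^sub>R w) * z" if "z * h = h * z" for z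
      using w(4)[of z] that by (simp add: r_def algebra_simps)
    ultimately show ?thesis by blast
  qed
qed

text \<open>The existential t can always be taken to be \<open>norm h\<close>: write h as a square
  and use \<open>cpos_square\<close>. In this form the condition is continuous in h, which gives
  \<open>cpos_closed\<close>.\<close>

lemma cpos_norm:
  assumes "cpos (h::'a::unital_cstar_algebra)"
  shows "norm (norm h *\<^sub>R 1 - h) \<le> norm h"
proof -
  obtain y where "cpos y" "y * y = h" using cpos_sqrt[OF assms] by blast
  then show ?thesis using cpos_square(1)[of y] norm_square_sa[of y] by (simp add: cpos_def)
qed

lemma cpos_shift:
  assumes "cpos (h::'a::unital_cstar_algebra)" "norm h \<le> t"
  shows "norm (t *\<^sub>R 1 - h) \<le> t"
proof -
  have "t *\<^sub>R 1 - h = (t - norm h) *\<^sub>R 1 + (norm h *\<^sub>R 1 - h)" by (simp add: algebra_simps)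
  also have "norm \<dots> \<le> norm ((t - norm h) *\<^sub>R (1::'a)) + norm (norm h *\<^sub>R 1 - h)"
    by (rule norm_triangle_ineq)
  also have "\<dots> \<le> (t - norm h) * 1 + norm h"
    using assms(2) norm_one_le[where 'a='a]
    by (intro add_mono cpos_norm assms(1)) (auto simp: mult_left_le)
  finally show ?thesis by simp
qed

lemma cpos_add:
  assumes "cpos h" "cpos (k::'a::unital_cstar_algebra)"
  shows "cpos (h + k)"
proof -
  obtain s t where st: "s \<ge> 0" "norm (s *\<^sub>R 1 - h) \<le> s" "t \<ge> 0" "norm (t *\<^sub>R 1 - k) \<le> t"
    using assms by (auto simp: cpos_def)
  have "(s + t) *\<^sub>R 1 - (h + k) = (s *\<^sub>R 1 - h) + (t *\<^sub>R 1 - k)" by (simp add: algebra_simps)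
  then have "norm ((s + t) *\<^sub>R 1 - (h + k)) \<le> norm (s *\<^sub>R 1 - h) + norm (t *\<^sub>R 1 - k)"
    by (simp only: norm_triangle_ineq)
  then have "norm ((s + t) *\<^sub>R 1 - (h + k)) \<le> s + t" using st by linarith
  then show ?thesis unfolding cpos_def using assms st
    by (auto simp: cpos_def star_add intro!: exI[of _ "s + t"])
qed

lemma cpos_zero [simp]: "cpos (0::'a::unital_cstar_algebra)"
  by (auto simp: cpos_def intro!: exI[of _ 0])

lemma cpos_sum: "(\<And>i. i \<in> I \<Longrightarrow> cpos (f i)) \<Longrightarrow> cpos (sum f I :: 'a::unital_cstar_algebra)"
  by (induction I rule: infinite_finite_induct) (auto intro: cpos_add)

lemma cpos_scaleR:
  assumes "cpos (h::'a::unital_cstar_algebra)" "0 \<le> c"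
  shows "cpos (c *\<^sub>R h)"
proof -
  obtain y where y: "cpos y" "y * y = h" using cpos_sqrt[OF assms(1)] by blast
  have "(sqrt c *\<^sub>R y) * (sqrt c *\<^sub>R y) = c *\<^sub>R h" using assms(2) y by simp
  moreover have "star (sqrt c *\<^sub>R y) = sqrt c *\<^sub>R y" using y by (simp add: cpos_def)
  ultimately show ?thesis using cpos_square(2) by metis
qed

lemma norm_squares_diff_le:
  fixes a b :: "'a::real_normed_algebra"
  assumes "norm a \<le> s" "norm b \<le> t"
  shows "norm (a * a - b * b) \<le> s * s + t * t"
proof -
  have "norm (a * a) \<le> s * s" "norm (b * b) \<le> t * t"
    using norm_mult_ineq[of a a] norm_mult_ineq[of b b]
      mult_mono[OF assms(1) assms(1)] mult_mono[OF assms(2) assms(2)]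
      order.trans[OF norm_ge_zero assms(1)] order.trans[OF norm_ge_zero assms(2)] by force+
  then show ?thesis using norm_triangle_ineq4[of "a * a" "b * b"] by linarith
qed

text \<open>For t = \<open>norm h\<close> both t + h and t - h have norm at most t, while the
  difference of their squares is 4 t h; so 4 t^2 \<le> 2 t^2.\<close>

lemma cpos_antisym:
  assumes "cpos h" "cpos (- (h::'a::unital_cstar_algebra))"
  shows "h = 0"
proof -
  let ?t = "norm h"
  have "norm (?t *\<^sub>R 1 - h) \<le> ?t" "norm (?t *\<^sub>R 1 + h) \<le> ?t"
    using cpos_norm[OF assms(1)] cpos_norm[OF assms(2)] by auto
  then have "norm ((?t *\<^sub>R 1 + h) * (?t *\<^sub>R 1 + h) - (?t *\<^sub>R 1 - h) * (?t *\<^sub>R 1 - h)) \<le> ?t * ?t + ?t * ?t"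
    by (intro norm_squares_diff_le)
  also have "(?t *\<^sub>R 1 + h) * (?t *\<^sub>R 1 + h) - (?t *\<^sub>R 1 - h) * (?t *\<^sub>R 1 - h) = (4 * ?t) *\<^sub>R h"
    by (simp add: algebra_simps flip: scaleR_add_left)
  also have "norm \<dots> = 4 * (?t * ?t)" by simp
  finally have "?t * ?t \<le> 0" by linarith
  then show ?thesis by (metis mult_eq_0_iff norm_eq_zero norm_ge_zero order_antisym zero_le_square)
qed

lemma cpos_closed:
  fixes l :: "'a::unital_cstar_algebra"
  assumes "\<And>n. cpos (u n)" "u \<longlonglongrightarrow> l"
  shows "cpos l"
proof -
  have "star l = l"
    using LIMSEQ_unique[OF tendsto_star[OF assms(2)]] cpos_selfadjoint[OF assms(1)] assms(2) by simp
  moreover have "norm (norm l *\<^sub>R 1 - l) \<le> norm l"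
  proof (rule LIMSEQ_le)
    show "(\<lambda>n. norm (norm (u n) *\<^sub>R 1 - u n)) \<longlonglongrightarrow> norm (norm l *\<^sub>R 1 - l)"
      by (intro tendsto_intros assms(2))
    show "(\<lambda>n. norm (u n)) \<longlonglongrightarrow> norm l" by (intro tendsto_intros assms(2))
  qed (use cpos_norm assms(1) in auto)
  ultimately show ?thesis by (auto simp: cpos_def intro!: exI[of _ "norm l"])
qed

text \<open>The roots of h and k commute as well, so hk is the square of their self-adjoint
  product.\<close>

lemma cpos_commuting_mult:
  fixes h k :: "'a::unital_cstar_algebra"
  assumes "cpos h" "cpos k" "h * k = k * h"
  shows "cpos (h * k)"
proof -
  obtain x where x: "cpos x" "x * x = h" "\<And>z. z * h = h * z \<Longrightarrow> z * x = x * z"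
    using cpos_sqrt[OF assms(1)] by blast
  have "k * x = x * k" using x(3) assms(3) by simp
  obtain y where y: "cpos y" "y * y = k" "\<And>z. z * k = k * z \<Longrightarrow> z * y = y * z"
    using cpos_sqrt[OF assms(2)] by blast
  have xy: "x * y = y * x" using y(3) \<open>k * x = x * k\<close> by simp
  then have "star (x * y) = x * y" using x(1) y(1) by (simp add: star_mult cpos_def)
  moreover have "(x * y) * (x * y) = h * k" by (metis x(2) y(2) xy mult.assoc)
  ultimately show ?thesis using cpos_square(2) by metis
qed

text \<open>Writing c = x - iy with x and y self-adjoint, the sum is 2(x^2 + y^2).\<close>

lemma complex_split:
  fixes c :: "'a::unital_cstar_algebra"
  shows "cpos (star c * c + c * star c)"
proof -
  define x where "x = (1/2) *\<^sub>R (c + star c)"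
  define y where "y = (1/2) *\<^sub>R (\<i> *\<^sub>C (c - star c))"
  have sx: "star x = x" by (simp add: x_def star_add star_star add.commute)
  have sy: "star y = y"
    by (simp add: y_def star_scaleC star_diff star_star scaleC_diff_right)
  have "x * x = (1/4) *\<^sub>R (c * c + c * star c + star c * c + star c * star c)"
    by (simp add: x_def algebra_simps)
  moreover have "y * y = (1/4) *\<^sub>R (- (c * c) + c * star c + star c * c - star c * star c)"
    by (simp add: y_def algebra_simps mult_scaleC_left mult_scaleC_right scaleC_scaleC scaleC_one
        scaleC_diff_right scaleR_scaleC scaleC_add_right)
  ultimately have "x * x + y * y = (1/4) *\<^sub>R (2 *\<^sub>R (star c * c + c * star c))"
    unfolding scaleR_2 by (simp add: algebra_simps)
  then have "star c * c + c * star c = 2 *\<^sub>R (x * x + y * y)" by simp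
  then show ?thesis using cpos_square(2)[OF sx] cpos_square(2)[OF sy]
    by (metis cpos_add cpos_scaleR zero_le_numeral)
qed

text \<open>With \<open>d = c q\<close>, \<open>q\<^sup>2 = - c\<^sup>*c\<close>, both \<open>d\<^sup>*d\<close> and \<open>d d\<^sup>*\<close> are negative, while their sum is
  positive; no spectral theory is needed.\<close>

lemma star_mult_neg_imp_zero:
  fixes c :: "'a::unital_cstar_algebra"
  assumes "cpos (- (star c * c))"
  shows "c = 0"
proof -
  define k where "k = - (star c * c)"
  define p where "p = c * star c"
  obtain q where q: "cpos q" "q * q = k" using cpos_sqrt[of k] assms k_def by metis
  have sq: "star q = q" using q by (simp add: cpos_def)
  have "cpos (star c * c + c * star c)" by (rule complex_split)
  then have "cpos (k + (star c * c + c * star c))" using assms cpos_add k_def by blast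
  then have p: "cpos p" by (simp add: k_def p_def)
  define d where "d = c * q"
  have dd: "star d * d = - (k * k)"
    unfolding d_def by (simp add: star_mult sq mult.assoc) (metis (no_types) k_def mult.assoc
      mult_minus_left mult_minus_right minus_minus q(2))
  have "d * star d = c * k * star c"
    unfolding d_def by (simp add: star_mult sq mult.assoc flip: q(2))
  also have "\<dots> = - (p * p)" by (simp add: k_def p_def mult.assoc)
  finally have dd': "d * star d = - (p * p)" .
  have kk: "cpos (k * k)" "cpos (p * p)"
    using assms p cpos_square(2) by (auto simp: k_def cpos_def)
  have "cpos (- (k * k) - p * p)" using complex_split[of d] dd dd' by simp
  then have "cpos (- (k * k))" using cpos_add[OF _ kk(2)] by fastforce
  then have "k * k = 0" using cpos_antisym kk(1) by blast
  then have "norm k = 0" using norm_square_sa[of k] assms by (simp add: k_def cpos_def)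
  then have "(norm c)\<^sup>2 = 0" using cstar_identity[of c] by (simp add: k_def)
  then show ?thesis by simp
qed

text \<open>Compare h = a^*a with its modulus m, the root of h^2. For n = m - h, twice the negative
  part, (an)^*(an) = nhn = -nmn is negative, so an = 0 by \<open>star_mult_neg_imp_zero\<close>;
  then hn = 0, mn = 0 and n^2 = 0, that is h = m.\<close>

theorem cpos_star_mult: "cpos (star a * (a::'a::unital_cstar_algebra))"
proof -
  define h where "h = star a * a"
  have sh: "star h = h" by (simp add: h_def star_mult star_star)
  obtain m where m: "cpos m" "m * m = h * h" "\<And>z. z * (h * h) = h * h * z \<Longrightarrow> z * m = m * z"
    using cpos_sqrt[OF cpos_square(2)[OF sh]] by blast
  have hm: "h * m = m * h" using m(3)[of h] by (simp add: mult.assoc)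
  obtain q where q: "cpos q" "q * q = m" "\<And>z. z * m = m * z \<Longrightarrow> z * q = q * z"
    using cpos_sqrt[OF m(1)] by blast
  define n where "n = m - h"
  have sn: "star n = n" using m(1) sh by (simp add: n_def star_diff cpos_def)
  have nm: "n * m = m * n" by (simp add: n_def algebra_simps hm)
  have hn: "h * n = - (m * n)" by (simp add: n_def right_diff_distrib m(2) hm)
  have "star (a * n) * (a * n) = n * (h * n)"
    by (simp add: star_mult sn h_def mult.assoc)
  also have "\<dots> = - (n * m * n)" by (simp add: hn mult.assoc)
  \<comment> \<open>q is the root of m and commutes with n, so nmn is visibly the square of the
    self-adjoint \<open>q * n\<close>.\<close>
  also have "n * m * n = (q * n) * (q * n)"
    by (metis q(2) q(3)[OF nm] mult.assoc)
  finally have eq: "- (star (a * n) * (a * n)) = (q * n) * (q * n)" by simp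
  have "star (q * n) = q * n" using q(1) q(3)[OF nm] sn by (simp add: star_mult cpos_def)
  then have "cpos (- (star (a * n) * (a * n)))" unfolding eq by (rule cpos_square(2))
  then have "a * n = 0" by (rule star_mult_neg_imp_zero)
  then have "h * n = 0" by (simp add: h_def mult.assoc)
  then have "m * n = 0" using hn by simp
  then have "n * n = 0" using \<open>h * n = 0\<close> by (simp add: n_def left_diff_distrib)
  then have "norm n = 0" using norm_square_sa[OF sn] by simp
  then have "h = m" by (simp add: n_def)
  then show ?thesis using m(1) h_def by simp
qed

section \<open>Norm estimates from the order\<close>

lemma cpos_conj:
  assumes "cpos (p::'a::unital_cstar_algebra)"
  shows "cpos (star a * p * a)"
proof -
  obtain y where y: "cpos y" "y * y = p" using cpos_sqrt[OF assms] by blast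
  then have "star a * p * a = star (y * a) * (y * a)"
    by (metis cpos_selfadjoint mult.assoc star_mult)
  then show ?thesis using cpos_star_mult by simp
qed

lemma cpos_norm_minus:
  assumes "star (q::'a::unital_cstar_algebra) = q" "norm q \<le> t"
  shows "cpos (t *\<^sub>R 1 - q)"
  unfolding cpos_def using assms by (auto simp: star_diff intro!: exI[of _ t] order.trans[OF norm_ge_zero])

text \<open>A crude bound from 4mp = (m + p)^2 - (m - p)^2 with m = \<open>norm p\<close>: taking
  norms gives 4m^2 \<le> (1 + m)^2 + m^2. The next lemma sharpens it by repeated squaring.\<close>

lemma cpos_le_one_norm_lt:
  fixes p :: "'a::unital_cstar_algebra"
  assumes "cpos p" "cpos (1 - p)"
  shows "norm p < 2"
proof -
  let ?m = "norm p"
  have 1: "norm (?m *\<^sub>R 1 - p) \<le> ?m" using cpos_norm[OF assms(1)] .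
  have "norm (1 - p) \<le> 1 + ?m"
    using norm_triangle_ineq4[of 1 p] norm_one_le[where 'a='a] by simp
  from cpos_shift[OF assms(2) this] have 2: "norm (?m *\<^sub>R 1 + p) \<le> 1 + ?m"
    by (simp add: algebra_simps)
  have "norm ((?m *\<^sub>R 1 + p) * (?m *\<^sub>R 1 + p) - (?m *\<^sub>R 1 - p) * (?m *\<^sub>R 1 - p))
      \<le> (1 + ?m) * (1 + ?m) + ?m * ?m"
    by (rule norm_squares_diff_le[OF 2 1])
  also have "(?m *\<^sub>R 1 + p) * (?m *\<^sub>R 1 + p) - (?m *\<^sub>R 1 - p) * (?m *\<^sub>R 1 - p) = (4 * ?m) *\<^sub>R p"
    by (simp add: algebra_simps flip: scaleR_add_left)
  also have "norm \<dots> = 4 * (?m * ?m)" by simp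
  finally have *: "2 * (?m * ?m) \<le> 1 + 2 * ?m" by (simp add: algebra_simps)
  show ?thesis
  proof (rule ccontr)
    assume "\<not> ?m < 2"
    then have "2 * ?m \<le> ?m * ?m" by (simp add: mult_right_mono)
    then show False using * \<open>\<not> ?m < 2\<close> by linarith
  qed
qed

text \<open>Squaring keeps an element between 0 and 1, because 1 - q^2 = (1 - q) + q(1 - q), and it
  squares the norm. A norm above 1 would thus pass the crude bound 2 after finitely many
  squarings.\<close>

lemma cpos_le_one_norm_le:
  fixes p :: "'a::unital_cstar_algebra"
  assumes "cpos p" "cpos (1 - p)"
  shows "norm p \<le> 1"
proof (rule ccontr)
  assume "\<not> norm p \<le> 1"
  then obtain n where n: "2 < (norm p) ^ n" using real_arch_pow[of "norm p" 2] by auto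
  have "\<exists>q::'a. cpos q \<and> cpos (1 - q) \<and> norm q = norm p ^ (2 ^ k)" for k
  proof (induction k)
    case 0
    then show ?case using assms by (auto intro: exI[of _ p])
  next
    case (Suc k)
    then obtain q :: 'a where q: "cpos q" "cpos (1 - q)" "norm q = norm p ^ (2 ^ k)" by blast
    have "cpos (q * (1 - q))" using q by (intro cpos_commuting_mult) (auto simp: algebra_simps)
    then have "cpos ((1 - q) + q * (1 - q))" using q cpos_add by blast
    then have "cpos (1 - q * q)" by (simp add: algebra_simps)
    moreover have "norm (q * q) = norm p ^ (2 ^ Suc k)"
      using q norm_square_sa[of q] by (simp add: cpos_def power_mult flip: power_mult)
        (simp add: mult.commute)
    ultimately show ?case using cpos_square(2)[of q] q(1) by (auto simp: cpos_def)
  qed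
  then obtain q :: 'a where "cpos q" "cpos (1 - q)" "norm q = norm p ^ (2 ^ n)" by blast
  then have "norm p ^ (2 ^ n) < 2" using cpos_le_one_norm_lt by metis
  moreover have "norm p ^ n \<le> norm p ^ (2 ^ n)"
    using \<open>\<not> norm p \<le> 1\<close> by (intro power_increasing) (auto simp: less_imp_le)
  ultimately show False using n by linarith
qed

lemma cpos_norm_mono:
  fixes p q :: "'a::unital_cstar_algebra"
  assumes "cpos p" "cpos (q - p)"
  shows "norm p \<le> norm q"
proof -
  have q: "cpos q" using cpos_add[OF assms] by simp
  have *: "norm p \<le> t" if "norm q \<le> t" "0 < t" for t
  proof -
    have "cpos (t *\<^sub>R 1 - q)" using cpos_norm_minus cpos_selfadjoint[OF q] that(1) by blast
    then have "cpos (t *\<^sub>R 1 - p)" using cpos_add[OF assms(2)] by fastforce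
    then have "cpos ((1/t) *\<^sub>R (t *\<^sub>R 1 - p))" using that(2) by (intro cpos_scaleR) auto
    then have "cpos (1 - (1/t) *\<^sub>R p)" using that(2) by (simp add: real_vector.scale_right_diff_distrib)
    then have "norm ((1/t) *\<^sub>R p) \<le> 1" using that(2) cpos_scaleR[OF assms(1), of "1/t"] by (intro cpos_le_one_norm_le) auto
    then show ?thesis using that(2) by (simp add: field_simps)
  qed
  \<comment> \<open>The rescaling above divides by t, so a possibly vanishing \<open>norm q\<close>
    is approached through positive t.\<close>
  have "norm p \<le> norm q + e" if "e > 0" for e
    using *[of "norm q + e"] that by (simp add: add_nonneg_pos)
  then show ?thesis by (rule field_le_epsilon)
qed

lemma cpos_complex_iff: "cpos (z::complex) \<longleftrightarrow> Im z = 0 \<and> 0 \<le> Re z"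
proof
  assume "cpos z"
  then obtain y where "cpos y" "y * y = z" using cpos_sqrt by blast
  then show "Im z = 0 \<and> 0 \<le> Re z" by (auto simp: cpos_def star_complex_def complex_eq_iff simp flip: \<open>y * y = z\<close>)
next
  assume "Im z = 0 \<and> 0 \<le> Re z"
  then have "star (complex_of_real (sqrt (Re z))) * complex_of_real (sqrt (Re z)) = z"
    by (simp add: star_complex_def complex_eq_iff)
  then show "cpos z" using cpos_star_mult by metis
qed

subsection \<open>Semi-inner-product modules and their completions\<close>

text \<open>The module laws are demanded only under \<open>ip\<close>: lists representing sums of
  tensors obey them up to vectors of seminorm 0, not as equalities. Completeness and separation are
  added in \<open>hmod\<close>.\<close>

locale semi_module =
  fixes M :: "('a, 'b::unital_cstar_algebra, 'x) corr"
  assumes zer_car [simp]: "zer M \<in> car M"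
    and add_car [simp]: "\<And>x y. x \<in> car M \<Longrightarrow> y \<in> car M \<Longrightarrow> add M x y \<in> car M"
    and ract_car [simp]: "\<And>x b. x \<in> car M \<Longrightarrow> ract M x b \<in> car M"
    and ip_zer_right [simp]: "\<And>x. x \<in> car M \<Longrightarrow> ip M x (zer M) = 0"
    and ip_add_right [simp]: "\<And>x y z. x \<in> car M \<Longrightarrow> y \<in> car M \<Longrightarrow> z \<in> car M \<Longrightarrow>
      ip M x (add M y z) = ip M x y + ip M x z"
    and ip_ract_right [simp]: "\<And>x y b. x \<in> car M \<Longrightarrow> y \<in> car M \<Longrightarrow>
      ip M x (ract M y b) = ip M x y * b"
    and ip_star: "\<And>x y. x \<in> car M \<Longrightarrow> y \<in> car M \<Longrightarrow> star (ip M x y) = ip M y x"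
    and ip_pos: "\<And>x. x \<in> car M \<Longrightarrow> cpos (ip M x x)"
begin

lemma ip_zer_left [simp]: "x \<in> car M \<Longrightarrow> ip M (zer M) x = 0"
  using ip_star[of x "zer M"] by simp

lemma ip_add_left [simp]: "x \<in> car M \<Longrightarrow> y \<in> car M \<Longrightarrow> z \<in> car M \<Longrightarrow>
    ip M (add M y z) x = ip M y x + ip M z x"
  using ip_star[of x "add M y z"] ip_star[of x y] ip_star[of x z] by (simp add: star_add)

lemma ip_ract_left [simp]: "x \<in> car M \<Longrightarrow> y \<in> car M \<Longrightarrow> ip M (ract M y b) x = star b * ip M y x"
  using ip_star[of x "ract M y b"] ip_star[of x y] by (simp add: star_mult)

definition mdiff :: "'x \<Rightarrow> 'x \<Rightarrow> 'x"
  where "mdiff x y = add M x (ract M y (- 1))"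

lemma mdiff_car [simp]: "x \<in> car M \<Longrightarrow> y \<in> car M \<Longrightarrow> mdiff x y \<in> car M"
  by (simp add: mdiff_def)

lemma ip_mdiff_right [simp]: "x \<in> car M \<Longrightarrow> y \<in> car M \<Longrightarrow> z \<in> car M \<Longrightarrow>
    ip M x (mdiff y z) = ip M x y - ip M x z"
  by (simp add: mdiff_def)

lemma ip_mdiff_left [simp]: "x \<in> car M \<Longrightarrow> y \<in> car M \<Longrightarrow> z \<in> car M \<Longrightarrow>
    ip M (mdiff y z) x = ip M y x - ip M z x"
  by (simp add: mdiff_def)

lemma mdist_eq: "mdist M x y = mnorm M (mdiff x y)"
  by (simp add: mdist_def mdiff_def)

lemma mnorm_nonneg [simp]: "0 \<le> mnorm M x"
  by (simp add: mnorm_def)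

lemma mnorm_square: "(mnorm M x)\<^sup>2 = norm (ip M x x)"
  by (simp add: mnorm_def)

lemma mdist_nonneg [simp]: "0 \<le> mdist M x y"
  by (simp add: mdist_eq)

lemma mdist_square:
  assumes "x \<in> car M" "y \<in> car M"
  shows "(mdist M x y)\<^sup>2 = norm (ip M x x - ip M x y - (ip M y x - ip M y y))"
  using assms by (simp add: mdist_eq mnorm_square algebra_simps)

text \<open>Expand the positive \<open>ip M w w\<close> for w = t z - x a with a =
  \<open>ip M x z\<close>, estimate the inner square of x inside it by t, and cancel one factor t.
  The result is an inequality between algebra elements, and \<open>gram_contraction\<close> needs it
  in this strength.\<close>

lemma cauchy_schwarz_pos:
  assumes x: "x \<in> car M" and z: "z \<in> car M" and t: "0 < t" "norm (ip M x x) \<le> t"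
  shows "cpos (t *\<^sub>R ip M z z - star (ip M x z) * ip M x z)"
proof -
  define a where "a = ip M x z"
  define w where "w = mdiff (ract M z (t *\<^sub>R 1)) (ract M x a)"
  have zx: "ip M z x = star a" unfolding a_def using ip_star x z by simp
  have "ip M w w = t *\<^sub>R (t *\<^sub>R ip M z z - star a * a) - t *\<^sub>R (star a * a) + star a * ip M x x * a"
    unfolding w_def using x z by (simp add: zx a_def[symmetric] algebra_simps)
  moreover have "cpos (star a * (t *\<^sub>R 1 - ip M x x) * a)"
    by (intro cpos_conj cpos_norm_minus t(2) cpos_selfadjoint ip_pos x)
  moreover have "cpos (ip M w w)" unfolding w_def using x z by (intro ip_pos) simp
  ultimately have "cpos (t *\<^sub>R (t *\<^sub>R ip M z z - star a * a) - t *\<^sub>R (star a * a) + star a * ip M x x * a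
      + star a * (t *\<^sub>R 1 - ip M x x) * a)"
    using cpos_add by metis
  also have "t *\<^sub>R (t *\<^sub>R ip M z z - star a * a) - t *\<^sub>R (star a * a) + star a * ip M x x * a
      + star a * (t *\<^sub>R 1 - ip M x x) * a = t *\<^sub>R (t *\<^sub>R ip M z z - star a * a)"
    by (simp add: algebra_simps)
  finally have "cpos (t *\<^sub>R (t *\<^sub>R ip M z z - star a * a))" .
  from cpos_scaleR[OF this, of "1/t"] show ?thesis
    using t(1) by (simp add: a_def del: scaleR_right_diff_distrib)
qed

lemma cauchy_schwarz:
  assumes x: "x \<in> car M" and y: "y \<in> car M"
  shows "norm (ip M x y) \<le> mnorm M x * mnorm M y"
proof -
  have "(norm (ip M x y))\<^sup>2 \<le> (norm (ip M x x) + e) * norm (ip M y y)" if e: "e > 0" for e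
  proof -
    have "(norm (ip M x y))\<^sup>2 = norm (star (ip M x y) * ip M x y)" by (simp add: cstar_identity)
    also have "\<dots> \<le> norm ((norm (ip M x x) + e) *\<^sub>R ip M y y)"
      using x y e by (intro cpos_norm_mono cpos_star_mult cauchy_schwarz_pos) (auto intro: add_nonneg_pos)
    finally show ?thesis using e by (simp add: abs_of_nonneg)
  qed
  \<comment> \<open>\<open>cauchy_schwarz_pos\<close> asks for a strictly positive t, hence the
    perturbation e, which is now sent to 0.\<close>
  moreover have "((\<lambda>e. (norm (ip M x x) + e) * norm (ip M y y)) \<longlongrightarrow> (norm (ip M x x) + 0) * norm (ip M y y)) (at_right 0)"
    by (intro tendsto_intros)
  ultimately have "(norm (ip M x y))\<^sup>2 \<le> (norm (ip M x x) + 0) * norm (ip M y y)"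
    by (intro tendsto_lowerbound[where F="at_right (0::real)"]) (auto simp: eventually_at_right_less eventually_at_filter)
  then have "(norm (ip M x y))\<^sup>2 \<le> (mnorm M x * mnorm M y)\<^sup>2"
    by (simp add: power_mult_distrib mnorm_square)
  then show ?thesis by (rule power2_le_imp_le) simp
qed

lemma mnorm_add_le:
  assumes "x \<in> car M" "y \<in> car M"
  shows "mnorm M (add M x y) \<le> mnorm M x + mnorm M y"
proof (rule power2_le_imp_le)
  have "(mnorm M (add M x y))\<^sup>2 = norm ((ip M x x + ip M y x) + (ip M x y + ip M y y))"
    using assms by (simp add: mnorm_square)
  also have "\<dots> \<le> (norm (ip M x x) + norm (ip M y x)) + (norm (ip M x y) + norm (ip M y y))"
    by (intro order.trans[OF norm_triangle_ineq] add_mono norm_triangle_ineq)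
  also have "\<dots> \<le> ((mnorm M x)\<^sup>2 + mnorm M y * mnorm M x) + (mnorm M x * mnorm M y + (mnorm M y)\<^sup>2)"
    using assms by (intro add_mono cauchy_schwarz) (auto simp: mnorm_square)
  also have "\<dots> = (mnorm M x + mnorm M y)\<^sup>2" by (simp add: power2_eq_square algebra_simps)
  finally show "(mnorm M (add M x y))\<^sup>2 \<le> (mnorm M x + mnorm M y)\<^sup>2" .
qed simp

text \<open>Takes the place of rewriting: two expressions that agree only modulo null vectors are
  compared by expanding their inner squares.\<close>

lemma mnorm_cong:
  "ip M x x = ip M y y \<Longrightarrow> mnorm M x = mnorm M y"
  by (simp add: mnorm_def)

lemma mdist_self [simp]: "x \<in> car M \<Longrightarrow> mdist M x x = 0"
  using mdist_square[of x x] by simp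

lemma mdist_commute: "x \<in> car M \<Longrightarrow> y \<in> car M \<Longrightarrow> mdist M x y = mdist M y x"
  unfolding mdist_eq by (rule mnorm_cong) simp

lemma mdist_triangle:
  assumes "x \<in> car M" "y \<in> car M" "z \<in> car M"
  shows "mdist M x z \<le> mdist M x y + mdist M y z"
proof -
  have "mdist M x z = mnorm M (add M (mdiff x y) (mdiff y z))"
    unfolding mdist_eq using assms by (intro mnorm_cong) (simp add: algebra_simps)
  also have "\<dots> \<le> mdist M x y + mdist M y z"
    unfolding mdist_eq using assms by (intro mnorm_add_le) auto
  finally show ?thesis .
qed

lemma mdist_add:
  assumes "x \<in> car M" "y \<in> car M" "x' \<in> car M" "y' \<in> car M"
  shows "mdist M (add M x y) (add M x' y') \<le> mdist M x x' + mdist M y y'"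
proof -
  have "mdist M (add M x y) (add M x' y') = mnorm M (add M (mdiff x x') (mdiff y y'))"
    unfolding mdist_eq using assms by (intro mnorm_cong) (simp add: algebra_simps)
  also have "\<dots> \<le> mdist M x x' + mdist M y y'"
    unfolding mdist_eq using assms by (intro mnorm_add_le) auto
  finally show ?thesis .
qed

lemma mnorm_ract: 
  assumes "x \<in> car M"
  shows "mnorm M (ract M x b) \<le> mnorm M x * norm b"
proof (rule power2_le_imp_le)
  have "(mnorm M (ract M x b))\<^sup>2 = norm (star b * ip M x x * b)"
    using assms by (simp add: mnorm_square mult.assoc)
  also have "\<dots> \<le> norm (star b) * norm (ip M x x) * norm b"
    by (intro order.trans[OF norm_mult_ineq] mult_right_mono norm_mult_ineq) simp
  also have "\<dots> = (mnorm M x * norm b)\<^sup>2" 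
    by (simp add: power_mult_distrib mnorm_square) (simp add: power2_eq_square)
  finally show "(mnorm M (ract M x b))\<^sup>2 \<le> (mnorm M x * norm b)\<^sup>2" .
qed simp

lemma mdist_ract:
  assumes "x \<in> car M" "y \<in> car M"
  shows "mdist M (ract M x b) (ract M y b) \<le> mdist M x y * norm b"
proof -
  have "mdist M (ract M x b) (ract M y b) = mnorm M (ract M (mdiff x y) b)"
    unfolding mdist_eq using assms by (intro mnorm_cong) (simp add: algebra_simps)
  then show ?thesis unfolding mdist_eq using assms mnorm_ract by simp
qed

lemma mnorm_le_mdist:
  assumes "x \<in> car M" "y \<in> car M"
  shows "mnorm M x \<le> mnorm M y + mdist M y x"
proof -
  have "mnorm M x = mnorm M (add M y (mdiff x y))"
    using assms by (intro mnorm_cong) (simp add: algebra_simps)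
  also have "\<dots> \<le> mnorm M y + mnorm M (mdiff x y)"
    using assms by (intro mnorm_add_le) auto
  also have "mnorm M (mdiff x y) = mdist M y x"
    using mdist_commute[OF assms] by (simp add: mdist_eq)
  finally show ?thesis .
qed

lemma ip_lipschitz:
  assumes "x \<in> car M" "y \<in> car M" "x' \<in> car M" "y' \<in> car M"
  shows "norm (ip M x y - ip M x' y') \<le> mnorm M x * mdist M y y' + mdist M x x' * mnorm M y'"
proof -
  have "ip M x y - ip M x' y' = ip M x (mdiff y y') + ip M (mdiff x x') y'"
    using assms by simp
  also have "norm \<dots> \<le> norm (ip M x (mdiff y y')) + norm (ip M (mdiff x x') y')"
    by (rule norm_triangle_ineq)
  also have "\<dots> \<le> mnorm M x * mdist M y y' + mdist M x x' * mnorm M y'"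
    unfolding mdist_eq using assms by (intro add_mono cauchy_schwarz) auto
  finally show ?thesis .
qed

definition mnull :: "(nat \<Rightarrow> 'x) \<Rightarrow> (nat \<Rightarrow> 'x) \<Rightarrow> bool"
  where "mnull u v \<longleftrightarrow> (\<lambda>n. mdist M (u n) (v n)) \<longlonglongrightarrow> 0"

lemma mnull_bound:
  assumes "\<And>n. mdist M (u n) (v n) \<le> f n" "f \<longlonglongrightarrow> 0"
  shows "mnull u v"
  unfolding mnull_def by (rule Lim_null_comparison[OF _ assms(2)]) (use assms(1) in auto)

lemma mnull_refl: "range u \<subseteq> car M \<Longrightarrow> mnull u u"
  by (auto simp: mnull_def image_subset_iff)

lemma mnull_sym: "range u \<subseteq> car M \<Longrightarrow> range v \<subseteq> car M \<Longrightarrow> mnull u v \<Longrightarrow> mnull v u"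
  unfolding mnull_def by (subst mdist_commute) (auto simp: image_subset_iff)

lemma mnull_trans:
  assumes "range u \<subseteq> car M" "range v \<subseteq> car M" "range w \<subseteq> car M" "mnull u v" "mnull v w"
  shows "mnull u w"
proof (rule mnull_bound)
  show "mdist M (u n) (w n) \<le> mdist M (u n) (v n) + mdist M (v n) (w n)" for n
    using assms(1-3) by (intro mdist_triangle) auto
  show "(\<lambda>n. mdist M (u n) (v n) + mdist M (v n) (w n)) \<longlonglongrightarrow> 0"
    using tendsto_add[OF assms(4,5)[unfolded mnull_def]] by simp
qed

lemma mnull_add:
  assumes "range u \<subseteq> car M" "range v \<subseteq> car M" "range u' \<subseteq> car M" "range v' \<subseteq> car M"
    "mnull u u'" "mnull v v'"
  shows "mnull (\<lambda>n. add M (u n) (v n)) (\<lambda>n. add M (u' n) (v' n))"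
proof (rule mnull_bound)
  show "mdist M (add M (u n) (v n)) (add M (u' n) (v' n)) \<le> mdist M (u n) (u' n) + mdist M (v n) (v' n)" for n
    using assms(1-4) by (intro mdist_add) auto
  show "(\<lambda>n. mdist M (u n) (u' n) + mdist M (v n) (v' n)) \<longlonglongrightarrow> 0"
    using tendsto_add[OF assms(5,6)[unfolded mnull_def]] by simp
qed

lemma mnull_ract:
  assumes "range u \<subseteq> car M" "range v \<subseteq> car M" "mnull u v"
  shows "mnull (\<lambda>n. ract M (u n) b) (\<lambda>n. ract M (v n) b)"
proof (rule mnull_bound)
  show "mdist M (ract M (u n) b) (ract M (v n) b) \<le> mdist M (u n) (v n) * norm b" for n
    using assms(1,2) by (intro mdist_ract) auto
  show "(\<lambda>n. mdist M (u n) (v n) * norm b) \<longlonglongrightarrow> 0"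
    using tendsto_mult_right[OF assms(3)[unfolded mnull_def], of "norm b"] by simp
qed

lemma cauchy_range: "u \<in> cauchy_seqs M \<Longrightarrow> range u \<subseteq> car M"
  by (auto simp: cauchy_seqs_def)

lemma cauchy_car [simp]: "u \<in> cauchy_seqs M \<Longrightarrow> u n \<in> car M"
  by (auto simp: cauchy_seqs_def)

lemma cauchyD: "u \<in> cauchy_seqs M \<Longrightarrow> e > 0 \<Longrightarrow> \<exists>N. \<forall>m\<ge>N. \<forall>n\<ge>N. mdist M (u m) (u n) < e"
  unfolding cauchy_seqs_def by simp

lemma const_cauchy: "x \<in> car M \<Longrightarrow> (\<lambda>_. x) \<in> cauchy_seqs M"
  unfolding cauchy_seqs_def by simp

lemma cauchy_bounded:
  assumes "u \<in> cauchy_seqs M"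
  obtains K where "K > 0" "\<And>n. mnorm M (u n) \<le> K"
proof -
  obtain N where N: "\<And>m n. m \<ge> N \<Longrightarrow> n \<ge> N \<Longrightarrow> mdist M (u m) (u n) < 1"
    using cauchyD[OF assms, of 1] by auto
  have "\<forall>\<^sub>F n in sequentially. norm (mnorm M (u n)) \<le> mnorm M (u N) + 1"
  proof (rule eventually_sequentiallyI)
    fix n assume "N \<le> n"
    then show "norm (mnorm M (u n)) \<le> mnorm M (u N) + 1"
      using mnorm_le_mdist[of "u n" "u N"] N[of N n] assms by simp
  qed
  then have "Bseq (\<lambda>n. mnorm M (u n))" by (rule BfunI)
  then obtain K where "K > 0" "\<And>n. norm (mnorm M (u n)) \<le> K" by (auto elim: BseqE)
  then show ?thesis using that by fastforce
qed

lemma cauchy_ip_convergent: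
  assumes u: "u \<in> cauchy_seqs M" and v: "v \<in> cauchy_seqs M"
  shows "convergent (\<lambda>n. ip M (u n) (v n))"
proof (rule Cauchy_convergent, rule metric_CauchyI)
  fix e :: real assume e: "0 < e"
  obtain K where K: "K > 0" "\<And>n. mnorm M (u n) \<le> K" using cauchy_bounded[OF u] by blast
  obtain L where L: "L > 0" "\<And>n. mnorm M (v n) \<le> L" using cauchy_bounded[OF v] by blast
  obtain N1 where N1: "\<And>m n. m \<ge> N1 \<Longrightarrow> n \<ge> N1 \<Longrightarrow> mdist M (u m) (u n) < e / (2 * L)"
    using cauchyD[OF u, of "e / (2 * L)"] e L(1) by (meson divide_pos_pos mult_pos_pos zero_less_numeral)
  obtain N2 where N2: "\<And>m n. m \<ge> N2 \<Longrightarrow> n \<ge> N2 \<Longrightarrow> mdist M (v m) (v n) < e / (2 * K)"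
    using cauchyD[OF v, of "e / (2 * K)"] e K(1) by (meson divide_pos_pos mult_pos_pos zero_less_numeral)
  have "dist (ip M (u m) (v m)) (ip M (u n) (v n)) < e" if "m \<ge> max N1 N2" "n \<ge> max N1 N2" for m n
  proof -
    have "dist (ip M (u m) (v m)) (ip M (u n) (v n))
        \<le> mnorm M (u m) * mdist M (v m) (v n) + mdist M (u m) (u n) * mnorm M (v n)"
      unfolding dist_norm using u v by (intro ip_lipschitz) auto
    also have "\<dots> \<le> K * mdist M (v m) (v n) + mdist M (u m) (u n) * L"
      by (intro add_mono mult_right_mono mult_left_mono K L) auto
    also have "\<dots> < K * (e / (2 * K)) + (e / (2 * L)) * L"
      using that K(1) L(1) N1[of m n] N2[of m n]
      by (intro add_strict_mono mult_strict_left_mono mult_strict_right_mono) auto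
    also have "\<dots> = e" using K(1) L(1) by (simp add: field_simps)
    finally show ?thesis .
  qed
  then show "\<exists>N. \<forall>m\<ge>N. \<forall>n\<ge>N. dist (ip M (u m) (v m)) (ip M (u n) (v n)) < e" by blast
qed

lemma mnull_ip_diff:
  assumes u: "u \<in> cauchy_seqs M" and v: "v \<in> cauchy_seqs M"
    and u': "u' \<in> cauchy_seqs M" and v': "v' \<in> cauchy_seqs M" and "mnull u u'" "mnull v v'"
  shows "(\<lambda>n. ip M (u n) (v n) - ip M (u' n) (v' n)) \<longlonglongrightarrow> 0"
proof -
  obtain K where K: "K > 0" "\<And>n. mnorm M (u n) \<le> K" using cauchy_bounded[OF u] by blast
  obtain L where L: "L > 0" "\<And>n. mnorm M (v' n) \<le> L" using cauchy_bounded[OF v'] by blast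
  have "norm (ip M (u n) (v n) - ip M (u' n) (v' n)) \<le> K * mdist M (v n) (v' n) + mdist M (u n) (u' n) * L" for n
  proof -
    have "norm (ip M (u n) (v n) - ip M (u' n) (v' n))
        \<le> mnorm M (u n) * mdist M (v n) (v' n) + mdist M (u n) (u' n) * mnorm M (v' n)"
      using u v u' v' by (intro ip_lipschitz) auto
    also have "\<dots> \<le> K * mdist M (v n) (v' n) + mdist M (u n) (u' n) * L"
      by (intro add_mono mult_right_mono mult_left_mono K L) auto
    finally show ?thesis .
  qed
  note b1 = this
  have b2: "(\<lambda>n. K * mdist M (v n) (v' n) + mdist M (u n) (u' n) * L) \<longlonglongrightarrow> 0"
    using tendsto_add[OF tendsto_mult_left[OF assms(6)[unfolded mnull_def], of K]
        tendsto_mult_right[OF assms(5)[unfolded mnull_def], of L]] by simp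
  show ?thesis by (rule Lim_null_comparison[OF always_eventually[OF allI[OF b1]] b2])
qed

lemma mnull_cauchy:
  assumes u: "u \<in> cauchy_seqs M" and v: "range v \<subseteq> car M" and "mnull u v"
  shows "v \<in> cauchy_seqs M"
  unfolding cauchy_seqs_def
proof (intro CollectI conjI allI impI)
  show "v n \<in> car M" for n using v by auto
  fix e :: real assume "e > 0"
  then have "e/3 > 0" by simp
  obtain N1 where N1: "\<And>m n. m \<ge> N1 \<Longrightarrow> n \<ge> N1 \<Longrightarrow> mdist M (u m) (u n) < e/3"
    using cauchyD[OF u \<open>e/3 > 0\<close>] by auto
  obtain N2 where N2: "\<And>n. n \<ge> N2 \<Longrightarrow> mdist M (u n) (v n) < e/3"
    using LIMSEQ_D[OF assms(3)[unfolded mnull_def] \<open>e/3 > 0\<close>] by auto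
  have "mdist M (v m) (v n) < e" if "m \<ge> max N1 N2" "n \<ge> max N1 N2" for m n
  proof -
    have car: "u m \<in> car M" "u n \<in> car M" "v m \<in> car M" "v n \<in> car M" using u v by auto
    have "mdist M (v m) (v n) \<le> mdist M (v m) (u m) + (mdist M (u m) (u n) + mdist M (u n) (v n))"
      by (meson mdist_triangle car add_left_mono order_trans)
    also have "\<dots> < e/3 + (e/3 + e/3)"
      using that N1[of m n] N2[of m] N2[of n] mdist_commute[of "u m" "v m"] car by (intro add_strict_mono) auto
    finally show ?thesis by simp
  qed
  then show "\<exists>N. \<forall>m\<ge>N. \<forall>n\<ge>N. mdist M (v m) (v n) < e" by blast
qed

lemma cauchy_add:
  assumes "u \<in> cauchy_seqs M" "v \<in> cauchy_seqs M"
  shows "(\<lambda>n. add M (u n) (v n)) \<in> cauchy_seqs M"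
  unfolding cauchy_seqs_def
proof (intro CollectI conjI allI impI)
  show "add M (u n) (v n) \<in> car M" for n using assms by simp
  fix e :: real assume "e > 0"
  then have "e/2 > 0" by simp
  obtain N1 where N1: "\<And>m n. m \<ge> N1 \<Longrightarrow> n \<ge> N1 \<Longrightarrow> mdist M (u m) (u n) < e/2"
    using cauchyD[OF assms(1) \<open>e/2 > 0\<close>] by auto
  obtain N2 where N2: "\<And>m n. m \<ge> N2 \<Longrightarrow> n \<ge> N2 \<Longrightarrow> mdist M (v m) (v n) < e/2"
    using cauchyD[OF assms(2) \<open>e/2 > 0\<close>] by auto
  have "mdist M (add M (u m) (v m)) (add M (u n) (v n)) < e" if "m \<ge> max N1 N2" "n \<ge> max N1 N2" for m n
    using mdist_add[of "u m" "v m" "u n" "v n"] N1[of m n] N2[of m n] that assms by fastforce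
  then show "\<exists>N. \<forall>m\<ge>N. \<forall>n\<ge>N. mdist M (add M (u m) (v m)) (add M (u n) (v n)) < e" by blast
qed

lemma cauchy_lipschitz:
  assumes "u \<in> cauchy_seqs M" "\<And>x. x \<in> car M \<Longrightarrow> f x \<in> car M"
    and "\<And>x y. x \<in> car M \<Longrightarrow> y \<in> car M \<Longrightarrow> mdist M (f x) (f y) \<le> mdist M x y * K"
  shows "(\<lambda>n. f (u n)) \<in> cauchy_seqs M"
  unfolding cauchy_seqs_def
proof (intro CollectI conjI allI impI)
  show "f (u n) \<in> car M" for n using assms by simp
  fix e :: real assume "e > 0"
  then have "e / (\<bar>K\<bar> + 1) > 0" by simp
  obtain N where N: "\<And>m n. m \<ge> N \<Longrightarrow> n \<ge> N \<Longrightarrow> mdist M (u m) (u n) < e / (\<bar>K\<bar> + 1)"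
    using cauchyD[OF assms(1) \<open>e / (\<bar>K\<bar> + 1) > 0\<close>] by auto
  have "mdist M (f (u m)) (f (u n)) < e" if "m \<ge> N" "n \<ge> N" for m n
  proof -
    have "mdist M (f (u m)) (f (u n)) \<le> mdist M (u m) (u n) * (\<bar>K\<bar> + 1)"
      using assms(3)[of "u m" "u n"] assms(1)
      by (smt (verit) cauchy_car mdist_nonneg mult_left_mono)
    also have "\<dots> < e" using N[OF that] by (simp add: field_simps)
    finally show ?thesis .
  qed
  then show "\<exists>N. \<forall>m\<ge>N. \<forall>n\<ge>N. mdist M (f (u m)) (f (u n)) < e" by blast
qed

lemma cauchy_ract: "u \<in> cauchy_seqs M \<Longrightarrow> (\<lambda>n. ract M (u n) b) \<in> cauchy_seqs M"
  by (rule cauchy_lipschitz[where K="norm b"]) (auto intro: mdist_ract)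

lemma mem_cls_iff: "u \<in> cauchy_seqs M \<Longrightarrow> v \<in> cls M u \<longleftrightarrow> v \<in> cauchy_seqs M \<and> mnull u v"
  by (auto simp: cls_def mnull_def)

lemma cls_self: "u \<in> cauchy_seqs M \<Longrightarrow> u \<in> cls M u"
  by (simp add: mem_cls_iff mnull_refl cauchy_range)

lemma cls_eqI:
  assumes "u \<in> cauchy_seqs M" "v \<in> cauchy_seqs M" "mnull u v"
  shows "cls M u = cls M v"
proof -
  have "cls M u \<subseteq> cls M v" if u: "u \<in> cauchy_seqs M" and v: "v \<in> cauchy_seqs M" and uv: "mnull u v" for u v
  proof
    fix w assume "w \<in> cls M u"
    then have w: "w \<in> cauchy_seqs M" "mnull u w" using u mem_cls_iff by blast+
    have "mnull v u" by (rule mnull_sym[OF cauchy_range[OF u] cauchy_range[OF v] uv])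
    from mnull_trans[OF cauchy_range[OF v] cauchy_range[OF u] cauchy_range[OF w(1)] this w(2)]
    show "w \<in> cls M v" using v w(1) mem_cls_iff by blast
  qed
  then show ?thesis
    using assms mnull_sym[OF cauchy_range[OF assms(1)] cauchy_range[OF assms(2)] assms(3)] by blast
qed

abbreviation "compl \<equiv> completion M"

lemma compl_car: "car compl = cls M ` cauchy_seqs M"
  by (simp add: completion_def)

lemma cls_car [simp]: "u \<in> cauchy_seqs M \<Longrightarrow> cls M u \<in> car compl"
  by (simp add: compl_car)

lemma mem_compl:
  assumes "c \<in> car compl" "u \<in> c"
  shows "u \<in> cauchy_seqs M" "c = cls M u"
proof -
  obtain v where v: "v \<in> cauchy_seqs M" "c = cls M v" using assms(1) compl_car by auto
  then show u: "u \<in> cauchy_seqs M" using assms(2) mem_cls_iff by simp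
  show "c = cls M u" using v u assms(2) mem_cls_iff cls_eqI by simp
qed

lemma rep_mem:
  assumes "c \<in> car compl" shows "rep c \<in> c"
proof -
  obtain u where "u \<in> cauchy_seqs M" "c = cls M u" using assms compl_car by auto
  then have "u \<in> c" using cls_self by simp
  then show ?thesis unfolding rep_def by (rule someI[where P="\<lambda>u. u \<in> c"])
qed

lemma rep_cls:
  assumes "u \<in> cauchy_seqs M"
  shows "rep (cls M u) \<in> cauchy_seqs M" "mnull u (rep (cls M u))"
  using rep_mem[OF cls_car[OF assms]] mem_cls_iff[OF assms] by simp_all

lemma rep_cls_sym:
  assumes "u \<in> cauchy_seqs M" shows "mnull (rep (cls M u)) u"
  by (rule mnull_sym[OF cauchy_range[OF assms] cauchy_range[OF rep_cls(1)[OF assms]] rep_cls(2)[OF assms]])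

lemma ip_compl_tendsto:
  assumes "u \<in> cauchy_seqs M" "v \<in> cauchy_seqs M"
  shows "(\<lambda>n. ip M (u n) (v n)) \<longlonglongrightarrow> ip compl (cls M u) (cls M v)"
proof -
  let ?r = "\<lambda>n. ip M (rep (cls M u) n) (rep (cls M v) n)"
  have "?r \<longlonglongrightarrow> ip compl (cls M u) (cls M v)"
    using cauchy_ip_convergent[OF rep_cls(1)[OF assms(1)] rep_cls(1)[OF assms(2)]]
    by (simp add: completion_def convergent_LIMSEQ_iff)
  then show ?thesis
    using tendsto_add[OF mnull_ip_diff[OF assms rep_cls(1)[OF assms(1)] rep_cls(1)[OF assms(2)]
        rep_cls(2)[OF assms(1)] rep_cls(2)[OF assms(2)]]] by fastforce
qed

lemma add_compl: 
  assumes "u \<in> cauchy_seqs M" "v \<in> cauchy_seqs M"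
  shows "add compl (cls M u) (cls M v) = cls M (\<lambda>n. add M (u n) (v n))"
proof -
  note r = rep_cls(1)[OF assms(1)] rep_cls(1)[OF assms(2)]
  have "cls M (\<lambda>n. add M (rep (cls M u) n) (rep (cls M v) n)) = cls M (\<lambda>n. add M (u n) (v n))"
    by (intro cls_eqI cauchy_add r assms mnull_add cauchy_range rep_cls_sym)
  then show ?thesis by (simp add: completion_def)
qed

lemma ract_compl: 
  assumes "u \<in> cauchy_seqs M"
  shows "ract compl (cls M u) b = cls M (\<lambda>n. ract M (u n) b)"
proof -
  have "cls M (\<lambda>n. ract M (rep (cls M u) n) b) = cls M (\<lambda>n. ract M (u n) b)"
    by (intro cls_eqI cauchy_ract rep_cls(1) assms mnull_ract cauchy_range rep_cls_sym)
  then show ?thesis by (simp add: completion_def)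
qed

lemma zer_compl: "zer compl = cls M (\<lambda>_. zer M)"
  by (simp add: completion_def)

lemma compl_cases:
  assumes "c \<in> car compl" obtains u where "u \<in> cauchy_seqs M" "c = cls M u"
  using assms compl_car by auto

text \<open>Each law holds along the representing sequences and survives the limit; positivity
  survives by \<open>cpos_closed\<close>.\<close>

lemma semi_module_compl: "semi_module compl"
proof
  show "zer compl \<in> car compl" by (simp add: zer_compl const_cauchy)
  fix x y z :: "(nat \<Rightarrow> 'x) set" and b :: 'b
  assume "x \<in> car compl"
  then obtain u where u [simp]: "u \<in> cauchy_seqs M" "x = cls M u" by (rule compl_cases)
  show "ract compl x b \<in> car compl" by (simp add: ract_compl cauchy_ract)
  have "(\<lambda>n. ip M (u n) (zer M)) \<longlonglongrightarrow> ip compl (cls M u) (cls M (\<lambda>_. zer M))"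
    by (intro ip_compl_tendsto) (auto intro: const_cauchy)
  then show "ip compl x (zer compl) = 0" by (simp add: zer_compl LIMSEQ_const_iff)
  show "cpos (ip compl x x)"
    by (rule cpos_closed[of "\<lambda>n. ip M (u n) (u n)"]) (auto intro: ip_compl_tendsto ip_pos)
  assume "y \<in> car compl"
  then obtain v where v [simp]: "v \<in> cauchy_seqs M" "y = cls M v" by (rule compl_cases)
  show "add compl x y \<in> car compl" by (simp add: add_compl cauchy_add)
  have "(\<lambda>n. ip M (u n) (v n) * b) \<longlonglongrightarrow> ip compl x (ract compl y b)"
    using ip_compl_tendsto[OF u(1) cauchy_ract[OF v(1)]] by (simp add: ract_compl)
  then show "ip compl x (ract compl y b) = ip compl x y * b"
    using LIMSEQ_unique tendsto_mult_right[OF ip_compl_tendsto[OF u(1) v(1)], of b] by fastforce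
  have "(\<lambda>n. star (ip M (u n) (v n))) \<longlonglongrightarrow> ip compl y x"
    using ip_compl_tendsto[OF v(1) u(1)] by (simp add: ip_star)
  then show "star (ip compl x y) = ip compl y x"
    using LIMSEQ_unique tendsto_star[OF ip_compl_tendsto[OF u(1) v(1)]] by fastforce
  assume "z \<in> car compl"
  then obtain w where w [simp]: "w \<in> cauchy_seqs M" "z = cls M w" by (rule compl_cases)
  have "(\<lambda>n. ip M (u n) (v n) + ip M (u n) (w n)) \<longlonglongrightarrow> ip compl x (add compl y z)"
    using ip_compl_tendsto[OF u(1) cauchy_add[OF v(1) w(1)]] by (simp add: add_compl)
  then show "ip compl x (add compl y z) = ip compl x y + ip compl x z"
    using LIMSEQ_unique
      tendsto_add[OF ip_compl_tendsto[OF u(1) v(1)] ip_compl_tendsto[OF u(1) w(1)]] by fastforce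
qed

lemma mdist_compl_tendsto:
  assumes "u \<in> cauchy_seqs M" "v \<in> cauchy_seqs M"
  shows "(\<lambda>n. mdist M (u n) (v n)) \<longlonglongrightarrow> mdist compl (cls M u) (cls M v)"
proof -
  interpret compl: semi_module compl by (rule semi_module_compl)
  have "(\<lambda>n. sqrt (norm (ip M (u n) (u n) - ip M (u n) (v n) - (ip M (v n) (u n) - ip M (v n) (v n)))))
    \<longlonglongrightarrow> sqrt (norm (ip compl (cls M u) (cls M u) - ip compl (cls M u) (cls M v)
      - (ip compl (cls M v) (cls M u) - ip compl (cls M v) (cls M v))))"
    by (intro tendsto_intros ip_compl_tendsto assms)
  moreover have "sqrt (norm (ip M x x - ip M x y - (ip M y x - ip M y y))) = mdist M x y"
    if "x \<in> car M" "y \<in> car M" for x y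
    using mdist_square[OF that] real_sqrt_unique[of "mdist M x y"] by simp
  moreover have "sqrt (norm (ip compl x x - ip compl x y - (ip compl y x - ip compl y y))) = mdist compl x y"
    if "x \<in> car compl" "y \<in> car compl" for x y
    using compl.mdist_square[OF that] real_sqrt_unique[of "mdist compl x y"] by simp
  ultimately show ?thesis using assms by simp
qed

lemma compl_separated:
  assumes "x \<in> car compl" "y \<in> car compl" "mdist compl x y = 0"
  shows "x = y"
proof -
  interpret compl: semi_module compl by (rule semi_module_compl)
  obtain u v where u: "u \<in> cauchy_seqs M" "x = cls M u" and v: "v \<in> cauchy_seqs M" "y = cls M v"
    using assms compl_cases by metis
  have "mnull u v" unfolding mnull_def using mdist_compl_tendsto[OF u(1) v(1)] assms(3) u v by simp
  then show ?thesis using cls_eqI u v by simp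
qed

lemma cls_const_tendsto:
  assumes "u \<in> cauchy_seqs M"
  shows "(\<lambda>n. mdist compl (cls M (\<lambda>_. u n)) (cls M u)) \<longlonglongrightarrow> 0"
proof -
  interpret compl: semi_module compl by (rule semi_module_compl)
  show ?thesis
proof (rule LIMSEQ_I)
  fix e :: real assume "0 < e"
  then have "e/2 > 0" by simp
  obtain N where N: "\<And>m n. m \<ge> N \<Longrightarrow> n \<ge> N \<Longrightarrow> mdist M (u m) (u n) < e/2"
    using cauchyD[OF assms \<open>e/2 > 0\<close>] by auto
  have "mdist compl (cls M (\<lambda>_. u n)) (cls M u) < e" if "n \<ge> N" for n
  proof -
    have "mdist compl (cls M (\<lambda>_. u n)) (cls M u) \<le> e/2"
    proof (rule LIMSEQ_le_const2)
      show "(\<lambda>m. mdist M (u n) (u m)) \<longlonglongrightarrow> mdist compl (cls M (\<lambda>_. u n)) (cls M u)"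
        using assms by (intro mdist_compl_tendsto const_cauchy) auto
      show "\<exists>M'. \<forall>m\<ge>M'. mdist M (u n) (u m) \<le> e/2" using N[OF that] less_imp_le by blast
    qed
    then show ?thesis using \<open>0 < e\<close> by simp
  qed
  then show "\<exists>no. \<forall>n\<ge>no. norm (mdist compl (cls M (\<lambda>_. u n)) (cls M u) - 0) < e" by auto
qed
qed

text \<open>Constant classes are dense by \<open>cls_const_tendsto\<close>, so \<open>c n\<close>
  may be replaced by a constant class within 1/(n + 1). The chosen constants form a Cauchy sequence
  v in M itself, and the class of v is the limit.\<close>

lemma compl_complete:
  assumes "c \<in> cauchy_seqs compl"
  shows "\<exists>x\<in>car compl. (\<lambda>n. mdist compl (c n) x) \<longlonglongrightarrow> 0"
proof -
  interpret compl: semi_module compl by (rule semi_module_compl)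
  have "\<exists>x\<in>car M. mdist compl (c n) (cls M (\<lambda>_. x)) < 1 / real (Suc n)" for n
  proof -
    obtain u where u: "u \<in> cauchy_seqs M" "c n = cls M u" using assms compl_cases compl.cauchy_car by metis
    obtain k where "mdist compl (cls M (\<lambda>_. u k)) (cls M u) < 1 / real (Suc n)"
      using LIMSEQ_D[OF cls_const_tendsto[OF u(1)], of "1 / real (Suc n)"] by auto
    then show ?thesis using u compl.mdist_commute[of "cls M u" "cls M (\<lambda>_. u k)"]
      by (intro bexI[of _ "u k"]) (auto simp: const_cauchy)
  qed
  then obtain v where v: "\<And>n. v n \<in> car M" "\<And>n. mdist compl (c n) (cls M (\<lambda>_. v n)) < 1 / real (Suc n)"
    by metis
  have null: "compl.mnull c (\<lambda>n. cls M (\<lambda>_. v n))"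
    by (rule compl.mnull_bound[OF less_imp_le[OF v(2)]]) (rule LIMSEQ_inverse_real_of_nat[unfolded inverse_eq_divide])
  then have cv: "(\<lambda>n. cls M (\<lambda>_. v n)) \<in> cauchy_seqs compl"
    using v(1) by (intro compl.mnull_cauchy[OF assms]) (auto simp: const_cauchy)
  have "mdist compl (cls M (\<lambda>_. x)) (cls M (\<lambda>_. y)) = mdist M x y" if "x \<in> car M" "y \<in> car M" for x y
    using mdist_compl_tendsto[OF const_cauchy const_cauchy, OF that] by (simp add: LIMSEQ_const_iff)
  then have vc: "v \<in> cauchy_seqs M" using cv v(1)
    by (simp add: cauchy_seqs_def del: cauchy_car compl.cauchy_car)
  have "compl.mnull (\<lambda>n. cls M (\<lambda>_. v n)) (\<lambda>_. cls M v)"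
    using cls_const_tendsto[OF vc] by (simp add: compl.mnull_def)
  moreover have "range (\<lambda>_::nat. cls M v) \<subseteq> car compl" using cls_car[OF vc] by blast
  ultimately have "compl.mnull c (\<lambda>_. cls M v)"
    using compl.mnull_trans[OF compl.cauchy_range[OF assms] compl.cauchy_range[OF cv] _ null] by blast
  then show ?thesis unfolding compl.mnull_def using cls_car[OF vc] by blast
qed

end

locale hmod = semi_module X for X :: "('a, 'b::unital_cstar_algebra, 'x) corr" +
  assumes complete: "\<And>u. u \<in> cauchy_seqs X \<Longrightarrow> \<exists>x\<in>car X. (\<lambda>n. mdist X (u n) x) \<longlonglongrightarrow> 0"
    and separated: "\<And>x y. x \<in> car X \<Longrightarrow> y \<in> car X \<Longrightarrow> mdist X x y = 0 \<Longrightarrow> x = y"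

lemma (in semi_module) hmod_compl: "hmod compl"
  by (intro hmod.intro semi_module_compl hmod_axioms.intro compl_complete compl_separated)

context semi_module
begin

lemma msum_simps [simp]: "msum M [] = zer M" "msum M (x # xs) = add M x (msum M xs)"
  by (simp_all add: msum_def)

lemma msum_car [simp]: "set xs \<subseteq> car M \<Longrightarrow> msum M xs \<in> car M"
  by (induction xs) auto

lemma ip_msum_right: "x \<in> car M \<Longrightarrow> set ys \<subseteq> car M \<Longrightarrow> ip M x (msum M ys) = (\<Sum>y\<leftarrow>ys. ip M x y)"
  by (induction ys) auto

lemma ip_msum_left: "x \<in> car M \<Longrightarrow> set ys \<subseteq> car M \<Longrightarrow> ip M (msum M ys) x = (\<Sum>y\<leftarrow>ys. ip M y x)"
  by (induction ys) auto

lemma tendsto_ip: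
  assumes "range u \<subseteq> car M" "range v \<subseteq> car M" "x \<in> car M" "y \<in> car M"
    and "(\<lambda>n. mdist M (u n) x) \<longlonglongrightarrow> 0" "(\<lambda>n. mdist M (v n) y) \<longlonglongrightarrow> 0"
  shows "(\<lambda>n. ip M (u n) (v n)) \<longlonglongrightarrow> ip M x y"
proof -
  have null: "mnull (\<lambda>_. x) u" "mnull (\<lambda>_. y) v"
    using mnull_sym[of u "\<lambda>_. x"] mnull_sym[of v "\<lambda>_. y"] assms by (auto simp: mnull_def)
  have "u \<in> cauchy_seqs M" "v \<in> cauchy_seqs M"
    using mnull_cauchy[OF const_cauchy[OF assms(3)] assms(1) null(1)]
      mnull_cauchy[OF const_cauchy[OF assms(4)] assms(2) null(2)] .
  then have "(\<lambda>n. ip M x y - ip M (u n) (v n)) \<longlonglongrightarrow> 0"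
    by (rule mnull_ip_diff[OF const_cauchy[OF assms(3)] const_cauchy[OF assms(4)] _ _ null])
  from tendsto_diff[OF tendsto_const[of "ip M x y"] this] show ?thesis by simp
qed

end

subsection \<open>Interior tensor products\<close>

text \<open>As in \<open>semi_module\<close>, the laws of the left action are imposed only under
  \<open>ip\<close>. The unit of the coefficient algebra may act as a proper projection.\<close>

locale semi_corr = semi_module M
  for M :: "('a::unital_cstar_algebra, 'b::unital_cstar_algebra, 'x) corr" +
  assumes lact_car [simp]: "\<And>a x. x \<in> car M \<Longrightarrow> lact M a x \<in> car M"
    and ip_lact: "\<And>a x y. x \<in> car M \<Longrightarrow> y \<in> car M \<Longrightarrow>
      ip M (lact M a x) y = ip M x (lact M (star a) y)"
    and ip_lact_add: "\<And>a b x y. x \<in> car M \<Longrightarrow> y \<in> car M \<Longrightarrow>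
      ip M x (lact M (a + b) y) = ip M x (lact M a y) + ip M x (lact M b y)"
    and ip_lact_scaleC: "\<And>a c x y. x \<in> car M \<Longrightarrow> y \<in> car M \<Longrightarrow>
      ip M x (lact M (c *\<^sub>C a) y) = c *\<^sub>C ip M x (lact M a y)"
    and ip_lact_mult: "\<And>a b x y. x \<in> car M \<Longrightarrow> y \<in> car M \<Longrightarrow>
      ip M x (lact M (a * b) y) = ip M x (lact M a (lact M b y))"
begin

lemma ip_lact_scaleR:
  "x \<in> car M \<Longrightarrow> y \<in> car M \<Longrightarrow> ip M x (lact M (r *\<^sub>R a) y) = r *\<^sub>R ip M x (lact M a y)"
  by (simp add: scaleR_scaleC ip_lact_scaleC)

lemma ip_lact_zero: "x \<in> car M \<Longrightarrow> y \<in> car M \<Longrightarrow> ip M x (lact M 0 y) = 0"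
  using ip_lact_scaleR[of x y 0 0] by simp

lemma ip_lact_diff: "x \<in> car M \<Longrightarrow> y \<in> car M \<Longrightarrow>
    ip M x (lact M (a - b) y) = ip M x (lact M a y) - ip M x (lact M b y)"
  using ip_lact_add[of x y "a - b" b] by simp

lemma ip_lact_sum: "x \<in> car M \<Longrightarrow> y \<in> car M \<Longrightarrow>
    ip M x (lact M (sum f I) y) = (\<Sum>i\<in>I. ip M x (lact M (f i) y))"
  by (induction I rule: infinite_finite_induct) (auto simp: ip_lact_zero ip_lact_add)

lemma ip_lact_right: "x \<in> car M \<Longrightarrow> y \<in> car M \<Longrightarrow> ip M x (lact M a y) = ip M (lact M (star a) x) y"
  by (simp add: ip_lact star_star)

text \<open>With s the root of ||a||^2 - a^*a, the inner square of \<open>lact M s y\<close>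
  measures the defect on the range of \<open>lact M 1\<close>; the vector w accounts for the part of
  y which the unit may annihilate.\<close>

lemma mnorm_lact:
  assumes y: "y \<in> car M"
  shows "mnorm M (lact M a y) \<le> norm a * mnorm M y"
proof (rule power2_le_imp_le)
  let ?t = "(norm a)\<^sup>2"
  have "cpos (?t *\<^sub>R 1 - star a * a)"
    by (intro cpos_norm_minus) (auto simp: star_mult star_star cstar_identity)
  then obtain s where s: "cpos s" "s * s = ?t *\<^sub>R 1 - star a * a" using cpos_sqrt by blast
  have 1: "ip M (lact M a y) (lact M a y) = ip M y (lact M (star a * a) y)"
    using y by (simp add: ip_lact ip_lact_mult)
  have 2: "ip M (lact M s y) (lact M s y) = ?t *\<^sub>R ip M y (lact M 1 y) - ip M (lact M a y) (lact M a y)"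
    using y s by (simp add: ip_lact cpos_selfadjoint 1[unfolded ip_lact[OF y lact_car[OF y]]]
        ip_lact_diff ip_lact_scaleR flip: ip_lact_mult)
  define w where "w = mdiff y (lact M 1 y)"
  have "ip M (lact M 1 y) y = ip M y (lact M 1 y)" using y by (simp add: ip_lact)
  moreover have "ip M (lact M 1 y) (lact M 1 y) = ip M y (lact M 1 y)"
    using y by (simp add: ip_lact flip: ip_lact_mult)
  ultimately have 3: "ip M w w = ip M y y - ip M y (lact M 1 y)"
    unfolding w_def using y by simp
  have "cpos (?t *\<^sub>R ip M w w + ip M (lact M s y) (lact M s y))"
    unfolding w_def using y by (intro cpos_add cpos_scaleR ip_pos) auto
  also have "?t *\<^sub>R ip M w w + ip M (lact M s y) (lact M s y) = ?t *\<^sub>R ip M y y - ip M (lact M a y) (lact M a y)"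
    unfolding 2 3 by (simp add: algebra_simps)
  finally have "norm (ip M (lact M a y) (lact M a y)) \<le> norm (?t *\<^sub>R ip M y y)"
    using y by (intro cpos_norm_mono ip_pos) auto
  then show "(mnorm M (lact M a y))\<^sup>2 \<le> (norm a * mnorm M y)\<^sup>2"
    by (simp add: mnorm_square power_mult_distrib)
qed simp

lemma norm_ip_lact_le:
  assumes "x \<in> car M" "y \<in> car M"
  shows "norm (ip M x (lact M a y)) \<le> norm a * (mnorm M x * mnorm M y)"
proof -
  have "norm (ip M x (lact M a y)) \<le> mnorm M x * mnorm M (lact M a y)"
    using assms by (intro cauchy_schwarz) auto
  also have "\<dots> \<le> mnorm M x * (norm a * mnorm M y)"
    using assms by (intro mult_left_mono mnorm_lact) auto
  finally show ?thesis by (simp add: algebra_simps)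
qed

lemma mdist_lact:
  assumes "x \<in> car M" "y \<in> car M"
  shows "mdist M (lact M a x) (lact M a y) \<le> mdist M x y * norm a"
proof -
  have "mdist M (lact M a x) (lact M a y) = mnorm M (lact M a (mdiff x y))"
    unfolding mdist_eq
  proof (rule mnorm_cong)
    have *: "ip M w (lact M a (mdiff x y)) = ip M w (lact M a x) - ip M w (lact M a y)" if "w \<in> car M" for w
      using assms that by (simp add: ip_lact_right)
    have **: "ip M (lact M a (mdiff x y)) w = ip M (lact M a x) w - ip M (lact M a y) w" if "w \<in> car M" for w
      using assms that by (simp add: ip_lact)
    show "ip M (mdiff (lact M a x) (lact M a y)) (mdiff (lact M a x) (lact M a y))
      = ip M (lact M a (mdiff x y)) (lact M a (mdiff x y))"
      using assms by (simp add: * **)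
  qed
  then show ?thesis using assms mnorm_lact[of "mdiff x y" a] by (simp add: mdist_eq mult.commute)
qed

lemma cauchy_lact: "u \<in> cauchy_seqs M \<Longrightarrow> (\<lambda>n. lact M a (u n)) \<in> cauchy_seqs M"
  by (rule cauchy_lipschitz[where K="norm a"]) (auto intro: mdist_lact)

lemma mnull_lact:
  assumes "range u \<subseteq> car M" "range v \<subseteq> car M" "mnull u v"
  shows "mnull (\<lambda>n. lact M a (u n)) (\<lambda>n. lact M a (v n))"
proof (rule mnull_bound)
  show "mdist M (lact M a (u n)) (lact M a (v n)) \<le> mdist M (u n) (v n) * norm a" for n
    using assms(1,2) by (intro mdist_lact) auto
  show "(\<lambda>n. mdist M (u n) (v n) * norm a) \<longlonglongrightarrow> 0"
    using tendsto_mult_right[OF assms(3)[unfolded mnull_def], of "norm a"] by simp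
qed

lemma lact_compl:
  assumes "u \<in> cauchy_seqs M"
  shows "lact compl a (cls M u) = cls M (\<lambda>n. lact M a (u n))"
proof -
  have "cls M (\<lambda>n. lact M a (rep (cls M u) n)) = cls M (\<lambda>n. lact M a (u n))"
    by (intro cls_eqI cauchy_lact rep_cls(1) assms mnull_lact cauchy_range rep_cls_sym)
  then show ?thesis by (simp add: completion_def)
qed

lemma semi_corr_compl: "semi_corr compl"
proof (intro semi_corr.intro semi_module_compl, unfold_locales)
  fix a b :: 'a and c :: complex and x y :: "(nat \<Rightarrow> 'x) set"
  assume "x \<in> car compl"
  then obtain u where u [simp]: "u \<in> cauchy_seqs M" "x = cls M u" by (rule compl_cases)
  show "lact compl a x \<in> car compl" by (simp add: lact_compl cauchy_lact)
  assume "y \<in> car compl"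
  then obtain v where v [simp]: "v \<in> cauchy_seqs M" "y = cls M v" by (rule compl_cases)
  have lim: "(\<lambda>n. ip M (u n) (lact M a (v n))) \<longlonglongrightarrow> ip compl x (lact compl a y)" for a
    using ip_compl_tendsto[OF u(1) cauchy_lact[OF v(1)]] by (simp add: lact_compl)
  have "(\<lambda>n. ip M (u n) (lact M (star a) (v n))) \<longlonglongrightarrow> ip compl (lact compl a x) y"
    using ip_compl_tendsto[OF cauchy_lact[OF u(1), of a] v(1)] by (simp add: lact_compl ip_lact)
  then show "ip compl (lact compl a x) y = ip compl x (lact compl (star a) y)"
    using LIMSEQ_unique lim by blast
  have "(\<lambda>n. ip M (u n) (lact M (a + b) (v n))) \<longlonglongrightarrow> ip compl x (lact compl a y) + ip compl x (lact compl b y)"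
    using tendsto_add[OF lim[of a] lim[of b]] by (simp add: ip_lact_add)
  then show "ip compl x (lact compl (a + b) y) = ip compl x (lact compl a y) + ip compl x (lact compl b y)"
    using LIMSEQ_unique lim by blast
  have bl: "bounded_linear (\<lambda>z::'b. c *\<^sub>C z)"
    by (rule bounded_linear_intro[where K="norm c"])
      (auto simp: scaleC_add_right scaleR_scaleC scaleC_scaleC norm_scaleC mult.commute)
  have "(\<lambda>n. ip M (u n) (lact M (c *\<^sub>C a) (v n))) \<longlonglongrightarrow> c *\<^sub>C ip compl x (lact compl a y)"
    using bounded_linear.tendsto[OF bl lim[of a]] by (simp add: ip_lact_scaleC)
  then show "ip compl x (lact compl (c *\<^sub>C a) y) = c *\<^sub>C ip compl x (lact compl a y)"
    using LIMSEQ_unique lim by blast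
  have "(\<lambda>n. ip M (u n) (lact M a (lact M b (v n)))) \<longlonglongrightarrow> ip compl x (lact compl a (lact compl b y))"
    using ip_compl_tendsto[OF u(1) cauchy_lact[OF cauchy_lact[OF v(1)]]]
    by (simp add: lact_compl cauchy_lact)
  then have "(\<lambda>n. ip M (u n) (lact M (a * b) (v n))) \<longlonglongrightarrow> ip compl x (lact compl a (lact compl b y))"
    by (simp add: ip_lact_mult)
  then show "ip compl x (lact compl (a * b) y) = ip compl x (lact compl a (lact compl b y))"
    using LIMSEQ_unique lim by blast
qed

end

section \<open>Columns and matrices over a C*-algebra\<close>

definition column_module :: "nat \<Rightarrow> ('b::unital_cstar_algebra, 'b, nat \<Rightarrow> 'b) corr"
  where "column_module n = \<lparr>car = UNIV, zer = (\<lambda>_. 0), add = (\<lambda>a b i. a i + b i),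
    ract = (\<lambda>a b i. a i * b), ip = (\<lambda>a b. \<Sum>i<n. star (a i) * b i), lact = (\<lambda>a b i. a * b i)\<rparr>"

lemma column_module_sel [simp]:
  "car (column_module n) = UNIV" "zer (column_module n) = (\<lambda>_. 0)"
  "add (column_module n) a b = (\<lambda>i. a i + b i)" "ract (column_module n) a c = (\<lambda>i. a i * c)"
  "ip (column_module n) a b = (\<Sum>i<n. star (a i) * b i)"
  by (simp_all add: column_module_def)

interpretation column: semi_module "column_module n"
  by unfold_locales
    (auto simp: sum.distrib distrib_left star_sum star_mult star_star sum_distrib_right mult.assoc
      intro!: cpos_sum cpos_star_mult)

abbreviation col_norm :: "nat \<Rightarrow> (nat \<Rightarrow> 'b::unital_cstar_algebra) \<Rightarrow> real"
  where "col_norm n a \<equiv> mnorm (column_module n) a"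

definition mat_app :: "nat \<Rightarrow> (nat \<Rightarrow> nat \<Rightarrow> 'b::unital_cstar_algebra) \<Rightarrow> (nat \<Rightarrow> 'b) \<Rightarrow> nat \<Rightarrow> 'b"
  where "mat_app n D a = (\<lambda>i. \<Sum>j<n. D i j * a j)"

definition mat_mul :: "nat \<Rightarrow> (nat \<Rightarrow> nat \<Rightarrow> 'b::unital_cstar_algebra) \<Rightarrow> (nat \<Rightarrow> nat \<Rightarrow> 'b) \<Rightarrow> nat \<Rightarrow> nat \<Rightarrow> 'b"
  where "mat_mul n D D' = (\<lambda>i j. \<Sum>k<n. D i k * D' k j)"

lemma mat_app_mul: "mat_app n (mat_mul n D D') a = mat_app n D (mat_app n D' a)"
  unfolding mat_app_def mat_mul_def
  by (simp add: sum_distrib_left sum_distrib_right mult.assoc) (subst sum.swap, simp)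

lemma mat_app_diff: "mat_app n (\<lambda>i j. D i j - D' i j) a = (\<lambda>i. mat_app n D a i - mat_app n D' a i)"
  by (simp add: mat_app_def left_diff_distrib sum_subtractf)

lemma mat_app_diff_right: "mat_app n D (\<lambda>i. a i - b i) = (\<lambda>i. mat_app n D a i - mat_app n D b i)"
  by (simp add: mat_app_def right_diff_distrib sum_subtractf)

lemma col_norm_half_add: "col_norm n (\<lambda>i. (1/2) *\<^sub>R (a i + b i)) \<le> (col_norm n a + col_norm n b) / 2"
proof -
  have "col_norm n (\<lambda>i. (1/2) *\<^sub>R (a i + b i))
      = col_norm n (ract (column_module n) (add (column_module n) a b) ((1/2) *\<^sub>R 1))"
    by (simp add: mnorm_def)
  also have "\<dots> \<le> col_norm n (add (column_module n) a b) * norm ((1/2) *\<^sub>R (1::'a))"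
    by (rule column.mnorm_ract) simp
  also have "\<dots> \<le> (col_norm n a + col_norm n b) * (1/2)"
    using norm_one_le[where 'a='a]
    by (intro mult_mono column.mnorm_add_le) (auto intro: add_nonneg_nonneg column.mnorm_nonneg)
  finally show ?thesis by simp
qed

lemma norm_le_col_norm:
  assumes "i < n" shows "norm (a i) \<le> col_norm n a"
proof (rule power2_le_imp_le)
  have "(\<Sum>i<n. star (a i) * a i) - star (a i) * a i = (\<Sum>i\<in>{..<n} - {i}. star (a i) * a i)"
    using assms by (simp add: sum_diff1)
  then have "norm (star (a i) * a i) \<le> norm (\<Sum>i<n. star (a i) * a i)"
    by (intro cpos_norm_mono cpos_star_mult) (auto intro: cpos_sum cpos_star_mult)
  then show "(norm (a i))\<^sup>2 \<le> (col_norm n a)\<^sup>2"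
    by (simp add: column.mnorm_square cstar_identity)
qed simp

text \<open>Operator bound of a matrix on the Hilbert module of columns. It stands in for the
  C*-norm of the matrix algebra, which would first have to be constructed.\<close>

definition mat_bound :: "nat \<Rightarrow> (nat \<Rightarrow> nat \<Rightarrow> 'b::unital_cstar_algebra) \<Rightarrow> real \<Rightarrow> bool"
  where "mat_bound n D s \<longleftrightarrow> (\<forall>a. col_norm n (mat_app n D a) \<le> s * col_norm n a)"

lemma mat_bound_entry:
  assumes "mat_bound n D s" "0 \<le> s" "i < n" "j < n"
  shows "norm (D i j :: 'b::unital_cstar_algebra) \<le> s"
proof -
  define e :: "nat \<Rightarrow> 'b" where "e = (\<lambda>k. if k = j then 1 else 0)"
  have "mat_app n D e = (\<lambda>i. \<Sum>k<n. if k = j then D i k else 0)"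
    by (simp add: mat_app_def e_def if_distrib cong: if_cong)
  then have 1: "mat_app n D e i = D i j" using assms(4) by simp
  have "(\<Sum>i<n. star (e i) * e i) = (\<Sum>i<n. if i = j then 1 else 0)"
    by (rule sum.cong) (auto simp: e_def)
  then have "col_norm n e \<le> 1"
    using assms(4) norm_one_le[where 'a='b] by (simp add: mnorm_def)
  then have "s * col_norm n e \<le> s" using assms(2) by (simp add: mult_left_le)
  moreover have "norm (mat_app n D e i) \<le> col_norm n (mat_app n D e)" using assms(3) by (rule norm_le_col_norm)
  ultimately show ?thesis using assms(1) 1 unfolding mat_bound_def by (metis order.trans)
qed

primrec mat_iter :: "nat \<Rightarrow> (nat \<Rightarrow> nat \<Rightarrow> 'b::unital_cstar_algebra) \<Rightarrow> nat \<Rightarrow> nat \<Rightarrow> nat \<Rightarrow> 'b" where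
  "mat_iter n R 0 = (\<lambda>_ _. 0)"
| "mat_iter n R (Suc k) = (\<lambda>i j. (1/2) *\<^sub>R (R i j + mat_mul n (mat_iter n R k) (mat_iter n R k) i j))"

lemma mat_iter_app:
  "mat_app n (mat_iter n R (Suc k)) a
    = (\<lambda>i. (1/2) *\<^sub>R (mat_app n R a i + mat_app n (mat_iter n R k) (mat_app n (mat_iter n R k) a) i))"
  unfolding mat_app_mul[symmetric]
  by (simp add: mat_app_def distrib_right sum.distrib flip: scaleR_sum_right)

text \<open>The argument of \<open>sqrt_iter_bounds\<close>, carried out for matrices acting on
  columns with the same scalar majorant. Bounds on the entries then follow by
  \<open>mat_bound_entry\<close>.\<close>

lemma mat_iter_bounds:
  assumes "mat_bound n R 1"
  shows "mat_bound n (mat_iter n R k) (sqrt_bound k) \<and>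
    mat_bound n (\<lambda>i j. mat_iter n R (Suc k) i j - mat_iter n R k i j) (sqrt_bound (Suc k) - sqrt_bound k)"
proof (induction k)
  case 0
  have "mat_app n (\<lambda>_ _. 0) a = (\<lambda>_. 0)" for a :: "nat \<Rightarrow> 'a" by (simp add: mat_app_def)
  moreover have "col_norm n (\<lambda>_. 0 :: 'a) = 0" by (simp add: mnorm_def)
  moreover have "col_norm n (mat_app n (mat_iter n R (Suc 0)) a) \<le> (1/2) * col_norm n a" for a
    unfolding mat_iter_app
    using col_norm_half_add[of n "mat_app n R a" "\<lambda>_. 0"] calculation assms
    by (simp add: mat_bound_def) (meson mult_left_mono order.trans)
  ultimately show ?case by (simp add: mat_bound_def)
next
  case (Suc k)
  let ?y = "mat_iter n R" and ?s = sqrt_bound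
  have s: "0 \<le> ?s (Suc k)" "0 \<le> ?s k" "?s k \<le> ?s (Suc k)"
    using sqrt_bound_range sqrt_bound_mono by blast+
  have 1: "mat_bound n (?y (Suc k)) (?s (Suc k))"
    unfolding mat_bound_def
  proof
    fix a :: "nat \<Rightarrow> 'a"
    have "mat_app n (?y (Suc k)) a = add (column_module n) (mat_app n (?y k) a)
        (mat_app n (\<lambda>i j. ?y (Suc k) i j - ?y k i j) a)"
      by (simp add: mat_app_diff del: mat_iter.simps)
    then have "col_norm n (mat_app n (?y (Suc k)) a) \<le> col_norm n (mat_app n (?y k) a)
        + col_norm n (mat_app n (\<lambda>i j. ?y (Suc k) i j - ?y k i j) a)"
      using column.mnorm_add_le by fastforce
    also have "\<dots> \<le> ?s k * col_norm n a + (?s (Suc k) - ?s k) * col_norm n a"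
      using Suc unfolding mat_bound_def by (intro add_mono) auto
    finally show "col_norm n (mat_app n (?y (Suc k)) a) \<le> ?s (Suc k) * col_norm n a"
      by (simp add: algebra_simps del: sqrt_bound.simps)
  qed
  let ?d = "\<lambda>i j. ?y (Suc k) i j - ?y k i j"
  have 2: "mat_bound n (\<lambda>i j. ?y (Suc (Suc k)) i j - ?y (Suc k) i j) (?s (Suc (Suc k)) - ?s (Suc k))"
    unfolding mat_bound_def
  proof
    fix a :: "nat \<Rightarrow> 'a"
    have eq: "mat_app n (\<lambda>i j. ?y (Suc (Suc k)) i j - ?y (Suc k) i j) a
      = (\<lambda>i. (1/2) *\<^sub>R (mat_app n ?d (mat_app n (?y (Suc k)) a) i + mat_app n (?y k) (mat_app n ?d a) i))"
      unfolding mat_app_diff mat_app_diff_right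
      by (subst mat_iter_app, subst (3) mat_iter_app)
        (simp add: fun_eq_iff algebra_simps del: mat_iter.simps)
    have "col_norm n (mat_app n (\<lambda>i j. ?y (Suc (Suc k)) i j - ?y (Suc k) i j) a)
        \<le> (col_norm n (mat_app n ?d (mat_app n (?y (Suc k)) a))
          + col_norm n (mat_app n (?y k) (mat_app n ?d a))) / 2"
      unfolding eq by (rule col_norm_half_add)
    also have "\<dots> \<le> ((?s (Suc k) - ?s k) * (?s (Suc k) * col_norm n a)
          + ?s k * ((?s (Suc k) - ?s k) * col_norm n a)) / 2"
    proof (intro divide_right_mono add_mono)
      show "col_norm n (mat_app n ?d (mat_app n (?y (Suc k)) a)) \<le> (?s (Suc k) - ?s k) * (?s (Suc k) * col_norm n a)"
        using Suc 1 s unfolding mat_bound_def by (meson diff_ge_0_iff_ge mult_left_mono order.trans)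
      show "col_norm n (mat_app n (?y k) (mat_app n ?d a)) \<le> ?s k * ((?s (Suc k) - ?s k) * col_norm n a)"
        using Suc s unfolding mat_bound_def by (meson mult_left_mono order.trans)
    qed simp
    also have "\<dots> = (((?s (Suc k))\<^sup>2 - (?s k)\<^sup>2) / 2) * col_norm n a"
      by (simp add: power2_eq_square field_simps del: sqrt_bound.simps)
    also have "((?s (Suc k))\<^sup>2 - (?s k)\<^sup>2) / 2 = ?s (Suc (Suc k)) - ?s (Suc k)"
      unfolding sqrt_bound.simps(2)[of "Suc k"]
      by (subst (3) sqrt_bound.simps(2)) (simp add: field_simps del: sqrt_bound.simps)
    finally show "col_norm n (mat_app n (\<lambda>i j. ?y (Suc (Suc k)) i j - ?y (Suc k) i j) a)
      \<le> (?s (Suc (Suc k)) - ?s (Suc k)) * col_norm n a" .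
  qed
  show ?case using 1 2 by blast
qed

lemma mat_iter_star:
  assumes "\<And>i j. star (R i j) = R j i"
  shows "star (mat_iter n R k i j) = mat_iter n R k j i"
  by (induction k arbitrary: i j) (auto simp: assms star_add mat_mul_def star_sum star_mult)

text \<open>The Gram matrix \<open>G\<close> of \<open>x\<^sub>1,\<dots>,x\<^sub>n\<close>, scaled so that \<open>0 \<le> G \<le> c\<close> on columns, is a limit of squares
  \<open>c B\<^sup>*B\<close> of matrices over the coefficient algebra; this transfers its positivity to any left module.\<close>

lemma gram_contraction:
  fixes M :: "('a, 'b::unital_cstar_algebra, 'x) corr"
  assumes "semi_module M" and x: "\<And>i. i < n \<Longrightarrow> x i \<in> car M"
  obtains c where "c > 0" "mat_bound n (\<lambda>i j. (if i = j then 1 else 0) - (1/c) *\<^sub>R ip M (x i) (x j)) 1"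
proof -
  interpret semi_module M by fact
  define t where "t i = norm (ip M (x i) (x i)) + 1" for i
  \<comment> \<open>Chosen so that the square of the Gram matrix G is at most c G: Cauchy-Schwarz
    contributes \<open>t i\<close> for the i-th row. The added 1s keep \<open>t i\<close> and c
    strictly positive.\<close>
  define c where "c = 1 + (\<Sum>i<n. t i)"
  have t: "t i > 0" for i by (simp add: t_def add_nonneg_pos)
  then have c: "c > 0" unfolding c_def by (intro add_pos_nonneg sum_nonneg) (auto intro: less_imp_le)
  define R where "R = (\<lambda>i j. (if i = j then 1 else 0) - (1/c) *\<^sub>R ip M (x i) (x j))"
  have "mat_bound n R 1"
    unfolding mat_bound_def
  proof
    fix a :: "nat \<Rightarrow> 'b"
    define z where "z = msum M (map (\<lambda>j. ract M (x j) (a j)) [0..<n])"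
    have zc: "set (map (\<lambda>j. ract M (x j) (a j)) [0..<n]) \<subseteq> car M" using x by auto
    then have z: "z \<in> car M" unfolding z_def by (rule msum_car)
    define g where "g i = ip M (x i) z" for i
    have g: "g i = (\<Sum>j<n. ip M (x i) (x j) * a j)" if "i < n" for i
    proof -
      have "g i = (\<Sum>j\<leftarrow>[0..<n]. ip M (x i) (ract M (x j) (a j)))"
        unfolding g_def z_def using ip_msum_right[OF x[OF that] zc] by (simp add: o_def)
      also have "\<dots> = (\<Sum>j<n. ip M (x i) (ract M (x j) (a j)))"
        by (simp add: interv_sum_list_conv_sum_set_nat atLeast0LessThan)
      finally show ?thesis using x that by simp
    qed
    have Ra: "mat_app n R a i = a i - (1/c) *\<^sub>R g i" if "i < n" for i
    proof -
      have "mat_app n R a i = (\<Sum>j<n. (if i = j then a j else 0) - (1/c) *\<^sub>R (ip M (x i) (x j) * a j))"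
        unfolding mat_app_def R_def by (rule sum.cong) (auto simp: left_diff_distrib)
      also have "\<dots> = a i - (1/c) *\<^sub>R g i"
        using that by (simp add: sum_subtractf g scaleR_sum_right)
      finally show ?thesis .
    qed
    have zz: "ip M z z = (\<Sum>i<n. star (a i) * g i)"
    proof -
      have "ip M z z = (\<Sum>i\<leftarrow>[0..<n]. ip M (ract M (x i) (a i)) z)"
        using ip_msum_left[OF z zc] by (simp add: z_def[symmetric] o_def)
      also have "\<dots> = (\<Sum>i<n. ip M (ract M (x i) (a i)) z)"
        by (simp add: interv_sum_list_conv_sum_set_nat atLeast0LessThan)
      finally show ?thesis using x z by (simp add: g_def)
    qed
    have zz': "ip M z z = (\<Sum>i<n. star (g i) * a i)"
      using arg_cong[OF zz, of star] ip_star[OF z z] by (simp add: star_sum star_mult star_star)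
    have "cpos (\<Sum>i<n. t i *\<^sub>R ip M z z - star (g i) * g i)"
      unfolding g_def using x z t by (intro cpos_sum cauchy_schwarz_pos) (auto simp: t_def)
    then have "cpos (ip M z z + (\<Sum>i<n. t i *\<^sub>R ip M z z - star (g i) * g i))"
      using cpos_add[OF ip_pos[OF z]] by blast
    then have pos: "cpos (c *\<^sub>R ip M z z - (\<Sum>i<n. star (g i) * g i))"
      by (simp add: c_def sum_subtractf algebra_simps flip: scaleR_sum_left)
    let ?A = "\<Sum>i<n. star (a i) * a i" and ?RA = "\<Sum>i<n. star (mat_app n R a i) * mat_app n R a i"
    have "?RA = (\<Sum>i<n. star (a i) * a i - (1/c) *\<^sub>R (star (a i) * g i) - (1/c) *\<^sub>R (star (g i) * a i)
        + (1/c\<^sup>2) *\<^sub>R (star (g i) * g i))"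
      by (rule sum.cong) (auto simp: Ra star_diff algebra_simps power2_eq_square)
    also have "\<dots> = ?A - (1/c) *\<^sub>R ip M z z - (1/c) *\<^sub>R ip M z z + (1/c\<^sup>2) *\<^sub>R (\<Sum>i<n. star (g i) * g i)"
      by (subst (1) zz, subst zz') (simp add: sum.distrib sum_subtractf scaleR_sum_right)
    \<comment> \<open>The defect 1 - R^2 for R = 1 - G/c, evaluated on the column a and written as
      G/c + (cG - G^2)/c^2; both terms are positive.\<close>
    finally have "?A - ?RA = (1/c) *\<^sub>R ip M z z + (1/c\<^sup>2) *\<^sub>R (c *\<^sub>R ip M z z - (\<Sum>i<n. star (g i) * g i))"
      using c by (simp add: algebra_simps power2_eq_square)
    also have "cpos \<dots>" using c by (intro cpos_add cpos_scaleR ip_pos z pos) auto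
    finally have "norm ?RA \<le> norm ?A"
      by (intro cpos_norm_mono) (auto intro: cpos_sum cpos_star_mult)
    then show "col_norm n (mat_app n R a) \<le> 1 * col_norm n a"
      by (simp add: mnorm_def)
  qed
  then show ?thesis using that c by (simp add: R_def)
qed

text \<open>With \<open>B k\<close> = 1 - \<open>Y k\<close> the recursion gives (B k)^2 = G/c + 2(Y
  (k+1) - Y k). The square contributes the inner squares \<open>ip N (w l) (w l)\<close>; the
  increment contributes \<open>E k\<close>, which tends to 0 by the majorant.\<close>

lemma gram_pos:
  fixes M :: "('a, 'b::unital_cstar_algebra, 'x) corr" and N :: "('b, 'c::unital_cstar_algebra, 'y) corr"
    and n :: nat
  assumes "semi_module M" "semi_corr N"
    and x: "\<And>i. i < n \<Longrightarrow> x i \<in> car M" and y: "\<And>i. i < n \<Longrightarrow> y i \<in> car N"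
  shows "cpos (\<Sum>i<n. \<Sum>j<n. ip N (y i) (lact N (ip M (x i) (x j)) (y j)))"
proof -
  interpret M: semi_module M by fact
  interpret N: semi_corr N by fact
  obtain c where c: "c > 0"
    "mat_bound n (\<lambda>i j. (if i = j then 1 else 0) - (1/c) *\<^sub>R ip M (x i) (x j)) 1"
    using gram_contraction[where M=M and n=n and x=x, OF assms(1) x] by blast
  define dl :: "nat \<Rightarrow> nat \<Rightarrow> 'b" where "dl = (\<lambda>i j. if i = j then 1 else 0)"
  \<comment> \<open>Set to 0 outside the n by n block, where x need not lie in M, so that R is
    hermitian at all indices as \<open>mat_iter_star\<close> requires.\<close>
  define R where "R i j = (if i < n \<and> j < n then dl i j - (1/c) *\<^sub>R ip M (x i) (x j) else 0)" for i j
  have "mat_app n R a i = mat_app n (\<lambda>i j. dl i j - (1/c) *\<^sub>R ip M (x i) (x j)) a i" if "i < n" for a i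
    using that by (simp add: mat_app_def R_def)
  then have Rb: "mat_bound n R 1" using c(2) unfolding mat_bound_def dl_def by (simp add: mnorm_def)
  have Rs: "star (R i j) = R j i" for i j
    by (auto simp: R_def dl_def star_diff M.ip_star x)
  define Y where "Y = mat_iter n R"
  define B where "B k i j = dl i j - Y k i j" for k i j
  have Bs: "star (B k i j) = B k j i" for k i j
    using mat_iter_star[OF Rs] by (auto simp: B_def Y_def dl_def star_diff)
  have BB: "(\<Sum>l<n. B k i l * B k l j) = (1/c) *\<^sub>R ip M (x i) (x j) + 2 *\<^sub>R (Y (Suc k) i j - Y k i j)"
    if ij: "i < n" "j < n" for i j k
  proof -
    have "(\<Sum>l<n. B k i l * B k l j)
      = (\<Sum>l<n. (if i = l then dl l j else 0) - (if i = l then Y k l j else 0)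
          - (if l = j then Y k i l else 0) + Y k i l * Y k l j)"
      by (rule sum.cong) (auto simp: B_def dl_def algebra_simps)
    also have "\<dots> = dl i j - 2 *\<^sub>R Y k i j + mat_mul n (Y k) (Y k) i j"
      using ij by (simp add: sum.distrib sum_subtractf mat_mul_def scaleR_2)
    also have "mat_mul n (Y k) (Y k) i j = 2 *\<^sub>R Y (Suc k) i j - R i j"
      by (simp add: Y_def)
    also have "R i j = dl i j - (1/c) *\<^sub>R ip M (x i) (x j)" using ij by (simp add: R_def)
    finally show ?thesis by (simp add: algebra_simps)
  qed
  define G where "G = (\<Sum>i<n. \<Sum>j<n. ip N (y i) (lact N (ip M (x i) (x j)) (y j)))"
  define E where "E k = (\<Sum>i<n. \<Sum>j<n. ip N (y i) (lact N (Y (Suc k) i j - Y k i j) (y j)))" for k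
  have pos: "cpos ((1/c) *\<^sub>R G + 2 *\<^sub>R E k)" for k
  proof -
    define w where "w l = msum N (map (\<lambda>j. lact N (B k l j) (y j)) [0..<n])" for l
    have wc: "set (map (\<lambda>j. lact N (B k l j) (y j)) [0..<n]) \<subseteq> car N" for l using y by auto
    have w: "w l \<in> car N" for l unfolding w_def by (intro N.msum_car wc)
    have "ip N (w l) (w l) = (\<Sum>i<n. \<Sum>j<n. ip N (y i) (lact N (B k i l * B k l j) (y j)))" for l
    proof -
      have "ip N (w l) (w l) = (\<Sum>i<n. ip N (lact N (B k l i) (y i)) (w l))"
        using N.ip_msum_left[OF w wc] by (subst (1) w_def)
          (simp add: o_def interv_sum_list_conv_sum_set_nat atLeast0LessThan)
      also have "\<dots> = (\<Sum>i<n. \<Sum>j<n. ip N (lact N (B k l i) (y i)) (lact N (B k l j) (y j)))"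
        unfolding w_def using y by (intro sum.cong refl, subst N.ip_msum_right)
          (auto simp: o_def interv_sum_list_conv_sum_set_nat atLeast0LessThan)
      also have "\<dots> = (\<Sum>i<n. \<Sum>j<n. ip N (y i) (lact N (B k i l * B k l j) (y j)))"
        using y by (intro sum.cong refl) (simp add: N.ip_lact N.ip_lact_mult Bs)
      finally show ?thesis .
    qed
    then have "(\<Sum>l<n. ip N (w l) (w l))
        = (\<Sum>l<n. \<Sum>i<n. \<Sum>j<n. ip N (y i) (lact N (B k i l * B k l j) (y j)))" by simp
    also have "\<dots> = (\<Sum>i<n. \<Sum>l<n. \<Sum>j<n. ip N (y i) (lact N (B k i l * B k l j) (y j)))"
      by (rule sum.swap)
    also have "\<dots> = (\<Sum>i<n. \<Sum>j<n. \<Sum>l<n. ip N (y i) (lact N (B k i l * B k l j) (y j)))"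
      by (intro sum.cong refl sum.swap)
    also have "\<dots> = (\<Sum>i<n. \<Sum>j<n. ip N (y i) (lact N (\<Sum>l<n. B k i l * B k l j) (y j)))"
      using y by (intro sum.cong refl) (simp add: N.ip_lact_sum)
    also have "\<dots> = (\<Sum>i<n. \<Sum>j<n. (1/c) *\<^sub>R ip N (y i) (lact N (ip M (x i) (x j)) (y j))
        + 2 *\<^sub>R ip N (y i) (lact N (Y (Suc k) i j - Y k i j) (y j)))"
      using y by (intro sum.cong refl) (simp add: BB N.ip_lact_add N.ip_lact_scaleR)
    also have "\<dots> = (1/c) *\<^sub>R G + 2 *\<^sub>R E k"
      by (simp add: G_def E_def sum.distrib scaleR_sum_right)
    finally show ?thesis using cpos_sum[of "{..<n}" "\<lambda>l. ip N (w l) (w l)"] N.ip_pos w by auto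
  qed
  define K where "K = (\<Sum>i<n. \<Sum>j<n. mnorm N (y i) * mnorm N (y j))"
  have "norm (E k) \<le> (sqrt_bound (Suc k) - sqrt_bound k) * K" for k
  proof -
    have "norm (E k) \<le> (\<Sum>i<n. \<Sum>j<n. norm (ip N (y i) (lact N (Y (Suc k) i j - Y k i j) (y j))))"
      unfolding E_def by (intro order.trans[OF norm_sum] sum_mono norm_sum)
    also have "\<dots> \<le> (\<Sum>i<n. \<Sum>j<n. (sqrt_bound (Suc k) - sqrt_bound k) * (mnorm N (y i) * mnorm N (y j)))"
    proof (intro sum_mono)
      fix i j assume ij: "i \<in> {..<n}" "j \<in> {..<n}"
      have "norm (Y (Suc k) i j - Y k i j) \<le> sqrt_bound (Suc k) - sqrt_bound k"
        using mat_bound_entry[OF conjunct2[OF mat_iter_bounds[OF Rb, of k]]] ij sqrt_bound_mono[of k]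
        by (simp add: Y_def del: sqrt_bound.simps mat_iter.simps)
      then have "norm (Y (Suc k) i j - Y k i j) * (mnorm N (y i) * mnorm N (y j))
          \<le> (sqrt_bound (Suc k) - sqrt_bound k) * (mnorm N (y i) * mnorm N (y j))"
        by (rule mult_right_mono) simp
      then show "norm (ip N (y i) (lact N (Y (Suc k) i j - Y k i j) (y j)))
          \<le> (sqrt_bound (Suc k) - sqrt_bound k) * (mnorm N (y i) * mnorm N (y j))"
        using N.norm_ip_lact_le[of "y i" "y j" "Y (Suc k) i j - Y k i j"] y ij by force
    qed
    also have "\<dots> = (sqrt_bound (Suc k) - sqrt_bound k) * K"
      by (simp only: K_def sum_distrib_left)
    finally show ?thesis .
  qed
  note E_le = this
  have "(\<lambda>k. (sqrt_bound (Suc k) - sqrt_bound k) * K) \<longlonglongrightarrow> 0"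
    using tendsto_mult_right[OF sqrt_bound_step_tendsto_0, of K] by (simp del: sqrt_bound.simps)
  then have "E \<longlonglongrightarrow> 0"
    by (rule Lim_null_comparison[OF always_eventually[OF allI[OF E_le]]])
  then have "(\<lambda>k. (1/c) *\<^sub>R G + 2 *\<^sub>R E k) \<longlonglongrightarrow> (1/c) *\<^sub>R G + 2 *\<^sub>R 0"
    by (intro tendsto_intros)
  then have "cpos ((1/c) *\<^sub>R G)" using cpos_closed[OF pos] by simp
  from cpos_scaleR[OF this, of c] show ?thesis using c(1) by (simp add: G_def)
qed

section \<open>The semi-inner product on formal sums of tensors\<close>

lemma formal_tensor_sel [simp]:
  "car (formal_tensor M N) = {us. set us \<subseteq> car M \<times> car N}"
  "zer (formal_tensor M N) = []"
  "add (formal_tensor M N) us vs = us @ vs"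
  "ract (formal_tensor M N) us b = map (\<lambda>(x, y). (x, ract N y b)) us"
  "lact (formal_tensor M N) a us = map (\<lambda>(x, y). (lact M a x, y)) us"
  by (simp_all add: formal_tensor_def)

lemma ip_formal_tensor:
  "ip (formal_tensor M N) us vs
    = (\<Sum>(x, y)\<leftarrow>us. \<Sum>(x', y')\<leftarrow>vs. ip N y (lact N (ip M x x') y'))"
  by (simp add: formal_tensor_def)

lemma sum_list_conv_nth: "(\<Sum>x\<leftarrow>xs. f x) = (\<Sum>i<length xs. f (xs ! i) :: 'a::comm_monoid_add)"
  by (simp add: sum_list_sum_nth atLeast0LessThan)

lemma ip_formal_tensor_nth:
  "ip (formal_tensor M N) us vs = (\<Sum>i<length us. \<Sum>j<length vs.
    ip N (snd (us ! i)) (lact N (ip M (fst (us ! i)) (fst (vs ! j))) (snd (vs ! j))))"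
  by (simp add: ip_formal_tensor sum_list_conv_nth case_prod_unfold)

lemma formal_tensor_nth:
  assumes "us \<in> car (formal_tensor M N)" "i < length us"
  shows "fst (us ! i) \<in> car M" "snd (us ! i) \<in> car N"
proof -
  have "us ! i \<in> car M \<times> car N" using assms nth_mem[OF assms(2)] by auto
  then show "fst (us ! i) \<in> car M" "snd (us ! i) \<in> car N" by auto
qed

text \<open>Only positivity is not formal; it is \<open>gram_pos\<close> applied to the entries of
  the list.\<close>

lemma semi_module_formal_tensor:
  fixes M :: "('a, 'b::unital_cstar_algebra, 'x) corr" and N :: "('b, 'c::unital_cstar_algebra, 'y) corr"
  assumes "semi_module M" "semi_corr N"
  shows "semi_module (formal_tensor M N)"
proof -
  interpret M: semi_module M by fact
  interpret N: semi_corr N by fact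
  show ?thesis
  proof
    fix us vs ws :: "('x \<times> 'y) list" and b :: 'c
    show "zer (formal_tensor M N) \<in> car (formal_tensor M N)" by simp
    assume us: "us \<in> car (formal_tensor M N)"
    show "ract (formal_tensor M N) us b \<in> car (formal_tensor M N)" using us by auto
    show "ip (formal_tensor M N) us (zer (formal_tensor M N)) = 0"
      by (simp add: ip_formal_tensor_nth)
    show "cpos (ip (formal_tensor M N) us us)"
      unfolding ip_formal_tensor_nth using formal_tensor_nth[OF us] by (intro gram_pos assms) auto
    assume vs: "vs \<in> car (formal_tensor M N)"
    show "add (formal_tensor M N) us vs \<in> car (formal_tensor M N)" using us vs by auto
    show "ip (formal_tensor M N) us (ract (formal_tensor M N) vs b) = ip (formal_tensor M N) us vs * b"
      unfolding ip_formal_tensor_nth using formal_tensor_nth[OF us] formal_tensor_nth[OF vs]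
      by (simp add: sum_distrib_right case_prod_unfold N.ip_lact_right)
    show "star (ip (formal_tensor M N) us vs) = ip (formal_tensor M N) vs us"
      unfolding ip_formal_tensor_nth using formal_tensor_nth[OF us] formal_tensor_nth[OF vs]
      by (subst sum.swap) (simp add: star_sum N.ip_star N.ip_lact M.ip_star)
    show "ip (formal_tensor M N) us (add (formal_tensor M N) vs ws)
      = ip (formal_tensor M N) us vs + ip (formal_tensor M N) us ws"
      by (simp add: ip_formal_tensor sum_list_addf case_prod_unfold)
  qed
qed

lemma semi_corr_formal_tensor:
  fixes M :: "('a::unital_cstar_algebra, 'b::unital_cstar_algebra, 'x) corr"
    and N :: "('b, 'c::unital_cstar_algebra, 'y) corr"
  assumes "semi_corr M" "semi_corr N"
  shows "semi_corr (formal_tensor M N)"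
proof -
  interpret M: semi_corr M by fact
  interpret N: semi_corr N by fact
  interpret F: semi_module "formal_tensor M N"
    by (intro semi_module_formal_tensor M.semi_module_axioms assms)
  show ?thesis
  proof
    fix us vs :: "('x \<times> 'y) list" and a b :: 'a and c :: complex
    assume us: "us \<in> car (formal_tensor M N)"
    show "lact (formal_tensor M N) a us \<in> car (formal_tensor M N)" using us by auto
    assume vs: "vs \<in> car (formal_tensor M N)"
    note nth = formal_tensor_nth[OF us] formal_tensor_nth[OF vs]
    show "ip (formal_tensor M N) (lact (formal_tensor M N) a us) vs
      = ip (formal_tensor M N) us (lact (formal_tensor M N) (star a) vs)"
      unfolding ip_formal_tensor_nth using nth by (simp add: case_prod_unfold M.ip_lact)
    show "ip (formal_tensor M N) us (lact (formal_tensor M N) (a + b) vs)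
      = ip (formal_tensor M N) us (lact (formal_tensor M N) a vs)
        + ip (formal_tensor M N) us (lact (formal_tensor M N) b vs)"
      unfolding ip_formal_tensor_nth using nth
      by (simp add: case_prod_unfold M.ip_lact_add N.ip_lact_add sum.distrib)
    have scaleC_sum: "c *\<^sub>C sum f I = (\<Sum>i\<in>I. c *\<^sub>C f i)" for f :: "nat \<Rightarrow> 'c" and I
      by (induction I rule: infinite_finite_induct) (auto simp: scaleC_add_right)
    show "ip (formal_tensor M N) us (lact (formal_tensor M N) (c *\<^sub>C a) vs)
      = c *\<^sub>C ip (formal_tensor M N) us (lact (formal_tensor M N) a vs)"
      unfolding ip_formal_tensor_nth using nth
      by (simp add: case_prod_unfold M.ip_lact_scaleC N.ip_lact_scaleC scaleC_sum)
    show "ip (formal_tensor M N) us (lact (formal_tensor M N) (a * b) vs)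
      = ip (formal_tensor M N) us (lact (formal_tensor M N) a (lact (formal_tensor M N) b vs))"
      unfolding ip_formal_tensor_nth using nth by (simp add: case_prod_unfold M.ip_lact_mult)
  qed
qed

lemma semi_corr_tensor: "semi_corr M \<Longrightarrow> semi_corr N \<Longrightarrow> semi_corr (M \<otimes>\<^sub>m N)"
  unfolding tensor_def by (intro semi_corr.semi_corr_compl semi_corr_formal_tensor)

lemma hmod_tensor: "semi_module M \<Longrightarrow> semi_corr N \<Longrightarrow> hmod (M \<otimes>\<^sub>m N)"
  unfolding tensor_def by (intro semi_module.hmod_compl semi_module_formal_tensor)

subsection \<open>Lifts from tensor products\<close>

lemma (in hmod) limit_unique:
  assumes "range u \<subseteq> car X" "x \<in> car X" "y \<in> car X"
    "(\<lambda>n. mdist X (u n) x) \<longlonglongrightarrow> 0" "(\<lambda>n. mdist X (u n) y) \<longlonglongrightarrow> 0"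
  shows "x = y"
proof -
  have u: "u n \<in> car X" for n using assms(1) by blast
  have "mdist X x y \<le> mdist X (u n) x + mdist X (u n) y" for n
    using mdist_triangle[OF assms(2) u[of n] assms(3)] mdist_commute[OF assms(2) u[of n]] by simp
  moreover have "(\<lambda>n. mdist X (u n) x + mdist X (u n) y) \<longlonglongrightarrow> 0"
    using tendsto_add[OF assms(4,5)] by simp
  ultimately have "mdist X x y \<le> 0" using LIMSEQ_le_const by blast
  then show ?thesis using separated[OF assms(2,3)] mdist_nonneg[of x y] by linarith
qed

lemma (in hmod) add_zer [simp]: "x \<in> car X \<Longrightarrow> add X x (zer X) = x"
  using mdist_square[of "add X x (zer X)" x] by (intro separated) auto

text \<open>A Lipschitz map into a complete separated module extends uniquely to the completion;
  this is the existence proof behind the definite description in \<open>lift\<close>.\<close>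

lemma ext_ex1:
  assumes X: "hmod X" and F: "semi_module F" and g: "\<And>u. u \<in> car F \<Longrightarrow> g u \<in> car X"
    and L: "\<And>u v. u \<in> car F \<Longrightarrow> v \<in> car F \<Longrightarrow> mdist X (g u) (g v) \<le> C * mdist F u v"
    and c: "c \<in> car (completion F)"
  shows "\<exists>!z. z \<in> car X \<and> (\<forall>u\<in>c. (\<lambda>n. mdist X (g (u n)) z) \<longlonglongrightarrow> 0)"
proof -
  interpret X: hmod X by fact
  interpret F: semi_module F by fact
  obtain w where w: "w \<in> cauchy_seqs F" "c = cls F w" using F.compl_cases[OF c] .
  have wc: "w n \<in> car F" for n using F.cauchy_range[OF w(1)] by blast
  have "(\<lambda>n. g (w n)) \<in> cauchy_seqs X"
    unfolding cauchy_seqs_def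
  proof (intro CollectI conjI allI impI)
    show "g (w n) \<in> car X" for n using g[OF wc] .
    fix e :: real assume "e > 0"
    then have "e / (\<bar>C\<bar> + 1) > 0" by simp
    obtain N where N: "\<And>m n. m \<ge> N \<Longrightarrow> n \<ge> N \<Longrightarrow> mdist F (w m) (w n) < e / (\<bar>C\<bar> + 1)"
      using F.cauchyD[OF w(1) \<open>e / (\<bar>C\<bar> + 1) > 0\<close>] by auto
    have "mdist X (g (w m)) (g (w n)) < e" if "m \<ge> N" "n \<ge> N" for m n
    proof -
      have "mdist X (g (w m)) (g (w n)) \<le> C * mdist F (w m) (w n)" by (intro L wc)
      also have "\<dots> \<le> (\<bar>C\<bar> + 1) * mdist F (w m) (w n)" by (intro mult_right_mono) auto
      also have "\<dots> < e" using N[OF that] by (simp add: field_simps)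
      finally show ?thesis .
    qed
    then show "\<exists>N. \<forall>m\<ge>N. \<forall>n\<ge>N. mdist X (g (w m)) (g (w n)) < e" by blast
  qed
  then obtain z where z: "z \<in> car X" "(\<lambda>n. mdist X (g (w n)) z) \<longlonglongrightarrow> 0" using X.complete by blast
  have lim: "(\<lambda>n. mdist X (g (u n)) z) \<longlonglongrightarrow> 0" if "u \<in> c" for u
  proof -
    have u: "u \<in> cauchy_seqs F" "F.mnull w u" using that w F.mem_cls_iff[OF w(1)] by blast+
    have uc: "u n \<in> car F" for n using F.cauchy_range[OF u(1)] by blast
    have "X.mnull (\<lambda>n. g (w n)) (\<lambda>n. g (u n))"
    proof (rule X.mnull_bound)
      show "mdist X (g (w n)) (g (u n)) \<le> C * mdist F (w n) (u n)" for n by (intro L wc uc)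
      show "(\<lambda>n. C * mdist F (w n) (u n)) \<longlonglongrightarrow> 0"
        using tendsto_mult_left[OF u(2)[unfolded F.mnull_def], of C] by simp
    qed
    moreover have r: "range (\<lambda>n. g (w n)) \<subseteq> car X" "range (\<lambda>n. g (u n)) \<subseteq> car X" "range (\<lambda>_::nat. z) \<subseteq> car X"
      using g wc uc z(1) by auto
    ultimately have "X.mnull (\<lambda>n. g (u n)) (\<lambda>_. z)"
      using X.mnull_trans[OF r(2,1,3)] X.mnull_sym[OF r(1,2)] z(2) unfolding X.mnull_def by blast
    then show ?thesis by (simp add: X.mnull_def)
  qed
  have "y = z" if "y \<in> car X" "\<forall>u\<in>c. (\<lambda>n. mdist X (g (u n)) y) \<longlonglongrightarrow> 0" for y
  proof -
    have "w \<in> c" using w F.cls_self by simp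
    then show ?thesis using that z g wc by (intro X.limit_unique[of "\<lambda>n. g (w n)"]) auto
  qed
  then show ?thesis using z(1) lim by blast
qed

lemma (in semi_module) const_mem_cls: "x \<in> car M \<Longrightarrow> (\<lambda>_. x) \<in> cls M (\<lambda>_. x)"
  by (rule cls_self[OF const_cauchy])

text \<open>The bound is placed on finite sums, where it contains both that f respects the relations
  of the tensor product and that the extension is continuous.\<close>

locale tensor_lift = F: semi_module "formal_tensor M N" + X: hmod X
  for M :: "('a, 'b, 'x) corr" and N :: "('b, 'c::unital_cstar_algebra, 'y) corr"
    and X :: "('d, 'f::unital_cstar_algebra, 'z) corr" +
  fixes f :: "'x \<Rightarrow> 'y \<Rightarrow> 'z" and C :: real
  assumes f_car: "\<And>x y. x \<in> car M \<Longrightarrow> y \<in> car N \<Longrightarrow> f x y \<in> car X"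
    and f_bound: "\<And>u v. u \<in> car (formal_tensor M N) \<Longrightarrow> v \<in> car (formal_tensor M N) \<Longrightarrow>
      mdist X (msum X (map (\<lambda>(x, y). f x y) u)) (msum X (map (\<lambda>(x, y). f x y) v))
        \<le> C * mdist (formal_tensor M N) u v"
begin

abbreviation fsum :: "('x \<times> 'y) list \<Rightarrow> 'z"
  where "fsum us \<equiv> msum X (map (\<lambda>(x, y). f x y) us)"

lemma fmap_car: "us \<in> car (formal_tensor M N) \<Longrightarrow> set (map (\<lambda>(x, y). f x y) us) \<subseteq> car X"
  using f_car by auto

lemma fsum_car: "us \<in> car (formal_tensor M N) \<Longrightarrow> fsum us \<in> car X"
  by (intro X.msum_car fmap_car)

lemma tensor_rep_car:
  assumes "c \<in> car (M \<otimes>\<^sub>m N)" "u \<in> c"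
  shows "u n \<in> car (formal_tensor M N)"
  using F.mem_compl(1)[OF assms[unfolded tensor_def]] F.cauchy_range by blast

lemma lift_spec:
  assumes "c \<in> car (M \<otimes>\<^sub>m N)"
  shows "lift X f c \<in> car X" "u \<in> c \<Longrightarrow> (\<lambda>n. mdist X (fsum (u n)) (lift X f c)) \<longlonglongrightarrow> 0"
  using theI'[OF ext_ex1[OF X.hmod_axioms F.semi_module_axioms fsum_car f_bound assms[unfolded tensor_def]]]
  unfolding lift_def by blast+

lemma tensor_nonempty: "c \<in> car (M \<otimes>\<^sub>m N) \<Longrightarrow> \<exists>u. u \<in> c"
  using F.rep_mem unfolding tensor_def by blast

lemma lift_eqI:
  assumes "c \<in> car (M \<otimes>\<^sub>m N)" "u \<in> c" "z \<in> car X" "(\<lambda>n. mdist X (fsum (u n)) z) \<longlonglongrightarrow> 0"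
  shows "lift X f c = z"
proof -
  have "range (\<lambda>n. fsum (u n)) \<subseteq> car X" using fsum_car[OF tensor_rep_car[OF assms(1,2)]] by blast
  then show ?thesis by (rule X.limit_unique[OF _ lift_spec(1)[OF assms(1)] assms(3) lift_spec(2)[OF assms(1,2)] assms(4)])
qed

lemma const_tensor: "us \<in> car (formal_tensor M N) \<Longrightarrow> cls (formal_tensor M N) (\<lambda>_. us) \<in> car (M \<otimes>\<^sub>m N)"
  unfolding tensor_def by (intro F.cls_car F.const_cauchy)

lemma lift_const:
  assumes "us \<in> car (formal_tensor M N)"
  shows "lift X f (cls (formal_tensor M N) (\<lambda>_. us)) = fsum us"
proof (rule lift_eqI[OF const_tensor[OF assms] F.const_mem_cls[OF assms] fsum_car[OF assms]])
  show "(\<lambda>n. mdist X (fsum us) (fsum us)) \<longlonglongrightarrow> 0"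
    using X.mdist_self[OF fsum_car[OF assms]] by simp
qed

lemma lift_elem:
  assumes "x \<in> car M" "y \<in> car N"
  shows "lift X f (elem_tensor M N x y) = f x y"
  unfolding elem_tensor_def using lift_const[of "[(x, y)]"] assms f_car by simp

end

text \<open>Reproducing the inner product on elementary tensors forces the same on finite sums,
  hence the Lipschitz bound with constant 1. The tilde maps of isometric representations, the outer
  lift of the associator, I \<otimes> \<tau> and the flip all enter through this locale.\<close>

locale iso_lift = F: semi_module "formal_tensor M N" + X: hmod X
  for M :: "('a, 'b, 'x) corr" and N :: "('b, 'c::unital_cstar_algebra, 'y) corr"
    and X :: "('d, 'c, 'z) corr" +
  fixes f :: "'x \<Rightarrow> 'y \<Rightarrow> 'z"
  assumes iso_car: "\<And>x y. x \<in> car M \<Longrightarrow> y \<in> car N \<Longrightarrow> f x y \<in> car X"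
    and iso_ip: "\<And>x y x' y'. x \<in> car M \<Longrightarrow> y \<in> car N \<Longrightarrow> x' \<in> car M \<Longrightarrow> y' \<in> car N \<Longrightarrow>
      ip X (f x y) (f x' y') = ip N y (lact N (ip M x x') y')"
begin

lemma ip_fsum:
  assumes "us \<in> car (formal_tensor M N)" "vs \<in> car (formal_tensor M N)"
  shows "ip X (msum X (map (\<lambda>(x, y). f x y) us)) (msum X (map (\<lambda>(x, y). f x y) vs))
    = ip (formal_tensor M N) us vs"
proof -
  have car: "set (map (\<lambda>(x, y). f x y) us) \<subseteq> car X" "set (map (\<lambda>(x, y). f x y) vs) \<subseteq> car X"
    using assms iso_car by auto
  have "ip X (msum X (map (\<lambda>(x, y). f x y) us)) (msum X (map (\<lambda>(x, y). f x y) vs))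
      = (\<Sum>x\<leftarrow>us. ip X (f (fst x) (snd x)) (msum X (map (\<lambda>(x, y). f x y) vs)))"
    using X.ip_msum_left[OF X.msum_car[OF car(2)] car(1)] by (simp add: o_def case_prod_unfold)
  also have "\<dots> = (\<Sum>x\<leftarrow>us. \<Sum>y\<leftarrow>vs. ip X (f (fst x) (snd x)) (f (fst y) (snd y)))"
    using X.ip_msum_right[OF _ car(2)] assms iso_car
    by (intro arg_cong[where f=sum_list] map_cong refl) (auto simp: o_def case_prod_unfold)
  also have "\<dots> = ip (formal_tensor M N) us vs"
    unfolding ip_formal_tensor case_prod_unfold
    using assms by (intro arg_cong[where f=sum_list] map_cong refl iso_ip) auto
  finally show ?thesis .
qed

sublocale tensor_lift M N X f 1
proof
  fix u v assume uv: "u \<in> car (formal_tensor M N)" "v \<in> car (formal_tensor M N)"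
  have car: "set (map (\<lambda>(x, y). f x y) u) \<subseteq> car X" "set (map (\<lambda>(x, y). f x y) v) \<subseteq> car X"
    using uv iso_car by auto
  have "(mdist X (msum X (map (\<lambda>(x, y). f x y) u)) (msum X (map (\<lambda>(x, y). f x y) v)))\<^sup>2
      = (mdist (formal_tensor M N) u v)\<^sup>2"
    using X.mdist_square[OF X.msum_car[OF car(1)] X.msum_car[OF car(2)]] F.mdist_square[OF uv] uv
    by (simp only: ip_fsum)
  then show "mdist X (msum X (map (\<lambda>(x, y). f x y) u)) (msum X (map (\<lambda>(x, y). f x y) v))
      \<le> 1 * mdist (formal_tensor M N) u v"
    using X.mdist_nonneg F.mdist_nonneg by (simp add: power2_eq_iff_nonneg)
qed (rule iso_car)

lemma ip_lift:
  assumes "c \<in> car (M \<otimes>\<^sub>m N)" "d \<in> car (M \<otimes>\<^sub>m N)"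
  shows "ip X (lift X f c) (lift X f d) = ip (M \<otimes>\<^sub>m N) c d"
proof -
  obtain u v where u: "u \<in> c" and v: "v \<in> d" using tensor_nonempty assms by meson
  have "range (\<lambda>n. fsum (u n)) \<subseteq> car X" "range (\<lambda>n. fsum (v n)) \<subseteq> car X"
    using fsum_car tensor_rep_car assms u v by blast+
  then have "(\<lambda>n. ip X (fsum (u n)) (fsum (v n))) \<longlonglongrightarrow> ip X (lift X f c) (lift X f d)"
    by (intro X.tendsto_ip lift_spec assms u v)
  moreover have "ip X (fsum (u n)) (fsum (v n)) = ip (formal_tensor M N) (u n) (v n)" for n
    by (intro ip_fsum tensor_rep_car[OF assms(1) u] tensor_rep_car[OF assms(2) v])
  moreover have "(\<lambda>n. ip (formal_tensor M N) (u n) (v n)) \<longlonglongrightarrow> ip (M \<otimes>\<^sub>m N) c d"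
    using F.ip_compl_tendsto[OF F.mem_compl(1) F.mem_compl(1), of c u d v]
      F.mem_compl(2)[of c u] F.mem_compl(2)[of d v] assms u v unfolding tensor_def by simp
  ultimately show ?thesis using LIMSEQ_unique by simp
qed

end

lemma tensor_compl_facts:
  fixes M :: "('a, 'b::unital_cstar_algebra, 'x) corr" and N :: "('b, 'c::unital_cstar_algebra, 'y) corr"
  assumes "semi_module (formal_tensor M N)"
  shows "x \<in> car M \<Longrightarrow> y \<in> car N \<Longrightarrow> elem_tensor M N x y \<in> car (M \<otimes>\<^sub>m N)"
    and "x \<in> car M \<Longrightarrow> y \<in> car N \<Longrightarrow> x' \<in> car M \<Longrightarrow> y' \<in> car N \<Longrightarrow>
      ip (M \<otimes>\<^sub>m N) (elem_tensor M N x y) (elem_tensor M N x' y') = ip N y (lact N (ip M x x') y')"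
    and "u \<in> cauchy_seqs (formal_tensor M N) \<Longrightarrow>
      (\<lambda>n. mdist (M \<otimes>\<^sub>m N) (msum (M \<otimes>\<^sub>m N) (map (\<lambda>(x, y). elem_tensor M N x y) (u n)))
        (cls (formal_tensor M N) u)) \<longlonglongrightarrow> 0"
proof -
  interpret F: semi_module "formal_tensor M N" by fact
  interpret C: hmod "M \<otimes>\<^sub>m N" unfolding tensor_def by (rule F.hmod_compl)
  show elem: "elem_tensor M N x y \<in> car (M \<otimes>\<^sub>m N)" if "x \<in> car M" "y \<in> car N" for x y
    unfolding tensor_def elem_tensor_def using that by (intro F.cls_car F.const_cauchy) simp
  have ipc: "ip (M \<otimes>\<^sub>m N) (cls (formal_tensor M N) (\<lambda>_. us)) (cls (formal_tensor M N) (\<lambda>_. vs))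
      = ip (formal_tensor M N) us vs"
    if "us \<in> car (formal_tensor M N)" "vs \<in> car (formal_tensor M N)" for us vs
    using F.ip_compl_tendsto[OF F.const_cauchy F.const_cauchy, OF that]
    unfolding tensor_def by (simp add: LIMSEQ_const_iff)
  show "ip (M \<otimes>\<^sub>m N) (elem_tensor M N x y) (elem_tensor M N x' y') = ip N y (lact N (ip M x x') y')"
    if "x \<in> car M" "y \<in> car N" "x' \<in> car M" "y' \<in> car N"
    unfolding elem_tensor_def using that by (subst ipc) (auto simp: ip_formal_tensor)
  have "msum (M \<otimes>\<^sub>m N) (map (\<lambda>(x, y). elem_tensor M N x y) us) = cls (formal_tensor M N) (\<lambda>_. us)"
    if "us \<in> car (formal_tensor M N)" for us
    using that
  proof (induction us)
    case Nil
    show ?case by (simp add: F.zer_compl tensor_def msum_def)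
  next
    case (Cons p us)
    then have us: "us \<in> car (formal_tensor M N)" "[p] \<in> car (formal_tensor M N)" by auto
    obtain x y where p: "p = (x, y)" by force
    show ?case
      using Cons.IH[OF us(1)] F.add_compl[OF F.const_cauchy[OF us(2)] F.const_cauchy[OF us(1)]]
      by (simp add: p elem_tensor_def tensor_def msum_def)
  qed
  then show "(\<lambda>n. mdist (M \<otimes>\<^sub>m N) (msum (M \<otimes>\<^sub>m N) (map (\<lambda>(x, y). elem_tensor M N x y) (u n)))
        (cls (formal_tensor M N) u)) \<longlonglongrightarrow> 0" if "u \<in> cauchy_seqs (formal_tensor M N)"
    using F.cls_const_tendsto[OF that] F.cauchy_range[OF that] by (simp add: tensor_def image_subset_iff)
qed

section \<open>Hilbert modules and correspondences\<close>

lemma hilbert_module_hmod: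
  assumes "hilbert_module M"
  shows "hmod M"
proof -
  note H = assms[unfolded hilbert_module_def]
  have zc: "zer M \<in> car M"
    using H by (elim conjE)
  have ac: "\<forall>x\<in>car M. \<forall>y\<in>car M. add M x y \<in> car M"
    using H by (elim conjE)
  have as: "\<forall>x\<in>car M. \<forall>y\<in>car M. \<forall>z\<in>car M. add M (add M x y) z = add M x (add M y z)"
    using H by (elim conjE)
  have co: "\<forall>x\<in>car M. \<forall>y\<in>car M. add M x y = add M y x"
    using H by (elim conjE)
  have zl: "\<forall>x\<in>car M. add M (zer M) x = x"
    using H by (elim conjE)
  have rc: "\<forall>x\<in>car M. \<forall>b. ract M x b \<in> car M"
    using H by (elim conjE)
  have ra: "\<forall>x\<in>car M. \<forall>b c. ract M x (b + c) = add M (ract M x b) (ract M x c)"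
    using H by (elim conjE)
  have r1: "\<forall>x\<in>car M. ract M x 1 = x"
    using H by (elim conjE)
  have ia: "\<forall>x\<in>car M. \<forall>y\<in>car M. \<forall>z\<in>car M. ip M x (add M y z) = ip M x y + ip M x z"
    using H by (elim conjE)
  have ir: "\<forall>x\<in>car M. \<forall>y\<in>car M. \<forall>b. ip M x (ract M y b) = ip M x y * b"
    using H by (elim conjE)
  have sy: "\<forall>x\<in>car M. \<forall>y\<in>car M. ip M y x = star (ip M x y)"
    using H by (elim conjE)
  have pos: "\<forall>x\<in>car M. \<exists>b. ip M x x = star b * b"
    using H by (elim conjE)
  have sep0: "\<forall>x\<in>car M. ip M x x = 0 \<longrightarrow> x = zer M"
    using H by (elim conjE)
  have cmp: "\<forall>u\<in>cauchy_seqs M. \<exists>x\<in>car M. (\<lambda>n. mdist M (u n) x) \<longlonglongrightarrow> 0"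
    using H by (elim conjE)
  have ipz: "ip M x (zer M) = 0" if "x \<in> car M" for x
    using bspec[OF bspec[OF bspec[OF ia that] zc] that] bspec[OF zl that] by simp
  interpret semi_module M
  proof
    show "zer M \<in> car M" by (rule zc)
    fix x y z b assume x: "x \<in> car M"
    show "ract M x b \<in> car M" using rc x by blast
    show "ip M x (zer M) = 0" by (rule ipz[OF x])
    have "\<exists>b. ip M x x = star b * b" using pos x by blast
    then show "cpos (ip M x x)" using cpos_star_mult by auto
    assume y: "y \<in> car M"
    show "add M x y \<in> car M" using ac x y by blast
    show "ip M x (ract M y b) = ip M x y * b" using ir x y by blast
    show "star (ip M x y) = ip M y x" using bspec[OF bspec[OF sy x] y] by (rule sym)
    assume z: "z \<in> car M"
    show "ip M x (add M y z) = ip M x y + ip M x z" using ia x y z by blast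
  qed
  show ?thesis
  proof
    show "\<exists>x\<in>car M. (\<lambda>n. mdist M (u n) x) \<longlonglongrightarrow> 0" if "u \<in> cauchy_seqs M" for u
      using cmp that by blast
    fix x y assume x: "x \<in> car M" and y: "y \<in> car M" and "mdist M x y = 0"
    then have "ip M (mdiff x y) (mdiff x y) = 0" unfolding mdist_eq by (simp add: mnorm_def)
    moreover have sep: "w = zer M" if "w \<in> car M" "ip M w w = 0" for w using sep0 that by blast
    ultimately have d: "add M x (ract M y (- 1)) = zer M" using x y mdiff_car unfolding mdiff_def by blast
    have "ract M y 1 = y" using r1 y by blast
    moreover have "ract M y (1 + - 1) = add M (ract M y 1) (ract M y (- 1))" using ra y by blast
    ultimately have "ract M y 0 = add M y (ract M y (- 1))" by simp
    moreover have "ract M y 0 = zer M" using y by (intro sep) auto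
    ultimately have yy: "add M y (ract M y (- 1)) = zer M" by simp
    have ny: "ract M y (- 1) \<in> car M" using y by simp
    have "add M (ract M y (- 1)) y = zer M" using co yy y ny by metis
    then have "x = add M x (add M (ract M y (- 1)) y)" using co zl zc x by metis
    also have "\<dots> = add M (add M x (ract M y (- 1))) y" using as x ny y by metis
    also have "\<dots> = y" using d zl y by simp
    finally show "x = y" .
  qed
qed

lemma correspondence_semi_corr:
  assumes "correspondence M"
  shows "semi_corr M"
proof -
  note H = assms[unfolded correspondence_def]
  interpret hmod M using H by (intro hilbert_module_hmod) blast
  show ?thesis
  proof
    have lc: "\<forall>a. \<forall>x\<in>car M. lact M a x \<in> car M"
      using H by (elim conjE)
    have la: "\<forall>a b. \<forall>x\<in>car M. lact M (a + b) x = add M (lact M a x) (lact M b x)"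
      using H by (elim conjE)
    have ls: "\<forall>a c. \<forall>x\<in>car M. lact M (c *\<^sub>C a) x = ract M (lact M a x) (c *\<^sub>C 1)"
      using H by (elim conjE)
    have lm: "\<forall>a b. \<forall>x\<in>car M. lact M (a * b) x = lact M a (lact M b x)"
      using H by (elim conjE)
    have li: "\<forall>a. \<forall>x\<in>car M. \<forall>y\<in>car M. ip M (lact M a x) y = ip M x (lact M (star a) y)"
      using H by (elim conjE)
    fix a b c and x y assume x: "x \<in> car M"
    show "lact M a x \<in> car M" using lc x by blast
    assume y: "y \<in> car M"
    have ly: "lact M a y \<in> car M" for a using lc y by blast
    show "ip M (lact M a x) y = ip M x (lact M (star a) y)" using li x y by blast
    have "lact M (a + b) y = add M (lact M a y) (lact M b y)" using la y by blast
    then show "ip M x (lact M (a + b) y) = ip M x (lact M a y) + ip M x (lact M b y)"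
      using x ly by simp
    have "lact M (c *\<^sub>C a) y = ract M (lact M a y) (c *\<^sub>C 1)" using ls y by blast
    then show "ip M x (lact M (c *\<^sub>C a) y) = c *\<^sub>C ip M x (lact M a y)"
      using x ly by (simp add: mult_scaleC_right)
    have "lact M (a * b) y = lact M a (lact M b y)" using lm y by blast
    then show "ip M x (lact M (a * b) y) = ip M x (lact M a (lact M b y))" by simp
  qed
qed

subsection \<open>Hilbert spaces\<close>

interpretation cvec: vector_space "scaleC :: complex \<Rightarrow> 'v \<Rightarrow> 'v::complex_vector"
  by unfold_locales (auto simp: scaleC_add_right scaleC_add_left scaleC_scaleC scaleC_one)

lemma cinner_add_left: "cinner (x + y) z = cinner x z + cinner y (z::'h::chilbert_space)"
  using cinner_commute[of "x + y" z] cinner_commute[of x z] cinner_commute[of y z]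
  by (simp add: cinner_add_right)

lemma cinner_scaleC_left: "cinner (c *\<^sub>C x) y = cnj c * cinner x (y::'h::chilbert_space)"
  using cinner_commute[of "c *\<^sub>C x" y] cinner_commute[of x y] by (simp add: cinner_scaleC_right)

lemma cinner_self: "cinner x (x::'h::chilbert_space) = complex_of_real ((norm x)\<^sup>2)"
proof -
  have "Im (cinner x x) = 0" using cinner_commute[of x x] by (simp add: complex_eq_iff)
  then show ?thesis by (simp add: complex_eq_iff norm_eq_sqrt_cinner cinner_ge_zero)
qed

lemma hs_corr_sel [simp]: "car (hs_corr V \<sigma>) = V" "zer (hs_corr V \<sigma>) = 0" "add (hs_corr V \<sigma>) = (+)"
  "ract (hs_corr V \<sigma>) = (\<lambda>x c. c *\<^sub>C x)" "ip (hs_corr V \<sigma>) = cinner" "lact (hs_corr V \<sigma>) = \<sigma>"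
  by (simp_all add: hs_corr_def)

lemma csubspace_iff: "csubspace V \<longleftrightarrow> 0 \<in> V \<and> (\<forall>x\<in>V. \<forall>y\<in>V. x + y \<in> V) \<and> (\<forall>c. \<forall>x\<in>V. c *\<^sub>C x \<in> V)"
  by (auto simp: csubspace_def cvec.subspace_def)

lemma csubspace_diff: "csubspace V \<Longrightarrow> x \<in> V \<Longrightarrow> y \<in> V \<Longrightarrow> x - y \<in> (V::'v::complex_vector set)"
  unfolding csubspace_def by (rule cvec.subspace_diff)

lemma semi_module_hs_corr: 
  assumes "csubspace (V::'h::chilbert_space set)"
  shows "semi_module (hs_corr V \<sigma>)"
proof -
  have "cinner x (0::'h) = 0" for x using cinner_scaleC_right[of x 0 0] by simp
  moreover have "star (cinner x y) = cinner y (x::'h)" for x y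
    using cinner_commute[of y x] by (simp add: star_complex_def)
  ultimately show ?thesis using assms
    by unfold_locales (auto simp: csubspace_iff cinner_add_right cinner_scaleC_right cpos_complex_iff
        cinner_self mult.commute)
qed

lemma mdist_hs_corr [simp]: "mdist (hs_corr V \<sigma>) x y = norm (x - y)"
  by (simp add: mdist_def mnorm_def cinner_self scaleC_one norm_power)

lemma mnorm_hs_corr [simp]: "mnorm (hs_corr V \<sigma>) x = norm x"
  by (simp add: mnorm_def cinner_self norm_power)

lemma csubspace_UNIV [simp]: "csubspace UNIV"
  by (simp add: csubspace_iff)

lemma cinner_bound: "cmod (cinner x y) \<le> norm x * norm (y::'h::chilbert_space)"
  using semi_module.cauchy_schwarz[OF semi_module_hs_corr[OF csubspace_UNIV], where x=x and y=y] by simp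

interpretation cinner: bounded_bilinear "cinner :: 'h::chilbert_space \<Rightarrow> 'h \<Rightarrow> complex"
proof
  show "\<exists>K. \<forall>a b. norm (cinner a b) \<le> norm a * norm (b::'h) * K"
    by (rule exI[of _ 1]) (simp add: cinner_bound)
qed (auto simp: cinner_add_left cinner_add_right scaleR_scaleC cinner_scaleC_left cinner_scaleC_right
    scaleR_conv_of_real scaleC_complex_def)

lemma hmod_hs_corr:
  assumes "closed_csubspace (V::'h::chilbert_space set)"
  shows "hmod (hs_corr V \<sigma>)"
proof -
  interpret semi_module "hs_corr V \<sigma>"
    using assms by (intro semi_module_hs_corr) (simp add: closed_csubspace_def)
  show ?thesis
  proof
    fix u assume "u \<in> cauchy_seqs (hs_corr V \<sigma>)"
    then have "\<forall>n. u n \<in> V" "Cauchy u" by (auto simp: cauchy_seqs_def Cauchy_def dist_norm)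
    then obtain x where "u \<longlonglongrightarrow> x" "x \<in> V"
      using assms closed_sequentially Cauchy_convergent convergent_def unfolding closed_csubspace_def by metis
    then show "\<exists>x\<in>car (hs_corr V \<sigma>). (\<lambda>n. mdist (hs_corr V \<sigma>) (u n) x) \<longlonglongrightarrow> 0"
      using tendsto_norm_zero[OF LIM_zero] by auto
  qed simp
qed

lemma semi_corr_hs_corr:
  assumes "csubspace (V::'h::chilbert_space set)" "algebra_rep V \<sigma>"
  shows "semi_corr (hs_corr V \<sigma>)"
proof -
  interpret semi_module "hs_corr V \<sigma>" using assms(1) by (rule semi_module_hs_corr)
  show ?thesis
    using assms(2)
    by unfold_locales (auto simp: algebra_rep_def bounded_op_def cinner_add_right cinner_scaleC_right
        scaleC_complex_def)
qed

lemma msum_hs_corr [simp]: "msum (hs_corr V \<sigma>) xs = sum_list xs"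
  by (induction xs) (auto simp: msum_def)

lemma cinner_eq_zero_iff [simp]: "cinner x x = 0 \<longleftrightarrow> x = (0::'h::chilbert_space)"
  by (simp add: cinner_self)

section \<open>Orthogonality, projections and adjoints\<close>

lemma norm_square_add:
  "(norm (x + y))\<^sup>2 = (norm x)\<^sup>2 + 2 * Re (cinner x y) + (norm (y::'h::chilbert_space))\<^sup>2"
proof -
  have "cinner (x + y) (x + y) = cinner x x + cinner x y + (cnj (cinner x y) + cinner y y)"
    using cinner_commute[of y x] by (simp add: cinner_add_left cinner_add_right)
  from arg_cong[OF this, of Re] show ?thesis by (simp add: cinner_self)
qed

lemma pythagoras: "cinner x y = 0 \<Longrightarrow> (norm (x + y))\<^sup>2 = (norm x)\<^sup>2 + (norm (y::'h::chilbert_space))\<^sup>2"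
  by (simp add: norm_square_add)

lemma cinner_zero_commute: "cinner x y = 0 \<Longrightarrow> cinner y (x::'h::chilbert_space) = 0"
  using cinner_commute[of y x] by simp

lemma parallelogram:
  "(norm (x + y))\<^sup>2 + (norm (x - y))\<^sup>2 = 2 * (norm x)\<^sup>2 + 2 * (norm (y::'h::chilbert_space))\<^sup>2"
  using norm_square_add[of x y] norm_square_add[of x "- y"] by (simp add: cinner.minus_right)

lemma closed_csubspaceD:
  assumes "closed_csubspace X"
  shows "csubspace X" "closed X" "0 \<in> X" "x \<in> X \<Longrightarrow> y \<in> X \<Longrightarrow> x + y \<in> X" "x \<in> X \<Longrightarrow> c *\<^sub>C x \<in> X"
    "x \<in> X \<Longrightarrow> y \<in> X \<Longrightarrow> x - y \<in> X"
  using assms csubspace_diff[of X x y] by (auto simp: closed_csubspace_def csubspace_iff)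

lemma closed_csubspace_UNIV [simp]: "closed_csubspace UNIV"
  by (simp add: closed_csubspace_def)

lemma closed_csubspace_Int: "closed_csubspace X \<Longrightarrow> closed_csubspace Y \<Longrightarrow> closed_csubspace (X \<inter> Y)"
  by (auto simp: closed_csubspace_def csubspace_iff)

lemma closed_csubspace_orth_compl [simp]: "closed_csubspace (orth_compl (X::'h::chilbert_space set))"
proof -
  have "orth_compl X = (\<Inter>x\<in>X. {y. cinner x y = 0})" by (auto simp: orth_compl_def)
  moreover have "closed {y. cinner x y = 0}" for x :: 'h
    by (intro closed_Collect_eq continuous_intros cinner.continuous_on)
  ultimately have "closed (orth_compl X)" by auto
  then show ?thesis
    by (auto simp: closed_csubspace_def csubspace_iff orth_compl_def cinner_add_right cinner_scaleC_right
        cinner.zero_right)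
qed

text \<open>A minimizing sequence is Cauchy by the parallelogram law, since midpoints stay in X at
  distance at least d from y. The residue is orthogonal to z because otherwise moving the minimizer
  along z would shorten it.\<close>

lemma projection_exists:
  fixes X :: "'h::chilbert_space set"
  assumes "closed_csubspace X"
  shows "\<exists>x\<in>X. y - x \<in> orth_compl X"
proof -
  note X = closed_csubspaceD[OF assms]
  define d where "d = (INF x\<in>X. norm (y - x))"
  have bdd: "bdd_below ((\<lambda>x. norm (y - x)) ` X)" by (intro bdd_belowI2[of _ 0]) simp
  have d: "d \<le> norm (y - x)" if "x \<in> X" for x
    unfolding d_def by (rule cINF_lower[OF bdd that])
  have d0: "d \<ge> 0" unfolding d_def using X(3) by (intro cINF_greatest) auto
  have "\<exists>x\<in>X. norm (y - x) < d + 1 / real (Suc n)" for n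
    using cINF_less_iff[OF _ bdd, of "d + 1 / real (Suc n)"] X(3) unfolding d_def by auto
  then obtain u where u: "\<And>n. u n \<in> X" "\<And>n. norm (y - u n) < d + 1 / real (Suc n)" by metis
  have lim: "(\<lambda>n. norm (y - u n)) \<longlonglongrightarrow> d"
  proof (rule tendsto_sandwich[of "\<lambda>_. d" _ _ "\<lambda>n. d + 1 / real (Suc n)"])
    show "(\<lambda>n. d + 1 / real (Suc n)) \<longlonglongrightarrow> d"
      using tendsto_add[OF tendsto_const[of d] LIMSEQ_inverse_real_of_nat] by (simp add: inverse_eq_divide)
  qed (use d[OF u(1)] less_imp_le[OF u(2)] in \<open>simp_all\<close>)
  have est: "(norm (u m - u n))\<^sup>2 \<le> 2 * ((norm (y - u m))\<^sup>2 - d\<^sup>2) + 2 * ((norm (y - u n))\<^sup>2 - d\<^sup>2)" for m n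
  proof -
    have "(1/2) *\<^sub>C (u m + u n) \<in> X" by (intro X u)
    then have "d \<le> norm (y - (1/2) *\<^sub>C (u m + u n))" by (rule d)
    then have "2 * d \<le> norm ((2::complex) *\<^sub>C (y - (1/2) *\<^sub>C (u m + u n)))" by (simp add: norm_scaleC)
    also have "(2::complex) *\<^sub>C (y - (1/2) *\<^sub>C (u m + u n)) = (y - u m) + (y - u n)"
      using scaleC_add_left[of 1 1 y] by (simp add: scaleC_diff_right scaleC_scaleC scaleC_one)
    finally have "(2 * d)\<^sup>2 \<le> (norm ((y - u m) + (y - u n)))\<^sup>2" using d0 by (intro power_mono) auto
    then show ?thesis
      using parallelogram[of "y - u m" "y - u n"] norm_minus_commute[of "u m" "u n"]
      by (simp add: power_mult_distrib)
  qed
  have lim2: "(\<lambda>n. (norm (y - u n))\<^sup>2 - d\<^sup>2) \<longlonglongrightarrow> 0"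
    using tendsto_diff[OF tendsto_power[OF lim, of 2] tendsto_const[of "d\<^sup>2"]] by simp
  have "Cauchy u"
  proof (rule metric_CauchyI)
    fix e :: real assume "e > 0"
    then have "e\<^sup>2 / 4 > 0" by simp
    then obtain N where N: "\<And>n. n \<ge> N \<Longrightarrow> \<bar>(norm (y - u n))\<^sup>2 - d\<^sup>2\<bar> < e\<^sup>2 / 4"
      using LIMSEQ_D[OF lim2] by (metis diff_zero real_norm_def)
    have "dist (u m) (u n) < e" if "m \<ge> N" "n \<ge> N" for m n
    proof -
      have "(norm (u m - u n))\<^sup>2 < e\<^sup>2"
        using est[of m n] le_less_trans[OF abs_ge_self N[OF that(1)]] le_less_trans[OF abs_ge_self N[OF that(2)]]
        by (simp add: field_simps)
      then show ?thesis using \<open>e > 0\<close> by (simp add: dist_norm power2_less_imp_less less_imp_le)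
    qed
    then show "\<exists>N. \<forall>m\<ge>N. \<forall>n\<ge>N. dist (u m) (u n) < e" by blast
  qed
  then obtain x where x: "u \<longlonglongrightarrow> x" using Cauchy_convergent convergent_def by blast
  then have "x \<in> X" using closed_sequentially[OF X(2)] u(1) by blast
  have nx: "norm (y - x) = d"
    using LIMSEQ_unique[OF tendsto_norm[OF tendsto_diff[OF tendsto_const x]] lim] .
  have "cinner z (y - x) = 0" if "z \<in> X" for z
  proof (cases "z = 0")
    case False
    define w where "w = y - x"
    define c where "c = cinner z w / complex_of_real ((norm z)\<^sup>2)"
    have "x + c *\<^sub>C z \<in> X" using that \<open>x \<in> X\<close> X by blast
    then have "d \<le> norm (w - c *\<^sub>C z)" using d[of "x + c *\<^sub>C z"] by (simp add: w_def algebra_simps)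
    then have le: "(norm w)\<^sup>2 \<le> (norm (w - c *\<^sub>C z))\<^sup>2"
      using d0 nx w_def power_mono by metis
    have "c * cinner z z = cinner z w" using False by (simp add: c_def cinner_self)
    then have "cinner (c *\<^sub>C z) (w - c *\<^sub>C z) = 0"
      by (simp only: cinner.diff_right cinner_scaleC_left cinner_scaleC_right) simp
    from pythagoras[OF this] have "(norm w)\<^sup>2 = (norm (c *\<^sub>C z))\<^sup>2 + (norm (w - c *\<^sub>C z))\<^sup>2" by simp
    then have "norm (c *\<^sub>C z) = 0" using le by simp
    then show ?thesis using False by (simp add: c_def w_def norm_scaleC)
  qed (simp add: cinner.zero_left)
  then show ?thesis using \<open>x \<in> X\<close> by (auto simp: orth_compl_def)
qed

lemma orth_complD: "y \<in> orth_compl X \<Longrightarrow> x \<in> X \<Longrightarrow> cinner x y = 0" "y \<in> orth_compl X \<Longrightarrow> x \<in> X \<Longrightarrow> cinner y x = 0"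
  using cinner_zero_commute by (auto simp: orth_compl_def)

lemma orth_complI: "(\<And>x. x \<in> X \<Longrightarrow> cinner x y = 0) \<Longrightarrow> y \<in> orth_compl X"
  by (simp add: orth_compl_def)

lemma orth_compl_antimono: "X \<subseteq> Y \<Longrightarrow> orth_compl Y \<subseteq> orth_compl X"
  by (auto simp: orth_compl_def)

lemma orth_compl_Int: "x \<in> X \<Longrightarrow> x \<in> orth_compl X \<Longrightarrow> x = 0"
  using orth_complD(1) by fastforce

locale closed_sub =
  fixes X :: "'h::chilbert_space set"
  assumes closed_csubspace: "closed_csubspace X"
begin

lemmas sub = closed_csubspaceD[OF closed_csubspace]

lemma proj_unique:
  assumes "x \<in> X" "y - x \<in> orth_compl X"
  shows "proj X y = x"
  unfolding proj_def
proof (rule the_equality)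
  fix x' assume x': "x' \<in> X \<and> y - x' \<in> orth_compl X"
  have "(y - x') - (y - x) \<in> orth_compl X"
    using x' assms(2) closed_csubspaceD(6)[OF closed_csubspace_orth_compl] by blast
  moreover have "x - x' \<in> X" using x' assms(1) sub by blast
  ultimately show "x' = x" using orth_compl_Int[of "x - x'" X] by simp
qed (use assms in blast)

lemma proj_mem [simp]: "proj X y \<in> X" and proj_orth: "y - proj X y \<in> orth_compl X"
  using projection_exists[OF closed_csubspace, of y] proj_unique by auto

lemma proj_id: "x \<in> X \<Longrightarrow> proj X x = x"
  using closed_csubspaceD(3)[OF closed_csubspace_orth_compl] by (intro proj_unique) auto

lemma proj_zero_iff: "proj X x = 0 \<longleftrightarrow> x \<in> orth_compl X"
  using proj_orth[of x] proj_unique[of 0 x] sub(3) by auto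

lemma proj_add: "proj X (x + y) = proj X x + proj X y"
proof (rule proj_unique)
  have "(x - proj X x) + (y - proj X y) \<in> orth_compl X"
    by (intro closed_csubspaceD[OF closed_csubspace_orth_compl] proj_orth)
  then show "x + y - (proj X x + proj X y) \<in> orth_compl X" by (simp add: algebra_simps)
qed (intro sub proj_mem)

lemma proj_scaleC: "proj X (c *\<^sub>C x) = c *\<^sub>C proj X x"
proof (rule proj_unique)
  have "c *\<^sub>C (x - proj X x) \<in> orth_compl X"
    by (intro closed_csubspaceD[OF closed_csubspace_orth_compl] proj_orth)
  then show "c *\<^sub>C x - c *\<^sub>C proj X x \<in> orth_compl X" by (simp add: scaleC_diff_right)
qed (intro sub proj_mem)

lemma cinner_proj: "cinner (proj X x) y = cinner (proj X x) (proj X y)"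
  using orth_complD(1)[OF proj_orth proj_mem, of x y] by (simp add: cinner.diff_right)

lemma cinner_proj_right: "cinner x (proj X y) = cinner (proj X x) (proj X y)"
  using orth_complD(2)[OF proj_orth proj_mem, of x y] by (simp add: cinner.diff_left)

lemma cinner_proj_swap: "cinner (proj X x) y = cinner x (proj X y)"
  using cinner_proj cinner_proj_right by simp

lemma norm_proj_pythagoras: "(norm x)\<^sup>2 = (norm (proj X x))\<^sup>2 + (norm (x - proj X x))\<^sup>2"
  using pythagoras[of "proj X x" "x - proj X x"] orth_complD(1)[OF proj_orth proj_mem] by simp

lemma norm_proj_le: "norm (proj X x) \<le> norm x"
  by (rule power2_le_imp_le) (simp_all add: norm_proj_pythagoras[of x])

lemma norm_diff_proj_le: "z \<in> X \<Longrightarrow> norm (x - proj X x) \<le> norm (x - z)"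
proof (rule power2_le_imp_le)
  assume z: "z \<in> X"
  have "(norm (x - z))\<^sup>2 = (norm (x - proj X x + (proj X x - z)))\<^sup>2" by simp
  also have "\<dots> = (norm (x - proj X x))\<^sup>2 + (norm (proj X x - z))\<^sup>2"
    using orth_complD(2)[OF proj_orth, of "proj X x - z"] z sub by (intro pythagoras) auto
  finally show "(norm (x - proj X x))\<^sup>2 \<le> (norm (x - z))\<^sup>2" by simp
qed simp

lemma orth_orth: "orth_compl (orth_compl X) = X"
proof
  show "orth_compl (orth_compl X) \<subseteq> X"
  proof
    fix x assume x: "x \<in> orth_compl (orth_compl X)"
    have "cinner (x - proj X x) x = 0" using orth_complD(1)[OF x proj_orth] .
    moreover have "cinner (x - proj X x) (proj X x) = 0" using orth_complD(2)[OF proj_orth proj_mem] .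
    ultimately have "cinner (x - proj X x) (x - proj X x) = 0" by (simp add: cinner.diff_right)
    then have "x = proj X x" by simp
    then show "x \<in> X" using proj_mem[of x] by simp
  qed
  show "X \<subseteq> orth_compl (orth_compl X)" using orth_complD(2) by (auto intro: orth_complI)
qed

end

lemma closed_csubspace_closed_cspan [simp]: "closed_csubspace (closed_cspan (S::'h::chilbert_space set))"
proof -
  have sub: "csubspace (cspan S)" by (simp add: csubspace_def cspan_def cvec.subspace_span)
  have "0 \<in> closure (cspan S)"
    using sub closure_subset[of "cspan S"] unfolding csubspace_iff by blast
  moreover have "x + y \<in> closure (cspan S)" if x: "x \<in> closure (cspan S)" and y: "y \<in> closure (cspan S)" for x y
  proof -
    obtain u where u: "\<forall>n. u n \<in> cspan S" "u \<longlonglongrightarrow> x" using x unfolding closure_sequential by blast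
    obtain v where v: "\<forall>n. v n \<in> cspan S" "v \<longlonglongrightarrow> y" using y unfolding closure_sequential by blast
    have "\<forall>n. u n + v n \<in> cspan S" using u(1) v(1) sub by (simp add: csubspace_iff)
    then show ?thesis unfolding closure_sequential
      using tendsto_add[OF u(2) v(2)] by (intro exI[of _ "\<lambda>n. u n + v n"] conjI)
  qed
  moreover have "c *\<^sub>C x \<in> closure (cspan S)" if x: "x \<in> closure (cspan S)" for c x
  proof -
    obtain u where u: "\<forall>n. u n \<in> cspan S" "u \<longlonglongrightarrow> x" using x unfolding closure_sequential by blast
    have bl: "bounded_linear (\<lambda>z::'h. c *\<^sub>C z)"
      by (rule bounded_linear_intro[where K="norm c"])
        (auto simp: scaleC_add_right scaleR_scaleC scaleC_scaleC norm_scaleC mult.commute)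
    have "\<forall>n. c *\<^sub>C u n \<in> cspan S" using u(1) sub by (simp add: csubspace_iff)
    then show ?thesis unfolding closure_sequential
      using bounded_linear.tendsto[OF bl u(2)] by (intro exI[of _ "\<lambda>n. c *\<^sub>C u n"] conjI)
  qed
  ultimately show ?thesis by (simp add: closed_csubspace_def closed_cspan_def csubspace_iff)
qed

lemma closed_cspan_superset: "S \<subseteq> closed_cspan S"
  unfolding closed_cspan_def cspan_def using closure_subset cvec.span_superset by blast

lemma closed_cspan_minimal: "S \<subseteq> X \<Longrightarrow> closed_csubspace X \<Longrightarrow> closed_cspan S \<subseteq> (X::'h::chilbert_space set)"
  unfolding closed_cspan_def cspan_def closed_csubspace_def csubspace_def
  by (intro closure_minimal cvec.span_minimal) auto

lemma closed_cspan_mono: "S \<subseteq> T \<Longrightarrow> closed_cspan S \<subseteq> closed_cspan (T::'h::chilbert_space set)"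
  by (meson closed_cspan_minimal closed_cspan_superset closed_csubspace_closed_cspan order_trans)

lemma orth_compl_closed_cspan: "orth_compl (closed_cspan S) = orth_compl (S::'h::chilbert_space set)"
proof
  show "orth_compl (closed_cspan S) \<subseteq> orth_compl S" by (rule orth_compl_antimono[OF closed_cspan_superset])
  have "S \<subseteq> orth_compl (orth_compl S)" using orth_complD(2) by (auto intro: orth_complI)
  then have "closed_cspan S \<subseteq> orth_compl (orth_compl S)" by (rule closed_cspan_minimal) simp
  then show "orth_compl S \<subseteq> orth_compl (closed_cspan S)"
    using orth_complD(2) by (auto intro!: orth_complI)
qed

text \<open>Riesz representation of the functional \<phi>: if it is not 0, the complement of its
  kernel in X is spanned by one vector w, and a multiple of w represents it. This gives the definite
  description in \<open>adj_on\<close> its meaning.\<close>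

lemma riesz:
  fixes X :: "'h::chilbert_space set"
  assumes X: "closed_csubspace X" and T: "bounded_op X T"
  shows "\<exists>!z. z \<in> X \<and> (\<forall>x\<in>X. cinner (T x) y = cinner x z)"
proof -
  interpret X: closed_sub X by unfold_locales (rule X)
  define \<phi> where "\<phi> x = cinner y (T x)" for x
  have add: "\<phi> (x + x') = \<phi> x + \<phi> x'" if "x \<in> X" "x' \<in> X" for x x'
    using T that by (simp add: \<phi>_def bounded_op_def cinner_add_right)
  have scale: "\<phi> (c *\<^sub>C x) = c * \<phi> x" if "x \<in> X" for c x
    using T that by (simp add: \<phi>_def bounded_op_def cinner_scaleC_right)
  obtain K where K: "\<And>x. x \<in> X \<Longrightarrow> norm (T x) \<le> K * norm x" using T unfolding bounded_op_def by blast
  have bd: "cmod (\<phi> x) \<le> norm y * (\<bar>K\<bar> * norm x)" if "x \<in> X" for x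
  proof -
    have "norm (T x) \<le> \<bar>K\<bar> * norm x" using K[OF that] by (smt (verit) mult_right_mono norm_ge_zero)
    then show ?thesis
      using cinner_bound[of y "T x"] by (simp add: \<phi>_def) (meson mult_left_mono norm_ge_zero order_trans)
  qed
  have diff: "\<phi> (x - x') = \<phi> x - \<phi> x'" if "x \<in> X" "x' \<in> X" for x x'
    using add[of "x - x'" x'] that X.sub by simp
  define K0 where "K0 = {x \<in> X. \<phi> x = 0}"
  have "closed K0"
  proof (rule closed_sequential_limits[THEN iffD2], intro allI impI)
    fix u l assume u: "(\<forall>n. u n \<in> K0) \<and> u \<longlonglongrightarrow> l"
    then have l: "l \<in> X" using closed_sequentially[OF X.sub(2), of u l] by (auto simp: K0_def)
    have "cmod (\<phi> l) \<le> norm y * (\<bar>K\<bar> * norm (l - u n))" for n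
    proof -
      have un: "u n \<in> X" "\<phi> (u n) = 0" using u by (auto simp: K0_def)
      then have "\<phi> l = \<phi> (l - u n)" using diff[OF l un(1)] by simp
      then show ?thesis using bd[of "l - u n"] l un X.sub by simp
    qed
    moreover have "(\<lambda>n. norm y * (\<bar>K\<bar> * norm (l - u n))) \<longlonglongrightarrow> norm y * (\<bar>K\<bar> * norm (l - l))"
      using u by (intro tendsto_intros) auto
    ultimately have "cmod (\<phi> l) \<le> 0" using LIMSEQ_le_const by fastforce
    then show "l \<in> K0" using l by (simp add: K0_def)
  qed
  moreover have "csubspace K0"
    using X.sub scale[of 0 0] by (auto simp: csubspace_iff K0_def add scale)
  ultimately have cK: "closed_csubspace K0" by (simp add: closed_csubspace_def)
  interpret K0: closed_sub K0 by unfold_locales (rule cK)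
  have "\<exists>z\<in>X. \<forall>x\<in>X. \<phi> x = cinner z x"
  proof (cases "X \<subseteq> K0")
    case True
    then show ?thesis using X.sub(3) by (intro bexI[of _ 0]) (auto simp: K0_def cinner.zero_left)
  next
    case False
    then obtain w0 where w0: "w0 \<in> X" "w0 \<notin> K0" by blast
    define w where "w = w0 - proj K0 w0"
    have wX: "w \<in> X" using w0 K0.proj_mem[of w0] X.sub by (auto simp: w_def K0_def)
    have wo: "w \<in> orth_compl K0" unfolding w_def by (rule K0.proj_orth)
    have "\<phi> w = \<phi> w0" using diff[of w0 "proj K0 w0"] K0.proj_mem[of w0] w0 by (simp add: w_def K0_def)
    then have fw: "\<phi> w \<noteq> 0" using w0 by (simp add: K0_def)
    have w_nz: "w \<noteq> 0" using fw scale[OF X.sub(3), of 0] by auto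
    define z where "z = (cnj (\<phi> w) / complex_of_real ((norm w)\<^sup>2)) *\<^sub>C w"
    have "\<phi> x = cinner z x" if x: "x \<in> X" for x
    proof -
      have "x - (\<phi> x / \<phi> w) *\<^sub>C w \<in> K0"
        using x wX X.sub fw by (simp add: K0_def diff scale)
      then have "cinner w x = (\<phi> x / \<phi> w) * cinner w w"
        using orth_complD(2)[OF wo, of "x - (\<phi> x / \<phi> w) *\<^sub>C w"]
        by (simp only: cinner.diff_right cinner_scaleC_right) simp
      then show ?thesis using fw w_nz by (simp add: z_def cinner_scaleC_left cinner_self)
    qed
    moreover have "z \<in> X" unfolding z_def using wX X.sub by blast
    ultimately show ?thesis by blast
  qed
  then obtain z where z: "z \<in> X" "\<And>x. x \<in> X \<Longrightarrow> \<phi> x = cinner z x" by blast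
  have zz: "cinner (T x) y = cinner x z" if "x \<in> X" for x
    using z(2)[OF that] cinner_commute[of "T x" y] cinner_commute[of x z] by (simp add: \<phi>_def)
  moreover have "z' = z" if "z' \<in> X" "\<forall>x\<in>X. cinner (T x) y = cinner x z'" for z'
  proof -
    have "z' - z \<in> X" using that z X.sub by blast
    then have "cinner (z' - z) (z' - z) = 0" using that zz by (simp add: cinner.diff_right)
    then show ?thesis by simp
  qed
  ultimately show ?thesis using z(1) by blast
qed

lemma adj_on:
  assumes "closed_csubspace X" "bounded_op X T"
  shows "adj_on X T y \<in> X" "x \<in> X \<Longrightarrow> cinner (T x) y = cinner x (adj_on X T y)"
  using theI'[OF riesz[OF assms]] unfolding adj_on_def by blast+

lemma adj_on_eqI:
  assumes "closed_csubspace X" "bounded_op X T" "z \<in> X" "\<And>x. x \<in> X \<Longrightarrow> cinner (T x) y = cinner x z"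
  shows "adj_on X T y = z"
  using riesz[OF assms(1,2), of y] adj_on[OF assms(1,2)] assms(3,4) by blast

subsection \<open>Finite-dimensional subspaces\<close>

lemma csubspace_cspan [simp]: "csubspace (cspan B)"
  by (simp add: csubspace_def cspan_def cvec.subspace_span)

lemma cspan_subspace: "csubspace X \<Longrightarrow> cspan X = X"
  unfolding csubspace_def cspan_def by (rule cvec.span_eq_iff[THEN iffD2])

text \<open>Heine-Borel in sequential form. It yields closedness of finite-dimensional subspaces and
  the compactness behind \<open>distance_bounded_below\<close>.\<close>

definition bounded_seq_compact :: "'h::chilbert_space set \<Rightarrow> bool"
  where "bounded_seq_compact W \<longleftrightarrow> (\<forall>u K. (\<forall>n. u n \<in> W \<and> norm (u n) \<le> K) \<longrightarrow>
    (\<exists>r l. strict_mono r \<and> l \<in> W \<and> (\<lambda>n. u (r n :: nat)) \<longlonglongrightarrow> l))"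

lemma bounded_seq_compactD:
  assumes "bounded_seq_compact W" "\<And>n. u n \<in> W" "\<And>n. norm (u n) \<le> K"
  obtains r l where "strict_mono r" "l \<in> W" "(\<lambda>n. u (r n :: nat)) \<longlonglongrightarrow> l"
  using assms unfolding bounded_seq_compact_def by meson

lemma closed_if_bounded_seq_compact:
  assumes "bounded_seq_compact (W::'h::chilbert_space set)"
  shows "closed W"
proof (rule closed_sequential_limits[THEN iffD2], intro allI impI)
  fix u l assume u: "(\<forall>n. u n \<in> W) \<and> u \<longlonglongrightarrow> l"
  then have "Bseq u" using convergent_imp_Bseq unfolding convergent_def by blast
  then obtain K where K: "\<forall>n. norm (u n) \<le> K" unfolding Bseq_def by blast
  obtain r l' where r: "strict_mono r" "l' \<in> W" "(\<lambda>n. u (r n :: nat)) \<longlonglongrightarrow> l'"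
    using bounded_seq_compactD[OF assms, of u K] u K by blast
  have "(\<lambda>n. u (r n)) \<longlonglongrightarrow> l"
    using LIMSEQ_subseq_LIMSEQ[OF conjunct2[OF u] r(1)] by (simp add: o_def)
  then show "l \<in> W" using r LIMSEQ_unique by blast
qed

text \<open>The new direction is taken orthogonal to the old span, so Pythagoras bounds both
  components by the same K and convergent subsequences can be extracted one after the other.\<close>

lemma bounded_seq_compact_insert:
  assumes W: "bounded_seq_compact (cspan B)"
  shows "bounded_seq_compact (cspan (insert (b::'h::chilbert_space) B))"
proof (cases "b \<in> cspan B")
  case True
  then have "cspan (insert b B) = cspan B" unfolding cspan_def by (rule cvec.span_redundant)
  then show ?thesis using W by simp
next
  case False
  have cl: "closed_csubspace (cspan B)"
    using closed_if_bounded_seq_compact[OF W] by (simp add: closed_csubspace_def)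
  interpret W: closed_sub "cspan B" by unfold_locales (rule cl)
  define e where "e = b - proj (cspan B) b"
  have e_orth: "e \<in> orth_compl (cspan B)" unfolding e_def by (rule W.proj_orth)
  have "e \<noteq> 0" using False W.proj_mem[of b] unfolding e_def by (metis eq_iff_diff_eq_0)
  have in_span: "y + k *\<^sub>C e \<in> cspan (insert b B)" if "y \<in> cspan B" for y k
  proof -
    have sub: "cspan B \<subseteq> cspan (insert b B)" unfolding cspan_def by (intro cvec.span_mono) auto
    have "b \<in> cspan (insert b B)" unfolding cspan_def by (intro cvec.span_base) auto
    then have "e \<in> cspan (insert b B)"
      unfolding e_def using sub W.proj_mem[of b] by (intro csubspace_diff) auto
    then show ?thesis using sub that csubspace_cspan[of "insert b B"] by (auto simp: csubspace_iff)
  qed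
  have decomp: "\<exists>y k. y \<in> cspan B \<and> x = y + k *\<^sub>C e" if x: "x \<in> cspan (insert b B)" for x
  proof -
    obtain k where "x - k *\<^sub>C b \<in> cspan B"
      using x cvec.span_breakdown_eq[of x b B] unfolding cspan_def by blast
    then have "(x - k *\<^sub>C b) + k *\<^sub>C proj (cspan B) b \<in> cspan B"
      by (rule W.sub(4)[OF _ W.sub(5)[OF W.proj_mem]])
    moreover have "x = ((x - k *\<^sub>C b) + k *\<^sub>C proj (cspan B) b) + k *\<^sub>C e"
      by (simp add: e_def scaleC_diff_right)
    ultimately show ?thesis by blast
  qed
  show ?thesis
    unfolding bounded_seq_compact_def
  proof (intro allI impI)
    fix u :: "nat \<Rightarrow> 'h" and K assume u: "\<forall>n. u n \<in> cspan (insert b B) \<and> norm (u n) \<le> K"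
    have "\<exists>q. fst q \<in> cspan B \<and> u n = fst q + snd q *\<^sub>C e" for n
    proof -
      have "u n \<in> cspan (insert b B)" using u by blast
      then obtain y k where "y \<in> cspan B" "u n = y + k *\<^sub>C e" using decomp by blast
      then show ?thesis by (intro exI[of _ "(y, k)"]) simp
    qed
    then obtain q where q: "\<And>n. fst (q n) \<in> cspan B \<and> u n = fst (q n) + snd (q n) *\<^sub>C e" by metis
    define y k where "y n = fst (q n)" and "k n = snd (q n)" for n
    have yk: "y n \<in> cspan B" "u n = y n + k n *\<^sub>C e" for n using q by (simp_all add: y_def k_def)
    have py: "(norm (u n))\<^sup>2 = (norm (y n))\<^sup>2 + (norm (k n *\<^sub>C e))\<^sup>2" for n
      using orth_complD(1)[OF e_orth yk(1)] unfolding yk(2)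
      by (intro pythagoras) (simp add: cinner_scaleC_right)
    have K: "norm (y n) \<le> K" "norm (k n *\<^sub>C e) \<le> K" for n
    proof -
      have "norm (y n) \<le> norm (u n)" "norm (k n *\<^sub>C e) \<le> norm (u n)"
        by (rule power2_le_imp_le; simp add: py)+
      then show "norm (y n) \<le> K" "norm (k n *\<^sub>C e) \<le> K" using u order_trans by blast+
    qed
    have "cmod (k n) \<le> K / norm e" for n
      using K(2)[of n] \<open>e \<noteq> 0\<close> by (simp add: norm_scaleC field_simps)
    then have "bounded (range k)" by (intro boundedI) auto
    then obtain r1 k0 where r1: "strict_mono r1" "(k \<circ> r1) \<longlonglongrightarrow> k0"
      using bounded_imp_convergent_subsequence by blast
    obtain r2 y0 where r2: "strict_mono r2" "y0 \<in> cspan B" "(\<lambda>n. y (r1 (r2 n))) \<longlonglongrightarrow> y0"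
      using bounded_seq_compactD[OF W, of "\<lambda>n. y (r1 n)" K] yk(1) K(1) by blast
    have "(\<lambda>n. k (r1 (r2 n))) \<longlonglongrightarrow> k0"
      using LIMSEQ_subseq_LIMSEQ[OF r1(2) r2(1)] by (simp add: o_def)
    moreover have "bounded_linear (\<lambda>c. c *\<^sub>C e)"
      by (rule bounded_linear_intro[where K="norm e"])
        (auto simp: scaleC_add_left scaleR_scaleC scaleC_scaleC norm_scaleC scaleC_complex_def)
    ultimately have "(\<lambda>n. k (r1 (r2 n)) *\<^sub>C e) \<longlonglongrightarrow> k0 *\<^sub>C e"
      using bounded_linear.tendsto by blast
    then have "(\<lambda>n. u (r1 (r2 n))) \<longlonglongrightarrow> y0 + k0 *\<^sub>C e"
      unfolding yk(2) by (intro tendsto_add r2)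
    moreover have "strict_mono (\<lambda>n. r1 (r2 n))" using strict_mono_o[OF r1(1) r2(1)] by (simp add: o_def)
    ultimately show "\<exists>r l. strict_mono r \<and> l \<in> cspan (insert b B) \<and> (\<lambda>n. u (r n)) \<longlonglongrightarrow> l"
      using in_span[OF r2(2)] by (intro exI[of _ "\<lambda>n. r1 (r2 n)"] exI[of _ "y0 + k0 *\<^sub>C e"]) simp
  qed
qed

lemma fin_dim_bounded_seq_compact:
  assumes "fin_dim (W::'h::chilbert_space set)"
  shows "bounded_seq_compact W"
proof -
  obtain B where B: "finite B" "W = cspan B" using assms by (auto simp: fin_dim_def)
  have "bounded_seq_compact (cspan B)" using B(1)
  proof (induction B rule: finite_induct)
    case empty
    have "cspan ({}::'h set) = {0}" by (simp add: cspan_def cvec.span_empty)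
    then show ?case unfolding bounded_seq_compact_def
      by (auto intro!: exI[of _ "\<lambda>n. n"] simp: strict_mono_def)
  next
    case (insert b B)
    then show ?case by (intro bounded_seq_compact_insert)
  qed
  then show ?thesis using B(2) by simp
qed

lemma fin_dim_csubspace: "fin_dim W \<Longrightarrow> csubspace W"
  unfolding fin_dim_def by auto

lemma fin_dim_closed: "fin_dim (W::'h::chilbert_space set) \<Longrightarrow> closed_csubspace W"
  by (simp add: closed_csubspace_def fin_dim_csubspace closed_if_bounded_seq_compact fin_dim_bounded_seq_compact)

lemma fin_dim_subspace:
  assumes "fin_dim Z" "csubspace Y" "Y \<subseteq> Z"
  shows "fin_dim Y"
proof -
  obtain C where C: "finite C" "Z = cspan C" using assms(1) by (auto simp: fin_dim_def)
  obtain B where B: "B \<subseteq> Y" "cvec.independent B" "Y \<subseteq> cvec.span B"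
    using cvec.maximal_independent_subset by blast
  then have "finite B" using cvec.independent_span_bound[OF C(1) B(2)] C(2) assms(3)
    unfolding cspan_def by blast
  moreover have "cspan B = Y"
    using B(1,3) assms(2) cvec.span_minimal[of B Y] unfolding cspan_def csubspace_def by blast
  ultimately show ?thesis unfolding fin_dim_def by blast
qed

text \<open>Replaces induction on the dimension: among the subspaces satisfying P inside Y, one with
  a spanning set of least cardinality is minimal. It supplies minimal coinvariant subspaces as well
  as the minimal counterexample in \<open>intertwiner_commutes_adj\<close>.\<close>

lemma csubspace_minimal_exists:
  assumes Z: "fin_dim (Z::'v::complex_vector set)" and Y: "P Y" and P: "\<And>Y. P Y \<Longrightarrow> csubspace Y \<and> Y \<subseteq> Z"
  obtains X where "P X" "X \<subseteq> Y" "\<And>X'. P X' \<Longrightarrow> X' \<subseteq> X \<Longrightarrow> X' = X"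
proof -
  define Q where "Q n \<longleftrightarrow> (\<exists>X B. P X \<and> X \<subseteq> Y \<and> finite B \<and> cspan B = X \<and> card B = n)" for n
  have fd: "\<exists>B. finite B \<and> cspan B = X" if "P X" for X
    using fin_dim_subspace[OF Z] P[OF that] unfolding fin_dim_def by metis
  have "\<exists>n. Q n" using fd[OF Y] Y unfolding Q_def by blast
  then obtain n where n: "Q n" "\<And>m. m < n \<Longrightarrow> \<not> Q m" using exists_least_iff[of Q] by blast
  then obtain X B where X: "P X" "X \<subseteq> Y" "finite B" "cspan B = X" "card B = n" unfolding Q_def by blast
  have "X' = X" if X': "P X'" "X' \<subseteq> X" for X'
  proof (rule ccontr)
    assume "X' \<noteq> X"
    then obtain z where z: "z \<in> X" "z \<notin> X'" using X'(2) by blast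
    obtain C where C: "C \<subseteq> X'" "cvec.independent C" "X' \<subseteq> cvec.span C"
      using cvec.maximal_independent_subset by blast
    have spC: "cspan C = X'"
      using C(1,3) P[OF X'(1)] cvec.span_minimal[of C X'] unfolding cspan_def csubspace_def by blast
    have "cvec.independent (insert z C)"
      using cvec.independent_insertI[OF _ C(2), of z] z(2) spC unfolding cspan_def by blast
    moreover have "insert z C \<subseteq> cvec.span B" using z C X'(2) X(4) unfolding cspan_def by blast
    ultimately have "finite (insert z C) \<and> card (insert z C) \<le> card B"
      by (intro cvec.independent_span_bound X)
    moreover have "z \<notin> C" using z C by blast
    ultimately have "finite C" "card C < n" using X(5) by auto
    moreover have "Q (card C)" unfolding Q_def using X' X(2) spC \<open>finite C\<close> by blast
    ultimately show False using n(2) by blast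
  qed
  then show ?thesis using that X by blast
qed

lemma fin_dim_image:
  assumes "fin_dim W" "\<And>x y. T (x + y) = T x + T y" "\<And>c x. T (c *\<^sub>C x) = c *\<^sub>C T x"
  shows "fin_dim (T ` W)"
proof -
  obtain B where B: "finite B" "W = cspan B" using assms(1) by (auto simp: fin_dim_def)
  have "T ` W = cspan (T ` B)"
  proof
    have "T 0 = 0" using assms(3)[of 0 0] by simp
    then have "csubspace (T -` cspan (T ` B))"
      using csubspace_cspan[of "T ` B"] by (simp add: csubspace_iff assms)
    moreover have "B \<subseteq> T -` cspan (T ` B)" by (auto simp: cspan_def intro!: cvec.span_base)
    ultimately have "cspan B \<subseteq> T -` cspan (T ` B)"
      unfolding cspan_def csubspace_def by (intro cvec.span_minimal)
    then show "T ` W \<subseteq> cspan (T ` B)" using B by blast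
    have "csubspace (T ` W)"
      unfolding csubspace_iff
    proof (intro conjI ballI allI)
      have sW: "csubspace W" using B by simp
      then show "0 \<in> T ` W" using \<open>T 0 = 0\<close> by (force simp: csubspace_iff)
      show "x + y \<in> T ` W" if "x \<in> T ` W" "y \<in> T ` W" for x y
        using that sW by (auto simp: csubspace_iff simp flip: assms(2))
      show "c *\<^sub>C x \<in> T ` W" if "x \<in> T ` W" for c x
        using that sW by (auto simp: csubspace_iff simp flip: assms(3))
    qed
    moreover have "T ` B \<subseteq> T ` W" using B(2) cvec.span_base unfolding cspan_def by blast
    ultimately show "cspan (T ` B) \<subseteq> T ` W"
      unfolding cspan_def csubspace_def by (intro cvec.span_minimal)
  qed
  then show ?thesis unfolding fin_dim_def using B(1) by blast
qed

subsection \<open>Isometric representations of a single correspondence\<close>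

definition inv_sub :: "('a \<Rightarrow> 'h \<Rightarrow> 'h) \<Rightarrow> 'h::chilbert_space set \<Rightarrow> bool"
  where "inv_sub \<rho> W \<longleftrightarrow> closed_csubspace W \<and> (\<forall>a. \<forall>h\<in>W. \<rho> a h \<in> W)"

lemma bounded_op_UNIV_bounded_linear:
  assumes "bounded_op UNIV T"
  shows "bounded_linear T"
proof -
  obtain K where "\<forall>x. norm (T x) \<le> K * norm x" using assms unfolding bounded_op_def by blast
  then show ?thesis
    using assms unfolding bounded_op_def
    by (intro bounded_linear_intro[of _ K]) (auto simp: scaleR_scaleC mult.commute)
qed

lemma closed_cspan_image:
  assumes "bounded_op UNIV T" "\<And>x. x \<in> S \<Longrightarrow> T x \<in> X" "closed_csubspace X" "x \<in> closed_cspan S"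
  shows "T x \<in> X"
proof -
  have T: "T (x + y) = T x + T y" "T (c *\<^sub>C x) = c *\<^sub>C T x" for x y c
    using assms(1) by (auto simp: bounded_op_def)
  have "T 0 = 0" using T(2)[of 0 0] by simp
  then have "csubspace (T -` X)"
    using closed_csubspaceD[OF assms(3)] T by (auto simp: csubspace_iff)
  moreover have "closed (T -` X)"
    using closed_csubspaceD(2)[OF assms(3)]
      linear_continuous_on[OF bounded_op_UNIV_bounded_linear[OF assms(1)], of UNIV]
    by (intro closed_vimage) (auto simp: continuous_on_eq_continuous_at)
  ultimately have "closed_csubspace (T -` X)" by (simp add: closed_csubspace_def)
  then have "closed_cspan S \<subseteq> T -` X" using assms(2) by (intro closed_cspan_minimal) auto
  then show ?thesis using assms(4) by blast
qed

locale star_rep =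
  fixes \<rho> :: "'a::unital_cstar_algebra \<Rightarrow> 'h \<Rightarrow> 'h::chilbert_space"
  assumes rho: "algebra_rep UNIV \<rho>"
begin

lemma rho_bounded: "bounded_op UNIV (\<rho> a)"
  using rho by (simp add: algebra_rep_def)

lemma rho_lin: "\<rho> a (x + y) = \<rho> a x + \<rho> a y" "\<rho> a (c *\<^sub>C x) = c *\<^sub>C \<rho> a x"
  using rho_bounded[of a] by (auto simp: bounded_op_def)

lemma rho_diff: "\<rho> a (x - y) = \<rho> a x - \<rho> a y"
  using rho_lin(1)[of a "x - y" y] by simp

lemma cinner_rho: "cinner (\<rho> a h) k = cinner h (\<rho> (star a) k)"
  using rho by (simp add: algebra_rep_def)

lemma rho_mult: "\<rho> (a * b) h = \<rho> a (\<rho> b h)"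
  using rho by (simp add: algebra_rep_def)

lemma rho_one [simp]: "\<rho> 1 h = h"
  using rho by (simp add: algebra_rep_def)

lemma inv_subD:
  assumes "inv_sub \<rho> W"
  shows "closed_csubspace W" "h \<in> W \<Longrightarrow> \<rho> a h \<in> W"
  using assms by (auto simp: inv_sub_def)

lemma inv_sub_orth: 
  assumes "inv_sub \<rho> W" shows "inv_sub \<rho> (orth_compl W)"
  unfolding inv_sub_def
proof (intro conjI allI ballI orth_complI closed_csubspace_orth_compl)
  fix a h x assume h: "h \<in> orth_compl W" and x: "x \<in> W"
  have "cinner x (\<rho> a h) = cinner (\<rho> (star a) x) h" by (simp add: cinner_rho star_star)
  also have "\<dots> = 0" by (intro orth_complD(1)[OF h] inv_subD(2)[OF assms x])
  finally show "cinner x (\<rho> a h) = 0" .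
qed

lemma inv_sub_iff_orth:
  assumes "closed_csubspace W"
  shows "inv_sub \<rho> W \<longleftrightarrow> (\<forall>a. \<forall>h\<in>orth_compl W. \<rho> a h \<in> orth_compl W)"
proof
  assume "\<forall>a. \<forall>h\<in>orth_compl W. \<rho> a h \<in> orth_compl W"
  then have "inv_sub \<rho> (orth_compl W)" by (simp add: inv_sub_def)
  then show "inv_sub \<rho> W"
    using inv_sub_orth closed_sub.orth_orth[OF closed_sub.intro[OF assms]] by metis
qed (use inv_sub_orth inv_subD(2) in blast)

lemma inv_sub_Int: "inv_sub \<rho> W \<Longrightarrow> inv_sub \<rho> X \<Longrightarrow> inv_sub \<rho> (W \<inter> X)"
  by (auto simp: inv_sub_def closed_csubspace_Int)

lemma inv_sub_UNIV [simp]: "inv_sub \<rho> UNIV"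
  by (simp add: inv_sub_def)

lemma inv_sub_closed_cspan:
  assumes "\<And>a x. x \<in> S \<Longrightarrow> \<rho> a x \<in> closed_cspan S"
  shows "inv_sub \<rho> (closed_cspan S)"
  unfolding inv_sub_def
  using closed_cspan_image[OF rho_bounded assms closed_csubspace_closed_cspan] by simp

lemma proj_rho:
  assumes "inv_sub \<rho> W" shows "proj W (\<rho> a h) = \<rho> a (proj W h)"
proof -
  interpret W: closed_sub W by unfold_locales (rule inv_subD(1)[OF assms])
  show ?thesis
  proof (rule W.proj_unique)
    show "\<rho> a (proj W h) \<in> W" by (intro inv_subD(2)[OF assms] W.proj_mem)
    have "\<rho> a (h - proj W h) \<in> orth_compl W"
      by (intro inv_subD(2)[OF inv_sub_orth[OF assms]] W.proj_orth)
    then show "\<rho> a h - \<rho> a (proj W h) \<in> orth_compl W" by (simp add: rho_diff)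
  qed
qed

end

text \<open>The step \<open>W \<mapsto> T(F)W\<close> carries \<open>W\<close> to the image of \<open>F \<otimes> W\<close>; its lower adjoint sends \<open>W\<close> to
  the subspace generated by \<open>T(F)\<^sup>*W\<close>.\<close>

locale iso_action = star_rep \<rho> + F: semi_corr F
  for \<rho> :: "'a::unital_cstar_algebra \<Rightarrow> 'h \<Rightarrow> 'h::chilbert_space"
    and F :: "('a, 'a, 'x) corr" +
  fixes T :: "'x \<Rightarrow> 'h \<Rightarrow> 'h"
  assumes iso: "\<And>\<xi> \<eta> h k. \<xi> \<in> car F \<Longrightarrow> \<eta> \<in> car F \<Longrightarrow>
      cinner (T \<xi> h) (T \<eta> k) = cinner h (\<rho> (ip F \<xi> \<eta>) k)"
    and T_lact: "\<And>\<xi> a h. \<xi> \<in> car F \<Longrightarrow> T (lact F a \<xi>) h = \<rho> a (T \<xi> h)"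
begin

text \<open>Linearity of \<open>T \<xi>\<close> in the Hilbert space variable and the rule
  \<open>T_ract\<close> are consequences of \<open>iso\<close>: the difference of the two sides is a
  combination of vectors \<open>T \<theta> l\<close> and is orthogonal to all such vectors.\<close>

lemma T_eqI:
  assumes "\<xi> \<in> car F" "\<eta> \<in> car F" "\<zeta> \<in> car F"
    and "\<And>\<theta> l. \<theta> \<in> car F \<Longrightarrow> cinner (T \<theta> l) (T \<xi> h) = cinner (T \<theta> l) (T \<eta> k) + c * cinner (T \<theta> l) (T \<zeta> m)"
  shows "T \<xi> h = T \<eta> k + c *\<^sub>C T \<zeta> m"
proof -
  define d where "d = T \<xi> h - (T \<eta> k + c *\<^sub>C T \<zeta> m)"
  have o: "cinner (T \<theta> l) d = 0" if "\<theta> \<in> car F" for \<theta> l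
    using assms(4)[OF that] by (simp add: d_def cinner.diff_right cinner.add_right cinner_scaleC_right)
  have "cinner d d = 0"
    using cinner_zero_commute[OF o[OF assms(1)]] cinner_zero_commute[OF o[OF assms(2)]]
      cinner_zero_commute[OF o[OF assms(3)]]
    by (subst (2) d_def) (simp add: cinner.diff_right cinner.add_right cinner_scaleC_right)
  then show ?thesis by (simp add: d_def)
qed

lemma T_add: "\<xi> \<in> car F \<Longrightarrow> T \<xi> (h + k) = T \<xi> h + T \<xi> k"
  using T_eqI[of \<xi> \<xi> \<xi> "h + k" h 1 k] by (simp add: iso rho_lin cinner.add_right scaleC_one)

lemma T_scaleC: "\<xi> \<in> car F \<Longrightarrow> T \<xi> (c *\<^sub>C h) = c *\<^sub>C T \<xi> h"
  using T_eqI[of \<xi> \<xi> \<xi> "c *\<^sub>C h" h "c - 1" h]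
  by (simp add: iso rho_lin cinner_scaleC_right left_diff_distrib cvec.scale_left_diff_distrib scaleC_one)

lemma T_diff: "\<xi> \<in> car F \<Longrightarrow> T \<xi> (h - k) = T \<xi> h - T \<xi> k"
  using T_add[of \<xi> "h - k" k] by simp

lemma T_ract: 
  assumes "\<xi> \<in> car F" shows "T (ract F \<xi> b) h = T \<xi> (\<rho> b h)"
  using T_eqI[of "ract F \<xi> b" \<xi> \<xi> h "\<rho> b h" 0 h] assms
  by (simp add: iso rho_mult)

lemma T_bounded: 
  assumes "\<xi> \<in> car F" shows "bounded_op UNIV (T \<xi>)"
proof -
  obtain K where K: "\<And>x. norm (\<rho> (ip F \<xi> \<xi>) x) \<le> K * norm x"
    using rho_bounded[of "ip F \<xi> \<xi>"] by (auto simp: bounded_op_def)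
  have "norm (T \<xi> h) \<le> sqrt \<bar>K\<bar> * norm h" for h
  proof (rule power2_le_imp_le)
    have "(norm (T \<xi> h))\<^sup>2 = cmod (cinner h (\<rho> (ip F \<xi> \<xi>) h))"
      unfolding iso[OF assms assms, symmetric] by (simp add: cinner_self norm_power)
    also have "\<dots> \<le> norm h * norm (\<rho> (ip F \<xi> \<xi>) h)" by (rule cinner_bound)
    also have "\<dots> \<le> norm h * (\<bar>K\<bar> * norm h)"
      using K[of h] by (intro mult_left_mono order.trans[OF K] mult_right_mono) auto
    also have "\<dots> = (sqrt \<bar>K\<bar> * norm h)\<^sup>2" by (simp add: power_mult_distrib power2_eq_square)
    finally show "(norm (T \<xi> h))\<^sup>2 \<le> (sqrt \<bar>K\<bar> * norm h)\<^sup>2" .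
  qed simp
  then show ?thesis unfolding bounded_op_def
    by (intro conjI ballI allI T_add T_scaleC assms exI[of _ "sqrt \<bar>K\<bar>"]) simp_all
qed

definition gens :: "'h set \<Rightarrow> 'h set"
  where "gens W = {T \<xi> h | \<xi> h. \<xi> \<in> car F \<and> h \<in> W}"

definition step :: "'h set \<Rightarrow> 'h set"
  where "step W = closed_cspan (gens W)"

lemma closed_step [simp]: "closed_csubspace (step W)"
  by (simp add: step_def)

lemma T_step:
  assumes "\<xi> \<in> car F" "h \<in> W" shows "T \<xi> h \<in> step W"
proof -
  have "T \<xi> h \<in> gens W" unfolding gens_def using assms by blast
  then show ?thesis using closed_cspan_superset[of "gens W"] unfolding step_def by blast
qed

lemma step_mono: "W \<subseteq> X \<Longrightarrow> step W \<subseteq> step X"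
  unfolding step_def gens_def by (intro closed_cspan_mono) blast

lemma step_minimal: "closed_csubspace X \<Longrightarrow> (\<And>\<xi> h. \<xi> \<in> car F \<Longrightarrow> h \<in> W \<Longrightarrow> T \<xi> h \<in> X) \<Longrightarrow> step W \<subseteq> X"
  unfolding step_def gens_def by (intro closed_cspan_minimal) auto

lemma inv_sub_step: "inv_sub \<rho> (step W)"
  unfolding step_def
proof (rule inv_sub_closed_cspan)
  fix a x assume "x \<in> gens W"
  then obtain \<xi> h where x: "x = T \<xi> h" "\<xi> \<in> car F" "h \<in> W" by (auto simp: gens_def)
  then have "\<rho> a x = T (lact F a \<xi>) h" by (simp add: T_lact)
  then show "\<rho> a x \<in> closed_cspan (gens W)"
    using T_step[OF F.lact_car[OF x(2)] x(3)] by (simp add: step_def)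
qed

text \<open>The complement of W is \<rho>-invariant along with W, so its tensor product with F is
  orthogonal to F \<otimes> W.\<close>

lemma T_orth:
  assumes "inv_sub \<rho> W" "k \<in> orth_compl W" "\<xi> \<in> car F"
  shows "T \<xi> k \<in> orth_compl (step W)"
  unfolding step_def orth_compl_closed_cspan
proof (rule orth_complI)
  fix x assume "x \<in> gens W"
  then obtain \<eta> h where x: "x = T \<eta> h" "\<eta> \<in> car F" "h \<in> W" by (auto simp: gens_def)
  have "cinner x (T \<xi> k) = cinner h (\<rho> (ip F \<eta> \<xi>) k)" unfolding x(1) by (rule iso[OF x(2) assms(3)])
  also have "\<dots> = 0"
    by (intro orth_complD(1)[OF _ x(3)] inv_subD(2)[OF inv_sub_orth[OF assms(1)]] assms(2))
  finally show "cinner x (T \<xi> k) = 0" .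
qed

text \<open>In the tensor picture the projection onto F \<otimes> W is I \<otimes> P_W.\<close>

lemma proj_step:
  assumes "inv_sub \<rho> W" "\<xi> \<in> car F"
  shows "proj (step W) (T \<xi> h) = T \<xi> (proj W h)"
proof -
  interpret W: closed_sub W by unfold_locales (rule inv_subD(1)[OF assms(1)])
  interpret sW: closed_sub "step W" by unfold_locales simp
  show ?thesis
  proof (rule sW.proj_unique)
    show "T \<xi> (proj W h) \<in> step W" by (intro T_step assms W.proj_mem)
    have "T \<xi> (h - proj W h) \<in> orth_compl (step W)" by (intro T_orth assms W.proj_orth)
    then show "T \<xi> h - T \<xi> (proj W h) \<in> orth_compl (step W)" using assms by (simp add: T_diff)
  qed
qed

lemma cspan_gens_list:
  assumes W: "csubspace W" and x: "x \<in> cspan (gens W)"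
  shows "\<exists>us. set us \<subseteq> car F \<times> W \<and> x = (\<Sum>(\<xi>, h)\<leftarrow>us. T \<xi> h)"
  using x unfolding cspan_def
proof (induction rule: cvec.span_induct_alt)
  case base
  show ?case by (intro exI[of _ "[]"]) simp
next
  case (step c x y)
  then obtain us where us: "set us \<subseteq> car F \<times> W" "y = (\<Sum>(\<xi>, h)\<leftarrow>us. T \<xi> h)" by blast
  obtain \<xi> h where x: "x = T \<xi> h" "\<xi> \<in> car F" "h \<in> W" using step(1) by (auto simp: gens_def)
  then show ?case using us W
    by (intro exI[of _ "(\<xi>, c *\<^sub>C h) # us"]) (auto simp: T_scaleC csubspace_iff)
qed

text \<open>The orthogonal complement of all T(F)^* W, expressed without adjoint operators.\<close>

definition pre :: "'h set \<Rightarrow> 'h set"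
  where "pre W = {x. \<forall>\<xi>\<in>car F. T \<xi> x \<in> orth_compl W}"

definition costep :: "'h set \<Rightarrow> 'h set"
  where "costep W = orth_compl (pre W)"

lemma inv_sub_pre: "inv_sub \<rho> (pre W)"
proof -
  have "pre W = (\<Inter>\<xi>\<in>car F. T \<xi> -` orth_compl W)" by (auto simp: pre_def)
  moreover have "closed (T \<xi> -` orth_compl W)" if "\<xi> \<in> car F" for \<xi>
    using closed_csubspaceD(2)[OF closed_csubspace_orth_compl]
      linear_continuous_on[OF bounded_op_UNIV_bounded_linear[OF T_bounded[OF that]], of UNIV]
    by (intro closed_vimage) (auto simp: continuous_on_eq_continuous_at)
  ultimately have "closed (pre W)" by auto
  moreover have "csubspace (pre W)"
  proof -
    have "T \<xi> 0 = 0" if "\<xi> \<in> car F" for \<xi> using T_scaleC[OF that, of 0 0] by simp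
    then show ?thesis
      using closed_csubspaceD[OF closed_csubspace_orth_compl[of W]]
      by (simp add: csubspace_iff pre_def T_add T_scaleC)
  qed
  moreover have "\<rho> a h \<in> pre W" if "h \<in> pre W" for a h
    using that by (simp add: pre_def flip: T_ract)
  ultimately show ?thesis by (simp add: inv_sub_def closed_csubspace_def)
qed

lemma inv_sub_costep: "inv_sub \<rho> (costep W)"
  unfolding costep_def by (intro inv_sub_orth inv_sub_pre)

end

locale full_action = iso_action \<rho> F T
  for \<rho> :: "'a::unital_cstar_algebra \<Rightarrow> 'h \<Rightarrow> 'h::chilbert_space"
    and F :: "('a, 'a, 'x) corr" and T :: "'x \<Rightarrow> 'h \<Rightarrow> 'h" +
  assumes full: "step UNIV = UNIV"
begin

text \<open>For the inclusion of W in \<open>step X\<close>, let P be the projection onto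
  \<open>step X\<close> and h in W. The vector h - P h pairs with \<open>T \<xi> k\<close> as h does
  with \<open>T \<xi> (k - proj X k)\<close>, which is 0 because \<open>k - proj X k\<close> lies in
  \<open>pre W\<close>. The vectors \<open>T \<xi> k\<close> are total by \<open>full\<close>, so h
  = P h. The other direction is \<open>T_orth\<close>.\<close>

theorem galois:
  assumes W: "closed_csubspace W" and X: "inv_sub \<rho> X"
  shows "costep W \<subseteq> X \<longleftrightarrow> W \<subseteq> step X"
proof
  assume le: "W \<subseteq> step X"
  have "orth_compl X \<subseteq> pre W"
    unfolding pre_def using T_orth[OF X] orth_compl_antimono[OF le] by blast
  then have "costep W \<subseteq> orth_compl (orth_compl X)" unfolding costep_def by (rule orth_compl_antimono)
  then show "costep W \<subseteq> X" using closed_sub.orth_orth[OF closed_sub.intro[OF inv_subD(1)[OF X]]] by simp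
next
  assume le: "costep W \<subseteq> X"
  interpret X: closed_sub X by unfold_locales (rule inv_subD(1)[OF X])
  interpret sX: closed_sub "step X" by unfold_locales simp
  interpret preW: closed_sub "pre W" by unfold_locales (rule inv_subD(1)[OF inv_sub_pre])
  have pre: "orth_compl X \<subseteq> pre W"
    using orth_compl_antimono[OF le] preW.orth_orth by (simp add: costep_def)
  show "W \<subseteq> step X"
  proof
    fix h assume h: "h \<in> W"
    have "h - proj (step X) h \<in> orth_compl (gens UNIV)"
    proof (rule orth_complI)
      fix x assume "x \<in> gens UNIV"
      then obtain \<xi> k where x: "x = T \<xi> k" "\<xi> \<in> car F" by (auto simp: gens_def)
      have "cinner x (h - proj (step X) h) = cinner (x - proj (step X) x) h"
        by (simp add: cinner.diff_right cinner.diff_left sX.cinner_proj_swap)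
      also have "x - proj (step X) x = T \<xi> (k - proj X k)"
        using x proj_step[OF X x(2)] by (simp add: T_diff)
      also have "cinner (T \<xi> (k - proj X k)) h = 0"
        using pre X.proj_orth[of k] x(2) by (intro orth_complD(2)[OF _ h]) (auto simp: pre_def)
      finally show "cinner x (h - proj (step X) h) = 0" .
    qed
    then have "h - proj (step X) h \<in> orth_compl (step UNIV)"
      by (simp add: step_def orth_compl_closed_cspan)
    then have "h - proj (step X) h = 0" unfolding full by (intro orth_compl_Int[of _ UNIV]) auto
    then show "h \<in> step X" using sX.proj_mem[of h] by simp
  qed
qed

text \<open>Connects the order-theoretic condition with the usual one: invariance of the complement
  under T(F) means invariance of Z under the adjoints.\<close>

lemma coinv_iff:
  assumes "inv_sub \<rho> Z"
  shows "Z \<subseteq> step Z \<longleftrightarrow> (\<forall>\<xi>\<in>car F. \<forall>x\<in>orth_compl Z. T \<xi> x \<in> orth_compl Z)"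
proof -
  interpret Z: closed_sub Z by unfold_locales (rule inv_subD(1)[OF assms])
  interpret preZ: closed_sub "pre Z" by unfold_locales (rule inv_subD(1)[OF inv_sub_pre])
  have "Z \<subseteq> step Z \<longleftrightarrow> costep Z \<subseteq> Z" using galois[OF Z.closed_csubspace assms] by simp
  also have "\<dots> \<longleftrightarrow> orth_compl Z \<subseteq> pre Z"
    unfolding costep_def
    using orth_compl_antimono[of "orth_compl (pre Z)" Z] orth_compl_antimono[of "orth_compl Z" "pre Z"]
      Z.orth_orth preZ.orth_orth by auto
  finally show ?thesis by (auto simp: pre_def)
qed

text \<open>\<open>reach W\<close> is the smallest closed subspace containing \<open>W\<close> and invariant under \<open>T(F)\<close>.\<close>

definition reach :: "'h set \<Rightarrow> 'h set"
  where "reach W = closed_cspan (\<Union>r. (step ^^ r) W)"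

lemma inv_sub_steps: "inv_sub \<rho> W \<Longrightarrow> inv_sub \<rho> ((step ^^ r) W)"
  by (cases r) (auto simp: inv_sub_step)

lemma steps_mono: "W \<subseteq> X \<Longrightarrow> (step ^^ r) W \<subseteq> (step ^^ r) X"
  by (induction r) (simp_all add: step_mono)

lemma steps_Suc: "W \<subseteq> step W \<Longrightarrow> (step ^^ r) W \<subseteq> (step ^^ Suc r) W"
  using steps_mono[of W "step W" r] by (simp add: funpow_swap1)

lemma steps_incseq: "W \<subseteq> step W \<Longrightarrow> r \<le> s \<Longrightarrow> (step ^^ r) W \<subseteq> (step ^^ s) W"
  using lift_Suc_mono_le[of "\<lambda>r. (step ^^ r) W" r s, OF steps_Suc] by blast

lemma closed_reach [simp]: "closed_csubspace (reach W)"
  by (simp add: reach_def)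

lemma steps_subset_reach: "(step ^^ r) W \<subseteq> reach W"
  unfolding reach_def using closed_cspan_superset[of "\<Union>r. (step ^^ r) W"] by blast

lemma subset_reach: "W \<subseteq> reach W"
  using steps_subset_reach[of 0 W] by simp

lemma inv_sub_reach: "inv_sub \<rho> W \<Longrightarrow> inv_sub \<rho> (reach W)"
  unfolding reach_def
proof (rule inv_sub_closed_cspan)
  fix a x assume "inv_sub \<rho> W" "x \<in> (\<Union>r. (step ^^ r) W)"
  then have "\<rho> a x \<in> (\<Union>r. (step ^^ r) W)" using inv_subD(2)[OF inv_sub_steps] by blast
  then show "\<rho> a x \<in> closed_cspan (\<Union>r. (step ^^ r) W)" by (rule subsetD[OF closed_cspan_superset])
qed

lemma step_reach_subset: "step (reach W) \<subseteq> reach W"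
proof (rule step_minimal[OF closed_reach])
  fix \<xi> h assume \<xi>: "\<xi> \<in> car F" and h: "h \<in> reach W"
  have "T \<xi> x \<in> reach W" if x: "x \<in> (\<Union>r. (step ^^ r) W)" for x
  proof -
    obtain r where "x \<in> (step ^^ r) W" using x by blast
    then have "T \<xi> x \<in> (step ^^ Suc r) W" using T_step[OF \<xi>] by simp
    then show ?thesis using steps_subset_reach by blast
  qed
  then show "T \<xi> h \<in> reach W"
    using closed_cspan_image[OF T_bounded[OF \<xi>] _ closed_reach h[unfolded reach_def]] by blast
qed

lemma reach_minimal:
  assumes "W \<subseteq> X" "closed_csubspace X" "step X \<subseteq> X"
  shows "reach W \<subseteq> X"
proof -
  have "(step ^^ r) W \<subseteq> X" for r
  proof (induction r)
    case (Suc r)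
    then show ?case using step_mono[OF Suc] assms(3) by simp
  qed (simp add: assms(1))
  then show ?thesis unfolding reach_def by (intro closed_cspan_minimal assms) blast
qed

lemma reach_subset_step:
  assumes "W \<subseteq> step W" shows "reach W \<subseteq> step (reach W)"
proof -
  have "(step ^^ r) W \<subseteq> step (reach W)" for r
    using steps_Suc[OF assms, of r] step_mono[OF steps_subset_reach[of r W]] by simp
  then show ?thesis by (subst (1) reach_def) (intro closed_cspan_minimal closed_step, blast)
qed

lemma step_reach: "W \<subseteq> step W \<Longrightarrow> step (reach W) = reach W"
  using step_reach_subset reach_subset_step by blast

text \<open>The translates increase, so their union is already a subspace; a vector of
  \<open>reach W\<close> is therefore approximated by vectors of a single translate.\<close>

lemma reach_eq_closure:
  assumes "W \<subseteq> step W" "closed_csubspace W"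
  shows "reach W = closure (\<Union>r. (step ^^ r) W)"
proof -
  have cl: "closed_csubspace ((step ^^ r) W)" for r using assms(2) by (cases r) auto
  have "csubspace (\<Union>r. (step ^^ r) W)"
    unfolding csubspace_iff
  proof (intro conjI ballI allI)
    show "0 \<in> (\<Union>r. (step ^^ r) W)" using closed_csubspaceD(3)[OF cl] by blast
    fix x assume "x \<in> (\<Union>r. (step ^^ r) W)"
    then obtain r where r: "x \<in> (step ^^ r) W" by blast
    show "c *\<^sub>C x \<in> (\<Union>r. (step ^^ r) W)" for c using closed_csubspaceD(5)[OF cl r] by blast
    fix y assume "y \<in> (\<Union>r. (step ^^ r) W)"
    then obtain s where s: "y \<in> (step ^^ s) W" by blast
    have "x \<in> (step ^^ max r s) W" "y \<in> (step ^^ max r s) W"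
      using r s steps_incseq[OF assms(1), of r "max r s"] steps_incseq[OF assms(1), of s "max r s"] by auto
    then show "x + y \<in> (\<Union>r. (step ^^ r) W)" using closed_csubspaceD(4)[OF cl] by blast
  qed
  then show ?thesis unfolding reach_def closed_cspan_def by (simp add: cspan_subspace)
qed

text \<open>Compactness: unit vectors of Z orthogonal to Z \<inter> V whose distance to V tends to 0
  have projections to V with a convergent subsequence. Its limit lies in Z \<inter> V, is orthogonal
  to it and has norm 1.\<close>

lemma distance_bounded_below:
  assumes V: "fin_dim V" and Z: "closed_csubspace Z"
  shows "\<exists>e>0. \<forall>z\<in>Z. e * norm (z - proj (Z \<inter> V) z) \<le> norm (z - proj V z)"
proof (rule ccontr)
  assume "\<not> ?thesis"
  then have "\<exists>z\<in>Z. norm (z - proj V z) < 1 / real (Suc n) * norm (z - proj (Z \<inter> V) z)" for n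
    using not_le by (metis of_nat_0_less_iff zero_less_Suc zero_less_divide_1_iff)
  then obtain z where z: "\<And>n. z n \<in> Z"
    "\<And>n. norm (z n - proj V (z n)) < 1 / real (Suc n) * norm (z n - proj (Z \<inter> V) (z n))" by metis
  interpret V: closed_sub V by unfold_locales (rule fin_dim_closed[OF V])
  interpret Z: closed_sub Z by unfold_locales (rule Z)
  interpret ZV: closed_sub "Z \<inter> V"
    by unfold_locales (intro closed_csubspace_Int Z V.closed_csubspace)
  define w where "w n = z n - proj (Z \<inter> V) (z n)" for n
  have w_nz: "norm (w n) > 0" for n
  proof -
    have "0 < 1 / real (Suc n) * norm (w n)" using z(2)[of n] norm_ge_zero le_less_trans unfolding w_def by blast
    then show ?thesis by (auto simp: zero_less_divide_iff)
  qed
  have wZ: "w n \<in> Z" for n unfolding w_def using z(1) ZV.proj_mem by (intro Z.sub) auto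
  have wp: "w n - proj V (w n) = z n - proj V (z n)" for n
  proof -
    have "proj V (w n) + proj V (proj (Z \<inter> V) (z n)) = proj V (z n)"
      unfolding w_def by (simp flip: V.proj_add)
    moreover have "proj V (proj (Z \<inter> V) (z n)) = proj (Z \<inter> V) (z n)"
      using ZV.proj_mem[of "z n"] by (intro V.proj_id) auto
    ultimately show ?thesis by (simp add: w_def algebra_simps)
  qed
  define y where "y n = complex_of_real (1 / norm (w n)) *\<^sub>C w n" for n
  have ny: "norm (y n) = 1" for n
    using w_nz[of n] by (simp add: y_def norm_scaleC norm_divide)
  have yZ: "y n \<in> Z" for n unfolding y_def using wZ Z.sub by blast
  have yd: "norm (y n - proj V (y n)) < 1 / real (Suc n)" for n
  proof -
    have "y n - proj V (y n) = complex_of_real (1 / norm (w n)) *\<^sub>C (w n - proj V (w n))"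
      by (simp add: y_def V.proj_scaleC scaleC_diff_right)
    also have "norm \<dots> = (1 / norm (w n)) * norm (z n - proj V (z n))"
      unfolding wp using w_nz[of n] by (simp add: norm_scaleC norm_divide)
    also have "\<dots> < (1 / norm (w n)) * (1 / real (Suc n) * norm (w n))"
      using z(2)[of n] w_nz[of n] unfolding w_def[symmetric] by (intro mult_strict_left_mono) auto
    finally show ?thesis using w_nz[of n] by simp
  qed
  have "norm (proj V (y n)) \<le> 1" for n using V.norm_proj_le[of "y n"] ny[of n] by simp
  then obtain r l where r: "strict_mono r" "l \<in> V" "(\<lambda>n. proj V (y (r n))) \<longlonglongrightarrow> l"
    using bounded_seq_compactD[OF fin_dim_bounded_seq_compact[OF V], of "\<lambda>n. proj V (y n)" 1] V.proj_mem by blast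
  have lim0: "(\<lambda>n. y n - proj V (y n)) \<longlonglongrightarrow> 0"
    by (rule Lim_null_comparison[OF always_eventually[OF allI[OF less_imp_le[OF yd]]]])
      (rule LIMSEQ_inverse_real_of_nat[unfolded inverse_eq_divide])
  have "(\<lambda>n. y (r n) - proj V (y (r n))) \<longlonglongrightarrow> 0"
    using LIMSEQ_subseq_LIMSEQ[OF lim0 r(1)] by (simp add: o_def)
  from tendsto_add[OF this r(3)] have yl: "(\<lambda>n. y (r n)) \<longlonglongrightarrow> l" by simp
  then have "l \<in> Z" using closed_sequentially[OF Z.sub(2), of "\<lambda>n. y (r n)"] yZ by blast
  then have lZV: "l \<in> Z \<inter> V" using r(2) by blast
  have wo: "w n \<in> orth_compl (Z \<inter> V)" for n unfolding w_def by (rule ZV.proj_orth)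
  have "y n \<in> orth_compl (Z \<inter> V)" for n
    unfolding y_def by (intro closed_csubspaceD(5)[OF closed_csubspace_orth_compl] wo)
  then have "l \<in> orth_compl (Z \<inter> V)"
    by (intro closed_sequentially[OF closed_csubspaceD(2)[OF closed_csubspace_orth_compl] _ yl]) simp_all
  then have "l = 0" using orth_compl_Int lZV by blast
  moreover have "norm l = 1" using LIMSEQ_unique[OF tendsto_norm[OF yl]] by (simp add: ny)
  ultimately show False by simp
qed

text \<open>By \<open>galois\<close>, coinvariance of Z is \<open>costep Z \<subseteq> Z\<close>, a
  closure condition for a monotone map, and such conditions pass to intersections.\<close>

lemma coinv_Int:
  assumes "inv_sub \<rho> Z" "Z \<subseteq> step Z" "inv_sub \<rho> V" "V \<subseteq> step V"
  shows "Z \<inter> V \<subseteq> step (Z \<inter> V)"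
proof -
  note inv = inv_sub_Int[OF assms(1,3)]
  have le: "costep (Z \<inter> V) \<subseteq> costep X" if "Z \<inter> V \<subseteq> X" for X
    unfolding costep_def pre_def using orth_compl_antimono[OF that] by (intro orth_compl_antimono) blast
  have "costep Z \<subseteq> Z" "costep V \<subseteq> V"
    using galois[OF inv_subD(1)[OF assms(1)] assms(1)] galois[OF inv_subD(1)[OF assms(3)] assms(3)] assms by auto
  then have "costep (Z \<inter> V) \<subseteq> Z \<inter> V" using le[of Z] le[of V] by blast
  then show ?thesis using galois[OF inv_subD(1)[OF inv] inv] by simp
qed

text \<open>The estimate is propagated by the positivity of \<open>I \<otimes> X\<close> on \<open>F \<otimes> Z\<close> for the positive form \<open>X\<close>
  on \<open>Z\<close> expressing it.\<close>

lemma distance_estimate_step: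
  assumes Z: "inv_sub \<rho> Z" "Z \<subseteq> step Z" and U: "inv_sub \<rho> U" and L: "inv_sub \<rho> L" "step L = L"
    and e: "e > 0" and le: "\<And>z. z \<in> Z \<Longrightarrow> e * norm (z - proj L z) \<le> norm (z - proj U z)"
    and z: "z \<in> Z"
  shows "e * norm (z - proj L z) \<le> norm (z - proj (step U) z)"
proof -
  interpret U: closed_sub U by unfold_locales (rule inv_subD(1)[OF U])
  interpret U': closed_sub "step U" by unfold_locales simp
  interpret L: closed_sub L by unfold_locales (rule inv_subD(1)[OF L(1)])
  interpret Z: closed_sub Z by unfold_locales (rule inv_subD(1)[OF Z(1)])
  define B where "B y y' = cinner (y - proj U y) (y' - proj U y')
      - complex_of_real (e\<^sup>2) * cinner (y - proj L y) (y' - proj L y')" for y y'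
  \<comment> \<open>Z with B as inner product; B may be degenerate, which \<open>semi_corr\<close>
    permits. Positivity of \<open>formal_tensor F N\<close> is the desired estimate on finite
    sums.\<close>
  define N :: "('a, complex, 'h) corr" where "N = \<lparr>car = Z, zer = 0, add = (+), ract = (\<lambda>x c. c *\<^sub>C x),
    ip = B, lact = \<rho>\<rparr>"
  have N_sel [simp]: "car N = Z" "zer N = 0" "add N = (+)" "ract N = (\<lambda>x c. c *\<^sub>C x)" "ip N = B" "lact N = \<rho>"
    by (simp_all add: N_def)
  have p0: "proj U 0 = 0" "proj L 0 = 0" using U.proj_scaleC[of 0 0] L.proj_scaleC[of 0 0] by simp_all
  have Badd: "B x (y + y') = B x y + B x y'" for x y y'
    by (simp add: B_def U.proj_add L.proj_add cinner.add_right cinner.diff_right algebra_simps)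
  have Bscale: "B x (c *\<^sub>C y) = c * B x y" for x y c
    unfolding B_def U.proj_scaleC L.proj_scaleC scaleC_diff_right[symmetric] cinner_scaleC_right
    by (simp add: algebra_simps)
  have rU: "\<rho> a y - proj U (\<rho> a y) = \<rho> a (y - proj U y)" for a y
    by (simp add: proj_rho[OF U] rho_diff)
  have rL: "\<rho> a y - proj L (\<rho> a y) = \<rho> a (y - proj L y)" for a y
    by (simp add: proj_rho[OF L(1)] rho_diff)
  have rho_add: "\<rho> (a + b) y = \<rho> a y + \<rho> b y" "\<rho> (c *\<^sub>C a) y = c *\<^sub>C \<rho> a y" for a b c y
    using rho by (simp_all add: algebra_rep_def)
  have "semi_corr N"
  proof
    fix x y y' :: 'h and b :: complex and a a' :: 'a and c :: complex
    show "zer N \<in> car N" using Z.sub by simp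
    assume x: "x \<in> car N"
    show "ract N x b \<in> car N" using x Z.sub by simp
    show "ip N x (zer N) = 0" by (simp add: B_def p0 cinner.zero_right)
    have "B x x = complex_of_real ((norm (x - proj U x))\<^sup>2 - e\<^sup>2 * (norm (x - proj L x))\<^sup>2)"
      by (simp add: B_def cinner_self)
    moreover have "(e * norm (x - proj L x))\<^sup>2 \<le> (norm (x - proj U x))\<^sup>2"
      using le[of x] x e by (intro power_mono) auto
    ultimately show "cpos (ip N x x)" by (simp add: cpos_complex_iff power_mult_distrib)
    show "lact N a x \<in> car N" using x inv_subD(2)[OF Z(1)] by simp
    show "add N x y \<in> car N" if "y \<in> car N" using x that Z.sub by simp
    show "ip N x (ract N y b) = ip N x y * b" by (simp add: Bscale)
    show "star (ip N x y) = ip N y x"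
      using cinner_commute[of "y - proj U y" "x - proj U x"] cinner_commute[of "y - proj L y" "x - proj L x"]
      by (simp add: B_def star_complex_def)
    show "ip N x (add N y y') = ip N x y + ip N x y'" by (simp add: Badd)
    show "ip N (lact N a x) y = ip N x (lact N (star a) y)"
      by (simp add: B_def rU rL cinner_rho)
    show "ip N x (lact N (a + a') y) = ip N x (lact N a y) + ip N x (lact N a' y)"
      by (simp add: rho_add Badd)
    show "ip N x (lact N (c *\<^sub>C a) y) = c *\<^sub>C ip N x (lact N a y)"
      by (simp add: rho_add Bscale scaleC_complex_def)
    show "ip N x (lact N (a * a') y) = ip N x (lact N a (lact N a' y))" by (simp add: rho_mult)
  qed
  then interpret FN: semi_module "formal_tensor F N"
    by (intro semi_module_formal_tensor F.semi_module_axioms)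
  have fin: "e * norm (s - proj L s) \<le> norm (s - proj (step U) s)" if s: "s \<in> cspan (gens Z)" for s
  proof -
    obtain us where us: "set us \<subseteq> car F \<times> Z" "s = (\<Sum>(\<xi>, h)\<leftarrow>us. T \<xi> h)"
      using cspan_gens_list[OF Z.sub(1) s] by blast
    have "set us \<subseteq> car F \<times> Z \<Longrightarrow>
      (\<Sum>(\<xi>, h)\<leftarrow>us. T \<xi> h) - proj L (\<Sum>(\<xi>, h)\<leftarrow>us. T \<xi> h) = (\<Sum>(\<xi>, h)\<leftarrow>us. T \<xi> (h - proj L h)) \<and>
      (\<Sum>(\<xi>, h)\<leftarrow>us. T \<xi> h) - proj (step U) (\<Sum>(\<xi>, h)\<leftarrow>us. T \<xi> h) = (\<Sum>(\<xi>, h)\<leftarrow>us. T \<xi> (h - proj U h))"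
    proof (induction us)
      case (Cons u us)
      obtain \<xi> h where u: "u = (\<xi>, h)" by force
      have \<xi>: "\<xi> \<in> car F" using Cons.prems u by simp
      \<comment> \<open>\<open>step L = L\<close> enters here: the translation leaves L in place, so
        the same e and L recur at every stage.\<close>
      have pL: "proj L (T \<xi> h) = T \<xi> (proj L h)" using proj_step[OF L(1) \<xi>] L(2) by simp
      have pU: "proj (step U) (T \<xi> h) = T \<xi> (proj U h)" by (rule proj_step[OF U \<xi>])
      have IH: "(\<Sum>(\<xi>, h)\<leftarrow>us. T \<xi> h) - proj L (\<Sum>(\<xi>, h)\<leftarrow>us. T \<xi> h) = (\<Sum>(\<xi>, h)\<leftarrow>us. T \<xi> (h - proj L h))"
        "(\<Sum>(\<xi>, h)\<leftarrow>us. T \<xi> h) - proj (step U) (\<Sum>(\<xi>, h)\<leftarrow>us. T \<xi> h) = (\<Sum>(\<xi>, h)\<leftarrow>us. T \<xi> (h - proj U h))"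
        using Cons by simp_all
      show ?case
        by (simp add: u L.proj_add U'.proj_add pL pU T_diff \<xi> algebra_simps flip: IH)
    qed (use p0 U'.proj_scaleC[of 0 0] in simp_all)
    then have sL: "s - proj L s = (\<Sum>(\<xi>, h)\<leftarrow>us. T \<xi> (h - proj L h))"
      and sU: "s - proj (step U) s = (\<Sum>(\<xi>, h)\<leftarrow>us. T \<xi> (h - proj U h))"
      unfolding us(2) using us(1) by blast+
    have nsq: "cinner (\<Sum>(\<xi>, h)\<leftarrow>us. T \<xi> (f h)) (\<Sum>(\<xi>, h)\<leftarrow>us. T \<xi> (f h))
        = (\<Sum>(\<xi>, h)\<leftarrow>us. \<Sum>(\<xi>', h')\<leftarrow>us. cinner (f h) (\<rho> (ip F \<xi> \<xi>') (f h')))" for f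
    proof -
      have l: "cinner (\<Sum>x\<leftarrow>vs. g x) y = (\<Sum>x\<leftarrow>vs. cinner (g x) y)" for vs :: "('x \<times> 'h) list" and g y
        by (induction vs) (auto simp: cinner.add_left cinner.zero_left)
      have r: "cinner y (\<Sum>x\<leftarrow>vs. g x) = (\<Sum>x\<leftarrow>vs. cinner y (g x))" for vs :: "('x \<times> 'h) list" and g y
        by (induction vs) (auto simp: cinner.add_right cinner.zero_right)
      show ?thesis unfolding case_prod_unfold l unfolding r
        using us(1) by (intro arg_cong[where f=sum_list] map_cong refl iso) auto
    qed
    have "us \<in> car (formal_tensor F N)" using us(1) by simp
    then have "cpos (ip (formal_tensor F N) us us)" by (rule FN.ip_pos)
    moreover have "ip (formal_tensor F N) us us
        = (\<Sum>(\<xi>, h)\<leftarrow>us. \<Sum>(\<xi>', h')\<leftarrow>us. cinner (h - proj U h) (\<rho> (ip F \<xi> \<xi>') (h' - proj U h')))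
          - complex_of_real (e\<^sup>2) * (\<Sum>(\<xi>, h)\<leftarrow>us. \<Sum>(\<xi>', h')\<leftarrow>us. cinner (h - proj L h) (\<rho> (ip F \<xi> \<xi>') (h' - proj L h')))"
      unfolding ip_formal_tensor
      by (simp add: B_def rU rL case_prod_unfold sum_list_subtractf sum_list_const_mult)
    ultimately have "0 \<le> (norm (s - proj (step U) s))\<^sup>2 - e\<^sup>2 * (norm (s - proj L s))\<^sup>2"
      unfolding nsq[symmetric] sL[symmetric] sU[symmetric] cinner_self
      by (simp add: cpos_complex_iff flip: of_real_power of_real_mult)
    then have "(e * norm (s - proj L s))\<^sup>2 \<le> (norm (s - proj (step U) s))\<^sup>2"
      by (simp add: power_mult_distrib)
    then show ?thesis by (rule power2_le_imp_le) simp
  qed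
  have cont: "continuous_on UNIV (\<lambda>x. norm (x - proj Y x))" if "closed_csubspace Y" for Y :: "'h set"
  proof -
    interpret Y: closed_sub Y by unfold_locales (rule that)
    have "bounded_linear (proj Y)"
      using Y.norm_proj_le
      by (intro bounded_linear_intro[of _ 1]) (auto simp: Y.proj_add scaleR_scaleC Y.proj_scaleC)
    then show ?thesis by (intro continuous_intros linear_continuous_on)
  qed
  have "closed {s. e * norm (s - proj L s) \<le> norm (s - proj (step U) s)}"
    by (intro closed_Collect_le continuous_intros cont L.closed_csubspace closed_step)
  then have "closure (cspan (gens Z)) \<subseteq> {s. e * norm (s - proj L s) \<le> norm (s - proj (step U) s)}"
    using fin by (intro closure_minimal) auto
  \<comment> \<open>The estimate holds on the span of T(F)Z and is a closed condition; coinvariance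
    places Z in the closure of that span.\<close>
  moreover have "z \<in> closure (cspan (gens Z))" using Z(2) z by (auto simp: step_def closed_cspan_def)
  ultimately show ?thesis by blast
qed

text \<open>The constant e is the same for all translates of V, while the distance from z to the
  r-th translate tends to 0; so z has distance 0 from L.\<close>

theorem coinv_subset_reach:
  assumes V: "fin_dim V" "inv_sub \<rho> V" "V \<subseteq> step V" and Z: "inv_sub \<rho> Z" "Z \<subseteq> step Z"
    and ZV: "Z \<subseteq> reach V"
  shows "Z \<subseteq> reach (Z \<inter> V)"
proof
  fix z assume z: "z \<in> Z"
  define L where "L = reach (Z \<inter> V)"
  note invZV = inv_sub_Int[OF Z(1) V(2)]
  have co: "Z \<inter> V \<subseteq> step (Z \<inter> V)" by (rule coinv_Int[OF Z V(2,3)])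
  have L: "inv_sub \<rho> L" "step L = L" unfolding L_def by (rule inv_sub_reach[OF invZV], rule step_reach[OF co])
  interpret L: closed_sub L by unfold_locales (rule inv_subD(1)[OF L(1)])
  interpret ZV: closed_sub "Z \<inter> V" by unfold_locales (rule inv_subD(1)[OF invZV])
  obtain e where e: "e > 0" "\<And>z. z \<in> Z \<Longrightarrow> e * norm (z - proj (Z \<inter> V) z) \<le> norm (z - proj V z)"
    using distance_bounded_below[OF V(1) inv_subD(1)[OF Z(1)]] by blast
  have est: "e * norm (z - proj L z) \<le> norm (z - proj ((step ^^ r) V) z)" if "z \<in> Z" for r z
    using that
  proof (induction r arbitrary: z)
    case 0
    have "norm (z - proj L z) \<le> norm (z - proj (Z \<inter> V) z)"
      using subset_reach[of "Z \<inter> V"] ZV.proj_mem[of z] by (intro L.norm_diff_proj_le) (auto simp: L_def)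
    then show ?case using e(2)[OF 0] e(1) by (simp add: order.trans[OF mult_left_mono])
  next
    case (Suc r)
    then show ?case
      using distance_estimate_step[OF Z inv_sub_steps[OF V(2), of r] L e(1) Suc.IH Suc.prems] by simp
  qed
  have small: "e * norm (z - proj L z) < d" if d: "d > 0" for d
  proof -
    have "z \<in> closure (\<Union>r. (step ^^ r) V)"
      using z ZV reach_eq_closure[OF V(3) inv_subD(1)[OF V(2)]] by blast
    then obtain x r where x: "x \<in> (step ^^ r) V" "dist x z < d"
      using d unfolding closure_approachable by blast
    interpret U: closed_sub "(step ^^ r) V" by unfold_locales (rule inv_subD(1)[OF inv_sub_steps[OF V(2)]])
    have "norm (z - proj ((step ^^ r) V) z) \<le> norm (z - x)" by (rule U.norm_diff_proj_le[OF x(1)])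
    also have "\<dots> < d" using x(2) by (simp add: dist_norm norm_minus_commute)
    finally show ?thesis using est[OF z, of r] by simp
  qed
  have "e * norm (z - proj L z) = 0"
  proof (rule ccontr)
    assume "e * norm (z - proj L z) \<noteq> 0"
    then have "e * norm (z - proj L z) > 0" using e(1) by simp
    then show False using small by blast
  qed
  then have "z = proj L z" using e(1) by simp
  then show "z \<in> reach (Z \<inter> V)" using L.proj_mem[of z] by (simp add: L_def)
qed

corollary coinv_meets:
  assumes V: "fin_dim V" "inv_sub \<rho> V" "V \<subseteq> step V" and Z: "inv_sub \<rho> Z" "Z \<subseteq> step Z"
    and "Z \<subseteq> reach V" "Z \<noteq> {0}"
  shows "Z \<inter> V \<noteq> {0}"
proof
  assume "Z \<inter> V = {0}"
  then have "Z \<subseteq> reach {0}" using coinv_subset_reach[OF assms(1-6)] by simp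
  moreover have "closed_csubspace {0::'h}" by (simp add: closed_csubspace_def csubspace_iff)
  moreover have "T \<xi> 0 = 0" if "\<xi> \<in> car F" for \<xi> using T_scaleC[OF that, of 0 0] by simp
  ultimately have "Z \<subseteq> {0}" using reach_minimal[of "{0}" "{0}"] step_minimal[of "{0}" "{0}"] by blast
  then show False using assms(7) closed_csubspaceD(3)[OF inv_subD(1)[OF Z(1)]] by blast
qed

end

subsection \<open>Isometric maps on tensor products with a Hilbert space\<close>

lemma (in semi_module) eq_by_ip:
  assumes "hmod M" "x \<in> car M" "y \<in> car M" "\<And>w. w \<in> car M \<Longrightarrow> ip M w x = ip M w y"
  shows "x = y"
proof -
  interpret hmod M by fact
  have "(mdist M x y)\<^sup>2 = norm (ip M x x - ip M x y - (ip M y x - ip M y y))"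
    by (rule mdist_square[OF assms(2,3)])
  then show ?thesis using assms(2-4) separated[OF assms(2,3)] by simp
qed

lemma (in semi_module) ip_msum_msum:
  assumes "set xs \<subseteq> car M" "set ys \<subseteq> car M"
  shows "ip M (msum M xs) (msum M ys) = (\<Sum>x\<leftarrow>xs. \<Sum>y\<leftarrow>ys. ip M x y)"
  unfolding ip_msum_left[OF msum_car[OF assms(2)] assms(1)]
  using assms by (intro arg_cong[where f=sum_list] map_cong refl ip_msum_right) auto

text \<open>G is known to preserve inner products but not to be additive; expanding the square shows
  that the sum of values approximates \<open>G e\<close> exactly as well as the module sum
  approximates e.\<close>

lemma norm_sum_list_ip:
  assumes "semi_module C" and G: "\<And>x y. x \<in> car C \<Longrightarrow> y \<in> car C \<Longrightarrow> cinner (G x) (G y) = ip C x y"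
    and xs: "set xs \<subseteq> car C" and e: "e \<in> car C"
  shows "norm ((\<Sum>x\<leftarrow>xs. G x) - (G e :: 'h::chilbert_space)) = mdist C (msum C xs) e"
proof -
  interpret semi_module C by fact
  have l: "cinner (\<Sum>x\<leftarrow>xs. G x) y = (\<Sum>x\<leftarrow>xs. cinner (G x) y)" for y
    by (induction xs) (auto simp: cinner.add_left cinner.zero_left)
  have r: "cinner y (\<Sum>x\<leftarrow>xs. G x) = (\<Sum>x\<leftarrow>xs. cinner y (G x))" for y
    by (induction xs) (auto simp: cinner.add_right cinner.zero_right)
  note m = msum_car[OF xs]
  have a: "(\<Sum>x\<leftarrow>xs. cinner (G x) (G e)) = ip C (msum C xs) e"
    unfolding ip_msum_left[OF e xs]
    using xs e G by (intro arg_cong[where f=sum_list] map_cong refl) auto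
  have b: "(\<Sum>x\<leftarrow>xs. cinner (G e) (G x)) = ip C e (msum C xs)"
    unfolding ip_msum_right[OF e xs]
    using xs e G by (intro arg_cong[where f=sum_list] map_cong refl) auto
  have c: "(\<Sum>x\<leftarrow>xs. \<Sum>y\<leftarrow>xs. cinner (G x) (G y)) = ip C (msum C xs) (msum C xs)"
    unfolding ip_msum_left[OF m xs]
  proof (intro arg_cong[where f=sum_list] map_cong refl)
    fix x assume x: "x \<in> set xs"
    show "(\<Sum>y\<leftarrow>xs. cinner (G x) (G y)) = ip C x (msum C xs)"
      using x xs by (subst ip_msum_right[OF _ xs]) (auto intro!: arg_cong[where f=sum_list] map_cong G)
  qed
  have "complex_of_real ((norm ((\<Sum>x\<leftarrow>xs. G x) - G e))\<^sup>2)
      = cinner ((\<Sum>x\<leftarrow>xs. G x) - G e) ((\<Sum>x\<leftarrow>xs. G x) - G e)"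
    by (simp only: cinner_self)
  also have "\<dots> = ip C (msum C xs) (msum C xs) - ip C (msum C xs) e - (ip C e (msum C xs) - ip C e e)"
    unfolding cinner.diff_left cinner.diff_right l unfolding r a b c by (simp add: G e)
  finally have "cmod (complex_of_real ((norm ((\<Sum>x\<leftarrow>xs. G x) - G e))\<^sup>2)) = (mdist C (msum C xs) e)\<^sup>2"
    using mdist_square[OF m e] by simp
  then have "(norm ((\<Sum>x\<leftarrow>xs. G x) - G e))\<^sup>2 = (mdist C (msum C xs) e)\<^sup>2" by (simp add: norm_power)
  then show ?thesis by (simp add: power2_eq_iff_nonneg)
qed

context star_rep
begin

abbreviation hs :: "('a, complex, 'h) corr" where "hs \<equiv> hs_corr UNIV \<rho>"

sublocale hs: semi_corr "hs_corr UNIV \<rho>"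
  by (intro semi_corr_hs_corr rho) simp

lemma hmod_hs: "hmod hs"
  by (intro hmod_hs_corr) simp

lemma norm_cinner_rho_le: "cmod (cinner h (\<rho> a k)) \<le> norm a * (norm h * norm k)"
  using hs.norm_ip_lact_le[of h k a] by simp

lemma tendsto_cinner_rho:
  assumes "(u \<longlongrightarrow> a) A"
  shows "((\<lambda>n. cinner h (\<rho> (u n) k)) \<longlongrightarrow> cinner h (\<rho> a k)) A"
proof -
  have "bounded_linear (\<lambda>a. cinner h (\<rho> a k))"
  proof (rule bounded_linear_intro)
    show "cinner h (\<rho> (a + b) k) = cinner h (\<rho> a k) + cinner h (\<rho> b k)" for a b
      using hs.ip_lact_add[of h k a b] by simp
    show "cinner h (\<rho> (r *\<^sub>R a) k) = r *\<^sub>R cinner h (\<rho> a k)" for r a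
      using hs.ip_lact_scaleR[of h k r a] by simp
    show "norm (cinner h (\<rho> a k)) \<le> norm a * (norm h * norm k)" for a by (rule norm_cinner_rho_le)
  qed
  then show ?thesis using assms by (rule bounded_linear.tendsto)
qed

definition ip_map :: "('a, 'a, 'y) corr \<Rightarrow> (('y, 'h) tens \<Rightarrow> 'h) \<Rightarrow> bool"
  where "ip_map M \<tau> \<longleftrightarrow> (\<forall>c\<in>car (M \<otimes>\<^sub>m hs). \<forall>d\<in>car (M \<otimes>\<^sub>m hs). cinner (\<tau> c) (\<tau> d) = ip (M \<otimes>\<^sub>m hs) c d)"

lemma ip_map_elem:
  assumes "semi_corr M" "ip_map M \<tau>" "x \<in> car M" "y \<in> car M"
  shows "cinner (\<tau> (elem_tensor M hs x h)) (\<tau> (elem_tensor M hs y k)) = cinner h (\<rho> (ip M x y) k)"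
proof -
  interpret M: semi_corr M by fact
  have F: "semi_module (formal_tensor M hs)"
    by (intro semi_module_formal_tensor M.semi_module_axioms hs.semi_corr_axioms)
  show ?thesis using assms(2-4) tensor_compl_facts(1,2)[OF F] by (simp add: ip_map_def)
qed

lemma ip_map_tendsto:
  assumes M: "semi_corr M" and \<tau>: "ip_map M \<tau>" and c: "c \<in> car (M \<otimes>\<^sub>m hs)" "u \<in> c"
  shows "(\<lambda>n. \<Sum>(x, h)\<leftarrow>u n. \<tau> (elem_tensor M hs x h)) \<longlonglongrightarrow> \<tau> c"
proof -
  interpret M: semi_corr M by fact
  interpret F: semi_module "formal_tensor M hs"
    by (intro semi_module_formal_tensor M.semi_module_axioms hs.semi_corr_axioms)
  interpret C: hmod "M \<otimes>\<^sub>m hs" by (intro hmod_tensor M.semi_module_axioms hs.semi_corr_axioms)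
  have u: "u \<in> cauchy_seqs (formal_tensor M hs)" "c = cls (formal_tensor M hs) u"
    using F.mem_compl c unfolding tensor_def by blast+
  have xs: "set (map (\<lambda>(x, h). elem_tensor M hs x h) (u n)) \<subseteq> car (M \<otimes>\<^sub>m hs)" for n
  proof -
    have "set (u n) \<subseteq> car M \<times> car hs" using F.cauchy_range[OF u(1)] by (auto simp: image_subset_iff)
    then show ?thesis using tensor_compl_facts(1)[OF F.semi_module_axioms] by auto
  qed
  have "norm ((\<Sum>(x, h)\<leftarrow>u n. \<tau> (elem_tensor M hs x h)) - \<tau> c)
      = mdist (M \<otimes>\<^sub>m hs) (msum (M \<otimes>\<^sub>m hs) (map (\<lambda>(x, h). elem_tensor M hs x h) (u n))) c" for n
    using norm_sum_list_ip[OF C.semi_module_axioms _ xs[of n] c(1), of \<tau>] \<tau>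
    by (simp add: ip_map_def o_def case_prod_unfold)
  then have "(\<lambda>n. norm ((\<Sum>(x, h)\<leftarrow>u n. \<tau> (elem_tensor M hs x h)) - \<tau> c)) \<longlonglongrightarrow> 0"
    using tensor_compl_facts(3)[OF F.semi_module_axioms u(1)] u(2) by simp
  then show ?thesis by (simp add: tendsto_norm_zero_iff LIM_zero_iff)
qed

lemma ip_map_lact:
  assumes M: "semi_corr M" and \<tau>: "ip_map M \<tau>"
    and t: "\<And>x h a. x \<in> car M \<Longrightarrow> \<tau> (elem_tensor M hs (lact M a x) h) = \<rho> a (\<tau> (elem_tensor M hs x h))"
    and c: "c \<in> car (M \<otimes>\<^sub>m hs)"
  shows "\<tau> (lact (M \<otimes>\<^sub>m hs) a c) = \<rho> a (\<tau> c)"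
proof -
  interpret M: semi_corr M by fact
  interpret F: semi_corr "formal_tensor M hs"
    by (intro semi_corr_formal_tensor M hs.semi_corr_axioms)
  obtain u where u: "u \<in> cauchy_seqs (formal_tensor M hs)" "c = cls (formal_tensor M hs) u"
    using c F.compl_cases unfolding tensor_def by metis
  have uc: "u \<in> c" using u F.cls_self by simp
  have lc: "lact (M \<otimes>\<^sub>m hs) a c = cls (formal_tensor M hs) (\<lambda>n. lact (formal_tensor M hs) a (u n))"
    unfolding u(2) tensor_def by (rule F.lact_compl[OF u(1)])
  have lcar: "lact (M \<otimes>\<^sub>m hs) a c \<in> car (M \<otimes>\<^sub>m hs)"
    using semi_corr.lact_car[OF F.semi_corr_compl] c unfolding tensor_def by blast
  have "(\<lambda>n. lact (formal_tensor M hs) a (u n)) \<in> lact (M \<otimes>\<^sub>m hs) a c"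
    unfolding lc by (intro F.cls_self F.cauchy_lact u)
  from ip_map_tendsto[OF M \<tau> lcar this]
  have "(\<lambda>n. \<Sum>(x, h)\<leftarrow>u n. \<tau> (elem_tensor M hs (lact M a x) h)) \<longlonglongrightarrow> \<tau> (lact (M \<otimes>\<^sub>m hs) a c)"
    by (simp add: o_def case_prod_unfold)
  moreover have "(\<Sum>(x, h)\<leftarrow>u n. \<tau> (elem_tensor M hs (lact M a x) h))
      = \<rho> a (\<Sum>(x, h)\<leftarrow>u n. \<tau> (elem_tensor M hs x h))" for n
  proof -
    have "set us \<subseteq> car M \<times> UNIV \<Longrightarrow> (\<Sum>(x, h)\<leftarrow>us. \<tau> (elem_tensor M hs (lact M a x) h))
      = \<rho> a (\<Sum>(x, h)\<leftarrow>us. \<tau> (elem_tensor M hs x h))" for us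
      using rho_lin(2)[of a 0 0] by (induction us) (auto simp: t rho_lin)
    moreover have "set (u n) \<subseteq> car M \<times> UNIV"
      using F.cauchy_range[OF u(1)] by (auto simp: image_subset_iff)
    ultimately show ?thesis by blast
  qed
  moreover have "(\<lambda>n. \<rho> a (\<Sum>(x, h)\<leftarrow>u n. \<tau> (elem_tensor M hs x h))) \<longlonglongrightarrow> \<rho> a (\<tau> c)"
    by (intro bounded_linear.tendsto[OF bounded_op_UNIV_bounded_linear[OF rho_bounded]]
        ip_map_tendsto M \<tau> c uc)
  ultimately show ?thesis using LIMSEQ_unique by simp
qed

end

text \<open>The composite \<open>s \<circ> (I \<otimes> \<tau>) \<circ> assoc\<close> occurring in the definition of \<open>tilde_word\<close> and in the
  commutation relation.\<close>

locale assoc_step = star_rep \<rho> + M1: iso_action \<rho> M1 s + M2: semi_corr M2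
  for \<rho> :: "'a::unital_cstar_algebra \<Rightarrow> 'h \<Rightarrow> 'h::chilbert_space"
    and M1 :: "('a, 'a, 'x) corr" and s and M2 :: "('a, 'a, 'y) corr" +
  fixes \<tau> :: "('y, 'h) tens \<Rightarrow> 'h"
  assumes ip_map: "ip_map M2 \<tau>"
    and elem_lact: "\<And>x h a. x \<in> car M2 \<Longrightarrow>
      \<tau> (elem_tensor M2 hs (lact M2 a x) h) = \<rho> a (\<tau> (elem_tensor M2 hs x h))"
begin

abbreviation K where "K \<equiv> M2 \<otimes>\<^sub>m hs"
abbreviation Q where "Q \<equiv> M1 \<otimes>\<^sub>m M2"

lemma K: "semi_corr K"
  by (intro semi_corr_tensor M2.semi_corr_axioms hs.semi_corr_axioms)

lemma Q: "semi_corr Q"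
  by (intro semi_corr_tensor M2.semi_corr_axioms M1.F.semi_corr_axioms)

lemma fQ: "semi_module (formal_tensor M1 M2)"
  by (intro semi_module_formal_tensor M1.F.semi_module_axioms M2.semi_corr_axioms)

lemma fK: "semi_module (formal_tensor M2 hs)"
  by (intro semi_module_formal_tensor M2.semi_module_axioms hs.semi_corr_axioms)

lemma fM1K: "semi_module (formal_tensor M1 K)"
  by (intro semi_module_formal_tensor M1.F.semi_module_axioms K)

lemma hM1K: "hmod (M1 \<otimes>\<^sub>m K)"
  by (intro hmod_tensor M1.F.semi_module_axioms K)

lemma elem_K: "y \<in> car M2 \<Longrightarrow> elem_tensor M2 hs y h \<in> car K"
  using tensor_compl_facts(1)[OF fK] by simp

lemma elem_K_lact: 
  assumes "d \<in> car K" "y \<in> car M2"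
  shows "ip K d (lact K a (elem_tensor M2 hs y h)) = ip K d (elem_tensor M2 hs (lact M2 a y) h)"
proof -
  interpret FK: semi_corr "formal_tensor M2 hs"
    by (intro semi_corr_formal_tensor M2.semi_corr_axioms hs.semi_corr_axioms)
  have "lact K a (elem_tensor M2 hs y h) = elem_tensor M2 hs (lact M2 a y) h"
    unfolding tensor_def elem_tensor_def using assms(2)
    by (subst FK.lact_compl) (auto intro!: FK.const_cauchy)
  then show ?thesis by simp
qed

lemma iso_inner:
  assumes "x \<in> car M1" "y \<in> car M2" "x' \<in> car M1" "y' \<in> car M2"
  shows "ip (M1 \<otimes>\<^sub>m K) (elem_tensor M1 K x (elem_tensor M2 hs y h)) (elem_tensor M1 K x' (elem_tensor M2 hs y' k))
    = cinner h (\<rho> (ip M2 y (lact M2 (ip M1 x x') y')) k)"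
  using assms tensor_compl_facts(2)[OF fM1K] tensor_compl_facts(2)[OF fK]
  by (simp add: elem_K elem_K_lact)

lemma ip_inner_msum:
  assumes us: "us \<in> car (formal_tensor M1 M2)" and vs: "vs \<in> car (formal_tensor M1 M2)"
  shows "ip (M1 \<otimes>\<^sub>m K)
      (msum (M1 \<otimes>\<^sub>m K) (map (\<lambda>(x, y). elem_tensor M1 K x (elem_tensor M2 hs y h)) us))
      (msum (M1 \<otimes>\<^sub>m K) (map (\<lambda>(x, y). elem_tensor M1 K x (elem_tensor M2 hs y k)) vs))
    = cinner h (\<rho> (ip (formal_tensor M1 M2) us vs) k)"
proof -
  interpret C: hmod "M1 \<otimes>\<^sub>m K" by (rule hM1K)
  have car: "set (map (\<lambda>(x, y). elem_tensor M1 K x (elem_tensor M2 hs y h)) us) \<subseteq> car (M1 \<otimes>\<^sub>m K)"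
    if "us \<in> car (formal_tensor M1 M2)" for us h
    using that tensor_compl_facts(1)[OF fM1K] elem_K by auto
  have rsum: "cinner h (\<rho> (\<Sum>x\<leftarrow>xs. f x) k) = (\<Sum>x\<leftarrow>xs. cinner h (\<rho> (f x) k))" for xs :: "('x \<times> 'y) list" and f
    using hs.ip_lact_zero[of h k] by (induction xs) (auto simp: hs.ip_lact_add[simplified])
  have "ip (M1 \<otimes>\<^sub>m K)
      (msum (M1 \<otimes>\<^sub>m K) (map (\<lambda>(x, y). elem_tensor M1 K x (elem_tensor M2 hs y h)) us))
      (msum (M1 \<otimes>\<^sub>m K) (map (\<lambda>(x, y). elem_tensor M1 K x (elem_tensor M2 hs y k)) vs))
    = (\<Sum>p\<leftarrow>us. \<Sum>q\<leftarrow>vs. ip (M1 \<otimes>\<^sub>m K) (elem_tensor M1 K (fst p) (elem_tensor M2 hs (snd p) h))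
        (elem_tensor M1 K (fst q) (elem_tensor M2 hs (snd q) k)))"
    by (subst C.ip_msum_msum[OF car[OF us] car[OF vs]]) (simp add: o_def case_prod_unfold)
  also have "\<dots> = (\<Sum>p\<leftarrow>us. \<Sum>q\<leftarrow>vs. cinner h (\<rho> (ip M2 (snd p) (lact M2 (ip M1 (fst p) (fst q)) (snd q))) k))"
    using us vs by (intro arg_cong[where f=sum_list] map_cong refl iso_inner) auto
  also have "\<dots> = cinner h (\<rho> (ip (formal_tensor M1 M2) us vs) k)"
    by (simp add: ip_formal_tensor case_prod_unfold rsum)
  finally show ?thesis .
qed

text \<open>The inner of the two nested lifts in \<open>assoc\<close>, for fixed h: it sends x
  \<otimes> y to x \<otimes> (y \<otimes> h).\<close>

definition inner_lift where
  "inner_lift c h = lift (M1 \<otimes>\<^sub>m K) (\<lambda>x y. elem_tensor M1 K x (elem_tensor M2 hs y h)) c"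

text \<open>For fixed h the map need not be isometric: its inner products are those of M1 \<otimes>
  M2 under the functional a \<mapsto> \<open>cinner h (\<rho> a h)\<close>, which is bounded by the
  square of \<open>norm h\<close>. Hence the constant \<open>norm h\<close>; isometry returns in
  \<open>iso_assoc\<close>, where h is a variable.\<close>

lemma tensor_lift_inner:
  "tensor_lift M1 M2 (M1 \<otimes>\<^sub>m K) (\<lambda>x y. elem_tensor M1 K x (elem_tensor M2 hs y h)) (norm h)"
proof -
  interpret C: hmod "M1 \<otimes>\<^sub>m K" by (rule hM1K)
  interpret F: semi_module "formal_tensor M1 M2" by (rule fQ)
  show ?thesis
  proof (intro tensor_lift.intro tensor_lift_axioms.intro fQ hM1K)
    show "elem_tensor M1 K x (elem_tensor M2 hs y h) \<in> car (M1 \<otimes>\<^sub>m K)" if "x \<in> car M1" "y \<in> car M2" for x y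
      using that tensor_compl_facts(1)[OF fM1K] elem_K by simp
    fix us vs assume us: "us \<in> car (formal_tensor M1 M2)" and vs: "vs \<in> car (formal_tensor M1 M2)"
    let ?m = "\<lambda>us. msum (M1 \<otimes>\<^sub>m K) (map (\<lambda>(x, y). elem_tensor M1 K x (elem_tensor M2 hs y h)) us)"
    have m: "?m us \<in> car (M1 \<otimes>\<^sub>m K)" if "us \<in> car (formal_tensor M1 M2)" for us
      using that tensor_compl_facts(1)[OF fM1K] elem_K by (intro C.msum_car) auto
    show "mdist (M1 \<otimes>\<^sub>m K) (?m us) (?m vs) \<le> norm h * mdist (formal_tensor M1 M2) us vs"
    proof (rule power2_le_imp_le)
      let ?i = "ip (formal_tensor M1 M2)"
      have "(mdist (M1 \<otimes>\<^sub>m K) (?m us) (?m vs))\<^sup>2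
          = cmod (cinner h (\<rho> (?i us us - ?i us vs - (?i vs us - ?i vs vs)) h))"
        unfolding C.mdist_square[OF m[OF us] m[OF vs]] ip_inner_msum[OF us us] ip_inner_msum[OF us vs]
          ip_inner_msum[OF vs us] ip_inner_msum[OF vs vs]
        using hs.ip_lact_diff[of h h] by simp
      also have "\<dots> \<le> norm (?i us us - ?i us vs - (?i vs us - ?i vs vs)) * (norm h * norm h)"
        by (rule norm_cinner_rho_le)
      also have "\<dots> = (norm h * mdist (formal_tensor M1 M2) us vs)\<^sup>2"
        unfolding power_mult_distrib F.mdist_square[OF us vs] by (simp add: power2_eq_square)
      finally show "(mdist (M1 \<otimes>\<^sub>m K) (?m us) (?m vs))\<^sup>2 \<le> (norm h * mdist (formal_tensor M1 M2) us vs)\<^sup>2" .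
    qed (simp add: F.mdist_nonneg)
  qed
qed

lemma ip_inner_lift:
  assumes "c \<in> car Q" "d \<in> car Q"
  shows "ip (M1 \<otimes>\<^sub>m K) (inner_lift c h) (inner_lift d k) = cinner h (\<rho> (ip Q c d) k)"
proof -
  interpret C: hmod "M1 \<otimes>\<^sub>m K" by (rule hM1K)
  interpret F: semi_module "formal_tensor M1 M2" by (rule fQ)
  interpret lh: tensor_lift M1 M2 "M1 \<otimes>\<^sub>m K" "\<lambda>x y. elem_tensor M1 K x (elem_tensor M2 hs y h)" "norm h"
    by (rule tensor_lift_inner)
  interpret lk: tensor_lift M1 M2 "M1 \<otimes>\<^sub>m K" "\<lambda>x y. elem_tensor M1 K x (elem_tensor M2 hs y k)" "norm k"
    by (rule tensor_lift_inner)
  obtain u v where u: "u \<in> c" and v: "v \<in> d" using lh.tensor_nonempty assms by meson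
  have r: "range (\<lambda>n. lh.fsum (u n)) \<subseteq> car (M1 \<otimes>\<^sub>m K)" "range (\<lambda>n. lk.fsum (v n)) \<subseteq> car (M1 \<otimes>\<^sub>m K)"
    using lh.fsum_car[OF lh.tensor_rep_car[OF assms(1) u]] lk.fsum_car[OF lk.tensor_rep_car[OF assms(2) v]] by blast+
  have 1: "(\<lambda>n. ip (M1 \<otimes>\<^sub>m K) (lh.fsum (u n)) (lk.fsum (v n))) \<longlonglongrightarrow> ip (M1 \<otimes>\<^sub>m K) (inner_lift c h) (inner_lift d k)"
    unfolding inner_lift_def
    by (intro C.tendsto_ip r lh.lift_spec[OF assms(1)] lk.lift_spec[OF assms(2)] u v)
  have 2: "ip (M1 \<otimes>\<^sub>m K) (lh.fsum (u n)) (lk.fsum (v n))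
      = cinner h (\<rho> (ip (formal_tensor M1 M2) (u n) (v n)) k)" for n
    by (intro ip_inner_msum lh.tensor_rep_car[OF assms(1) u] lh.tensor_rep_car[OF assms(2) v])
  have "(\<lambda>n. ip (formal_tensor M1 M2) (u n) (v n)) \<longlonglongrightarrow> ip Q c d"
    using F.ip_compl_tendsto[OF F.mem_compl(1) F.mem_compl(1), of c u d v]
      F.mem_compl(2)[of c u] F.mem_compl(2)[of d v] assms u v unfolding tensor_def by simp
  then have "(\<lambda>n. cinner h (\<rho> (ip (formal_tensor M1 M2) (u n) (v n)) k)) \<longlonglongrightarrow> cinner h (\<rho> (ip Q c d) k)"
    by (rule tendsto_cinner_rho)
  then show ?thesis by (rule LIMSEQ_unique[OF 1[unfolded 2]])
qed

lemma iso_assoc: "iso_lift Q hs (M1 \<otimes>\<^sub>m K) inner_lift"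
proof (intro iso_lift.intro iso_lift_axioms.intro hM1K)
  interpret Q: semi_corr Q by (rule Q)
  show "semi_module (formal_tensor Q hs)"
    by (intro semi_module_formal_tensor Q.semi_module_axioms hs.semi_corr_axioms)
  show "inner_lift c h \<in> car (M1 \<otimes>\<^sub>m K)" if "c \<in> car Q" for c h
    unfolding inner_lift_def by (rule tensor_lift.lift_spec(1)[OF tensor_lift_inner that])
qed (simp add: ip_inner_lift)

lemma assoc_eq: "assoc M1 M2 hs = lift (M1 \<otimes>\<^sub>m K) inner_lift"
  unfolding assoc_def inner_lift_def ..

lemma iso_tensor_map: "iso_lift M1 K (M1 \<otimes>\<^sub>m hs) (\<lambda>x d. elem_tensor M1 hs x (\<tau> d))"
proof -
  have F: "semi_module (formal_tensor M1 hs)"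
    by (intro semi_module_formal_tensor M1.F.semi_module_axioms hs.semi_corr_axioms)
  interpret K: semi_corr K by (rule K)
  show ?thesis
  proof (intro iso_lift.intro iso_lift_axioms.intro fM1K)
    show "hmod (M1 \<otimes>\<^sub>m hs)" by (intro hmod_tensor M1.F.semi_module_axioms hs.semi_corr_axioms)
    show "elem_tensor M1 hs x (\<tau> d) \<in> car (M1 \<otimes>\<^sub>m hs)" if "x \<in> car M1" for x d
      using tensor_compl_facts(1)[OF F that] by simp
    fix x d x' d' assume a: "x \<in> car M1" "d \<in> car K" "x' \<in> car M1" "d' \<in> car K"
    have "ip (M1 \<otimes>\<^sub>m hs) (elem_tensor M1 hs x (\<tau> d)) (elem_tensor M1 hs x' (\<tau> d'))
        = cinner (\<tau> d) (\<rho> (ip M1 x x') (\<tau> d'))"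
      using tensor_compl_facts(2)[OF F] a by simp
    also have "\<dots> = cinner (\<tau> d) (\<tau> (lact K (ip M1 x x') d'))"
      using ip_map_lact[OF M2.semi_corr_axioms ip_map elem_lact a(4)] by simp
    also have "\<dots> = ip K d (lact K (ip M1 x x') d')"
      using ip_map a K.lact_car unfolding ip_map_def by blast
    finally show "ip (M1 \<otimes>\<^sub>m hs) (elem_tensor M1 hs x (\<tau> d)) (elem_tensor M1 hs x' (\<tau> d'))
        = ip K d (lact K (ip M1 x x') d')" .
  qed
qed

lemma iso_tilde: "iso_lift M1 hs hs s"
  by (intro iso_lift.intro iso_lift_axioms.intro semi_module_formal_tensor M1.F.semi_module_axioms
      hs.semi_corr_axioms hmod_hs) (simp_all add: M1.iso)

definition comp where
  "comp w = tilde UNIV s \<rho> (tensor_map M1 hs id \<tau> (assoc M1 M2 hs w))"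

lemma comp_eq: "comp w = lift hs s (lift (M1 \<otimes>\<^sub>m hs) (\<lambda>x d. elem_tensor M1 hs x (\<tau> d)) (lift (M1 \<otimes>\<^sub>m K) inner_lift w))"
  by (simp add: comp_def tilde_def tensor_map_def assoc_eq)

lemma ip_comp:
  assumes "w \<in> car (Q \<otimes>\<^sub>m hs)" "w' \<in> car (Q \<otimes>\<^sub>m hs)"
  shows "cinner (comp w) (comp w') = ip (Q \<otimes>\<^sub>m hs) w w'"
proof -
  interpret a: iso_lift Q hs "M1 \<otimes>\<^sub>m K" inner_lift by (rule iso_assoc)
  interpret b: iso_lift M1 K "M1 \<otimes>\<^sub>m hs" "\<lambda>x d. elem_tensor M1 hs x (\<tau> d)" by (rule iso_tensor_map)
  interpret c: iso_lift M1 hs hs s by (rule iso_tilde)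
  show ?thesis
    unfolding comp_eq using assms c.ip_lift b.ip_lift a.ip_lift
    by (simp add: a.lift_spec(1) b.lift_spec(1))
qed

text \<open>The working formula for the composite: on an element of M1 \<otimes> M2 represented by
  sums of x \<otimes> y it is the limit of the sums of \<open>s x\<close> applied to \<tau>(y
  \<otimes> h). Inclusions between translates are read off from such limits.\<close>

lemma comp_tendsto:
  assumes c: "c \<in> car Q" "u \<in> c"
  shows "(\<lambda>n. \<Sum>(x, y)\<leftarrow>u n. s x (\<tau> (elem_tensor M2 hs y h))) \<longlonglongrightarrow> comp (elem_tensor Q hs c h)"
proof -
  interpret a: iso_lift Q hs "M1 \<otimes>\<^sub>m K" inner_lift by (rule iso_assoc)
  interpret b: iso_lift M1 K "M1 \<otimes>\<^sub>m hs" "\<lambda>x d. elem_tensor M1 hs x (\<tau> d)" by (rule iso_tensor_map)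
  interpret c: iso_lift M1 hs hs s by (rule iso_tilde)
  interpret l: tensor_lift M1 M2 "M1 \<otimes>\<^sub>m K" "\<lambda>x y. elem_tensor M1 K x (elem_tensor M2 hs y h)" "norm h"
    by (rule tensor_lift_inner)
  define G where "G e = lift hs s (lift (M1 \<otimes>\<^sub>m hs) (\<lambda>x d. elem_tensor M1 hs x (\<tau> d)) e)" for e
  have G: "cinner (G e) (G e') = ip (M1 \<otimes>\<^sub>m K) e e'"
    if "e \<in> car (M1 \<otimes>\<^sub>m K)" "e' \<in> car (M1 \<otimes>\<^sub>m K)" for e e'
    unfolding G_def using that c.ip_lift b.ip_lift by (simp add: b.lift_spec(1))
  have Gel: "G (elem_tensor M1 K x (elem_tensor M2 hs y h)) = s x (\<tau> (elem_tensor M2 hs y h))"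
    if "x \<in> car M1" "y \<in> car M2" for x y
    unfolding G_def using that b.lift_elem[OF that(1) elem_K[OF that(2)]] c.lift_elem by simp
  have e: "inner_lift c h \<in> car (M1 \<otimes>\<^sub>m K)" unfolding inner_lift_def by (rule l.lift_spec(1)[OF c(1)])
  have comp: "comp (elem_tensor Q hs c h) = G (inner_lift c h)"
    unfolding comp_eq G_def using a.lift_elem[OF c(1), of h] by simp
  have "norm ((\<Sum>(x, y)\<leftarrow>u n. s x (\<tau> (elem_tensor M2 hs y h))) - G (inner_lift c h))
      = mdist (M1 \<otimes>\<^sub>m K) (l.fsum (u n)) (inner_lift c h)" for n
  proof -
    have un: "u n \<in> car (formal_tensor M1 M2)" by (rule l.tensor_rep_car[OF c])
    have "(\<Sum>(x, y)\<leftarrow>u n. s x (\<tau> (elem_tensor M2 hs y h)))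
        = (\<Sum>x\<leftarrow>map (\<lambda>(x, y). elem_tensor M1 K x (elem_tensor M2 hs y h)) (u n). G x)"
      using un Gel by (auto intro!: arg_cong[where f=sum_list] map_cong simp: o_def case_prod_unfold)
    then show ?thesis
      using norm_sum_list_ip[OF hmod.axioms(1)[OF hM1K] G l.fmap_car[OF un] e] by simp
  qed
  then have "(\<lambda>n. norm ((\<Sum>(x, y)\<leftarrow>u n. s x (\<tau> (elem_tensor M2 hs y h))) - G (inner_lift c h))) \<longlonglongrightarrow> 0"
    using l.lift_spec(2)[OF c] unfolding inner_lift_def by simp
  then show ?thesis unfolding comp by (simp add: tendsto_norm_zero_iff LIM_zero_iff)
qed

end

subsection \<open>Coinvariant and cyclic subspaces of operator algebras\<close>

context closed_sub
begin

lemma bounded_op_proj: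
  assumes "bounded_op X T" shows "bounded_op UNIV (T \<circ> proj X)"
proof -
  obtain K where K: "\<forall>x\<in>X. norm (T x) \<le> K * norm x" using assms by (auto simp: bounded_op_def)
  have "norm (T (proj X x)) \<le> \<bar>K\<bar> * norm x" for x
  proof -
    have "norm (T (proj X x)) \<le> K * norm (proj X x)" using K by simp
    also have "\<dots> \<le> \<bar>K\<bar> * norm x" by (intro mult_mono norm_proj_le) auto
    finally show ?thesis .
  qed
  then show ?thesis using assms by (auto simp: bounded_op_def proj_add proj_scaleC)
qed

lemma closed_cspan_image_on:
  assumes T: "bounded_op X T" and S: "S \<subseteq> X" and Y: "\<And>x. x \<in> S \<Longrightarrow> T x \<in> Y" "closed_csubspace Y"
    and x: "x \<in> closed_cspan S"
  shows "T x \<in> Y"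
proof -
  have "(T \<circ> proj X) x \<in> Y"
    using S Y(1) by (intro closed_cspan_image[OF bounded_op_proj[OF T] _ Y(2) x]) (auto simp: proj_id subset_iff)
  moreover have "x \<in> X" using x closed_cspan_minimal[OF S closed_csubspace] by blast
  ultimately show ?thesis by (simp add: proj_id)
qed

lemma mem_iff_orth:
  assumes "x \<in> Y" "X \<subseteq> Y" "closed_csubspace Y"
  shows "x \<in> X \<longleftrightarrow> (\<forall>u\<in>Y \<inter> orth_compl X. cinner u x = 0)"
proof
  assume R: "\<forall>u\<in>Y \<inter> orth_compl X. cinner u x = 0"
  let ?u = "x - proj X x"
  have "?u \<in> Y \<inter> orth_compl X"
    using closed_csubspaceD(6)[OF assms(3,1) subsetD[OF assms(2) proj_mem]] proj_orth by blast
  then have "cinner ?u x = 0" "cinner ?u (proj X x) = 0" using R orth_complD(2)[OF proj_orth proj_mem] by blast+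
  then have "cinner ?u ?u = 0" by (simp add: cinner.diff_right)
  then show "x \<in> X" using proj_mem[of x] by simp
qed (use orth_complD(2) in blast)

lemma adj_on_image_iff:
  assumes T: "bounded_op X T" and Y: "closed_csubspace Y" "Y \<subseteq> X"
  shows "adj_on X T ` Y \<subseteq> Y \<longleftrightarrow> (\<forall>x\<in>X \<inter> orth_compl Y. T x \<in> orth_compl Y)"
proof -
  interpret Y: closed_sub Y by unfold_locales (rule Y)
  have "adj_on X T y \<in> Y \<longleftrightarrow> (\<forall>x\<in>X \<inter> orth_compl Y. cinner y (T x) = 0)" for y
    unfolding Y.mem_iff_orth[OF adj_on(1)[OF closed_csubspace T] Y(2) closed_csubspace]
    using adj_on(2)[OF closed_csubspace T] cinner_zero_commute by (metis IntD1)
  then show ?thesis by (auto simp: orth_compl_def)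
qed

lemma bounded_op_gen_alg:
  assumes "\<And>T. T \<in> G \<Longrightarrow> bounded_op X T" and "T \<in> gen_alg G"
  shows "bounded_op X T"
  using assms(2)
proof (induction rule: gen_alg.induct)
  case gen_id
  show ?case by (auto simp: bounded_op_def intro!: exI[of _ 1])
next
  case (gen_add S T)
  obtain K L where KL: "\<forall>x\<in>X. norm (S x) \<le> K * norm x" "\<forall>x\<in>X. norm (T x) \<le> L * norm x"
    using gen_add.IH by (auto simp: bounded_op_def)
  have "norm (S x + T x) \<le> (K + L) * norm x" if "x \<in> X" for x
    using KL that norm_triangle_ineq[of "S x" "T x"] by (fastforce simp: distrib_right)
  then show ?case using gen_add.IH by (auto simp: bounded_op_def sub scaleC_add_right)
next
  case (gen_scaleC T c)
  obtain L where L: "\<forall>x\<in>X. norm (T x) \<le> L * norm x"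
    using gen_scaleC.IH by (auto simp: bounded_op_def)
  have "\<exists>K. \<forall>x\<in>X. norm (c *\<^sub>C T x) \<le> K * norm x"
    using L by (intro exI[of _ "cmod c * L"]) (simp add: norm_scaleC mult.assoc mult_left_mono)
  then show ?case using gen_scaleC.IH
    by (simp add: bounded_op_def sub scaleC_add_right scaleC_scaleC mult.commute)
next
  case (gen_comp S T)
  obtain K L where KL: "\<forall>x\<in>X. norm (S x) \<le> K * norm x" "\<forall>x\<in>X. norm (T x) \<le> L * norm x"
    using gen_comp.IH by (auto simp: bounded_op_def)
  have "norm (S (T x)) \<le> (\<bar>K\<bar> * L) * norm x" if x: "x \<in> X" for x
  proof -
    have "T x \<in> X" using gen_comp.IH x by (auto simp: bounded_op_def)
    then have "norm (S (T x)) \<le> K * norm (T x)" using KL by blast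
    also have "\<dots> \<le> \<bar>K\<bar> * norm (T x)" by (intro mult_right_mono) auto
    also have "\<dots> \<le> \<bar>K\<bar> * (L * norm x)" using KL x by (intro mult_left_mono) auto
    finally show ?thesis by (simp add: mult.assoc)
  qed
  then show ?case using gen_comp.IH by (auto simp: bounded_op_def)
qed (rule assms(1))

end

text \<open>C lies between the generated algebra and its weak operator closure, so the criteria
  below apply both to the algebra on the finite-dimensional space, taken without closure, and to the
  closed algebras on the whole space.\<close>

locale op_alg = closed_sub X for X :: "'h::chilbert_space set" +
  fixes G C :: "('h \<Rightarrow> 'h) set"
  assumes gens_bounded: "\<And>T. T \<in> G \<Longrightarrow> bounded_op X T"
    and gens_subset: "gen_alg G \<subseteq> C" and subset_wot: "C \<subseteq> wot_closure X (gen_alg G)"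
begin

lemma gen_alg_bounded: "T \<in> gen_alg G \<Longrightarrow> bounded_op X T"
  using gens_bounded by (rule bounded_op_gen_alg)

lemma C_bounded: "T \<in> C \<Longrightarrow> bounded_op X T"
  using subset_wot by (auto simp: wot_closure_def)

text \<open>Matrix coefficients are weakly continuous; the approximation is invoked with tolerance
  equal to the supposed non-zero value.\<close>

lemma wot_orth:
  assumes T: "T \<in> C" and xy: "x \<in> X" "y \<in> X" and z: "\<And>T'. T' \<in> gen_alg G \<Longrightarrow> cinner y (T' x) = 0"
  shows "cinner y (T x) = 0"
proof (rule ccontr)
  assume nz: "cinner y (T x) \<noteq> 0"
  have "\<exists>T'\<in>gen_alg G. \<forall>(x, y)\<in>{(x, y)}. cmod (cinner y (T x - T' x)) < cmod (cinner y (T x))"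
    using T subset_wot xy nz unfolding wot_closure_def
    by (elim subsetD[THEN CollectE, of C] conjE allE[where x = "{(x, y)}"]) (auto simp: subset_iff)
  then show False using z by (auto simp: cinner.diff_right)
qed

text \<open>Passing to the complement avoids adjoints of products: its invariance spreads from the
  generators through the generated algebra and, by \<open>wot_orth\<close>, to C.\<close>

lemma coinvariant_iff:
  "coinvariant X C Y \<longleftrightarrow>
    closed_csubspace Y \<and> Y \<subseteq> X \<and> (\<forall>T\<in>G. \<forall>x\<in>X \<inter> orth_compl Y. T x \<in> orth_compl Y)"
proof (cases "closed_csubspace Y \<and> Y \<subseteq> X")
  case True
  have "T x \<in> orth_compl Y"
    if G: "\<forall>T\<in>G. \<forall>x\<in>X \<inter> orth_compl Y. T x \<in> orth_compl Y" and T: "T \<in> C" and x: "x \<in> X \<inter> orth_compl Y" for T x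
  proof (rule orth_complI)
    fix y assume y: "y \<in> Y"
    have "T' x' \<in> orth_compl Y" if "T' \<in> gen_alg G" "x' \<in> X \<inter> orth_compl Y" for T' x'
      using that
    proof (induction arbitrary: x' rule: gen_alg.induct)
      case (gen_comp S T)
      have "T x' \<in> X" using gen_alg_bounded[OF gen_comp.hyps(2)] gen_comp.prems by (auto simp: bounded_op_def)
      then show ?case using gen_comp by simp
    qed (use G in \<open>auto intro: closed_csubspaceD(4,5)[OF closed_csubspace_orth_compl]\<close>)
    then have "cinner y (T' x) = 0" if "T' \<in> gen_alg G" for T' using that x y orth_complD(1) by blast
    then show "cinner y (T x) = 0" using wot_orth[OF T] x y True by blast
  qed
  moreover have "G \<subseteq> C" using gens_subset gen_incl by blast
  ultimately show ?thesis
    using True adj_on_image_iff[OF C_bounded] unfolding coinvariant_def by (meson subsetD)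
qed (auto simp: coinvariant_def)

text \<open>A closed subspace invariant under the generators is invariant under C, because matrix
  coefficients against its complement vanish. Conversely, the closed span of the images of Y under
  the generated algebra is itself such a subspace.\<close>

lemma cyclic_iff:
  assumes Y: "Y \<subseteq> X"
  shows "cyclic X C Y \<longleftrightarrow>
    (\<forall>M. closed_csubspace M \<and> M \<subseteq> X \<and> Y \<subseteq> M \<and> (\<forall>T\<in>G. \<forall>x\<in>M. T x \<in> M) \<longrightarrow> M = X)"
proof
  assume cyc: "cyclic X C Y"
  show "\<forall>M. closed_csubspace M \<and> M \<subseteq> X \<and> Y \<subseteq> M \<and> (\<forall>T\<in>G. \<forall>x\<in>M. T x \<in> M) \<longrightarrow> M = X"
  proof (intro allI impI, elim conjE)
    fix M assume M: "closed_csubspace M" "M \<subseteq> X" "Y \<subseteq> M" "\<forall>T\<in>G. \<forall>x\<in>M. T x \<in> M"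
    interpret M: closed_sub M by unfold_locales (rule M)
    have gM: "T x \<in> M" if "T \<in> gen_alg G" "x \<in> M" for T x
      using that by (induction arbitrary: x rule: gen_alg.induct) (use M(4) M.sub in auto)
    have "T x \<in> M" if T: "T \<in> C" and x: "x \<in> M" for T x
    proof -
      have "T x \<in> X" using C_bounded[OF T] x M(2) by (auto simp: bounded_op_def)
      moreover have "cinner u (T x) = 0" if "u \<in> X \<inter> orth_compl M" for u
        using that x M(2) orth_complD(2)[of u M] gM by (intro wot_orth[OF T]) auto
      ultimately show ?thesis using M.mem_iff_orth[OF _ M(2) closed_csubspace] by blast
    qed
    then have "closed_cspan (\<Union>T\<in>C. T ` Y) \<subseteq> M" using M(3) by (intro closed_cspan_minimal M(1)) blast
    then show "M = X" using cyc M(2) by (auto simp: cyclic_def)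
  qed
next
  assume R: "\<forall>M. closed_csubspace M \<and> M \<subseteq> X \<and> Y \<subseteq> M \<and> (\<forall>T\<in>G. \<forall>x\<in>M. T x \<in> M) \<longrightarrow> M = X"
  let ?U = "\<Union>T\<in>gen_alg G. T ` Y"
  have UX: "?U \<subseteq> X" using Y gen_alg_bounded by (auto simp: bounded_op_def)
  have "T x \<in> closed_cspan ?U" if T: "T \<in> G" and x: "x \<in> closed_cspan ?U" for T x
  proof (rule closed_cspan_image_on[OF gens_bounded[OF T] UX _ closed_csubspace_closed_cspan x])
    fix z assume "z \<in> ?U"
    then obtain T' y where z: "z = T' y" "T' \<in> gen_alg G" "y \<in> Y" by blast
    have "T \<circ> T' \<in> gen_alg G" by (rule gen_alg.gen_comp[OF gen_alg.gen_incl[OF T] z(2)])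
    then have "(T \<circ> T') y \<in> ?U" using z(3) by blast
    then show "T z \<in> closed_cspan ?U" using closed_cspan_superset[of ?U] unfolding z(1) comp_def by (rule rev_subsetD)
  qed
  moreover have "Y \<subseteq> ?U" using UN_upper[OF gen_alg.gen_id[of G], of "\<lambda>T. T ` Y"] by simp
  ultimately have "closed_cspan ?U = X"
    using closed_cspan_minimal[OF UX closed_csubspace] closed_cspan_superset[of ?U]
    by (intro R[rule_format, of "closed_cspan ?U"]) simp_all
  moreover have "closed_cspan ?U \<subseteq> closed_cspan (\<Union>T\<in>C. T ` Y)"
    using gens_subset by (intro closed_cspan_mono) blast
  moreover have "closed_cspan (\<Union>T\<in>C. T ` Y) \<subseteq> X"
    using Y C_bounded by (intro closed_cspan_minimal closed_csubspace) (auto simp: bounded_op_def)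
  ultimately show "cyclic X C Y" by (simp add: cyclic_def)
qed

end

lemma op_alg_gen_alg:
  fixes X :: "'h::chilbert_space set"
  assumes X: "closed_csubspace X" and G: "\<And>T. T \<in> G \<Longrightarrow> bounded_op X T"
  shows "op_alg X G (gen_alg G)" "op_alg X G (wot_closure X (gen_alg G))"
proof -
  have "gen_alg G \<subseteq> wot_closure X (gen_alg G)"
    unfolding wot_closure_def
  proof (intro subsetI CollectI conjI allI impI)
    fix T :: "'h \<Rightarrow> 'h" and F :: "('h \<times> 'h) set" and e :: real
    assume T: "T \<in> gen_alg G" and F: "finite F \<and> F \<subseteq> X \<times> X \<and> 0 < e"
    show "\<exists>T'\<in>gen_alg G. \<forall>(x, y)\<in>F. cmod (cinner y (T x - T' x)) < e"
      using T F by (intro bexI[of _ T]) (auto simp: cinner.zero_right)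
  qed (rule closed_sub.bounded_op_gen_alg[OF closed_sub.intro[OF X] G])
  then show "op_alg X G (gen_alg G)" "op_alg X G (wot_closure X (gen_alg G))"
    using X G by (simp_all add: op_alg_def op_alg_axioms_def closed_sub_def)
qed

text \<open>A least element is the only minimal one.\<close>

lemma minimal_cyclic_coinvariant_unique:
  assumes "coinvariant X C Y" "cyclic X C Y"
    and "\<And>Z. coinvariant X C Z \<Longrightarrow> cyclic X C Z \<Longrightarrow> Y \<subseteq> Z"
  shows "minimal_cyclic_coinvariant X C Z \<longleftrightarrow> Z = Y"
  using assms unfolding minimal_cyclic_coinvariant_def by blast

subsection \<open>Reductive algebras on finite-dimensional spaces\<close>

definition linear_within :: "'v::complex_vector set \<Rightarrow> ('v \<Rightarrow> 'v) \<Rightarrow> bool"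
  where "linear_within M Z \<longleftrightarrow>
    (\<forall>x\<in>M. Z x \<in> M) \<and> (\<forall>x\<in>M. \<forall>y\<in>M. Z (x + y) = Z x + Z y) \<and> (\<forall>x\<in>M. \<forall>c. Z (c *\<^sub>C x) = c *\<^sub>C Z x)"

definition poly_op :: "('v \<Rightarrow> 'v) \<Rightarrow> complex poly \<Rightarrow> 'v::complex_vector \<Rightarrow> 'v"
  where "poly_op Z p x = (\<Sum>i\<le>degree p. coeff p i *\<^sub>C (Z ^^ i) x)"

lemma csubspace_sum: "csubspace M \<Longrightarrow> (\<And>i. i \<in> I \<Longrightarrow> f i \<in> M) \<Longrightarrow> sum f I \<in> M"
  by (simp add: csubspace_def cvec.subspace_sum)

lemma csubspaceD:
  assumes "csubspace M"
  shows "0 \<in> M" "x \<in> M \<Longrightarrow> y \<in> M \<Longrightarrow> x + y \<in> M" "x \<in> M \<Longrightarrow> c *\<^sub>C x \<in> M" "x \<in> M \<Longrightarrow> y \<in> M \<Longrightarrow> x - y \<in> M"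
  using assms csubspace_diff[OF assms] by (auto simp: csubspace_iff)

lemma linear_withinD:
  assumes "linear_within M Z"
  shows "x \<in> M \<Longrightarrow> Z x \<in> M" "x \<in> M \<Longrightarrow> y \<in> M \<Longrightarrow> Z (x + y) = Z x + Z y" "x \<in> M \<Longrightarrow> Z (c *\<^sub>C x) = c *\<^sub>C Z x"
  using assms by (auto simp: linear_within_def)

lemma linear_within_zero: "linear_within M Z \<Longrightarrow> csubspace M \<Longrightarrow> Z 0 = 0"
  using linear_withinD(3)[of M Z 0 0] csubspaceD(1)[of M] by simp

lemma linear_within_diff:
  assumes "linear_within M Z" "csubspace M" "x \<in> M" "y \<in> M"
  shows "Z (x - y) = Z x - Z y"
  using linear_withinD(2)[OF assms(1) csubspaceD(4)[OF assms(2-4)] assms(4)] by simp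

lemma linear_within_sum:
  assumes "linear_within M Z" "csubspace M" "\<And>i. i \<in> I \<Longrightarrow> f i \<in> M"
  shows "Z (sum f I) = (\<Sum>i\<in>I. Z (f i))"
  using assms(3)
proof (induction I rule: infinite_finite_induct)
  case (insert i I)
  then show ?case
    using linear_withinD(2)[OF assms(1), of "f i" "sum f I"] csubspace_sum[OF assms(2), of I f] by simp
qed (simp_all add: linear_within_zero[OF assms(1,2)])

lemma poly_op_eq:
  assumes "degree p \<le> n" shows "poly_op Z p x = (\<Sum>i\<le>n. coeff p i *\<^sub>C (Z ^^ i) x)"
  unfolding poly_op_def using assms by (intro sum.mono_neutral_left) (auto simp: coeff_eq_0 scaleC_zero_left)

text \<open>Among all pairs of a non-zero polynomial p and a non-zero x in M with p(Z)x = 0, take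
  one with p of least degree and split off a root c. The cofactor q has smaller degree, so q(Z)x is
  non-zero, and it is an eigenvector for c.\<close>

lemma eigenvector_exists:
  assumes Z: "linear_within M Z" and M: "fin_dim M" "M \<noteq> {0}"
  shows "\<exists>c x. x \<in> M \<and> x \<noteq> 0 \<and> Z x = c *\<^sub>C x"
proof -
  have sub: "csubspace M" by (rule fin_dim_csubspace[OF M(1)])
  obtain B where B: "finite B" "M = cspan B" using M(1) by (auto simp: fin_dim_def)
  obtain x where x: "x \<in> M" "x \<noteq> 0" using M(2) csubspaceD(1)[OF sub] by auto
  have pw: "(Z ^^ i) x \<in> M" if "x \<in> M" for i x
    using that by (induction i) (auto intro: linear_withinD(1)[OF Z])
  have "\<exists>p. p \<noteq> 0 \<and> poly_op Z p x = 0"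
  \<comment> \<open>Linear dependence has coefficients indexed by vectors, so a repetition among the
    powers applied to x is treated apart, by a difference of two monomials.\<close>
  proof (cases "inj (\<lambda>i. (Z ^^ i) x)")
    case False
    then obtain i j where ij: "i < j" "(Z ^^ i) x = (Z ^^ j) x" unfolding inj_def by (metis nat_neq_iff)
    let ?p = "monom 1 j - monom (1::complex) i"
    have "coeff ?p j = 1" using ij(1) by simp
    then have nz: "?p \<noteq> 0" by (metis coeff_0 zero_neq_one)
    have "degree ?p \<le> j" using ij(1) by (intro degree_diff_le order_trans[OF degree_monom_le]) auto
    then have "poly_op Z ?p x = (\<Sum>k\<le>j. coeff ?p k *\<^sub>C (Z ^^ k) x)" by (rule poly_op_eq)
    also have "\<dots> = (\<Sum>k\<le>j. (if k = j then (Z ^^ j) x else 0) - (if k = i then (Z ^^ i) x else 0))"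
      using ij(1) by (intro sum.cong refl) (auto simp: scaleC_one scaleC_zero_left cvec.scale_left_diff_distrib)
    also have "\<dots> = 0" using ij by (simp add: sum_subtractf)
    finally show ?thesis using nz by blast
  next
    case True
    let ?n = "card B" and ?f = "\<lambda>i. (Z ^^ i) x"
    have inj: "inj_on ?f {..?n}" using True by (rule inj_on_subset) simp
    have "?f ` {..?n} \<subseteq> cvec.span B" using pw[OF x(1)] B(2) by (auto simp: cspan_def)
    moreover have "card (?f ` {..?n}) > card B" using card_image[OF inj] by simp
    ultimately have "cvec.dependent (?f ` {..?n})" using cvec.independent_span_bound[OF B(1)] by fastforce
    then obtain u where u: "(\<Sum>v\<in>?f ` {..?n}. u v *\<^sub>C v) = 0" "\<exists>v\<in>?f ` {..?n}. u v \<noteq> 0"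
      by (subst (asm) cvec.dependent_finite) auto
    define p where "p = (\<Sum>i\<le>?n. monom (u (?f i)) i)"
    have cp: "coeff p k = (if k \<le> ?n then u (?f k) else 0)" for k
      by (simp add: p_def coeff_sum coeff_monom if_distrib cong: if_cong)
    obtain k where "k \<le> ?n" "u (?f k) \<noteq> 0" using u(2) by blast
    then have "p \<noteq> 0" using cp[of k] by auto
    moreover have "degree p \<le> ?n" by (rule degree_le) (simp add: cp)
    then have "poly_op Z p x = (\<Sum>k\<le>?n. u (?f k) *\<^sub>C ?f k)" by (subst poly_op_eq) (auto simp: cp)
    then have "poly_op Z p x = 0" using u(1) by (simp add: sum.reindex[OF inj])
    ultimately show ?thesis by blast
  qed
  then have "\<exists>n p x. x \<in> M \<and> x \<noteq> 0 \<and> p \<noteq> 0 \<and> poly_op Z p x = 0 \<and> degree p = n" using x by blast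
  then obtain n where n: "\<exists>p x. x \<in> M \<and> x \<noteq> 0 \<and> p \<noteq> 0 \<and> poly_op Z p x = 0 \<and> degree p = n"
    and least: "\<And>m. m < n \<Longrightarrow> \<not> (\<exists>p x. x \<in> M \<and> x \<noteq> 0 \<and> p \<noteq> 0 \<and> poly_op Z p x = 0 \<and> degree p = m)"
    using exists_least_iff[of "\<lambda>n. \<exists>p x. x \<in> M \<and> x \<noteq> 0 \<and> p \<noteq> 0 \<and> poly_op Z p x = 0 \<and> degree p = n"] by auto
  from n obtain p x where p: "x \<in> M" "x \<noteq> 0" "p \<noteq> 0" "poly_op Z p x = 0" "degree p = n" by blast
  have "n \<noteq> 0"
  proof
    assume "n = 0"
    then have "coeff p 0 *\<^sub>C x = 0" "coeff p 0 \<noteq> 0" using p leading_coeff_neq_0[of p] by (auto simp: poly_op_def)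
    then show False using p(2) by simp
  qed
  then have "\<not> constant (poly p)" using constant_degree[of p] p(5) by simp
  then obtain c where "poly p c = 0" using fundamental_theorem_of_algebra by blast
  then obtain q where q: "p = [:- c, 1:] * q" using poly_eq_0_iff_dvd by (metis dvdE)
  have q0: "q \<noteq> 0" using p(3) q by auto
  then have dq: "degree p = Suc (degree q)" unfolding q by (subst degree_mult_eq) auto
  let ?y = "poly_op Z q x"
  have yM: "?y \<in> M" unfolding poly_op_def by (intro csubspace_sum[OF sub] csubspaceD(3)[OF sub] pw p(1))
  have y0: "?y \<noteq> 0" using least[of "degree q"] dq p(1,2,5) q0 by auto
  have pq: "p = pCons 0 q - smult c q" unfolding q by simp
  have "poly_op Z p x = (\<Sum>i\<le>Suc (degree q). coeff (pCons 0 q) i *\<^sub>C (Z ^^ i) x - (c * coeff q i) *\<^sub>C (Z ^^ i) x)"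
    using dq by (subst poly_op_eq[of _ "Suc (degree q)"]) (auto simp: pq cvec.scale_left_diff_distrib)
  also have "\<dots> = (\<Sum>i\<le>Suc (degree q). coeff (pCons 0 q) i *\<^sub>C (Z ^^ i) x)
      - (\<Sum>i\<le>Suc (degree q). (c * coeff q i) *\<^sub>C (Z ^^ i) x)"
    by (rule sum_subtractf)
  also have "(\<Sum>i\<le>Suc (degree q). coeff (pCons 0 q) i *\<^sub>C (Z ^^ i) x) = (\<Sum>i\<le>degree q. coeff q i *\<^sub>C Z ((Z ^^ i) x))"
    by (subst sum.atMost_Suc_shift) (simp add: scaleC_zero_left)
  also have "\<dots> = Z ?y"
    unfolding poly_op_def
    using linear_within_sum[OF Z sub, of "{..degree q}" "\<lambda>i. coeff q i *\<^sub>C (Z ^^ i) x"]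
      csubspaceD(3)[OF sub] pw[OF p(1)] by (simp add: linear_withinD(3)[OF Z])
  also have "(\<Sum>i\<le>Suc (degree q). (c * coeff q i) *\<^sub>C (Z ^^ i) x) = c *\<^sub>C ?y"
    using poly_op_eq[of q "Suc (degree q)" Z x] by (simp add: cvec.scale_sum_right scaleC_scaleC cvec.scale_right_distrib)
  finally have "Z ?y = c *\<^sub>C ?y" using p(4) by simp
  then show ?thesis using yM y0 by blast
qed

text \<open>The spanning set is built up one vector at a time, each new vector being replaced by its
  component e orthogonal to the old span.\<close>

lemma fin_dim_bounded_op:
  assumes X: "fin_dim (X::'h::chilbert_space set)" and Z: "linear_within X Z"
  shows "bounded_op X Z"
proof -
  have sub: "csubspace X" by (rule fin_dim_csubspace[OF X])
  have bd: "\<exists>K. \<forall>x\<in>cspan B. norm (Z x) \<le> K * norm x" if "finite B" "B \<subseteq> X" for B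
    using that
  proof (induction B)
    case empty
    have "cspan ({}::'h set) = {0}" by (simp add: cspan_def)
    then show ?case using linear_within_zero[OF Z sub] by simp
  next
    case (insert b B)
    let ?W = "cspan B"
    interpret W: closed_sub ?W
      using insert.hyps(1) by unfold_locales (intro fin_dim_closed, auto simp: fin_dim_def)
    have WX: "?W \<subseteq> X" unfolding cspan_def
      using insert.prems sub by (intro cvec.span_minimal) (auto simp: csubspace_def)
    obtain K where K: "\<And>x. x \<in> ?W \<Longrightarrow> norm (Z x) \<le> K * norm x" using insert by blast
    define e where "e = b - proj ?W b"
    have eX: "e \<in> X" unfolding e_def using insert.prems WX W.proj_mem by (intro csubspaceD(4)[OF sub]) auto
    \<comment> \<open>K bounds Z on the old span, the quotient bounds it on e. For e = 0 the
      quotient is 0 by the convention for division, which is right because then Z e = 0.\<close>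
    define L where "L = \<bar>K\<bar> + norm (Z e) / norm e"
    have "norm (Z x) \<le> L * norm x" if x: "x \<in> cspan (insert b B)" for x
    proof -
      obtain c where c: "x - c *\<^sub>C b \<in> ?W" using x unfolding cspan_def by (auto simp: cvec.span_insert)
      let ?w = "x - c *\<^sub>C e"
      have w: "?w \<in> ?W"
        using W.sub(4)[OF c W.sub(5)[OF W.proj_mem[of b], of c]]
        by (simp add: e_def scaleC_diff_right algebra_simps)
      have "x - ?w \<in> orth_compl ?W"
        using closed_csubspaceD(5)[OF closed_csubspace_orth_compl W.proj_orth] by (simp add: e_def)
      then have px: "proj ?W x = ?w" by (intro W.proj_unique w)
      have "norm (Z x) = norm (Z ?w + c *\<^sub>C Z e)"
        using linear_withinD(2)[OF Z, of ?w "c *\<^sub>C e"] linear_withinD(3)[OF Z eX] w WX csubspaceD(3)[OF sub eX] by auto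
      also have "\<dots> \<le> \<bar>K\<bar> * norm ?w + cmod c * norm (Z e)"
        using norm_triangle_ineq[of "Z ?w" "c *\<^sub>C Z e"] K[OF w] mult_right_mono[OF abs_ge_self[of K] norm_ge_zero[of ?w]]
        by (simp add: norm_scaleC)
      also have "norm ?w \<le> norm x" using W.norm_proj_le[of x] by (simp add: px)
      then have "\<bar>K\<bar> * norm ?w \<le> \<bar>K\<bar> * norm x" by (intro mult_left_mono) auto
      also have "cmod c * norm (Z e) \<le> norm (Z e) / norm e * norm x"
      proof (cases "e = 0")
        case True
        then show ?thesis using linear_within_zero[OF Z sub] by simp
      next
        case False
        have "cmod c * norm e \<le> norm x"
          using W.norm_diff_proj_le[OF W.sub(3), of x] by (simp add: px norm_scaleC)
        then have "cmod c * norm e * norm (Z e) \<le> norm x * norm (Z e)" by (intro mult_right_mono) auto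
        then show ?thesis using False by (simp add: field_simps)
      qed
      finally show ?thesis by (simp add: L_def distrib_right)
    qed
    then show ?case by blast
  qed
  obtain B where B: "finite B" "X = cspan B" using X by (auto simp: fin_dim_def)
  then have "B \<subseteq> X" by (simp add: cspan_def cvec.span_superset)
  then have "\<exists>K. \<forall>x\<in>X. norm (Z x) \<le> K * norm x" using bd[OF B(1)] B(2) by simp
  then show ?thesis using Z by (simp add: linear_within_def bounded_op_def)
qed


lemma linear_within_adj_on:
  assumes X: "closed_csubspace (X::'h::chilbert_space set)" and T: "bounded_op X T"
  shows "linear_within X (adj_on X T)"
proof -
  note a = adj_on[OF X T]
  have "adj_on X T (x + y) = adj_on X T x + adj_on X T y" for x y
    using a by (intro adj_on_eqI[OF X T]) (auto simp: cinner.add_right closed_csubspaceD(4)[OF X])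
  moreover have "adj_on X T (c *\<^sub>C x) = c *\<^sub>C adj_on X T x" for c x
    using a by (intro adj_on_eqI[OF X T]) (auto simp: cinner_scaleC_right closed_csubspaceD(5)[OF X])
  ultimately show ?thesis using a(1) by (simp add: linear_within_def)
qed

text \<open>Members of \<B> are functions on the whole type of which only the values on X count. By
  \<open>reducing\<close>, every invariant subspace has an invariant complement; the aim is that the
  restrictions to X form a C*-algebra.\<close>

locale reductive_algebra =
  fixes X :: "'h::chilbert_space set" and \<B> :: "('h \<Rightarrow> 'h) set"
  assumes fin: "fin_dim X" and lin: "B \<in> \<B> \<Longrightarrow> linear_within X B"
    and id_mem: "id \<in> \<B>" and add_mem: "B \<in> \<B> \<Longrightarrow> C \<in> \<B> \<Longrightarrow> (\<lambda>x. B x + C x) \<in> \<B>"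
    and scale_mem: "B \<in> \<B> \<Longrightarrow> (\<lambda>x. c *\<^sub>C B x) \<in> \<B>" and comp_mem: "B \<in> \<B> \<Longrightarrow> C \<in> \<B> \<Longrightarrow> B \<circ> C \<in> \<B>"
    and reducing: "\<lbrakk>csubspace N; N \<subseteq> X; \<And>B x. B \<in> \<B> \<Longrightarrow> x \<in> N \<Longrightarrow> B x \<in> N; B \<in> \<B>; x \<in> X \<inter> orth_compl N\<rbrakk>
      \<Longrightarrow> B x \<in> orth_compl N"
begin

section \<open>Invariant subspaces and the commutant\<close>

definition inv :: "'h set \<Rightarrow> bool"
  where "inv N \<longleftrightarrow> csubspace N \<and> N \<subseteq> X \<and> (\<forall>B\<in>\<B>. \<forall>x\<in>N. B x \<in> N)"

definition comm :: "('h \<Rightarrow> 'h) \<Rightarrow> bool"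
  where "comm Z \<longleftrightarrow> linear_within X Z \<and> (\<forall>B\<in>\<B>. \<forall>x\<in>X. Z (B x) = B (Z x))"

sublocale closed_sub X by unfold_locales (rule fin_dim_closed[OF fin])

lemma csub: "csubspace X" by (rule sub(1))

lemma bounded: "B \<in> \<B> \<Longrightarrow> bounded_op X B"
  by (intro fin_dim_bounded_op fin lin)

lemma inv_closed: "inv N \<Longrightarrow> closed_csubspace N"
  unfolding inv_def by (intro fin_dim_closed fin_dim_subspace[OF fin]) auto

lemma inv_orth: "inv N \<Longrightarrow> inv M \<Longrightarrow> inv (M \<inter> orth_compl N)"
  using reducing[of N] closed_csubspaceD(1)[OF closed_csubspace_Int[of M "orth_compl N"]] inv_closed[of M]
  by (auto simp: inv_def)

lemma inv_full: "inv X"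
  using lin csub by (auto simp: inv_def linear_within_def)

text \<open>The complement of N in X is invariant, so N is invariant under the adjoints.\<close>

lemma adj_inv:
  assumes N: "inv N" and B: "B \<in> \<B>" and x: "x \<in> N"
  shows "adj_on X B x \<in> N"
  using adj_on_image_iff[OF bounded[OF B] inv_closed[OF N]] reducing[of N B] N B x unfolding inv_def by blast

lemma adj_lin: "B \<in> \<B> \<Longrightarrow> linear_within X (adj_on X B)"
  by (intro linear_within_adj_on closed_csubspace bounded)

lemma inv_split:
  assumes "inv N" "inv M" "N \<subseteq> M" "x \<in> M"
  shows "x - proj N x \<in> M \<inter> orth_compl N" "proj N x \<in> N"
proof -
  interpret N: closed_sub N by unfold_locales (rule inv_closed[OF assms(1)])
  show "proj N x \<in> N" by simp
  then show "x - proj N x \<in> M \<inter> orth_compl N"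
    using assms csubspaceD(4)[of M x "proj N x"] N.proj_orth by (simp add: inv_def subset_iff)
qed

lemma proj_commutes:
  assumes N: "inv N" and B: "B \<in> \<B>" and x: "x \<in> X"
  shows "proj N (B x) = B (proj N x)"
proof -
  interpret N: closed_sub N by unfold_locales (rule inv_closed[OF N])
  have NX: "N \<subseteq> X" using N by (simp add: inv_def)
  have "B x - B (proj N x) = B (x - proj N x)"
    using linear_within_diff[OF lin[OF B] csub x subsetD[OF NX N.proj_mem]] by simp
  also have "\<dots> \<in> orth_compl N"
    using inv_split[OF N inv_full NX x] inv_orth[OF N inv_full] B by (auto simp: inv_def)
  finally show ?thesis using N B by (intro N.proj_unique) (auto simp: inv_def)
qed

text \<open>By induction on the dimension: off-diagonal blocks have invariant graphs, and an
  operator with an eigenvalue is scalar on the corresponding eigenspace.\<close>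

lemma intertwiner_commutes_adj:
  assumes "inv M" "linear_within M Z" "\<And>B x. B \<in> \<B> \<Longrightarrow> x \<in> M \<Longrightarrow> Z (B x) = B (Z x)" "B \<in> \<B>" "x \<in> M"
  shows "Z (adj_on X B x) = adj_on X B (Z x)"
proof (rule ccontr)
  \<comment> \<open>The induction runs as a minimal counterexample: M will be a least invariant
    subspace carrying an operator Z that violates the claim.\<close>
  define bad where "bad M \<longleftrightarrow> inv M \<and> (\<exists>Z B x. linear_within M Z \<and> (\<forall>B\<in>\<B>. \<forall>x\<in>M. Z (B x) = B (Z x)) \<and>
    B \<in> \<B> \<and> x \<in> M \<and> Z (adj_on X B x) \<noteq> adj_on X B (Z x))" for M
  assume "Z (adj_on X B x) \<noteq> adj_on X B (Z x)"
  then have "bad M" using assms unfolding bad_def by blast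
  moreover have "bad Y \<Longrightarrow> csubspace Y \<and> Y \<subseteq> X" for Y by (auto simp: bad_def inv_def)
  ultimately obtain M where M: "bad M" and min: "\<And>Y. bad Y \<Longrightarrow> Y \<subseteq> M \<Longrightarrow> Y = M"
    using csubspace_minimal_exists[OF fin, of bad M] by metis
  then obtain Z B x where inv: "inv M" and Z: "linear_within M Z"
    and com: "\<And>B x. B \<in> \<B> \<Longrightarrow> x \<in> M \<Longrightarrow> Z (B x) = B (Z x)"
    and B: "B \<in> \<B>" and x: "x \<in> M" and ne: "Z (adj_on X B x) \<noteq> adj_on X B (Z x)"
    unfolding bad_def by blast
  let ?A = "adj_on X B"
  note A = linear_withinD[OF adj_lin[OF B]]
  have MX: "M \<subseteq> X" and subM: "csubspace M" using inv by (auto simp: inv_def)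
  have "M \<noteq> {0}"
  proof
    assume "M = {0}"
    then have "x = 0" "?A x = 0" using x adj_inv[OF inv B x] by auto
    then show False using ne linear_within_zero[OF Z subM] by simp
  qed
  then obtain c e where e: "e \<in> M" "e \<noteq> 0" "Z e = c *\<^sub>C e"
    using eigenvector_exists[OF Z] fin_dim_subspace[OF fin subM MX] by blast
  \<comment> \<open>On an eigenspace Z is scalar. The eigenspace is invariant because Z commutes
    with \<B>, hence invariant under the adjoints, and its complement in M is strictly smaller than
    M.\<close>
  define N where "N = {x \<in> M. Z x = c *\<^sub>C x}"
  have Nsub: "csubspace N"
    using csubspaceD[OF subM] linear_withinD[OF Z] linear_within_zero[OF Z subM]
    by (auto simp: N_def csubspace_iff scaleC_add_right scaleC_scaleC mult.commute)
  have invN: "inv N"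
    using inv com Nsub linear_withinD(3)[OF lin] MX by (auto simp: inv_def N_def)
  interpret N: closed_sub N by unfold_locales (rule inv_closed[OF invN])
  have NM: "N \<subseteq> M" by (auto simp: N_def)
  let ?N' = "M \<inter> orth_compl N"
  have invN': "inv ?N'" by (rule inv_orth[OF invN inv])
  have "e \<in> N" using e by (simp add: N_def)
  then have "?N' \<noteq> M" using e(1,2) NM orth_compl_Int[of e N] by blast
  then have good: "\<not> bad ?N'" using min by blast
  interpret N': closed_sub ?N' by unfold_locales (rule inv_closed[OF invN'])
  have onN: "Z (?A n) = ?A (Z n)" if "n \<in> N" for n
    using adj_inv[OF invN B that] that A(3) NM MX by (auto simp: N_def)
  have onN': "Z (?A n) = ?A (Z n)" if n: "n \<in> ?N'" for n
  proof -
    \<comment> \<open>The blocks of Z from the smaller summand into N and into that summand itself.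
      The second is covered by minimality of M, the first by its graph.\<close>
    define Z1 where "Z1 y = proj N (Z y)" for y
    define Z2 where "Z2 y = Z y - proj N (Z y)" for y
    have ZM: "Z y \<in> M" if "y \<in> ?N'" for y using linear_withinD(1)[OF Z] that by blast
    have com1: "Z1 (C y) = C (Z1 y)" if "C \<in> \<B>" "y \<in> ?N'" for C y
      using com[of C y] that proj_commutes[OF invN that(1)] ZM MX by (auto simp: Z1_def)
    have com2: "Z2 (C y) = C (Z2 y)" if "C \<in> \<B>" "y \<in> ?N'" for C y
    proof -
      have "Z y \<in> X" "Z1 y \<in> X" using ZM[OF that(2)] MX NM N.proj_mem[of "Z y"] unfolding Z1_def by blast+
      then show ?thesis
        using com1[OF that] com[of C y] that linear_within_diff[OF lin[OF that(1)] csub, of "Z y" "Z1 y"]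
        by (simp add: Z1_def Z2_def)
    qed
    have lin2: "linear_within ?N' Z2"
      using inv_split[OF invN inv NM ZM] linear_withinD(2,3)[OF Z]
      by (auto simp: linear_within_def Z2_def N.proj_add N.proj_scaleC scaleC_diff_right)
    have 2: "Z2 (?A n) = ?A (Z2 n)" using good invN' lin2 com2 B n unfolding bad_def by blast
    \<comment> \<open>The block into N commutes with \<B>, so its graph is invariant and, by
      \<open>adj_inv\<close>, also invariant under the adjoint; thus n + Z1 n is sent to some y + Z1
      y.\<close>
    define Gr where "Gr = {y + Z1 y | y. y \<in> ?N'}"
    have "csubspace Gr"
      unfolding csubspace_iff
    proof (intro conjI ballI allI)
      have "Z1 0 = 0" using linear_within_zero[OF Z subM] N.proj_id[OF N.sub(3)] by (simp add: Z1_def)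
      then show "0 \<in> Gr" using N'.sub(3) unfolding Gr_def by (intro CollectI exI[of _ 0]) simp
      show "a + b \<in> Gr" if ab: "a \<in> Gr" "b \<in> Gr" for a b
      proof -
        obtain y z where "a = y + Z1 y" "b = z + Z1 z" "y \<in> ?N'" "z \<in> ?N'" using ab unfolding Gr_def by blast
        then show ?thesis using N'.sub(4)[of y z] linear_withinD(2)[OF Z]
          unfolding Gr_def by (intro CollectI exI[of _ "y + z"]) (auto simp: Z1_def N.proj_add)
      qed
      show "k *\<^sub>C a \<in> Gr" if "a \<in> Gr" for k a
      proof -
        obtain y where "a = y + Z1 y" "y \<in> ?N'" using \<open>a \<in> Gr\<close> unfolding Gr_def by blast
        then show ?thesis using N'.sub(5)[of y k] linear_withinD(3)[OF Z]
          unfolding Gr_def by (intro CollectI exI[of _ "k *\<^sub>C y"]) (auto simp: Z1_def N.proj_scaleC scaleC_add_right)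
      qed
    qed
    moreover have "Gr \<subseteq> X" using MX NM N.proj_mem sub(4) unfolding Gr_def Z1_def by blast
    moreover have "C g \<in> Gr" if "C \<in> \<B>" "g \<in> Gr" for C g
    proof -
      obtain y where y: "g = y + Z1 y" "y \<in> ?N'" using \<open>g \<in> Gr\<close> unfolding Gr_def by blast
      then have "y \<in> X" "Z1 y \<in> X" using MX NM N.proj_mem[of "Z y"] unfolding Z1_def by blast+
      then have "C g = C y + C (Z1 y)"
        using linear_withinD(2)[OF lin[OF that(1)], of y "Z1 y"] y(1) by simp
      then show ?thesis using y(2) com1[OF that(1) y(2)] invN' that(1)
        unfolding Gr_def by (intro CollectI exI[of _ "C y"]) (auto simp: inv_def)
    qed
    ultimately have "inv Gr" by (auto simp: inv_def)
    moreover have "n + Z1 n \<in> Gr" using n unfolding Gr_def by blast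
    ultimately have "?A (n + Z1 n) \<in> Gr" using adj_inv B by blast
    then obtain y where y: "?A (n + Z1 n) = y + Z1 y" "y \<in> ?N'" unfolding Gr_def by blast
    have Z1N: "Z1 z \<in> N" for z by (simp add: Z1_def)
    have An: "?A n \<in> ?N'" "?A (Z1 n) \<in> N"
      using adj_inv[OF invN' B n] adj_inv[OF invN B Z1N] by auto
    have "?A n + ?A (Z1 n) = y + Z1 y"
      using y(1) A(2)[of n "Z1 n"] n MX NM Z1N[of n] by (simp add: subset_iff)
    then have eq: "?A n - y = Z1 y - ?A (Z1 n)" by (simp add: algebra_simps)
    \<comment> \<open>In \<open>eq\<close> the left side lies in the complement of N and the right
      side in N, so both are 0 and y is the adjoint applied to n.\<close>
    have "?A n - y = 0"
      using N.sub(6)[OF Z1N An(2), of y] N'.sub(6)[OF An(1) y(2)] orth_compl_Int[of "?A n - y" N] eq by auto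
    then have 1: "Z1 (?A n) = ?A (Z1 n)" using eq by simp
    have Zs: "Z y = Z1 y + Z2 y" for y by (simp add: Z1_def Z2_def)
    have "Z2 n \<in> X" using lin2 n MX by (auto simp: linear_within_def)
    then have "?A (Z n) = ?A (Z1 n) + ?A (Z2 n)"
      using A(2)[of "Z1 n" "Z2 n"] Z1N[of n] NM MX unfolding Zs[of n] by auto
    then show ?thesis using 1 2 Zs by metis
  qed
  let ?n = "proj N x" and ?n' = "x - proj N x"
  have sp: "?n \<in> N" "?n' \<in> ?N'" using inv_split[OF invN inv NM x] by auto
  have mem: "?n \<in> M" "?n' \<in> M" using sp NM by auto
  have "Z (?A x) = Z (?A ?n + ?A ?n')" using A(2)[of ?n ?n'] mem MX by (simp add: subset_iff)
  also have "\<dots> = ?A (Z ?n) + ?A (Z ?n')"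
    using linear_withinD(2)[OF Z adj_inv[OF inv B mem(1)] adj_inv[OF inv B mem(2)]] onN onN' sp by simp
  also have "\<dots> = ?A (Z x)"
    using A(2)[OF subsetD[OF MX linear_withinD(1)[OF Z mem(1)]] subsetD[OF MX linear_withinD(1)[OF Z mem(2)]]]
      linear_withinD(2)[OF Z mem] by simp
  finally show False using ne by simp
qed

section \<open>Density and the bicommutant\<close>

lemma comm_proj:
  assumes "inv N" shows "comm (proj N)" "comm (\<lambda>x. x - proj N x)"
proof -
  interpret N: closed_sub N by unfold_locales (rule inv_closed[OF assms])
  have pX: "proj N x \<in> X" for x using assms N.proj_mem[of x] by (auto simp: inv_def)
  show "comm (proj N)"
    using pX proj_commutes[OF assms] by (simp add: comm_def linear_within_def N.proj_add N.proj_scaleC)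
  have "x - proj N x \<in> X" if "x \<in> X" for x using that pX by (rule sub(6))
  moreover have "B x - proj N (B x) = B (x - proj N x)" if "B \<in> \<B>" "x \<in> X" for B x
    using proj_commutes[OF assms that] linear_within_diff[OF lin[OF that(1)] csub that(2) pX[of x]] by simp
  ultimately show "comm (\<lambda>x. x - proj N x)"
    by (simp add: comm_def linear_within_def N.proj_add N.proj_scaleC scaleC_diff_right)
qed

text \<open>The left ideal of elements vanishing at finitely many vectors, as in the proof of the
  Jacobson density theorem; its orbit of any vector of X is an invariant subspace.\<close>

definition ann :: "'h list \<Rightarrow> ('h \<Rightarrow> 'h) set"
  where "ann vs = {C \<in> \<B>. \<forall>v\<in>set vs. C v = 0}"

lemma ann_facts:
  assumes "C \<in> ann vs"
  shows "C \<in> \<B>" "D \<in> ann vs \<Longrightarrow> (\<lambda>x. C x + D x) \<in> ann vs" "(\<lambda>x. c *\<^sub>C C x) \<in> ann vs" "B \<in> \<B> \<Longrightarrow> B \<circ> C \<in> ann vs"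
  using assms add_mem[of C D] scale_mem[of C c] comp_mem[of B C] linear_within_zero[OF lin csub, of B]
  by (auto simp: ann_def)

lemma zero_ann: "(\<lambda>_. 0) \<in> ann vs"
  using scale_mem[OF id_mem, of 0] by (simp add: ann_def scaleC_zero_left)

lemma inv_ann:
  assumes "v \<in> X" shows "inv ((\<lambda>C. C v) ` ann vs)"
proof -
  have "csubspace ((\<lambda>C. C v) ` ann vs)"
    unfolding csubspace_iff
  proof (intro conjI ballI allI)
    show "0 \<in> (\<lambda>C. C v) ` ann vs" by (rule rev_image_eqI[OF zero_ann]) simp
    show "a + b \<in> (\<lambda>C. C v) ` ann vs" if ab: "a \<in> (\<lambda>C. C v) ` ann vs" "b \<in> (\<lambda>C. C v) ` ann vs" for a b
    proof -
      obtain C D where "a = C v" "b = D v" "C \<in> ann vs" "D \<in> ann vs" using ab by blast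
      then show ?thesis by (intro rev_image_eqI[OF ann_facts(2)[of C vs D]]) simp_all
    qed
    show "c *\<^sub>C a \<in> (\<lambda>C. C v) ` ann vs" if a: "a \<in> (\<lambda>C. C v) ` ann vs" for a c
    proof -
      obtain C where "a = C v" "C \<in> ann vs" using a by blast
      then show ?thesis by (intro rev_image_eqI[OF ann_facts(3)[of C vs c]]) simp_all
    qed
  qed
  moreover have "C v \<in> X" if "C \<in> ann vs" for C
    using linear_withinD(1)[OF lin[OF ann_facts(1)[OF that]] assms] .
  moreover have "B (C v) \<in> (\<lambda>C. C v) ` ann vs" if "C \<in> ann vs" "B \<in> \<B>" for B C
    by (rule rev_image_eqI[OF ann_facts(4)[OF that]]) simp
  ultimately show ?thesis by (auto simp: inv_def)
qed

text \<open>If all elements killing v and vs also kill w, then C v determines C w for C in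
  \<open>ann vs\<close>. The resulting map commutes with \<B>; preceded by the projection onto the
  orbit of v it is defined on all of X and lies in the commutant.\<close>

lemma comm_ann:
  assumes vs: "v \<in> X" "w \<in> X" and w: "\<And>C. C \<in> ann (v # vs) \<Longrightarrow> C w = 0"
  shows "\<exists>Z. comm Z \<and> (\<forall>C\<in>ann vs. Z (C v) = C w)"
proof -
  let ?N = "(\<lambda>C. C v) ` ann vs"
  have inv: "inv ?N" by (rule inv_ann[OF vs(1)])
  interpret N: closed_sub ?N by unfold_locales (rule inv_closed[OF inv])
  have wd: "C w = D w" if "C \<in> ann vs" "D \<in> ann vs" "C v = D v" for C D
  proof -
    have "(\<lambda>x. C x + (- 1) *\<^sub>C D x) \<in> ann vs" by (intro ann_facts(2,3) that)
    then have "(\<lambda>x. C x + (- 1) *\<^sub>C D x) \<in> ann (v # vs)" using that(3) by (simp add: ann_def)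
    from w[OF this] show ?thesis by simp
  qed
  define g where "g n = (SOME C. C \<in> ann vs \<and> C v = n)" for n
  have g: "g n \<in> ann vs" "g n v = n" if "n \<in> ?N" for n
  proof -
    have "\<exists>C. C \<in> ann vs \<and> C v = n" using that by blast
    from someI_ex[OF this] show "g n \<in> ann vs" "g n v = n" unfolding g_def by simp_all
  qed
  have gC: "g (C v) w = C w" if "C \<in> ann vs" for C
    by (rule wd[OF g(1) that g(2)]) (use that in simp_all)
  define f where "f n = g n w" for n
  have f: "f (C v) = C w" if "C \<in> ann vs" for C by (simp add: f_def gC[OF that])
  have add: "f (a + b) = f a + f b" if ab: "a \<in> ?N" "b \<in> ?N" for a b
  proof -
    obtain C D where "a = C v" "b = D v" "C \<in> ann vs" "D \<in> ann vs" using ab by blast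
    then show ?thesis using f[OF ann_facts(2)[of C vs D]] f by simp
  qed
  have scale: "f (c *\<^sub>C a) = c *\<^sub>C f a" if a: "a \<in> ?N" for a c
  proof -
    obtain C where "a = C v" "C \<in> ann vs" using a by blast
    then show ?thesis using f[OF ann_facts(3)[of C vs c]] f by simp
  qed
  have comp: "f (B a) = B (f a)" "f a \<in> X" if "a \<in> ?N" "B \<in> \<B>" for a B
  proof -
    obtain C where "a = C v" "C \<in> ann vs" using \<open>a \<in> ?N\<close> by blast
    then show "f (B a) = B (f a)" "f a \<in> X"
      using f[OF ann_facts(4)[of C vs B]] f that(2) linear_withinD(1)[OF lin[OF ann_facts(1)] vs(2)] by simp_all
  qed
  have "comm (\<lambda>x. f (proj ?N x))"
    using add scale comp id_mem proj_commutes[OF inv]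
    by (simp add: comm_def linear_within_def N.proj_add N.proj_scaleC)
  moreover have "f (proj ?N (C v)) = C w" if "C \<in> ann vs" for C
    using f[OF that] that N.proj_id[of "C v"] by simp
  ultimately show ?thesis by blast
qed

text \<open>Induction on vs: \<open>comm_ann\<close> gives Z in the commutant such that w - Z v is
  killed by \<open>ann vs\<close>, so the induction hypothesis applies to it, while B and D agree on
  Z v because both commute with Z and agree on v.\<close>

lemma bicommutant_ann:
  assumes D: "linear_within X D" "\<And>Z x. comm Z \<Longrightarrow> x \<in> X \<Longrightarrow> D (Z x) = Z (D x)"
    and B: "B \<in> \<B>" "\<forall>v\<in>set vs. B v = D v" and vs: "set vs \<subseteq> X"
    and w: "w \<in> X" "\<And>C. C \<in> ann vs \<Longrightarrow> C w = 0"
  shows "B w = D w"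
  using B(2) vs w
proof (induction vs arbitrary: w)
  case Nil
  have "id \<in> ann []" using id_mem by (simp add: ann_def)
  from Nil(4)[OF this] have "w = 0" by simp
  then show ?case using linear_within_zero[OF D(1) csub] linear_within_zero[OF lin[OF B(1)] csub] by simp
next
  case (Cons v vs)
  then have v: "v \<in> X" by simp
  obtain Z where Z: "comm Z" "\<And>C. C \<in> ann vs \<Longrightarrow> Z (C v) = C w"
    using comm_ann[where v = v and w = w and vs = vs] v Cons.prems(3,4) by blast
  have Zv: "Z v \<in> X" using Z(1) v by (simp add: comm_def linear_within_def)
  have u: "w - Z v \<in> X" by (rule sub(6)[OF Cons.prems(3) Zv])
  have "C (w - Z v) = 0" if C: "C \<in> ann vs" for C
    using Z(2)[OF C] Z(1) v linear_within_diff[OF lin[OF ann_facts(1)[OF C]] csub Cons.prems(3) Zv]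
      ann_facts(1)[OF C] by (simp add: comm_def)
  then have "B (w - Z v) = D (w - Z v)" using Cons.IH[OF _ _ u] Cons.prems(1,2) by simp
  moreover have "B (Z v) = Z (B v)" using Z(1) B(1) v by (simp add: comm_def)
  then have "B (Z v) = D (Z v)" using D(2)[OF Z(1) v] Cons.prems(1) by simp
  ultimately show ?case
    using linear_within_diff[OF D(1) csub Cons.prems(3) Zv] linear_within_diff[OF lin[OF B(1)] csub Cons.prems(3) Zv]
    by simp
qed

text \<open>D is matched by an element of \<B> on finite lists, one vector v at a time. The
  component of v orthogonal to its orbit under \<open>ann vs\<close> is killed by
  \<open>ann vs\<close> and hence already matched; the remaining error lies in that orbit and is
  removed by an element of \<open>ann vs\<close>, which leaves the earlier vectors alone. A spanning
  list then suffices.\<close>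

theorem bicommutant:
  assumes D: "linear_within X D" "\<And>Z x. comm Z \<Longrightarrow> x \<in> X \<Longrightarrow> D (Z x) = Z (D x)"
  shows "\<exists>B\<in>\<B>. \<forall>x\<in>X. B x = D x"
proof -
  have dense: "\<exists>B\<in>\<B>. \<forall>v\<in>set vs. B v = D v" if "set vs \<subseteq> X" for vs
    using that
  proof (induction vs)
    case Nil
    show ?case using id_mem by auto
  next
    case (Cons v vs)
    then obtain B where B: "B \<in> \<B>" "\<forall>v\<in>set vs. B v = D v" by auto
    let ?N = "(\<lambda>C. C v) ` ann vs"
    have v: "v \<in> X" using Cons.prems by simp
    have inv: "inv ?N" by (rule inv_ann[OF v])
    interpret N: closed_sub ?N by unfold_locales (rule inv_closed[OF inv])
    let ?P = "\<lambda>x. x - proj ?N x"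
    have P: "comm ?P" by (rule comm_proj[OF inv])
    have PX: "?P v \<in> X" using P v by (simp add: comm_def linear_within_def)
    have "C (?P v) = 0" if C: "C \<in> ann vs" for C
    proof -
      have "C (?P v) = ?P (C v)" using P v ann_facts(1)[OF C] by (simp add: comm_def)
      then show ?thesis using C N.proj_id[of "C v"] by simp
    qed
    then have "B (?P v) = D (?P v)"
      using bicommutant_ann[OF D B _ PX] Cons.prems by simp
    then have eq: "?P (B v) = ?P (D v)" using D(2)[OF P v] P B(1) v by (simp add: comm_def)
    have "D v - B v = proj ?N (D v) - proj ?N (B v)" using eq by (simp add: algebra_simps)
    then have "D v - B v \<in> ?N" using N.sub(6)[OF N.proj_mem N.proj_mem] by metis
    then obtain C where C: "C \<in> ann vs" "D v - B v = C v" by blast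
    have "\<forall>u\<in>set (v # vs). B u + C u = D u" using B(2) C by (auto simp: ann_def algebra_simps)
    moreover have "(\<lambda>x. B x + C x) \<in> \<B>" by (intro add_mem B ann_facts(1)[OF C(1)])
    ultimately show ?case by (intro bexI[of _ "\<lambda>x. B x + C x"])
  qed
  obtain K where K: "finite K" "X = cspan K" using fin by (auto simp: fin_dim_def)
  obtain vs where vs: "set vs = K" using finite_list[OF K(1)] by blast
  have KX: "K \<subseteq> X" unfolding K(2) by (simp add: cspan_def cvec.span_superset)
  obtain B where B: "B \<in> \<B>" "\<forall>v\<in>K. B v = D v" using dense[of vs] vs KX by auto
  have "x \<in> X \<and> B x = D x" if x: "x \<in> cvec.span K" for x
    using x
  proof (induction rule: cvec.span_induct_alt)
    case base
    show ?case using sub(3) linear_within_zero[OF D(1) csub] linear_within_zero[OF lin[OF B(1)] csub] by simp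
  next
    case (step c x y)
    then show ?case
      using B(2) KX sub(4,5) linear_withinD(2,3)[OF D(1)] linear_withinD(2,3)[OF lin[OF B(1)]]
      by (simp add: subset_iff)
  qed
  then show ?thesis using B(1) K(2) by (auto simp: cspan_def)
qed

text \<open>By \<open>intertwiner_commutes_adj\<close> the adjoint commutes with the commutant, so
  \<open>bicommutant\<close> applies.\<close>

theorem adj_mem:
  assumes "B \<in> \<B>" shows "\<exists>C\<in>\<B>. \<forall>x\<in>X. C x = adj_on X B x"
proof (rule bicommutant[OF adj_lin[OF assms]])
  fix Z x assume "comm Z" "x \<in> X"
  then show "adj_on X B (Z x) = Z (adj_on X B x)"
    using intertwiner_commutes_adj[OF inv_full, of Z B x] assms by (simp add: comm_def)
qed

theorem cstar: "cstar_algebra_on X {restrict B X | B. B \<in> \<B>}"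
proof -
  let ?C = "{restrict B X | B. B \<in> \<B>}"
  have mem: "restrict B X \<in> ?C" if "B \<in> \<B>" for B using that by blast
  have mem_eq: "restrict T X \<in> ?C" if "B \<in> \<B>" "\<And>x. x \<in> X \<Longrightarrow> T x = B x" for B T
    using mem[OF that(1)] restrict_cong[of X X T B] that(2) by (simp add: simp_implies_def)
  have val: "B x \<in> X" if "B \<in> \<B>" "x \<in> X" for B x using linear_withinD(1)[OF lin] that by blast
  have bnd: "bounded_op X (restrict B X)" if "B \<in> \<B>" for B
    using bounded[OF that] sub(4,5) by (simp add: bounded_op_def)
  have limit: "T \<in> ?C"
    if T: "bounded_op X T" "T \<in> extensional X" and lim: "\<forall>e>0. \<exists>T'\<in>?C. \<forall>x\<in>X. norm (T x - T' x) \<le> e * norm x" for T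
  proof -
    have Tlin: "linear_within X T" using T(1) by (simp add: bounded_op_def linear_within_def)
    \<comment> \<open>A norm limit of elements of \<B> still commutes with the commutant, so
      \<open>bicommutant\<close> represents it in \<B> again.\<close>
    have "T (Z x) = Z (T x)" if Z: "comm Z" and x: "x \<in> X" for Z x
    proof -
      have Zlin: "linear_within X Z" using Z by (simp add: comm_def)
      have Zx: "Z x \<in> X" and Tx: "T x \<in> X" using linear_withinD(1)[OF Zlin x] linear_withinD(1)[OF Tlin x] .
      obtain K where K: "\<And>y. y \<in> X \<Longrightarrow> norm (Z y) \<le> K * norm y"
        using fin_dim_bounded_op[OF fin Zlin] unfolding bounded_op_def by blast
      let ?d = "norm (T (Z x) - Z (T x))" and ?M = "norm (Z x) + \<bar>K\<bar> * norm x"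
      have d: "?d \<le> e * ?M" if "e > 0" for e
      proof -
        obtain B where B: "B \<in> \<B>" "\<And>y. y \<in> X \<Longrightarrow> norm (T y - B y) \<le> e * norm y"
          using lim \<open>e > 0\<close> by force
        have "norm (B (Z x) - Z (T x)) = norm (Z (B x - T x))"
          using Z B(1) x linear_within_diff[OF Zlin csub val[OF B(1) x] Tx] by (simp add: comm_def)
        also have "\<dots> \<le> \<bar>K\<bar> * norm (B x - T x)"
          using K[OF sub(6)[OF val[OF B(1) x] Tx]] mult_right_mono[OF abs_ge_self[of K] norm_ge_zero[of "B x - T x"]] by simp
        also have "\<dots> \<le> \<bar>K\<bar> * (e * norm x)" using B(2)[OF x] by (intro mult_left_mono) (simp_all add: norm_minus_commute)
        finally show ?thesis
          using B(2)[OF Zx] norm_triangle_ineq[of "T (Z x) - B (Z x)" "B (Z x) - Z (T x)"] by (simp add: algebra_simps)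
      qed
      have M: "?M \<ge> 0" by simp
      have "?d \<le> 0"
      proof (rule field_le_epsilon)
        fix e :: real assume e: "e > 0"
        \<comment> \<open>Dividing by \<open>?M + 1\<close> rather than \<open>?M\<close> covers the
          case \<open>?M = 0\<close>.\<close>
        have "?d \<le> e / (?M + 1) * ?M" using e M by (intro d) (simp add: add_nonneg_pos)
        also have "e / (m + 1) * m \<le> e" if "m \<ge> 0" for m using e that by (simp add: field_simps)
        then have "e / (?M + 1) * ?M \<le> e" using M by blast
        finally show "?d \<le> 0 + e" by simp
      qed
      then show ?thesis by simp
    qed
    then obtain B where B: "B \<in> \<B>" "\<forall>x\<in>X. B x = T x" using bicommutant[OF Tlin] by blast
    have "T = restrict B X" using T(2) B(2) by (intro extensionalityI[of T X "restrict B X"]) simp_all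
    then show ?thesis using B(1) by blast
  qed
  have adjC: "restrict (adj_on X (restrict B X)) X \<in> ?C" if "B \<in> \<B>" for B
  proof -
    have "adj_on X (restrict B X) = adj_on X B" unfolding adj_on_def by simp
    then show ?thesis using adj_mem[OF that] mem_eq[of _ "adj_on X B"] by metis
  qed
  show ?thesis
    unfolding cstar_algebra_on_def
  proof (intro conjI ballI allI impI)
    show "restrict id X \<in> ?C" by (rule mem[OF id_mem])
    show "bounded_op X T" "T \<in> extensional X" if "T \<in> ?C" for T using that bnd by auto
    show "restrict (\<lambda>x. S x + T x) X \<in> ?C" if ST: "S \<in> ?C" "T \<in> ?C" for S T
    proof -
      obtain B D where "S = restrict B X" "T = restrict D X" "B \<in> \<B>" "D \<in> \<B>" using ST by blast
      then show ?thesis by (intro mem_eq[OF add_mem[of B D]]) simp_all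
    qed
    show "restrict (\<lambda>x. c *\<^sub>C T x) X \<in> ?C" if T: "T \<in> ?C" for T c
    proof -
      obtain D where "T = restrict D X" "D \<in> \<B>" using T by blast
      then show ?thesis by (intro mem_eq[OF scale_mem[of D c]]) simp_all
    qed
    show "restrict (S \<circ> T) X \<in> ?C" if ST: "S \<in> ?C" "T \<in> ?C" for S T
    proof -
      obtain B D where "S = restrict B X" "T = restrict D X" "B \<in> \<B>" "D \<in> \<B>" using ST by blast
      then show ?thesis using val by (intro mem_eq[OF comp_mem[of B D]]) simp_all
    qed
    show "restrict (adj_on X T) X \<in> ?C" if "T \<in> ?C" for T using that adjC by auto
  qed (use limit in blast)
qed

end

subsection \<open>Isometric representations of product systems\<close>

context iso_action
begin

text \<open>Let J be the isometry from F \<otimes> V onto \<open>step V\<close> induced by T. Since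
  T dilates A, the tilde map of A is P_V J, so full coisometry reads P_V P h = h with P the
  projection onto \<open>step V\<close>. Then h is no longer than P h, which forces P h = h.\<close>

lemma coisometric_subset_step:
  assumes V: "closed_csubspace V" and \<sigma>: "algebra_rep V \<sigma>"
    and dil: "dilates F T \<rho> V A \<sigma>" and co: "fully_coisometric_rep F V A \<sigma>"
  shows "V \<subseteq> step V"
proof
  fix h assume h: "h \<in> V"
  interpret V: closed_sub V by unfold_locales (rule V)
  interpret K: closed_sub "step V" by unfold_locales simp
  let ?hV = "hs_corr V \<sigma>"
  have hV: "semi_corr ?hV" by (intro semi_corr_hs_corr V.sub \<sigma>)
  interpret Fm: semi_module "formal_tensor F ?hV"
    by (intro semi_module_formal_tensor F.semi_module_axioms hV)
  have \<rho>\<sigma>: "\<rho> a k = \<sigma> a k" if "k \<in> V" for a k using dil that by (simp add: dilates_def)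
  have A: "A \<xi> k = proj V (T \<xi> k)" if "\<xi> \<in> car F" "k \<in> V" for \<xi> k using dil that by (simp add: dilates_def)
  interpret J: iso_lift F ?hV hs T
  proof (intro iso_lift.intro iso_lift_axioms.intro Fm.semi_module_axioms hmod_hs)
    show "ip hs (T x y) (T x' y') = ip ?hV y (lact ?hV (ip F x x') y')"
      if "x \<in> car F" "y \<in> car ?hV" "x' \<in> car F" "y' \<in> car ?hV" for x y x' y'
      using that iso[of x x' y y'] \<rho>\<sigma>[of y'] by simp
  qed simp
  define jl where "jl c = lift hs T c" for c
  have fs: "J.fsum us = (\<Sum>(x, y)\<leftarrow>us. T x y)" for us by simp
  have Asum: "(\<Sum>(x, y)\<leftarrow>us. A x y) = proj V (\<Sum>(x, y)\<leftarrow>us. T x y)" if "set us \<subseteq> car F \<times> V" for us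
    using that V.proj_scaleC[of 0 0] by (induction us) (auto simp: A V.proj_add)
  have pdiff: "proj V x - proj V y = proj V (x - y)" for x y
    using V.proj_add[of "x - y" y] by simp
  interpret tA: tensor_lift F ?hV ?hV A 1
  proof (intro tensor_lift.intro tensor_lift_axioms.intro Fm.semi_module_axioms hmod_hs_corr V)
    show "A x y \<in> car ?hV" if "x \<in> car F" "y \<in> car ?hV" for x y using that A by simp
    fix u v assume uv: "u \<in> car (formal_tensor F ?hV)" "v \<in> car (formal_tensor F ?hV)"
    have "norm ((\<Sum>(x, y)\<leftarrow>u. A x y) - (\<Sum>(x, y)\<leftarrow>v. A x y))
        \<le> norm ((\<Sum>(x, y)\<leftarrow>u. T x y) - (\<Sum>(x, y)\<leftarrow>v. T x y))"
      using uv by (simp add: Asum pdiff V.norm_proj_le)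
    also have "\<dots> \<le> 1 * mdist (formal_tensor F ?hV) u v" using J.f_bound[OF uv] by simp
    finally show "mdist ?hV (msum ?hV (map (\<lambda>(x, y). A x y) u)) (msum ?hV (map (\<lambda>(x, y). A x y) v))
      \<le> 1 * mdist (formal_tensor F ?hV) u v" by simp
  qed
  have tilde: "tilde V A \<sigma> c = proj V (jl c)" if c: "c \<in> car (F \<otimes>\<^sub>m ?hV)" for c
    unfolding tilde_def
  proof -
    obtain u where u: "u \<in> c" using J.tensor_nonempty[OF c] by blast
    have un: "set (u n) \<subseteq> car F \<times> V" for n using J.tensor_rep_car[OF c u] by auto
    have "(\<lambda>n. norm ((\<Sum>(x, y)\<leftarrow>u n. A x y) - proj V (jl c))) \<longlonglongrightarrow> 0"
    proof (rule Lim_null_comparison[OF always_eventually[OF allI]])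
      show "norm (norm ((\<Sum>(x, y)\<leftarrow>u n. A x y) - proj V (jl c))) \<le> norm ((\<Sum>(x, y)\<leftarrow>u n. T x y) - jl c)" for n
        by (simp add: Asum[OF un] pdiff V.norm_proj_le)
      show "(\<lambda>n. norm ((\<Sum>(x, y)\<leftarrow>u n. T x y) - jl c)) \<longlonglongrightarrow> 0"
        using J.lift_spec(2)[OF c u] by (simp add: jl_def)
    qed
    then show "lift ?hV A c = proj V (jl c)" using V.proj_mem by (intro tA.lift_eqI[OF c u]) simp_all
  qed
  have JK: "jl c \<in> step V" if c: "c \<in> car (F \<otimes>\<^sub>m ?hV)" for c
  proof -
    obtain u where u: "u \<in> c" using J.tensor_nonempty[OF c] by blast
    have un: "set (u n) \<subseteq> car F \<times> V" for n using J.tensor_rep_car[OF c u] by auto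
    have "(\<Sum>(x, y)\<leftarrow>us. T x y) \<in> step V" if "set us \<subseteq> car F \<times> V" for us
      using that by (induction us) (auto intro: K.sub T_step)
    then have 1: "(\<Sum>(x, y)\<leftarrow>u n. T x y) \<in> step V" for n using un by blast
    have 2: "(\<lambda>n. \<Sum>(x, y)\<leftarrow>u n. T x y) \<longlonglongrightarrow> jl c"
      using J.lift_spec(2)[OF c u] by (simp add: jl_def tendsto_norm_zero_iff LIM_zero_iff)
    show ?thesis by (rule closed_sequentially[OF K.sub(2) 1 2])
  qed
  have Jsurj: "\<exists>c\<in>car (F \<otimes>\<^sub>m ?hV). jl c = k" if k: "k \<in> step V" for k
  proof -
    obtain s where s: "\<forall>n. s n \<in> cspan (gens V)" "s \<longlonglongrightarrow> k"
      using k unfolding step_def closed_cspan_def closure_sequential by blast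
    have "\<exists>us. set us \<subseteq> car F \<times> V \<and> s n = (\<Sum>(\<xi>, h)\<leftarrow>us. T \<xi> h)" for n
      using cspan_gens_list[OF V.sub(1)] s(1) by blast
    then obtain u where u: "\<And>n. set (u n) \<subseteq> car F \<times> V" "\<And>n. s n = (\<Sum>(\<xi>, h)\<leftarrow>u n. T \<xi> h)" by metis
    have uc: "u n \<in> car (formal_tensor F ?hV)" for n using u(1) by simp
    \<comment> \<open>J is isometric, so lists representing a convergent sequence of vectors form a
      Cauchy sequence of tensors, whose class is a preimage of the limit.\<close>
    have md: "mdist (formal_tensor F ?hV) (u m) (u n) = norm (s m - s n)" for m n
    proof -
      have "(norm (s m - s n))\<^sup>2 = (mdist (formal_tensor F ?hV) (u m) (u n))\<^sup>2"
        using hs.mdist_square[of "s m" "s n"] Fm.mdist_square[OF uc uc, of m n]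
        by (simp only: J.ip_fsum[OF uc uc, symmetric] fs u(2)[symmetric] msum_hs_corr) simp
      then show ?thesis by (simp add: power2_eq_iff_nonneg Fm.mdist_nonneg)
    qed
    have "Cauchy s" using s(2) LIMSEQ_imp_Cauchy by blast
    then have cu: "u \<in> cauchy_seqs (formal_tensor F ?hV)"
      unfolding cauchy_seqs_def Cauchy_def dist_norm using uc md by simp
    let ?c = "cls (formal_tensor F ?hV) u"
    have c: "?c \<in> car (F \<otimes>\<^sub>m ?hV)" unfolding tensor_def by (rule Fm.cls_car[OF cu])
    have "(\<lambda>n. norm (s n - k)) \<longlonglongrightarrow> 0" using s(2) by (simp add: tendsto_norm_zero_iff LIM_zero_iff)
    then have "jl ?c = k" unfolding jl_def
      by (intro J.lift_eqI[OF c Fm.cls_self[OF cu]]) (simp_all flip: u(2))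
    then show ?thesis using c by blast
  qed
  obtain z where z: "z \<in> car (F \<otimes>\<^sub>m ?hV)" "jl z = proj (step V) h" using Jsurj K.proj_mem by metis
  have adjz: "cinner (tilde V A \<sigma> x) h = ip (F \<otimes>\<^sub>m ?hV) x z" if x: "x \<in> car (F \<otimes>\<^sub>m ?hV)" for x
  proof -
    have "cinner (tilde V A \<sigma> x) h = cinner (jl x) (proj V h)"
      unfolding tilde[OF x] by (rule V.cinner_proj_swap)
    also have "\<dots> = cinner (proj (step V) (jl x)) h" using V.proj_id[OF h] K.proj_id[OF JK[OF x]] by simp
    also have "\<dots> = cinner (jl x) (jl z)" unfolding z(2) by (rule K.cinner_proj_swap)
    also have "\<dots> = ip (F \<otimes>\<^sub>m ?hV) x z" using J.ip_lift[OF x z(1)] by (simp add: jl_def)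
    finally show ?thesis .
  qed
  interpret C: hmod "F \<otimes>\<^sub>m ?hV" by (intro hmod_tensor F.semi_module_axioms hV)
  \<comment> \<open>The adjoint picks the tensor z with J z = P h: pairing with h in V removes P_V,
    and vectors in the range of J see only the component P h.\<close>
  have "adj (F \<otimes>\<^sub>m ?hV) ?hV (tilde V A \<sigma>) h = z"
    unfolding adj_def
  proof (rule the_equality)
    fix z' assume z': "z' \<in> car (F \<otimes>\<^sub>m ?hV) \<and> (\<forall>x\<in>car (F \<otimes>\<^sub>m ?hV). ip ?hV (tilde V A \<sigma> x) h = ip (F \<otimes>\<^sub>m ?hV) x z')"
    show "z' = z" using z' z(1) adjz by (intro C.eq_by_ip[OF C.hmod_axioms]) auto
  qed (use z adjz in simp)
  then have "tilde V A \<sigma> z = h" using co h unfolding fully_coisometric_rep_def by metis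
  then have "proj V (proj (step V) h) = h" using tilde[OF z(1)] z(2) by simp
  then have "norm h \<le> norm (proj (step V) h)" using V.norm_proj_le[of "proj (step V) h"] by simp
  then have "(norm h)\<^sup>2 \<le> (norm (proj (step V) h))\<^sup>2" by (intro power_mono) auto
  then have "norm (h - proj (step V) h) = 0" using K.norm_proj_pythagoras[of h] by simp
  then show "h \<in> step V" using K.proj_mem[of h] by simp
qed

end

text \<open>Keeps the generators of the index monoid in the form \<open>axis i 1\<close>.\<close>

declare One_nat_def [simp del]

section \<open>The multiplication isomorphisms of a product system\<close>

locale prod_sys =
  fixes p :: "'e::semigroup_mult \<Rightarrow> (nat, 'k::finite) vec"
    and E :: "(nat, 'k) vec \<Rightarrow> ('a::unital_cstar_algebra, 'a, 'e) corr" and \<iota> :: "'a \<Rightarrow> 'e"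
  assumes ps: "product_system p E \<iota>"
begin

lemma ps_facts:
  shows ps_mult: "\<forall>x y. p (x * y) = p x + p y"
    and ps_car: "\<forall>n. car (E n) = p -` {n}"
    and ps_corr: "\<forall>n. correspondence (E n)"
    and ps_unit: "correspondence_iso alg_corr (E 0) \<iota>"
    and ps_iso: "\<forall>n m. correspondence_iso (E n \<otimes>\<^sub>m E m) (E (n + m)) (mult_map E n m)"
  using ps unfolding product_system_def by blast+

lemma E_semi_corr: "semi_corr (E n)"
  using ps_corr by (intro correspondence_semi_corr) blast

lemma E_semi_module: "semi_module (E n)"
  using E_semi_corr by (simp add: semi_corr_def)

lemma E_hmod: "hmod (E n)"
  using ps_corr unfolding correspondence_def by (intro hilbert_module_hmod) blast

lemma E_formal: "semi_module (formal_tensor (E n) (E m))"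
  by (intro semi_module_formal_tensor E_semi_module E_semi_corr)

lemma mult_car: "x \<in> car (E n) \<Longrightarrow> y \<in> car (E m) \<Longrightarrow> x * y \<in> car (E (n + m))"
  using ps_mult ps_car by simp

lemma mult_map_facts:
  shows mult_map_bij: "bij_betw (mult_map E n m) (car (E n \<otimes>\<^sub>m E m)) (car (E (n + m)))"
    and mult_map_add: "\<And>c d. c \<in> car (E n \<otimes>\<^sub>m E m) \<Longrightarrow> d \<in> car (E n \<otimes>\<^sub>m E m) \<Longrightarrow>
      mult_map E n m (add (E n \<otimes>\<^sub>m E m) c d) = add (E (n + m)) (mult_map E n m c) (mult_map E n m d)"
    and mult_map_lact: "\<And>c a. c \<in> car (E n \<otimes>\<^sub>m E m) \<Longrightarrow>
      mult_map E n m (lact (E n \<otimes>\<^sub>m E m) a c) = lact (E (n + m)) a (mult_map E n m c)"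
    and mult_map_ip: "\<And>c d. c \<in> car (E n \<otimes>\<^sub>m E m) \<Longrightarrow> d \<in> car (E n \<otimes>\<^sub>m E m) \<Longrightarrow>
      ip (E (n + m)) (mult_map E n m c) (mult_map E n m d) = ip (E n \<otimes>\<^sub>m E m) c d"
  using ps_iso unfolding correspondence_iso_def by blast+

lemma mult_map_car: "c \<in> car (E n \<otimes>\<^sub>m E m) \<Longrightarrow> mult_map E n m c \<in> car (E (n + m))"
  using mult_map_bij bij_betwE by blast

lemma mult_map_inj: "c \<in> car (E n \<otimes>\<^sub>m E m) \<Longrightarrow> d \<in> car (E n \<otimes>\<^sub>m E m) \<Longrightarrow>
    mult_map E n m c = mult_map E n m d \<Longrightarrow> c = d"
  using mult_map_bij unfolding bij_betw_def inj_on_def by blast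

text \<open>A priori \<open>mult_map\<close> takes the junk value of \<open>THE\<close> where the lift of the multiplication does not
  exist; by injectivity this happens for at most one class, and additivity excludes that class.\<close>

lemma mult_map_elem:
  assumes x: "x \<in> car (E n)" and y: "y \<in> car (E m)"
  shows "mult_map E n m (elem_tensor (E n) (E m) x y) = x * y"
proof -
  let ?X = "E (n + m)" and ?C = "E n \<otimes>\<^sub>m E m" and ?F = "formal_tensor (E n) (E m)"
  let ?U = "mult_map E n m"
  interpret X: hmod ?X by (rule E_hmod)
  interpret F: semi_module ?F by (rule E_formal)
  interpret C: hmod ?C unfolding tensor_def by (rule F.hmod_compl)
  define fsum where "fsum us = msum ?X (map (\<lambda>(x, y). x * y) us)" for us
  define lc where "lc us = cls ?F (\<lambda>_. us)" for us
  define conv where "conv c z \<longleftrightarrow> z \<in> car ?X \<and> (\<forall>u\<in>c. (\<lambda>k. mdist ?X (fsum (u k)) z) \<longlonglongrightarrow> 0)" for c z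
  have U: "?U c = (THE z. conv c z)" for c
    unfolding mult_map_def lift_def conv_def fsum_def ..
  have fsum_car: "fsum us \<in> car ?X" if "us \<in> car ?F" for us
    unfolding fsum_def using that mult_car by (intro X.msum_car) auto
  have lc_car: "lc us \<in> car ?C" if "us \<in> car ?F" for us
    unfolding lc_def tensor_def by (intro F.cls_car F.const_cauchy that)
  have lc_add: "add ?C (lc us) (lc vs) = lc (us @ vs)" if "us \<in> car ?F" "vs \<in> car ?F" for us vs
    unfolding lc_def tensor_def using F.add_compl[OF F.const_cauchy[OF that(1)] F.const_cauchy[OF that(2)]] by simp
  have conv_lc: "z = fsum us" if "us \<in> car ?F" "conv (lc us) z" for us z
  proof -
    have "(\<lambda>_. us) \<in> lc us" unfolding lc_def by (rule F.const_mem_cls[OF that(1)])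
    then have "(\<lambda>k::nat. mdist ?X (fsum us) z) \<longlonglongrightarrow> 0" and z: "z \<in> car ?X"
      using that(2) by (auto simp: conv_def)
    then have "mdist ?X (fsum us) z = 0" by (simp add: LIMSEQ_const_iff)
    then show ?thesis using X.separated[OF fsum_car[OF that(1)] z] by simp
  qed
  have U_lc: "?U (lc us) = fsum us" if "us \<in> car ?F" "\<exists>z. conv (lc us) z" for us
    unfolding U using that conv_lc by (metis the_equality)
  have junk: "c = d" if "\<not> (\<exists>z. conv c z)" "\<not> (\<exists>z. conv d z)" "c \<in> car ?C" "d \<in> car ?C" for c d
  proof -
    have "conv c = conv d" using that(1,2) by auto
    then have "?U c = ?U d" unfolding U by simp
    then show ?thesis using mult_map_inj that by blast
  qed
  define a where "a = x * y"
  define c where "c = lc [(x, y)]"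
  have a: "a \<in> car ?X" unfolding a_def by (rule mult_car[OF x y])
  have xy: "[(x, y)] \<in> car ?F" using x y by simp
  have c: "c \<in> car ?C" unfolding c_def by (rule lc_car[OF xy])
  have Uc: "?U c \<in> car ?X" by (rule mult_map_car[OF c])
  have celem: "elem_tensor (E n) (E m) x y = c" by (simp add: c_def lc_def elem_tensor_def)
  have fs1: "fsum [(x', y')] = x' * y'" if "x' \<in> car (E n)" "y' \<in> car (E m)" for x' y'
    unfolding fsum_def using X.add_zer[OF mult_car[OF that]] by simp
  have "?U c = a"
  proof (cases "\<exists>z. conv c z")
    case True
    then show ?thesis using U_lc[OF xy] fs1[OF x y] by (simp add: c_def a_def)
  next
    case False
    have good: "?U (lc us) = fsum us" if "us \<in> car ?F" "lc us \<noteq> c" for us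
      using U_lc[OF that(1)] junk[OF _ False lc_car[OF that(1)] c] that(2) by blast
    have Ucc: "?U (add ?C c c) = add ?X (?U c) (?U c)" by (rule mult_map_add[OF c c])
    have cc: "add ?C c c = lc [(x, y), (x, y)]" unfolding c_def using lc_add[OF xy xy] by simp
    show ?thesis
    proof (cases "add ?C c c = c")
      \<comment> \<open>The class c + c then has a genuine lift, so U c and a have the same
        double.\<close>
      case False
      have "?U (add ?C c c) = fsum [(x, y), (x, y)]"
        unfolding cc using x y False cc by (intro good) auto
      also have "\<dots> = add ?X a a" unfolding fsum_def a_def using X.add_zer a by (simp add: a_def)
      finally have "add ?X (?U c) (?U c) = add ?X a a" using Ucc by simp
      then have "ip ?X w (?U c) + ip ?X w (?U c) = ip ?X w a + ip ?X w a" if "w \<in> car ?X" for w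
        using that a Uc X.ip_add_right by metis
      then have "2 *\<^sub>R ip ?X w (?U c) = 2 *\<^sub>R ip ?X w a" if "w \<in> car ?X" for w
        using that by (simp only: scaleR_2)
      then show ?thesis using a Uc by (intro X.eq_by_ip[OF X.hmod_axioms]) auto
    next
      \<comment> \<open>c + c = c forces U c = 0 by additivity, and it remains to see that the
        product a is 0 as well.\<close>
      case True
      have U0: "ip ?X w (?U c) = 0" if w: "w \<in> car ?X" for w
      proof -
        have "ip ?X w (?U c) = ip ?X w (?U c) + ip ?X w (?U c)"
          using X.ip_add_right[OF w Uc Uc] Ucc True by simp
        then show ?thesis by simp
      qed
      have a0: "ip ?X w a = 0" if w: "w \<in> car ?X" for w
      \<comment> \<open>If some elementary tensor e differs from c, additivity at e + c compares a
        with U c = 0.\<close>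
      proof (cases "\<exists>x'\<in>car (E n). \<exists>y'\<in>car (E m). lc [(x', y')] \<noteq> c")
        case True
        then obtain x' y' where xy': "x' \<in> car (E n)" "y' \<in> car (E m)" "lc [(x', y')] \<noteq> c" by blast
        define e where "e = lc [(x', y')]"
        have ef: "[(x', y')] \<in> car ?F" using xy' by simp
        have e: "e \<in> car ?C" unfolding e_def by (rule lc_car[OF ef])
        have a': "x' * y' \<in> car ?X" by (rule mult_car[OF xy'(1,2)])
        have Ue: "?U e = x' * y'" unfolding e_def using good[OF ef xy'(3)] fs1[OF xy'(1,2)] by simp
        have ec: "add ?C e c = lc [(x', y'), (x, y)]" unfolding e_def c_def using lc_add[OF ef xy] by simp
        have Uec: "?U (add ?C e c) = add ?X (x' * y') (?U c)" using mult_map_add[OF e c] Ue by simp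
        show ?thesis
        proof (cases "add ?C e c = c")
          case False
          have "?U (add ?C e c) = fsum [(x', y'), (x, y)]"
            unfolding ec using xy' x y False ec by (intro good) auto
          also have "\<dots> = add ?X (x' * y') a" unfolding fsum_def using X.add_zer[OF a] by (simp add: a_def)
          finally have "ip ?X w (add ?X (x' * y') a) = ip ?X w (add ?X (x' * y') (?U c))" using Uec by simp
          then show ?thesis using w a a' Uc U0[OF w] by simp
        next
          case True
          have "ip ?X w' (x' * y') = ip ?X w' (?U c)" if w': "w' \<in> car ?X" for w'
            using X.ip_add_right[OF w' a' Uc] Uec True U0[OF w'] by simp
          then have "x' * y' = ?U c" using a' Uc by (intro X.eq_by_ip[OF X.hmod_axioms])
          then have "e = c" using mult_map_inj[OF e c] Ue by simp
          then show ?thesis using xy'(3) e_def by simp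
        qed
      next
        \<comment> \<open>Every elementary tensor is now the null class c, so all inner products
          vanish; a is the image of some class by surjectivity, and that class is null.\<close>
        case False
        then have all: "lc [(x', y')] = c" if "x' \<in> car (E n)" "y' \<in> car (E m)" for x' y' using that by blast
        have "ip ?C c c = 0" using mult_map_ip[OF c c] U0[OF Uc] by simp
        then have z: "ip (E m) y1 (lact (E m) (ip (E n) x1 x2) y2) = 0"
          if "x1 \<in> car (E n)" "y1 \<in> car (E m)" "x2 \<in> car (E n)" "y2 \<in> car (E m)" for x1 y1 x2 y2
          using tensor_compl_facts(2)[OF E_formal that] all that by (simp add: elem_tensor_def lc_def)
        obtain g where g: "g \<in> car ?C" "?U g = a"
          using a mult_map_bij[of n m] unfolding bij_betw_def by (metis imageE)
        obtain u where u: "u \<in> cauchy_seqs ?F" "g = cls ?F u"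
          using F.compl_cases g(1) unfolding tensor_def by metis
        have "ip ?F (u k) (u k) = 0" for k
        proof -
          have uk: "u k \<in> car ?F" using F.cauchy_range[OF u(1)] by blast
          show ?thesis unfolding ip_formal_tensor_nth
            by (intro sum.neutral ballI z formal_tensor_nth[OF uk]) simp_all
        qed
        then have "ip ?C g g = 0" using F.ip_compl_tendsto[OF u(1) u(1)]
          unfolding u(2) tensor_def by (simp add: LIMSEQ_const_iff)
        then have "ip ?X a a = 0" using mult_map_ip[OF g(1) g(1)] g(2) by simp
        then have "mnorm ?X a = 0" by (simp add: mnorm_def)
        then show ?thesis using X.cauchy_schwarz[OF w a] by simp
      qed
      show ?thesis using a Uc a0 U0 by (intro X.eq_by_ip[OF X.hmod_axioms]) auto
    qed
  qed
  then show ?thesis unfolding celem a_def .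
qed

lemma mult_inv_car: "\<xi> \<in> car (E (n + m)) \<Longrightarrow> mult_inv E n m \<xi> \<in> car (E n \<otimes>\<^sub>m E m)"
  using mult_map_bij unfolding mult_inv_def bij_betw_def by (simp add: inv_into_into)

lemma mult_map_inv: "\<xi> \<in> car (E (n + m)) \<Longrightarrow> mult_map E n m (mult_inv E n m \<xi>) = \<xi>"
  using mult_map_bij unfolding mult_inv_def bij_betw_def by (simp add: f_inv_into_f)

lemma mult_inv_eqI: "c \<in> car (E n \<otimes>\<^sub>m E m) \<Longrightarrow> mult_map E n m c = \<xi> \<Longrightarrow> mult_inv E n m \<xi> = c"
  using mult_map_inj mult_inv_car mult_map_inv mult_map_car by metis

lemma ip_mult_inv: "\<xi> \<in> car (E (n + m)) \<Longrightarrow> \<eta> \<in> car (E (n + m)) \<Longrightarrow>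
    ip (E n \<otimes>\<^sub>m E m) (mult_inv E n m \<xi>) (mult_inv E n m \<eta>) = ip (E (n + m)) \<xi> \<eta>"
  using mult_map_ip[OF mult_inv_car mult_inv_car] mult_map_inv by metis

lemma elem_E_car: "x \<in> car (E n) \<Longrightarrow> y \<in> car (E m) \<Longrightarrow> elem_tensor (E n) (E m) x y \<in> car (E n \<otimes>\<^sub>m E m)"
  by (rule tensor_compl_facts(1)[OF E_formal])

lemma mult_inv_mult: "x \<in> car (E n) \<Longrightarrow> y \<in> car (E m) \<Longrightarrow>
    mult_inv E n m (x * y) = elem_tensor (E n) (E m) x y"
  by (intro mult_inv_eqI elem_E_car mult_map_elem)

lemma mult_inv_lact:
  assumes "\<xi> \<in> car (E (n + m))"
  shows "mult_inv E n m (lact (E (n + m)) a \<xi>) = lact (E n \<otimes>\<^sub>m E m) a (mult_inv E n m \<xi>)"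
proof (rule mult_inv_eqI)
  have "semi_corr (E n \<otimes>\<^sub>m E m)" by (intro semi_corr_tensor E_semi_corr)
  then show "lact (E n \<otimes>\<^sub>m E m) a (mult_inv E n m \<xi>) \<in> car (E n \<otimes>\<^sub>m E m)"
    by (intro semi_corr.lact_car mult_inv_car assms)
qed (simp add: mult_map_lact mult_inv_car mult_map_inv assms)

end

section \<open>Operators and translates along words\<close>

locale ps_iso_rep = prod_sys p E \<iota> + star_rep \<rho>
  for p :: "'e::semigroup_mult \<Rightarrow> (nat, 'k::finite) vec"
    and E :: "(nat, 'k) vec \<Rightarrow> ('a::unital_cstar_algebra, 'a, 'e) corr" and \<iota> :: "'a \<Rightarrow> 'e"
    and \<rho> :: "'a \<Rightarrow> 'h \<Rightarrow> 'h::chilbert_space" +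
  fixes S :: "'k \<Rightarrow> 'e \<Rightarrow> 'h \<Rightarrow> 'h"
  assumes act: "\<And>i. iso_action \<rho> (gen_fibre E i) (S i)"
    and commute: "ps_representation E UNIV S \<rho>"
begin

sublocale A: iso_action \<rho> "gen_fibre E i" "S i" for i
  by (rule act)

abbreviation tw :: "'k list \<Rightarrow> ('e, 'h) tens \<Rightarrow> 'h"
  where "tw w \<equiv> tilde_word E \<iota> UNIV S \<rho> w"

text \<open>For the canonical word of n this is \<open>ps_rep_at\<close> at n; arbitrary words make
  induction on the list possible.\<close>

definition word_op :: "'k list \<Rightarrow> 'e \<Rightarrow> 'h \<Rightarrow> 'h"
  where "word_op w \<xi> h = tw w (elem_tensor (E (word_deg w)) hs \<xi> h)"

text \<open>The two properties of the tail that \<open>assoc_step\<close> requires for adding a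
  letter, used as an induction invariant.\<close>

definition good_word :: "'k list \<Rightarrow> bool"
  where "good_word w \<longleftrightarrow> ip_map (E (word_deg w)) (tw w) \<and>
    (\<forall>\<xi>\<in>car (E (word_deg w)). \<forall>a h. word_op w (lact (E (word_deg w)) a \<xi>) h = \<rho> a (word_op w \<xi> h))"

lemma word_deg_simps [simp]: "word_deg [] = 0" "word_deg (i # w) = axis i 1 + word_deg w"
  by (simp_all add: word_deg_def)

lemma good_word_Nil: "good_word []"
proof -
  interpret E0: hmod "E 0" by (rule E_hmod)
  have bij: "bij_betw \<iota> UNIV (car (E 0))" and ip: "ip (E 0) (\<iota> a) (\<iota> b) = star a * b"
    and la: "\<iota> (a * b) = lact (E 0) a (\<iota> b)" for a b
    using ps_unit[unfolded correspondence_iso_def alg_corr_def, simplified] by blast+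
  have inv: "inv \<iota> (\<iota> a) = a" for a using bij by (simp add: bij_betw_def)
  have ex: "\<exists>a. x = \<iota> a" if "x \<in> car (E 0)" for x using bij that unfolding bij_betw_def by blast
  interpret l: iso_lift "E 0" hs hs "\<lambda>x. \<rho> (inv \<iota> x)"
  proof (intro iso_lift.intro iso_lift_axioms.intro hmod_hs semi_module_formal_tensor E_semi_module hs.semi_corr_axioms)
    fix x y x' y' assume "x \<in> car (E 0)" "x' \<in> car (E 0)"
    then obtain a b where "x = \<iota> a" "x' = \<iota> b" using ex by blast
    then show "ip hs (\<rho> (inv \<iota> x) y) (\<rho> (inv \<iota> x') y') = ip hs y (lact hs (ip (E 0) x x') y')"
      by (simp add: inv ip cinner_rho rho_mult)
  qed simp
  have tw: "tw [] = lift hs (\<lambda>x. \<rho> (inv \<iota> x))" by (simp add: tilde_def)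
  have op: "word_op [] x h = \<rho> (inv \<iota> x) h" if "x \<in> car (E 0)" for x h
    unfolding word_op_def tw using l.lift_elem that by simp
  have lact: "word_op [] (lact (E 0) a x) h = \<rho> a (word_op [] x h)" if x: "x \<in> car (E 0)" for x a h
  proof -
    obtain b where b: "x = \<iota> b" using ex x by blast
    have "lact (E 0) a x = \<iota> (a * b)" "lact (E 0) a x \<in> car (E 0)"
      using la b semi_corr.lact_car[OF E_semi_corr x] by simp_all
    then show ?thesis using op x inv b by (simp add: rho_mult)
  qed
  show ?thesis
    unfolding good_word_def using lact l.ip_lift by (simp add: ip_map_def tw del: tilde_word.simps)
qed

lemma assoc_step_word: 
  assumes "good_word w" shows "assoc_step \<rho> (gen_fibre E i) (S i) (E (word_deg w)) (tw w)"
  using assms unfolding good_word_def word_op_def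
  by (intro assoc_step.intro assoc_step_axioms.intro star_rep_axioms act E_semi_corr) auto

text \<open>Undoing the multiplication preserves inner products, so a letter is added by an
  isometric lift followed by the composite of \<open>assoc_step\<close>; the limit formula is
  \<open>comp_tendsto\<close> for that composite.\<close>

lemma word_Cons:
  assumes "good_word w"
  shows word_Cons_ip: "ip_map (E (word_deg (i # w))) (tw (i # w))"
    and word_Cons_tendsto: "\<And>\<xi> h u. \<xi> \<in> car (E (word_deg (i # w))) \<Longrightarrow>
      u \<in> mult_inv E (axis i 1) (word_deg w) \<xi> \<Longrightarrow>
      (\<lambda>n. \<Sum>(x, y)\<leftarrow>u n. S i x (word_op w y h)) \<longlonglongrightarrow> word_op (i # w) \<xi> h"
proof -
  interpret s: assoc_step \<rho> "gen_fibre E i" "S i" "E (word_deg w)" "tw w" by (rule assoc_step_word[OF assms])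
  let ?E = "E (word_deg (i # w))" and ?mi = "mult_inv E (axis i 1) (word_deg w)"
  interpret Q: semi_corr s.Q by (rule s.Q)
  have fQ: "semi_module (formal_tensor s.Q hs)"
    by (intro semi_module_formal_tensor Q.semi_module_axioms hs.semi_corr_axioms)
  interpret m: iso_lift ?E hs "s.Q \<otimes>\<^sub>m hs" "\<lambda>\<xi> h. elem_tensor s.Q hs (?mi \<xi>) h"
  proof (intro iso_lift.intro iso_lift_axioms.intro semi_module_formal_tensor E_semi_module hs.semi_corr_axioms)
    show "hmod (s.Q \<otimes>\<^sub>m hs)" by (intro hmod_tensor Q.semi_module_axioms hs.semi_corr_axioms)
    show "elem_tensor s.Q hs (?mi \<xi>) h \<in> car (s.Q \<otimes>\<^sub>m hs)" if "\<xi> \<in> car ?E" for \<xi> h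
      using tensor_compl_facts(1)[OF fQ mult_inv_car] that by simp
    show "ip (s.Q \<otimes>\<^sub>m hs) (elem_tensor s.Q hs (?mi \<xi>) h) (elem_tensor s.Q hs (?mi \<eta>) k)
        = ip hs h (lact hs (ip ?E \<xi> \<eta>) k)" if "\<xi> \<in> car ?E" "\<eta> \<in> car ?E" for \<xi> h \<eta> k
      using tensor_compl_facts(2)[OF fQ mult_inv_car _ mult_inv_car] that by (simp add: ip_mult_inv)
  qed
  have tw: "tw (i # w) c = s.comp (lift (s.Q \<otimes>\<^sub>m hs) (\<lambda>\<xi> h. elem_tensor s.Q hs (?mi \<xi>) h) c)" for c
    by (simp add: s.comp_def tensor_map_def)
  show "ip_map ?E (tw (i # w))"
    unfolding ip_map_def tw using m.ip_lift s.ip_comp m.lift_spec(1) by simp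
  show "(\<lambda>n. \<Sum>(x, y)\<leftarrow>u n. S i x (word_op w y h)) \<longlonglongrightarrow> word_op (i # w) \<xi> h"
    if \<xi>: "\<xi> \<in> car ?E" and u: "u \<in> ?mi \<xi>" for \<xi> h u
  proof -
    have "word_op (i # w) \<xi> h = s.comp (elem_tensor s.Q hs (?mi \<xi>) h)"
      unfolding word_op_def tw using m.lift_elem[OF \<xi>, of h] by simp
    then show ?thesis using s.comp_tendsto[OF _ u, of h] mult_inv_car \<xi> by (simp add: word_op_def)
  qed
qed

lemma good_word_Cons:
  assumes w: "good_word w" shows "good_word (i # w)"
proof -
  let ?E = "E (word_deg (i # w))" and ?mi = "mult_inv E (axis i 1) (word_deg w)"
  interpret FF: semi_corr "formal_tensor (gen_fibre E i) (E (word_deg w))"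
    by (intro semi_corr_formal_tensor E_semi_corr)
  have "word_op (i # w) (lact ?E a \<xi>) h = \<rho> a (word_op (i # w) \<xi> h)" if \<xi>: "\<xi> \<in> car ?E" for \<xi> a h
  proof -
    have mi: "?mi \<xi> \<in> car (gen_fibre E i \<otimes>\<^sub>m E (word_deg w))" using mult_inv_car \<xi> by simp
    obtain u where u: "u \<in> cauchy_seqs (formal_tensor (gen_fibre E i) (E (word_deg w)))"
      "?mi \<xi> = cls (formal_tensor (gen_fibre E i) (E (word_deg w))) u"
      using mi FF.compl_cases unfolding tensor_def by metis
    have um: "u \<in> ?mi \<xi>" using u FF.cls_self by simp
    have "?mi (lact ?E a \<xi>) = cls (formal_tensor (gen_fibre E i) (E (word_deg w)))
        (\<lambda>n. lact (formal_tensor (gen_fibre E i) (E (word_deg w))) a (u n))"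
      using mult_inv_lact[of \<xi> "axis i 1" "word_deg w" a] \<xi> FF.lact_compl[OF u(1), of a] u(2)
      by (simp add: tensor_def)
    then have lm: "(\<lambda>n. lact (formal_tensor (gen_fibre E i) (E (word_deg w))) a (u n)) \<in> ?mi (lact ?E a \<xi>)"
      using FF.cls_self[OF FF.cauchy_lact[OF u(1)]] by simp
    have "(\<lambda>n. \<Sum>(x, y)\<leftarrow>lact (formal_tensor (gen_fibre E i) (E (word_deg w))) a (u n). S i x (word_op w y h))
        \<longlonglongrightarrow> word_op (i # w) (lact ?E a \<xi>) h"
      by (rule word_Cons_tendsto[OF w semi_corr.lact_car[OF E_semi_corr \<xi>] lm])
    moreover have "(\<Sum>(x, y)\<leftarrow>lact (formal_tensor (gen_fibre E i) (E (word_deg w))) a (u n). S i x (word_op w y h))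
        = \<rho> a (\<Sum>(x, y)\<leftarrow>u n. S i x (word_op w y h))" for n
    proof -
      have "set us \<subseteq> car (gen_fibre E i) \<times> car (E (word_deg w)) \<Longrightarrow>
        (\<Sum>(x, y)\<leftarrow>us. S i (lact (gen_fibre E i) a x) (word_op w y h)) = \<rho> a (\<Sum>(x, y)\<leftarrow>us. S i x (word_op w y h))" for us
        using rho_lin(2)[of a 0 0] by (induction us) (auto simp: A.T_lact rho_lin)
      moreover have "set (u n) \<subseteq> car (gen_fibre E i) \<times> car (E (word_deg w))"
        using FF.cauchy_range[OF u(1)] by (auto simp: image_subset_iff)
      ultimately show ?thesis by (simp add: o_def case_prod_unfold)
    qed
    moreover have "(\<lambda>n. \<rho> a (\<Sum>(x, y)\<leftarrow>u n. S i x (word_op w y h))) \<longlonglongrightarrow> \<rho> a (word_op (i # w) \<xi> h)"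
      by (intro bounded_linear.tendsto[OF bounded_op_UNIV_bounded_linear[OF rho_bounded]]
          word_Cons_tendsto[OF w \<xi> um])
    ultimately show ?thesis using LIMSEQ_unique by simp
  qed
  then show ?thesis unfolding good_word_def using word_Cons_ip[OF w] by blast
qed

lemma good_word: "good_word w"
  by (induction w) (auto intro: good_word_Nil good_word_Cons)

lemma word_op_action: "iso_action \<rho> (E (word_deg w)) (word_op w)"
proof (intro iso_action.intro iso_action_axioms.intro star_rep_axioms E_semi_corr)
  show "cinner (word_op w \<xi> h) (word_op w \<eta> k) = cinner h (\<rho> (ip (E (word_deg w)) \<xi> \<eta>) k)"
    if "\<xi> \<in> car (E (word_deg w))" "\<eta> \<in> car (E (word_deg w))" for \<xi> \<eta> h k
    using good_word[of w] that unfolding word_op_def good_word_def by (intro ip_map_elem E_semi_corr) auto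
qed (use good_word in \<open>simp add: good_word_def\<close>)

sublocale W: iso_action \<rho> "E (word_deg w)" "word_op w" for w
  by (rule word_op_action)

lemma word_op_mult:
  assumes x: "x \<in> car (gen_fibre E i)" and y: "y \<in> car (E (word_deg w))"
  shows "word_op (i # w) (x * y) h = S i x (word_op w y h)"
proof -
  interpret F: semi_module "formal_tensor (gen_fibre E i) (E (word_deg w))" by (rule E_formal)
  have "(\<lambda>_. [(x, y)]) \<in> mult_inv E (axis i 1) (word_deg w) (x * y)"
    unfolding mult_inv_mult[OF x y] elem_tensor_def using x y by (intro F.const_mem_cls) simp
  then have "(\<lambda>_::nat. S i x (word_op w y h)) \<longlonglongrightarrow> word_op (i # w) (x * y) h"
    using word_Cons_tendsto[OF good_word, of "x * y" i w "\<lambda>_. [(x, y)]" h] mult_car[OF x y] by simp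
  then show ?thesis by (simp add: LIMSEQ_const_iff)
qed

abbreviation step :: "'k \<Rightarrow> 'h set \<Rightarrow> 'h set"
  where "step i \<equiv> iso_action.step (gen_fibre E i) (S i)"

abbreviation word_step :: "'k list \<Rightarrow> 'h set \<Rightarrow> 'h set"
  where "word_step w \<equiv> iso_action.step (E (word_deg w)) (word_op w)"

text \<open>The empty word acts through \<rho>: invariance of X gives one inclusion, the unit the
  other.\<close>

lemma word_step_Nil:
  assumes "inv_sub \<rho> X" shows "word_step [] X = X"
proof -
  have bij: "bij_betw \<iota> UNIV (car (E 0))" using ps_unit unfolding correspondence_iso_def by (simp add: alg_corr_def)
  interpret l: iso_lift "E 0" hs hs "\<lambda>x. \<rho> (inv \<iota> x)"
  proof (intro iso_lift.intro iso_lift_axioms.intro hmod_hs semi_module_formal_tensor E_semi_module hs.semi_corr_axioms)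
    fix x y x' y' assume "x \<in> car (E 0)" "x' \<in> car (E 0)"
    then obtain a b where "x = \<iota> a" "x' = \<iota> b" using bij unfolding bij_betw_def by blast
    moreover have "ip (E 0) (\<iota> a) (\<iota> b) = star a * b" for a b
      using ps_unit unfolding correspondence_iso_def by (simp add: alg_corr_def)
    moreover have "inv \<iota> (\<iota> a) = a" for a using bij by (simp add: bij_betw_def)
    ultimately show "ip hs (\<rho> (inv \<iota> x) y) (\<rho> (inv \<iota> x') y') = ip hs y (lact hs (ip (E 0) x x') y')"
      by (simp add: cinner_rho rho_mult)
  qed simp
  have op: "word_op [] x h = \<rho> (inv \<iota> x) h" if "x \<in> car (E 0)" for x h
    unfolding word_op_def using l.lift_elem that by (simp add: tilde_def)
  show ?thesis
  proof
    show "word_step [] X \<subseteq> X"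
      using inv_subD[OF assms] by (intro W.step_minimal) (auto simp: op)
    show "X \<subseteq> word_step [] X"
    proof
      fix h assume h: "h \<in> X"
      have "\<iota> 1 \<in> car (E 0)" "inv \<iota> (\<iota> 1) = 1" using bij by (auto simp: bij_betw_def)
      then have "word_op [] (\<iota> 1) h = h" using op by simp
      then show "h \<in> word_step [] X" using W.T_step[of "\<iota> 1" "[]" h X] h \<open>\<iota> 1 \<in> car (E 0)\<close> by simp
    qed
  qed
qed

text \<open>One inclusion holds because elements at the longer degree act as limits of sums over
  products x y (\<open>word_Cons_tendsto\<close>), the other because each single product is such an
  element (\<open>word_op_mult\<close>).\<close>

lemma word_step_Cons: "word_step (i # w) X = step i (word_step w X)"
proof
  interpret F: semi_module "formal_tensor (gen_fibre E i) (E (word_deg w))" by (rule E_formal)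
  have sub: "csubspace (step i (word_step w X))" "closed (step i (word_step w X))"
    using closed_csubspaceD[OF A.closed_step] by blast+
  show "word_step (i # w) X \<subseteq> step i (word_step w X)"
  proof (rule W.step_minimal[OF A.closed_step])
    fix \<xi> h assume \<xi>: "\<xi> \<in> car (E (word_deg (i # w)))" and h: "h \<in> X"
    have mi: "mult_inv E (axis i 1) (word_deg w) \<xi> \<in> car (gen_fibre E i \<otimes>\<^sub>m E (word_deg w))"
      using mult_inv_car \<xi> by simp
    obtain u where u: "u \<in> cauchy_seqs (formal_tensor (gen_fibre E i) (E (word_deg w)))"
      "mult_inv E (axis i 1) (word_deg w) \<xi> = cls (formal_tensor (gen_fibre E i) (E (word_deg w))) u"
      using mi F.compl_cases unfolding tensor_def by metis
    have "set us \<subseteq> car (gen_fibre E i) \<times> car (E (word_deg w)) \<Longrightarrow>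
        (\<Sum>(x, y)\<leftarrow>us. S i x (word_op w y h)) \<in> step i (word_step w X)" for us
      using h by (induction us) (auto intro!: closed_csubspaceD(3,4)[OF A.closed_step] A.T_step W.T_step)
    moreover have "set (u n) \<subseteq> car (gen_fibre E i) \<times> car (E (word_deg w))" for n
      using F.cauchy_range[OF u(1)] by (auto simp: image_subset_iff)
    ultimately have 1: "(\<Sum>(x, y)\<leftarrow>u n. S i x (word_op w y h)) \<in> step i (word_step w X)" for n by blast
    have 2: "(\<lambda>n. \<Sum>(x, y)\<leftarrow>u n. S i x (word_op w y h)) \<longlonglongrightarrow> word_op (i # w) \<xi> h"
      using word_Cons_tendsto[OF good_word \<xi>] F.cls_self[OF u(1)] u(2) by simp
    show "word_op (i # w) \<xi> h \<in> step i (word_step w X)"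
      by (rule closed_sequentially[OF sub(2) 1 2])
  qed
  show "step i (word_step w X) \<subseteq> word_step (i # w) X"
  proof (rule A.step_minimal[OF W.closed_step])
    fix x h assume x: "x \<in> car (gen_fibre E i)" and h: "h \<in> word_step w X"
    show "S i x h \<in> word_step (i # w) X"
    proof (rule closed_cspan_image[OF A.T_bounded[OF x] _ W.closed_step h[unfolded W.step_def]])
      fix k assume "k \<in> W.gens w X"
      then obtain y v where k: "k = word_op w y v" "y \<in> car (E (word_deg w))" "v \<in> X" by (auto simp: W.gens_def)
      then show "S i x k \<in> word_step (i # w) X"
        using W.T_step[of "x * y" "i # w" v X] word_op_mult[OF x k(2)] mult_car[OF x k(2)] by simp
    qed
  qed
qed

lemma word_step_eq: "inv_sub \<rho> X \<Longrightarrow> word_step w X = foldr step w X"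
proof (induction w)
  case Nil
  then show ?case by (simp add: word_step_Nil del: word_deg_simps)
next
  case (Cons i w)
  then show ?case unfolding word_step_Cons by simp
qed

text \<open>The flip preserves inner products, so the commutation relation can be evaluated on
  elementary tensors: \<open>S i x (S j y v)\<close> becomes a limit of sums of vectors
  \<open>S j y' (S i x' v)\<close>.\<close>

lemma step_commute: "step i (step j X) \<subseteq> step j (step i X)"
proof (rule A.step_minimal[OF A.closed_step])
  fix x h assume x: "x \<in> car (gen_fibre E i)" and h: "h \<in> step j X"
  let ?Ei = "gen_fibre E i" and ?Ej = "gen_fibre E j"
  have tld: "ip_map (gen_fibre E l) (tilde UNIV (S l) \<rho>)"
    "y \<in> car (gen_fibre E l) \<Longrightarrow> tilde UNIV (S l) \<rho> (elem_tensor (gen_fibre E l) hs y h) = S l y h" for l y h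
  proof -
    interpret l: iso_lift "gen_fibre E l" hs hs "S l"
      by (intro iso_lift.intro iso_lift_axioms.intro semi_module_formal_tensor E_semi_module
          hs.semi_corr_axioms hmod_hs) (simp_all add: A.iso)
    show "ip_map (gen_fibre E l) (tilde UNIV (S l) \<rho>)" using l.ip_lift by (simp add: ip_map_def tilde_def)
    show "tilde UNIV (S l) \<rho> (elem_tensor (gen_fibre E l) hs y h) = S l y h" if "y \<in> car (gen_fibre E l)" for y h
      using l.lift_elem that by (simp add: tilde_def)
  qed
  have step: "assoc_step \<rho> (gen_fibre E l) (S l) (gen_fibre E l') (tilde UNIV (S l') \<rho>)" for l l'
    by (intro assoc_step.intro assoc_step_axioms.intro star_rep_axioms act E_semi_corr tld(1))
      (simp add: tld(2) semi_corr.lact_car[OF E_semi_corr] A.T_lact)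
  interpret l: assoc_step \<rho> ?Ei "S i" ?Ej "tilde UNIV (S j) \<rho>" by (rule step)
  interpret r: assoc_step \<rho> ?Ej "S j" ?Ei "tilde UNIV (S i) \<rho>" by (rule step)
  interpret lQ: semi_corr l.Q by (rule l.Q)
  interpret rQ: semi_corr r.Q by (rule r.Q)
  have fl: "semi_module (formal_tensor l.Q hs)" and fr: "semi_module (formal_tensor r.Q hs)"
    by (intro semi_module_formal_tensor lQ.semi_module_axioms rQ.semi_module_axioms hs.semi_corr_axioms)+
  have ij: "axis j 1 + axis i 1 = (axis i 1 + axis j 1 :: (nat, 'k) vec)" by (rule add.commute)
  have flip_car: "flip E i j c \<in> car r.Q" if "c \<in> car l.Q" for c
    unfolding flip_def using mult_map_car[OF that] by (intro mult_inv_car) (simp add: ij)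
  have flip_ip: "ip r.Q (flip E i j c) (flip E i j d) = ip l.Q c d" if "c \<in> car l.Q" "d \<in> car l.Q" for c d
    unfolding flip_def using mult_map_car[OF that(1)] mult_map_car[OF that(2)] mult_map_ip[OF that]
    by (subst ip_mult_inv) (simp_all add: ij)
  interpret fl: iso_lift l.Q hs "r.Q \<otimes>\<^sub>m hs" "\<lambda>c h. elem_tensor r.Q hs (flip E i j c) h"
    using tensor_compl_facts(1)[OF fr flip_car] tensor_compl_facts(2)[OF fr flip_car _ flip_car]
    by (intro iso_lift.intro iso_lift_axioms.intro fl hmod_tensor rQ.semi_module_axioms hs.semi_corr_axioms)
      (simp_all add: flip_ip)
  have eq: "\<forall>w\<in>car (l.Q \<otimes>\<^sub>m hs). l.comp w = r.comp (lift (r.Q \<otimes>\<^sub>m hs) (\<lambda>c h. elem_tensor r.Q hs (flip E i j c) h) w)"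
    using commute unfolding ps_representation_def l.comp_def r.comp_def tensor_map_def id_apply by blast
  have key: "S i x (S j y v) \<in> step j (step i X)" if y: "y \<in> car ?Ej" and v: "v \<in> X" for y v
  proof -
    let ?c = "elem_tensor ?Ei ?Ej x y"
    have c: "?c \<in> car l.Q" by (rule elem_E_car[OF x y])
    have w: "elem_tensor l.Q hs ?c v \<in> car (l.Q \<otimes>\<^sub>m hs)" using tensor_compl_facts(1)[OF fl c] by simp
    interpret F: semi_module "formal_tensor ?Ei ?Ej" by (rule E_formal)
    interpret G: semi_module "formal_tensor ?Ej ?Ei" by (rule E_formal)
    have "(\<lambda>_. [(x, y)]) \<in> ?c" unfolding elem_tensor_def using x y by (intro F.const_mem_cls) simp
    from l.comp_tendsto[OF c this, of v] have "l.comp (elem_tensor l.Q hs ?c v) = S i x (S j y v)"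
      using tld(2)[OF y] by (simp add: LIMSEQ_const_iff)
    then have e: "S i x (S j y v) = r.comp (elem_tensor r.Q hs (flip E i j ?c) v)"
      using eq w fl.lift_elem[OF c, of v] by simp
    obtain u where u: "u \<in> cauchy_seqs (formal_tensor ?Ej ?Ei)" "flip E i j ?c = cls (formal_tensor ?Ej ?Ei) u"
      using flip_car[OF c] G.compl_cases unfolding tensor_def by metis
    have "set us \<subseteq> car ?Ej \<times> car ?Ei \<Longrightarrow>
        (\<Sum>(y, x)\<leftarrow>us. S j y (tilde UNIV (S i) \<rho> (elem_tensor ?Ei hs x v))) \<in> step j (step i X)" for us
      using v by (induction us)
        (auto simp: tld(2) intro!: closed_csubspaceD(3,4)[OF A.closed_step] A.T_step)
    moreover have "set (u n) \<subseteq> car ?Ej \<times> car ?Ei" for n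
      using G.cauchy_range[OF u(1)] by (auto simp: image_subset_iff)
    ultimately have 1: "(\<Sum>(y, x)\<leftarrow>u n. S j y (tilde UNIV (S i) \<rho> (elem_tensor ?Ei hs x v))) \<in> step j (step i X)" for n
      by blast
    have 2: "(\<lambda>n. \<Sum>(y, x)\<leftarrow>u n. S j y (tilde UNIV (S i) \<rho> (elem_tensor ?Ei hs x v))) \<longlonglongrightarrow> S i x (S j y v)"
      unfolding e using u G.cls_self by (intro r.comp_tendsto flip_car c) simp
    show ?thesis by (rule closed_sequentially[OF closed_csubspaceD(2)[OF A.closed_step] 1 2])
  qed
  show "S i x h \<in> step j (step i X)"
  proof (rule closed_cspan_image[OF A.T_bounded[OF x] _ A.closed_step h[unfolded A.step_def]])
    fix k assume "k \<in> A.gens j X"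
    then obtain y v where "k = S j y v" "y \<in> car ?Ej" "v \<in> X" by (auto simp: A.gens_def)
    then show "S i x k \<in> step j (step i X)" using key by simp
  qed
qed

end

subsection \<open>Jointly coinvariant subspaces\<close>

lemma orth_compl_eq_zero:
  assumes "closed_csubspace (L::'h::chilbert_space set)" "orth_compl L = {0}"
  shows "L = UNIV"
proof -
  have "orth_compl {0::'h} = UNIV" by (simp add: orth_compl_def cinner.zero_left)
  then show ?thesis using closed_sub.orth_orth[OF closed_sub.intro[OF assms(1)]] assms(2) by simp
qed

context iso_action
begin

definition coinv :: "'h set \<Rightarrow> bool"
  where "coinv Z \<longleftrightarrow> inv_sub \<rho> Z \<and> Z \<subseteq> step Z"

definition minimal_coinv :: "'h set \<Rightarrow> bool"
  where "minimal_coinv N \<longleftrightarrow> coinv N \<and> N \<noteq> {0} \<and> (\<forall>M. coinv M \<and> M \<noteq> {0} \<and> M \<subseteq> N \<longrightarrow> M = N)"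

lemma coinv_closed_cspan:
  assumes "\<And>Y. Y \<in> \<Y> \<Longrightarrow> coinv Y" shows "coinv (closed_cspan (\<Union>\<Y>))"
  unfolding coinv_def
proof
  show "inv_sub \<rho> (closed_cspan (\<Union>\<Y>))"
  proof (rule inv_sub_closed_cspan)
    fix a x assume "x \<in> \<Union>\<Y>"
    then have "\<rho> a x \<in> \<Union>\<Y>" using assms inv_subD(2) unfolding coinv_def by blast
    then show "\<rho> a x \<in> closed_cspan (\<Union>\<Y>)" by (rule subsetD[OF closed_cspan_superset])
  qed
  have "Y \<subseteq> step (closed_cspan (\<Union>\<Y>))" if "Y \<in> \<Y>" for Y
  proof -
    have "Y \<subseteq> closed_cspan (\<Union>\<Y>)" using that closed_cspan_superset[of "\<Union>\<Y>"] by blast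
    then show ?thesis using assms[OF that] step_mono unfolding coinv_def by blast
  qed
  then show "closed_cspan (\<Union>\<Y>) \<subseteq> step (closed_cspan (\<Union>\<Y>))"
    by (intro closed_cspan_minimal closed_step) blast
qed

lemma coinv_closed: "coinv Z \<Longrightarrow> closed_csubspace Z"
  by (simp add: coinv_def inv_sub_def)

end

context full_action
begin

lemma coinv_inter: "coinv Y \<Longrightarrow> coinv Z \<Longrightarrow> coinv (Y \<inter> Z)"
  unfolding coinv_def using coinv_Int inv_sub_Int by blast

lemma coinv_orth:
  assumes "inv_sub \<rho> L" "step L \<subseteq> L" shows "coinv (orth_compl L)"
  using coinv_iff[OF inv_sub_orth[OF assms(1)]] inv_sub_orth[OF assms(1)] T_step assms(2)
    closed_sub.orth_orth[OF closed_sub.intro[OF inv_subD(1)[OF assms(1)]]]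
  unfolding coinv_def by blast

text \<open>Cyclicity first passes from Z to Z \<inter> V by \<open>coinv_subset_reach\<close>; this
  intersection then takes the place of V in \<open>coinv_meets\<close>.\<close>

lemma coinv_meets_full:
  assumes V: "fin_dim V" "coinv V" "reach V = UNIV" and Z: "coinv Z" "reach Z = UNIV" and N: "coinv N" "N \<noteq> {0}"
  shows "N \<inter> (Z \<inter> V) \<noteq> {0}"
proof -
  have "Z \<subseteq> reach (Z \<inter> V)" using V Z coinv_subset_reach[of V Z] by (simp add: coinv_def)
  then have "reach Z \<subseteq> reach (Z \<inter> V)" by (intro reach_minimal closed_reach step_reach_subset)
  then have "N \<subseteq> reach (Z \<inter> V)" using Z(2) by blast
  moreover have "fin_dim (Z \<inter> V)"
    using fin_dim_subspace[OF V(1)] coinv_closed[OF coinv_inter[OF Z(1) V(2)]] closed_csubspaceD(1) by blast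
  ultimately show ?thesis
    using coinv_meets[of "Z \<inter> V" N] coinv_inter[OF Z(1) V(2)] N by (simp add: coinv_def)
qed

lemma minimal_subset_cyclic:
  assumes "fin_dim V" "coinv V" "reach V = UNIV" "coinv Z" "reach Z = UNIV" "minimal_coinv N"
  shows "N \<subseteq> Z"
proof -
  have N: "coinv N" "N \<noteq> {0}" using assms(6) by (auto simp: minimal_coinv_def)
  have "coinv (N \<inter> (Z \<inter> V))" by (intro coinv_inter N assms)
  moreover have "N \<inter> (Z \<inter> V) \<noteq> {0}" by (rule coinv_meets_full[OF assms(1-5) N])
  ultimately have "N \<inter> (Z \<inter> V) = N" using assms(6) by (simp add: minimal_coinv_def)
  then show ?thesis by blast
qed

text \<open>W is the closed span of the minimal coinvariant subspaces of V. If its reach had a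
  non-zero complement, that complement, being coinvariant, would meet V and so contain a minimal
  coinvariant subspace, which lies in W as well.\<close>

lemma minimal_span:
  assumes V: "fin_dim V" "coinv V" "reach V = UNIV"
  obtains W where "coinv W" "W \<subseteq> V" "reach W = UNIV" "\<And>Z. coinv Z \<Longrightarrow> reach Z = UNIV \<Longrightarrow> W \<subseteq> Z"
proof
  define W where "W = closed_cspan (\<Union>{N. minimal_coinv N \<and> N \<subseteq> V})"
  show W: "coinv W" unfolding W_def by (rule coinv_closed_cspan) (auto simp: minimal_coinv_def)
  show "W \<subseteq> V" unfolding W_def by (intro closed_cspan_minimal coinv_closed V) blast
  show "W \<subseteq> Z" if "coinv Z" "reach Z = UNIV" for Z
    unfolding W_def using minimal_subset_cyclic[OF V that] by (intro closed_cspan_minimal coinv_closed that) blast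
  let ?K = "orth_compl (reach W) \<inter> V"
  have Wi: "inv_sub \<rho> W" "W \<subseteq> step W" using W by (auto simp: coinv_def)
  have L: "coinv (orth_compl (reach W))" by (intro coinv_orth inv_sub_reach Wi step_reach_subset)
  have "orth_compl (reach W) = {0}"
  proof (rule ccontr)
    assume "orth_compl (reach W) \<noteq> {0}"
    then have K: "coinv ?K" "?K \<noteq> {0}"
      using coinv_inter[OF L V(2)] coinv_meets_full[OF V V(2,3) L] by auto
    have "coinv Y \<and> Y \<noteq> {0} \<and> Y \<subseteq> V \<Longrightarrow> csubspace Y \<and> Y \<subseteq> V" for Y
      using closed_csubspaceD(1)[OF coinv_closed] by blast
    then obtain N where N: "coinv N \<and> N \<noteq> {0} \<and> N \<subseteq> V" "N \<subseteq> ?K"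
      "\<And>M. coinv M \<and> M \<noteq> {0} \<and> M \<subseteq> V \<Longrightarrow> M \<subseteq> N \<Longrightarrow> M = N"
      using csubspace_minimal_exists[OF V(1), of "\<lambda>Y. coinv Y \<and> Y \<noteq> {0} \<and> Y \<subseteq> V" ?K] K by auto
    have "minimal_coinv N" using N(1,3) by (auto simp: minimal_coinv_def)
    then have "N \<subseteq> W" using N(1) closed_cspan_superset[of "\<Union>{N. minimal_coinv N \<and> N \<subseteq> V}"] unfolding W_def by blast
    then have "N \<subseteq> reach W \<inter> orth_compl (reach W)" using subset_reach N(2) by blast
    then have "N \<subseteq> {0}" using orth_compl_Int by blast
    then show False using N(1) closed_csubspaceD(3)[OF coinv_closed] by blast
  qed
  then show "reach W = UNIV" by (intro orth_compl_eq_zero closed_reach)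
qed

end

context ps_iso_rep
begin

definition joint :: "'h set \<Rightarrow> bool"
  where "joint Z \<longleftrightarrow> inv_sub \<rho> Z \<and> (\<forall>i. Z \<subseteq> step i Z)"

lemma joint_A: "joint Z \<longleftrightarrow> (\<forall>i. A.coinv i Z)"
  by (simp add: joint_def A.coinv_def)

lemma step_swap: "step i (step j X) = step j (step i X)"
  using step_commute by blast

lemma foldr_step_swap: "foldr step w (step i X) = step i (foldr step w X)"
  by (induction w) (simp_all add: step_swap)

lemma foldr_step_split: "foldr step (u @ i # v) X = step i (foldr step (u @ v) X)"
  by (simp add: foldr_step_swap)

lemma foldr_step_mono: "X \<subseteq> Y \<Longrightarrow> foldr step w X \<subseteq> foldr step w Y"
  by (induction w) (simp_all add: A.step_mono)

lemma foldr_step_superset: "(\<And>i. Z \<subseteq> step i Z) \<Longrightarrow> Z \<subseteq> foldr step w Z"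
proof (induction w)
  case (Cons i w)
  then show ?case using A.step_mono[of Z "foldr step w Z" i] by fastforce
qed simp

lemma foldr_step_subset: "(\<And>i. step i Z \<subseteq> Z) \<Longrightarrow> foldr step w Z \<subseteq> Z"
proof (induction w)
  case (Cons i w)
  then show ?case using A.step_mono[of "foldr step w Z" Z i] by fastforce
qed simp

lemma inv_sub_foldr: "inv_sub \<rho> X \<Longrightarrow> inv_sub \<rho> (foldr step w X)"
  by (cases w) (auto simp: A.inv_sub_step)

lemma joint_word: "joint Z \<Longrightarrow> W.coinv w Z"
  using foldr_step_superset by (simp add: joint_def W.coinv_def word_step_eq)

end

section \<open>Subspaces reached along a word\<close>

locale ps_unitary_rep = ps_iso_rep p E \<iota> \<rho> S
  for p :: "'e::semigroup_mult \<Rightarrow> (nat, 'k::finite) vec"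
    and E :: "(nat, 'k) vec \<Rightarrow> ('a::unital_cstar_algebra, 'a, 'e) corr" and \<iota> :: "'a \<Rightarrow> 'e"
    and \<rho> :: "'a \<Rightarrow> 'h \<Rightarrow> 'h::chilbert_space" and S :: "'k \<Rightarrow> 'e \<Rightarrow> 'h \<Rightarrow> 'h" +
  assumes step_full: "\<And>i. step i UNIV = UNIV"
begin

sublocale FA: full_action \<rho> "gen_fibre E i" "S i" for i
  by unfold_locales (rule step_full)

lemma word_step_full: "word_step w UNIV = UNIV"
  unfolding word_step_eq[OF inv_sub_UNIV] by (induction w) (simp_all add: step_full)

sublocale FW: full_action \<rho> "E (word_deg w)" "word_op w" for w
  by unfold_locales (rule word_step_full)

abbreviation word_reach :: "'k list \<Rightarrow> 'h set \<Rightarrow> 'h set"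
  where "word_reach w \<equiv> full_action.reach (E (word_deg w)) (word_op w)"

lemma joint_inter: "joint Y \<Longrightarrow> joint Z \<Longrightarrow> joint (Y \<inter> Z)"
  using FA.coinv_inter by (simp add: joint_A)

text \<open>Every letter enlarges the reach, since steps commute and Y is jointly coinvariant. So do
  the letters of c other than one occurrence of i together; hence \<open>step i\<close> of the reach
  lies in \<open>word_step c\<close> of the reach, which is in the reach.\<close>

lemma step_word_reach:
  assumes c: "set c = UNIV" and Y: "joint Y"
  shows "step i (word_reach c Y) = word_reach c Y"
proof -
  let ?L = "word_reach c Y"
  have Yi: "inv_sub \<rho> Y" "\<And>i. Y \<subseteq> step i Y" using Y by (auto simp: joint_def)
  have L: "inv_sub \<rho> ?L" by (rule FW.inv_sub_reach[OF Yi(1)])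
  have up: "?L \<subseteq> step j ?L" for j
  proof -
    have "(word_step c ^^ r) Y \<subseteq> step j ((word_step c ^^ r) Y)" for r
    proof (induction r)
      case (Suc r)
      have inv: "inv_sub \<rho> ((word_step c ^^ r) Y)" by (rule FW.inv_sub_steps[OF Yi(1)])
      show ?case using foldr_step_mono[OF Suc, of c]
        by (simp add: word_step_eq[OF inv] foldr_step_swap)
    qed (simp add: Yi)
    then have "(word_step c ^^ r) Y \<subseteq> step j ?L" for r
      using A.step_mono[OF FW.steps_subset_reach[where w = c and W = Y and r = r], of j] by blast
    then show ?thesis by (subst (1) FW.reach_def) (intro closed_cspan_minimal A.closed_step, blast)
  qed
  obtain u v where uv: "c = u @ i # v" using c split_list[of i c] by auto
  have "?L \<subseteq> foldr step (u @ v) ?L" by (rule foldr_step_superset[OF up])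
  then have "step i ?L \<subseteq> step i (foldr step (u @ v) ?L)" by (rule A.step_mono)
  also have "\<dots> = word_step c ?L"
    unfolding word_step_eq[OF L] foldr_step_split[symmetric] uv[symmetric] ..
  also have "\<dots> \<subseteq> ?L" by (rule FW.step_reach_subset)
  finally show ?thesis using up by blast
qed

text \<open>Equality in \<open>step_word_reach\<close> gives both: one inclusion makes the reach
  coinvariant, the other its complement.\<close>

lemma joint_orth_reach:
  assumes c: "set c = UNIV" and Y: "joint Y"
  shows "joint (word_reach c Y)" "joint (orth_compl (word_reach c Y))"
  using FA.coinv_orth[of "word_reach c Y"] step_word_reach[OF c Y] FW.inv_sub_reach[of Y c] Y
  by (auto simp: joint_def A.coinv_def)

text \<open>The least subspace \<open>W\<close> that is coinvariant and cyclic for a word containing every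
  generator is contained in the adjoint translate \<open>D\<close> of \<open>W\<close> under each generator, because
  \<open>D\<close> is again coinvariant and cyclic; by adjunction \<open>W \<subseteq> step i X\<close> implies \<open>W \<subseteq> X\<close>, and
  cancelling all other letters of the word from \<open>W \<subseteq> word_step c W\<close> leaves \<open>W \<subseteq> step i W\<close>.\<close>

lemma least_cyclic_joint:
  assumes c: "set c = UNIV" and V: "joint V" and W: "W.coinv c W" "W \<subseteq> V" "word_reach c W = UNIV"
    and least: "\<And>Z. W.coinv c Z \<Longrightarrow> word_reach c Z = UNIV \<Longrightarrow> W \<subseteq> Z"
  shows "joint W"
proof -
  have Wi: "inv_sub \<rho> W" "W \<subseteq> foldr step c W" using W(1) by (auto simp: W.coinv_def word_step_eq)
  have Wcl: "closed_csubspace W" by (rule inv_subD(1)[OF Wi(1)])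
  have cancel: "W \<subseteq> X" if X: "inv_sub \<rho> X" "W \<subseteq> step i X" for i X
  proof -
    let ?D = "A.costep i W"
    have D: "inv_sub \<rho> ?D" by (rule A.inv_sub_costep)
    have WD: "W \<subseteq> step i ?D" using FA.galois[OF Wcl D, of i] by simp
    have "W \<subseteq> step i (foldr step c ?D)"
      using Wi(2) foldr_step_mono[OF WD, of c] by (simp add: foldr_step_swap)
    then have cD: "W.coinv c ?D"
      using FA.galois[OF Wcl inv_sub_foldr[OF D], of i c] D by (simp add: W.coinv_def word_step_eq)
    let ?M = "word_reach c ?D"
    have M: "inv_sub \<rho> ?M" by (rule FW.inv_sub_reach[OF D])
    have Mst: "foldr step c ?M = ?M"
      using FW.step_reach[of ?D c] cD word_step_eq[OF M] by (simp add: W.coinv_def)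
    have "W \<subseteq> step i ?M" using WD A.step_mono[OF FW.subset_reach[of ?D c], of i] by blast
    moreover have "word_step c (step i ?M) = step i ?M"
      using word_step_eq[OF A.inv_sub_step] foldr_step_swap Mst by simp
    \<comment> \<open>\<open>step i ?M\<close> contains W and is fixed by the word, so cyclicity of
      W makes it everything; applying the remaining letters of the word then turns \<open>?M\<close>
      into everything too.\<close>
    ultimately have "word_reach c W \<subseteq> step i ?M" by (intro FW.reach_minimal) simp_all
    then have full: "step i ?M = UNIV" using W(3) by blast
    obtain u v where uv: "c = u @ i # v" using c split_list[of i c] by auto
    have "?M = foldr step (u @ v) (step i ?M)"
      using Mst unfolding uv foldr_step_split foldr_step_swap by simp
    also have "\<dots> = UNIV" unfolding full using word_step_full[of "u @ v"] by (simp add: word_step_eq)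
    finally have "W \<subseteq> ?D" using least[OF cD] by simp
    then show ?thesis using FA.galois[OF Wcl X(1), of i] X(2) by blast
  qed
  have cancel_word: "W \<subseteq> X" if "inv_sub \<rho> X" "W \<subseteq> foldr step w X" for w X
    using that(2)
  proof (induction w)
    case (Cons i w)
    then show ?case using cancel[OF inv_sub_foldr[OF that(1), of w], of i] by simp
  qed simp
  have "W \<subseteq> step i W" for i
  proof -
    obtain u v where uv: "c = u @ i # v" using c split_list[of i c] by auto
    have "W \<subseteq> foldr step (u @ v) (step i W)"
      using Wi(2) unfolding uv foldr_step_split foldr_step_swap .
    then show ?thesis by (rule cancel_word[OF A.inv_sub_step])
  qed
  then show ?thesis using Wi(1) by (simp add: joint_def)
qed

end

subsection \<open>Dilations of fully coisometric representations\<close>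

lemma iso_action_of_isometric_rep:
  assumes F: "correspondence F" and rep: "representation F UNIV T \<rho>" and iso: "isometric_rep F UNIV T \<rho>"
  shows "iso_action \<rho> F T"
proof -
  have alg: "algebra_rep UNIV \<rho>" and bd: "\<And>\<xi>. \<xi> \<in> car F \<Longrightarrow> bounded_op UNIV (T \<xi>)"
    and bimod: "\<And>a b \<xi> h. \<xi> \<in> car F \<Longrightarrow> T (lact F a (ract F \<xi> b)) h = \<rho> a (T \<xi> (\<rho> b h))"
    using rep by (simp_all add: representation_def)
  interpret star_rep \<rho> by unfold_locales (rule alg)
  have one: "ract F \<xi> 1 = \<xi>" if "\<xi> \<in> car F" for \<xi>
    using F that by (simp add: correspondence_def hilbert_module_def)
  show ?thesis
  proof (intro iso_action.intro iso_action_axioms.intro star_rep_axioms correspondence_semi_corr F)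
    show "cinner (T \<xi> h) (T \<eta> k) = cinner h (\<rho> (ip F \<xi> \<eta>) k)" if "\<xi> \<in> car F" "\<eta> \<in> car F" for \<xi> \<eta> h k
      using adj_on(2)[OF closed_csubspace_UNIV bd[OF that(1)], of h "T \<eta> k"] iso that
      by (simp add: isometric_rep_def)
    show "T (lact F a \<xi>) h = \<rho> a (T \<xi> h)" if "\<xi> \<in> car F" for \<xi> a h
      using bimod[OF that, of a 1 h] one[OF that] by simp
  qed
qed

context full_action
begin

lemma coinv_orth_iff:
  "coinv Z \<longleftrightarrow> closed_csubspace Z \<and> (\<forall>a. \<forall>x\<in>orth_compl Z. \<rho> a x \<in> orth_compl Z) \<and>
    (\<forall>\<xi>\<in>car F. \<forall>x\<in>orth_compl Z. T \<xi> x \<in> orth_compl Z)"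
  using inv_sub_iff_orth[of Z] coinv_iff[of Z] inv_subD(1)[of Z] unfolding coinv_def by blast

lemma rep_gens_bounded: "Q \<in> rep_gens F T \<rho> \<Longrightarrow> bounded_op UNIV Q"
  using T_bounded rho_bounded by (auto simp: rep_gens_def)

lemma op_alg_rep_gens:
  "op_alg UNIV (rep_gens F T \<rho>) (wot_closure UNIV (gen_alg (rep_gens F T \<rho>)))"
  by (intro op_alg_gen_alg closed_csubspace_UNIV rep_gens_bounded)

lemma coinvariant_rep_gens:
  "coinvariant UNIV (wot_closure UNIV (gen_alg (rep_gens F T \<rho>))) Z \<longleftrightarrow> coinv Z"
  unfolding op_alg.coinvariant_iff[OF op_alg_rep_gens] coinv_orth_iff
  by (auto simp: rep_gens_def)

lemma cyclic_rep_gens: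
  assumes "coinv Y"
  shows "cyclic UNIV (wot_closure UNIV (gen_alg (rep_gens F T \<rho>))) Y \<longleftrightarrow> reach Y = UNIV"
proof -
  note cyc = op_alg.cyclic_iff[OF op_alg_rep_gens subset_UNIV]
  have "inv_sub \<rho> (reach Y)" using assms by (intro inv_sub_reach) (simp add: coinv_def)
  then have "\<rho> a x \<in> reach Y" if "x \<in> reach Y" for a x using that by (rule inv_subD(2))
  moreover have "T \<xi> x \<in> reach Y" if "\<xi> \<in> car F" "x \<in> reach Y" for \<xi> x
    using T_step[OF that] step_reach_subset by blast
  ultimately have "\<forall>Q\<in>rep_gens F T \<rho>. \<forall>x\<in>reach Y. Q x \<in> reach Y" by (auto simp: rep_gens_def)
  moreover have "reach Y \<subseteq> M" if "closed_csubspace M" "Y \<subseteq> M" "\<forall>Q\<in>rep_gens F T \<rho>. \<forall>x\<in>M. Q x \<in> M" for M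
    using that by (intro reach_minimal step_minimal) (auto simp: rep_gens_def)
  moreover have "Y \<subseteq> reach Y" by (rule subset_reach)
  ultimately show ?thesis unfolding cyc using closed_reach[of Y] by (metis subset_UNIV top.extremum_uniqueI)
qed

end

context ps_unitary_rep
begin

abbreviation gens_S :: "('h \<Rightarrow> 'h) set"
  where "gens_S \<equiv> ps_gens E S \<rho>"

lemma gens_S_bounded: "Q \<in> gens_S \<Longrightarrow> bounded_op UNIV Q"
  using A.T_bounded rho_bounded by (auto simp: ps_gens_def)

lemma joint_orth_iff:
  "joint Z \<longleftrightarrow> closed_csubspace Z \<and> (\<forall>Q\<in>gens_S. \<forall>x\<in>orth_compl Z. Q x \<in> orth_compl Z)"
  unfolding joint_A FA.coinv_orth_iff ps_gens_def by blast

sublocale alg: op_alg UNIV gens_S "gen_alg gens_S"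
  by (intro op_alg_gen_alg closed_csubspace_UNIV gens_S_bounded)

sublocale wot: op_alg UNIV gens_S "wot_closure UNIV (gen_alg gens_S)"
  by (intro op_alg_gen_alg closed_csubspace_UNIV gens_S_bounded)

lemma coinvariant_alg: "coinvariant UNIV (gen_alg gens_S) Z \<longleftrightarrow> joint Z"
  by (simp add: alg.coinvariant_iff joint_orth_iff)

lemma coinvariant_wot: "coinvariant UNIV (wot_closure UNIV (gen_alg gens_S)) Z \<longleftrightarrow> joint Z"
  by (simp add: wot.coinvariant_iff joint_orth_iff)

lemma joint_adj: "joint Z \<Longrightarrow> Q \<in> gen_alg gens_S \<Longrightarrow> x \<in> Z \<Longrightarrow> adj_on UNIV Q x \<in> Z"
  unfolding coinvariant_alg[symmetric] coinvariant_def by blast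

lemma jointI:
  "closed_csubspace Z \<Longrightarrow> (\<And>Q x. Q \<in> gen_alg gens_S \<Longrightarrow> x \<in> Z \<Longrightarrow> adj_on UNIV Q x \<in> Z) \<Longrightarrow> joint Z"
  unfolding coinvariant_alg[symmetric] coinvariant_def by blast

lemma joint_closed: "joint Z \<Longrightarrow> closed_csubspace Z"
  by (simp add: joint_def inv_sub_def)

lemma adj_lin: "Q \<in> gen_alg gens_S \<Longrightarrow> linear_within UNIV (adj_on UNIV Q)"
  by (intro linear_within_adj_on closed_csubspace_UNIV alg.gen_alg_bounded)

lemma proj_adj:
  assumes "joint L" "joint (orth_compl L)" "Q \<in> gen_alg gens_S"
  shows "proj L (adj_on UNIV Q x) = adj_on UNIV Q (proj L x)"
proof -
  interpret L: closed_sub L by unfold_locales (rule joint_closed[OF assms(1)])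
  note lin = adj_lin[OF assms(3)]
  have "adj_on UNIV Q (x - proj L x) \<in> orth_compl L" by (rule joint_adj[OF assms(2,3) L.proj_orth])
  then show ?thesis
    using joint_adj[OF assms(1,3) L.proj_mem] linear_within_diff[OF lin closed_csubspaceD(1)[OF closed_csubspace_UNIV], of x "proj L x"]
    by (intro L.proj_unique) simp_all
qed

text \<open>The projection onto a reducing subspace commutes with all adjoints; finite dimension
  ensures that the image is closed.\<close>

lemma joint_proj_image:
  assumes "joint L" "joint (orth_compl L)" "fin_dim Y" "joint Y"
  shows "fin_dim (proj L ` Y)" "joint (proj L ` Y)"
proof -
  interpret L: closed_sub L by unfold_locales (rule joint_closed[OF assms(1)])
  show fin: "fin_dim (proj L ` Y)" by (intro fin_dim_image assms L.proj_add L.proj_scaleC)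
  show "joint (proj L ` Y)"
  proof (rule jointI[OF fin_dim_closed[OF fin]])
    fix Q z assume Q: "Q \<in> gen_alg gens_S" and "z \<in> proj L ` Y"
    then obtain y where y: "y \<in> Y" "z = proj L y" by blast
    show "adj_on UNIV Q z \<in> proj L ` Y"
      unfolding y(2) proj_adj[OF assms(1,2) Q, symmetric] by (intro imageI joint_adj[OF assms(4) Q y(1)])
  qed
qed

end

lemma direct_sum_eq_cspan:
  assumes "finite \<V>" "\<And>Y. Y \<in> \<V> \<Longrightarrow> csubspace (Y::'h::chilbert_space set)"
  shows "direct_sum \<V> = cspan (\<Union>\<V>)"
proof
  show "direct_sum \<V> \<subseteq> cspan (\<Union>\<V>)"
  proof
    fix x assume "x \<in> direct_sum \<V>"
    then obtain v where v: "x = (\<Sum>Y\<in>\<V>. v Y)" "\<forall>Y\<in>\<V>. v Y \<in> Y" unfolding direct_sum_def by blast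
    have "v Y \<in> cspan (\<Union>\<V>)" if "Y \<in> \<V>" for Y
      unfolding cspan_def using v(2) that by (intro cvec.span_base) blast
    then show "x \<in> cspan (\<Union>\<V>)" unfolding v(1) by (intro csubspace_sum csubspace_cspan)
  qed
  have "csubspace (direct_sum \<V>)"
    unfolding csubspace_iff
  proof (intro conjI ballI allI)
    show "0 \<in> direct_sum \<V>"
      unfolding direct_sum_def using csubspaceD(1)[OF assms(2)] by (intro CollectI exI[of _ "\<lambda>_. 0"]) simp
    show "x + y \<in> direct_sum \<V>" if xy: "x \<in> direct_sum \<V>" "y \<in> direct_sum \<V>" for x y
    proof -
      obtain v w where "x = (\<Sum>Y\<in>\<V>. v Y)" "\<forall>Y\<in>\<V>. v Y \<in> Y" "y = (\<Sum>Y\<in>\<V>. w Y)" "\<forall>Y\<in>\<V>. w Y \<in> Y"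
        using xy unfolding direct_sum_def by blast
      then show ?thesis unfolding direct_sum_def using csubspaceD(2)[OF assms(2)]
        by (intro CollectI exI[of _ "\<lambda>Y. v Y + w Y"]) (simp add: sum.distrib)
    qed
    show "c *\<^sub>C x \<in> direct_sum \<V>" if x: "x \<in> direct_sum \<V>" for c x
    proof -
      obtain v where "x = (\<Sum>Y\<in>\<V>. v Y)" "\<forall>Y\<in>\<V>. v Y \<in> Y" using x unfolding direct_sum_def by blast
      then show ?thesis unfolding direct_sum_def using csubspaceD(3)[OF assms(2)]
        by (intro CollectI exI[of _ "\<lambda>Y. c *\<^sub>C v Y"]) (simp add: cvec.scale_sum_right)
    qed
  qed
  moreover have "y \<in> direct_sum \<V>" if "Y \<in> \<V>" "y \<in> Y" for y Y
    unfolding direct_sum_def using assms that csubspaceD(1)[OF assms(2)]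
    by (intro CollectI exI[of _ "\<lambda>Z. if Z = Y then y else 0"]) simp
  ultimately show "cspan (\<Union>\<V>) \<subseteq> direct_sum \<V>"
    unfolding cspan_def csubspace_def by (intro cvec.span_minimal) blast+
qed

lemma word_deg_nth: "word_deg w $ j = count_list w j"
  by (induction w) (simp_all add: word_deg_def axis_def)

lemma count_list_replicate: "count_list (replicate n i) j = (if i = j then n else 0)"
  by (induction n) auto

lemma count_list_concat_replicate:
  "distinct L \<Longrightarrow> count_list (concat (map (\<lambda>i. replicate (f i) i) L)) j = (if j \<in> set L then f j else 0)"
  by (induction L) (auto simp: count_list_replicate)

lemma word_deg_canonical_word: "word_deg (canonical_word m) = m"
  by (simp add: vec_eq_iff word_deg_nth canonical_word_def count_list_concat_replicate)

lemma set_canonical_word: "(\<And>i. m $ i \<noteq> 0) \<Longrightarrow> set (canonical_word m) = UNIV"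
  by (auto simp: canonical_word_def)

section \<open>The dilation and its compression to V\<close>

locale ps_dilation = ps_iso_rep p E \<iota> \<rho> S
  for p :: "'e::semigroup_mult \<Rightarrow> (nat, 'k::{finite, linorder}) vec"
    and E :: "(nat, 'k) vec \<Rightarrow> ('a::unital_cstar_algebra, 'a, 'e) corr" and \<iota> :: "'a \<Rightarrow> 'e"
    and \<rho> :: "'a \<Rightarrow> 'h \<Rightarrow> 'h::chilbert_space" and S :: "'k \<Rightarrow> 'e \<Rightarrow> 'h \<Rightarrow> 'h" +
  fixes V :: "'h set" and A :: "'k \<Rightarrow> 'e \<Rightarrow> 'h \<Rightarrow> 'h" and \<sigma> :: "'a \<Rightarrow> 'h \<Rightarrow> 'h"
  assumes fin: "fin_dim V" and A_rep: "ps_representation E V A \<sigma>"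
    and coiso: "ps_fully_coisometric E V A \<sigma>" and dil: "minimal_isometric_dilation E \<iota> S \<rho> V A \<sigma>"
begin

sublocale V: closed_sub V by unfold_locales (rule fin_dim_closed[OF fin])

lemma dilates: "dilates (gen_fibre E i) (S i) \<rho> V (A i) \<sigma>"
  using dil by (simp add: minimal_isometric_dilation_def ps_dilates_def)

lemma dil_facts:
  shows rho_V: "h \<in> V \<Longrightarrow> \<rho> a h \<in> V" and sigma_eq: "h \<in> V \<Longrightarrow> \<sigma> a h = \<rho> a h"
    and rho_orth: "\<rho> a ` orth_compl V \<subseteq> orth_compl V"
    and S_orth: "\<xi> \<in> car (gen_fibre E i) \<Longrightarrow> S i \<xi> ` orth_compl V \<subseteq> orth_compl V"
    and A_eq: "\<xi> \<in> car (gen_fibre E i) \<Longrightarrow> h \<in> V \<Longrightarrow> A i \<xi> h = proj V (S i \<xi> h)"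
  using dilates[of i] unfolding dilates_def image_subset_iff by metis+

lemma joint_V: "joint V"
  unfolding joint_def
proof (intro conjI allI)
  show "inv_sub \<rho> V" using rho_V V.closed_csubspace by (simp add: inv_sub_def)
  fix i
  have "algebra_rep V \<sigma>" using A_rep by (simp add: ps_representation_def representation_def)
  then show "V \<subseteq> step i V"
    using coiso by (intro A.coisometric_subset_step[OF V.closed_csubspace _ dilates])
      (simp_all add: ps_fully_coisometric_def)
qed

lemma tilde_subtensor:
  assumes c: "c \<in> subtensor (E (word_deg w)) hs V" shows "tw w c \<in> word_step w V"
proof -
  obtain u where u: "c \<in> car (E (word_deg w) \<otimes>\<^sub>m hs)" "u \<in> c" "\<And>n x h. (x, h) \<in> set (u n) \<Longrightarrow> h \<in> V"
    using c unfolding subtensor_def by blast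
  interpret F: semi_module "formal_tensor (E (word_deg w)) hs"
    by (intro semi_module_formal_tensor E_semi_module hs.semi_corr_axioms)
  have "u \<in> cauchy_seqs (formal_tensor (E (word_deg w)) hs)"
    using F.mem_compl u(1,2) unfolding tensor_def by blast
  from F.cauchy_range[OF this] have "set (u n) \<subseteq> car (E (word_deg w)) \<times> car hs" for n
    by (auto simp: image_subset_iff)
  then have x: "x \<in> car (E (word_deg w))" if "(x, h) \<in> set (u n)" for x h n using that by blast
  have "(\<Sum>(x, h)\<leftarrow>us. word_op w x h) \<in> word_step w V" if "set us \<subseteq> set (u n)" for us n
    using that
  proof (induction us)
    case (Cons xh us)
    obtain x' h' where xh: "xh = (x', h')" by fastforce
    have "word_op w x' h' \<in> word_step w V" using Cons.prems x u(3) unfolding xh by (intro W.T_step) auto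
    then show ?case using Cons unfolding xh by (simp add: closed_csubspaceD(4)[OF W.closed_step])
  qed (simp add: closed_csubspaceD(3)[OF W.closed_step])
  then have "(\<Sum>(x, h)\<leftarrow>u n. word_op w x h) \<in> word_step w V" for n by blast
  moreover have "ip_map (E (word_deg w)) (tw w)" using good_word[of w] by (simp add: good_word_def)
  then have "(\<lambda>n. \<Sum>(x, h)\<leftarrow>u n. word_op w x h) \<longlonglongrightarrow> tw w c"
    unfolding word_op_def using ip_map_tendsto[OF E_semi_corr _ u(1,2)] by simp
  ultimately show ?thesis by (rule closed_sequentially[OF closed_csubspaceD(2)[OF W.closed_step]])
qed

lemma words_span: "closed_cspan (\<Union>w. word_step w V) = UNIV"
proof -
  have tw: "tw w ` subtensor (E (word_deg w)) hs V \<subseteq> (\<Union>w. word_step w V)" for w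
    using tilde_subtensor[of _ w] by (intro image_subsetI UN_I[OF UNIV_I])
  have "ps_tilde E \<iota> UNIV S \<rho> n ` subtensor (E n) hs V \<subseteq> (\<Union>w. word_step w V)" for n
    using tw[of "canonical_word n"] by (simp only: ps_tilde_def word_deg_canonical_word)
  then have "closed_cspan (\<Union>n. ps_tilde E \<iota> UNIV S \<rho> n ` subtensor (E n) hs V) \<subseteq> closed_cspan (\<Union>w. word_step w V)"
    by (intro closed_cspan_mono) blast
  then show ?thesis using dil by (auto simp: minimal_isometric_dilation_def)
qed

text \<open>Coinvariance of V and commutation put each translate of V inside its own
  \<open>step i\<close>, and the translates are total by minimality of the dilation.\<close>

lemma step_UNIV: "step i UNIV = UNIV"
proof -
  have V: "inv_sub \<rho> V" "V \<subseteq> step i V" using joint_V by (auto simp: joint_def)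
  have "word_step w V \<subseteq> step i UNIV" for w
    using foldr_step_mono[OF V(2), of w] A.step_mono[OF subset_UNIV, of i "foldr step w V"]
    unfolding word_step_eq[OF V(1)] foldr_step_swap by blast
  then have "closed_cspan (\<Union>w. word_step w V) \<subseteq> step i UNIV" by (intro closed_cspan_minimal A.closed_step) blast
  then show ?thesis unfolding words_span by blast
qed

sublocale ps_unitary_rep p E \<iota> \<rho> S
  by unfold_locales (rule step_UNIV)

text \<open>By \<open>step_word_reach\<close> the reach along c is invariant under every letter, so
  it contains the translates of V along all words, and these are total.\<close>

lemma reach_V:
  assumes "set c = UNIV" shows "word_reach c V = UNIV"
proof -
  have V: "inv_sub \<rho> V" using joint_V by (simp add: joint_def)
  have "word_step w V \<subseteq> word_reach c V" for w
    using foldr_step_mono[OF FW.subset_reach[of V c], of w] foldr_step_subset[of "word_reach c V" w]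
      step_word_reach[OF assms joint_V] unfolding word_step_eq[OF V] by blast
  then have "closed_cspan (\<Union>w. word_step w V) \<subseteq> word_reach c V" by (intro closed_cspan_minimal FW.closed_reach) blast
  then show ?thesis unfolding words_span by blast
qed

abbreviation gens_A :: "('h \<Rightarrow> 'h) set"
  where "gens_A \<equiv> ps_gens E A \<sigma>"

sublocale comp: op_alg V gens_A "gen_alg gens_A"
proof (intro op_alg_gen_alg V.closed_csubspace)
  show "bounded_op V Q" if "Q \<in> gens_A" for Q
    using that A_rep by (auto simp: ps_gens_def ps_representation_def representation_def algebra_rep_def)
qed

text \<open>For Y inside V, pairing with Y does not see components orthogonal to V, so P_V may be
  dropped from B; and T keeps vectors orthogonal to V orthogonal to V, hence to Y. Below V,
  coinvariance for the compression and for the dilation thus agree.\<close>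

lemma compression_orth:
  assumes T: "linear_within UNIV T" "T ` orth_compl V \<subseteq> orth_compl V" and Y: "Y \<subseteq> V"
    and B: "\<And>x. x \<in> V \<Longrightarrow> B x = proj V (T x)"
  shows "(\<forall>x\<in>V \<inter> orth_compl Y. B x \<in> orth_compl Y) \<longleftrightarrow> (\<forall>x\<in>orth_compl Y. T x \<in> orth_compl Y)"
proof -
  have pr: "proj V z \<in> orth_compl Y \<longleftrightarrow> z \<in> orth_compl Y" for z
  proof -
    have "cinner y (proj V z) = cinner y z" if "y \<in> Y" for y
      using V.cinner_proj_swap[of y z] V.proj_id[of y] that Y by auto
    then show ?thesis by (simp add: orth_compl_def)
  qed
  have "T x \<in> orth_compl Y" if L: "\<forall>x\<in>V \<inter> orth_compl Y. B x \<in> orth_compl Y" and x: "x \<in> orth_compl Y" for x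
  proof -
    have "B (proj V x) \<in> orth_compl Y" using L x pr by simp
    then have "T (proj V x) \<in> orth_compl Y" using B pr by simp
    moreover have "T (x - proj V x) \<in> orth_compl Y"
      using T(2) V.proj_orth orth_compl_antimono[OF Y] by blast
    moreover have "T x = T (proj V x) + T (x - proj V x)"
      using linear_withinD(2)[OF T(1), of "proj V x" "x - proj V x"] by simp
    ultimately show ?thesis using closed_csubspaceD(4)[OF closed_csubspace_orth_compl] by metis
  qed
  then show ?thesis using B pr by auto
qed

lemma coinvariant_comp: "coinvariant V (gen_alg gens_A) Y \<longleftrightarrow> Y \<subseteq> V \<and> joint Y"
proof (cases "Y \<subseteq> V")
  case True
  have lin: "linear_within UNIV Q" if "bounded_op UNIV Q" for Q :: "'h \<Rightarrow> 'h"
    using that by (simp add: bounded_op_def linear_within_def)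
  have S: "(\<forall>x\<in>V \<inter> orth_compl Y. A i \<xi> x \<in> orth_compl Y) \<longleftrightarrow> (\<forall>x\<in>orth_compl Y. S i \<xi> x \<in> orth_compl Y)"
    if "\<xi> \<in> car (gen_fibre E i)" for i \<xi>
    by (intro compression_orth True lin A.T_bounded S_orth A_eq that)
  have R: "(\<forall>x\<in>V \<inter> orth_compl Y. \<sigma> a x \<in> orth_compl Y) \<longleftrightarrow> (\<forall>x\<in>orth_compl Y. \<rho> a x \<in> orth_compl Y)" for a
    using V.proj_id rho_V by (intro compression_orth True lin rho_bounded rho_orth) (simp add: sigma_eq)
  have "(\<forall>Q\<in>gens_A. \<forall>x\<in>V \<inter> orth_compl Y. Q x \<in> orth_compl Y) \<longleftrightarrow>
      (\<forall>Q\<in>gens_S. \<forall>x\<in>orth_compl Y. Q x \<in> orth_compl Y)"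
    unfolding ps_gens_def ball_Un using S R by simp
  then show ?thesis unfolding comp.coinvariant_iff joint_orth_iff using True by blast
qed (auto simp: coinvariant_def)

text \<open>If the reach of Y had a non-zero complement, this coinvariant complement would meet V in
  a non-zero K. The complement of K in V is invariant under the generators and contains Y, against
  cyclicity.\<close>

lemma reach_if_cyclic:
  assumes c: "set c = UNIV" and Y: "joint Y" "Y \<subseteq> V" and cyc: "cyclic V (gen_alg gens_A) Y"
  shows "word_reach c Y = UNIV"
proof (rule orth_compl_eq_zero[OF FW.closed_reach])
  let ?N = "orth_compl (word_reach c Y)"
  have N: "joint ?N" by (rule joint_orth_reach(2)[OF c Y(1)])
  show "?N = {0}"
  proof (rule ccontr)
    assume ne: "?N \<noteq> {0}"
    let ?K = "?N \<inter> V"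
    have K: "?K \<noteq> {0}"
      using FW.coinv_meets_full[OF fin joint_word[OF joint_V] reach_V[OF c] joint_word[OF joint_V] reach_V[OF c]
        joint_word[OF N] ne] by simp
    have "coinvariant V (gen_alg gens_A) ?K" unfolding coinvariant_comp using joint_inter[OF N joint_V] by simp
    then have A: "A x \<in> orth_compl ?K" if "A \<in> gens_A" "x \<in> V \<inter> orth_compl ?K" for A x
      using that unfolding comp.coinvariant_iff by blast
    have "A x \<in> V" if "A \<in> gens_A" "x \<in> V" for A x
      using comp.gens_bounded that by (auto simp: bounded_op_def)
    moreover have "Y \<subseteq> orth_compl ?K"
      using FW.subset_reach[of Y c] orth_complD(2) by (intro subsetI orth_complI) blast
    ultimately have "V \<inter> orth_compl ?K = V"
      using cyc A Y(2) unfolding comp.cyclic_iff[OF Y(2)]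
      by (elim allE[of _ "V \<inter> orth_compl ?K"]) (auto intro: closed_csubspace_Int V.closed_csubspace)
    then have "?K \<subseteq> {0}" using orth_compl_Int[of _ ?K] by blast
    then show False using K V.sub(3) closed_csubspaceD(3)[OF joint_closed[OF N]] by blast
  qed
qed

end

section \<open>The sum of the minimal coinvariant subspaces\<close>

locale ps_dilation_family = ps_dilation p E \<iota> \<rho> S V A \<sigma>
  for p :: "'e::semigroup_mult \<Rightarrow> (nat, 'k::{finite, linorder}) vec"
    and E :: "(nat, 'k) vec \<Rightarrow> ('a::unital_cstar_algebra, 'a, 'e) corr" and \<iota> :: "'a \<Rightarrow> 'e"
    and \<rho> :: "'a \<Rightarrow> 'h \<Rightarrow> 'h::chilbert_space" and S :: "'k \<Rightarrow> 'e \<Rightarrow> 'h \<Rightarrow> 'h"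
    and V :: "'h set" and A :: "'k \<Rightarrow> 'e \<Rightarrow> 'h \<Rightarrow> 'h" and \<sigma> :: "'a \<Rightarrow> 'h \<Rightarrow> 'h" +
  fixes \<V> :: "'h set set"
  assumes family_finite: "finite \<V>" and family: "maximal_orthogonal_minimal_family V (gen_alg gens_A) \<V>"
begin

abbreviation Vhat :: "'h set"
  where "Vhat \<equiv> direct_sum \<V>"

lemma minimal_iff:
  "minimal_coinvariant V (gen_alg gens_A) N \<longleftrightarrow>
    N \<subseteq> V \<and> joint N \<and> N \<noteq> {0} \<and> (\<forall>M. joint M \<and> M \<noteq> {0} \<and> M \<subseteq> N \<longrightarrow> M = N)"
  unfolding minimal_coinvariant_def coinvariant_comp by blast

lemma familyD:
  assumes "Y \<in> \<V>"
  shows "minimal_coinvariant V (gen_alg gens_A) Y" "joint Y" "Y \<subseteq> V" "Y \<noteq> {0}" "csubspace Y" "fin_dim Y"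
    "\<And>M. joint M \<Longrightarrow> M \<noteq> {0} \<Longrightarrow> M \<subseteq> Y \<Longrightarrow> M = Y"
proof -
  show m: "minimal_coinvariant V (gen_alg gens_A) Y"
    using family assms unfolding maximal_orthogonal_minimal_family_def orthogonal_minimal_family_def by blast
  show Y: "joint Y" "Y \<subseteq> V" "Y \<noteq> {0}" "\<And>M. joint M \<Longrightarrow> M \<noteq> {0} \<Longrightarrow> M \<subseteq> Y \<Longrightarrow> M = Y"
    using m unfolding minimal_iff by blast+
  show "csubspace Y" by (rule closed_csubspaceD(1)[OF joint_closed[OF Y(1)]])
  then show "fin_dim Y" by (rule fin_dim_subspace[OF fin _ Y(2)])
qed

lemma Vhat_cspan: "Vhat = cspan (\<Union>\<V>)"
  by (intro direct_sum_eq_cspan family_finite familyD)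

lemma Vhat_minimal:
  assumes "\<And>Y. Y \<in> \<V> \<Longrightarrow> Y \<subseteq> X" "csubspace X" shows "Vhat \<subseteq> X"
  unfolding Vhat_cspan cspan_def using assms by (intro cvec.span_minimal) (auto simp: csubspace_def)

lemma family_subset: "Y \<in> \<V> \<Longrightarrow> Y \<subseteq> Vhat"
  unfolding Vhat_cspan cspan_def using cvec.span_superset[of "\<Union>\<V>"] by blast

lemma Vhat_subset: "Vhat \<subseteq> V"
  by (intro Vhat_minimal familyD V.sub)

lemma Vhat_fin: "fin_dim Vhat"
  by (intro fin_dim_subspace[OF fin] Vhat_subset) (simp add: Vhat_cspan)

lemma joint_Vhat: "joint Vhat"
proof -
  have cl: "closed Vhat" by (rule closed_csubspaceD(2)[OF fin_dim_closed[OF Vhat_fin]])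
  have eq: "closed_cspan (\<Union>\<V>) = Vhat" using cl by (simp add: closed_cspan_def flip: Vhat_cspan)
  have "A.coinv i (closed_cspan (\<Union>\<V>))" for i
    using familyD(2) by (intro A.coinv_closed_cspan) (simp add: joint_A)
  then show ?thesis unfolding eq by (simp add: joint_A)
qed

text \<open>If an invariant M containing \<open>Vhat\<close> were proper, its complement in V would
  contain a minimal coinvariant subspace orthogonal to the whole family, against maximality.\<close>

lemma Vhat_cyclic: "cyclic V (gen_alg gens_A) Vhat"
  unfolding comp.cyclic_iff[OF Vhat_subset]
proof (intro allI impI, elim conjE)
  fix M assume M: "closed_csubspace M" "M \<subseteq> V" "Vhat \<subseteq> M" "\<forall>A\<in>gens_A. \<forall>x\<in>M. A x \<in> M"
  interpret M: closed_sub M by unfold_locales (rule M)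
  let ?K = "V \<inter> orth_compl M"
  have Kcl: "closed_csubspace ?K" by (intro closed_csubspace_Int V.closed_csubspace closed_csubspace_orth_compl)
  have KM: "V \<inter> orth_compl ?K = M"
  proof
    show "M \<subseteq> V \<inter> orth_compl ?K" using M(2) orth_complD(2) by (intro subsetI IntI orth_complI) auto
    have "x \<in> M" if "x \<in> V" "x \<in> orth_compl ?K" for x
      using M.mem_iff_orth[OF that(1) M(2) V.closed_csubspace] orth_complD(1)[OF that(2)] by blast
    then show "V \<inter> orth_compl ?K \<subseteq> M" by blast
  qed
  have "M \<subseteq> orth_compl ?K" using KM by blast
  then have "coinvariant V (gen_alg gens_A) ?K"
    unfolding comp.coinvariant_iff KM using Kcl M(4) by blast
  then have K: "joint ?K" by (simp add: coinvariant_comp)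
  have "?K = {0}"
  proof (rule ccontr)
    assume ne: "?K \<noteq> {0}"
    define P where "P Y \<longleftrightarrow> joint Y \<and> Y \<noteq> {0} \<and> Y \<subseteq> V" for Y
    have "P ?K" using K ne by (simp add: P_def)
    moreover have "csubspace Y \<and> Y \<subseteq> V" if "P Y" for Y
      using that closed_csubspaceD(1)[OF joint_closed] by (auto simp: P_def)
    ultimately obtain N where N: "P N" "N \<subseteq> ?K" "\<And>Y. P Y \<Longrightarrow> Y \<subseteq> N \<Longrightarrow> Y = N"
      using csubspace_minimal_exists[OF fin, of P ?K] by metis
    have minN: "minimal_coinvariant V (gen_alg gens_A) N"
      unfolding minimal_iff using N(1,3) by (auto simp: P_def)
    have NM: "cinner x y = 0" "cinner y x = 0" if "x \<in> N" "y \<in> M" for x y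
      using that N(2) orth_complD by blast+
    have "orthogonal_minimal_family V (gen_alg gens_A) \<V>"
      using family unfolding maximal_orthogonal_minimal_family_def by blast
    moreover have "\<forall>Y\<in>\<V>. \<forall>x\<in>N. \<forall>y\<in>Y. cinner x y = 0 \<and> cinner y x = 0"
      using NM family_subset M(3) by blast
    ultimately have "orthogonal_minimal_family V (gen_alg gens_A) (insert N \<V>)"
      using minN unfolding orthogonal_minimal_family_def pairwise_insert by blast
    then have "insert N \<V> = \<V>" using family unfolding maximal_orthogonal_minimal_family_def by blast
    then have "N \<subseteq> M" using family_subset M(3) by blast
    then have "N \<subseteq> {0}" using N(2) orth_compl_Int[of _ M] by blast
    then show False using N(1) closed_csubspaceD(3)[OF joint_closed] by (auto simp: P_def)
  qed
  then have "V \<inter> orth_compl ?K = V" by (simp add: orth_compl_def cinner.zero_left)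
  then show "M = V" using KM by simp
qed

lemma Vhat_subset_cyclic:
  assumes c: "set c = UNIV" and Z: "joint Z" "word_reach c Z = UNIV"
  shows "Vhat \<subseteq> Z"
proof (rule Vhat_minimal[OF _ closed_csubspaceD(1)[OF joint_closed[OF Z(1)]]])
  fix Y assume Y: "Y \<in> \<V>"
  have "Y \<inter> (Z \<inter> V) \<noteq> {0}"
    by (rule FW.coinv_meets_full[OF fin joint_word[OF joint_V] reach_V[OF c] joint_word[OF Z(1)] Z(2)
      joint_word[OF familyD(2)[OF Y]] familyD(4)[OF Y]])
  moreover have "joint (Y \<inter> (Z \<inter> V))" by (intro joint_inter joint_V Z familyD(2)[OF Y])
  ultimately have "Y \<inter> (Z \<inter> V) = Y" using familyD(7)[OF Y] by blast
  then show "Y \<subseteq> Z" by blast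
qed

lemma generating_word: obtains c :: "'k list" where "set c = UNIV"
  using finite_list[OF finite[of "UNIV :: 'k set"]] by blast

theorem minimal_cyclic_comp: "minimal_cyclic_coinvariant V (gen_alg gens_A) Y \<longleftrightarrow> Y = Vhat"
proof (rule minimal_cyclic_coinvariant_unique[OF _ Vhat_cyclic])
  show "coinvariant V (gen_alg gens_A) Vhat" using Vhat_subset joint_Vhat by (simp add: coinvariant_comp)
  fix Z assume Z: "coinvariant V (gen_alg gens_A) Z" "cyclic V (gen_alg gens_A) Z"
  obtain c :: "'k list" where c: "set c = UNIV" by (rule generating_word)
  have "joint Z" "Z \<subseteq> V" using Z(1) by (simp_all add: coinvariant_comp)
  then show "Vhat \<subseteq> Z" by (intro Vhat_subset_cyclic[OF c] reach_if_cyclic[OF c] Z(2))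
qed

text \<open>A competitor Z is known to be coinvariant only for the single correspondence, so
  \<open>Vhat_subset_cyclic\<close> does not apply to it directly. The least such subspace W,
  however, is jointly coinvariant by \<open>least_cyclic_joint\<close>, and so lies between
  \<open>Vhat\<close> and Z.\<close>

theorem minimal_cyclic_word:
  assumes c: "set c = UNIV"
  shows "minimal_cyclic_coinvariant UNIV
    (wot_closure UNIV (gen_alg (rep_gens (E (word_deg c)) (word_op c) \<rho>))) Y \<longleftrightarrow> Y = Vhat"
proof (rule minimal_cyclic_coinvariant_unique)
  have R: "word_reach c Vhat = UNIV" by (rule reach_if_cyclic[OF c joint_Vhat Vhat_subset Vhat_cyclic])
  show "coinvariant UNIV (wot_closure UNIV (gen_alg (rep_gens (E (word_deg c)) (word_op c) \<rho>))) Vhat"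
    unfolding FW.coinvariant_rep_gens by (rule joint_word[OF joint_Vhat])
  show "cyclic UNIV (wot_closure UNIV (gen_alg (rep_gens (E (word_deg c)) (word_op c) \<rho>))) Vhat"
    unfolding FW.cyclic_rep_gens[OF joint_word[OF joint_Vhat]] by (rule R)
  fix Z assume "coinvariant UNIV (wot_closure UNIV (gen_alg (rep_gens (E (word_deg c)) (word_op c) \<rho>))) Z"
    and cyc: "cyclic UNIV (wot_closure UNIV (gen_alg (rep_gens (E (word_deg c)) (word_op c) \<rho>))) Z"
  then have Z: "W.coinv c Z" by (simp add: FW.coinvariant_rep_gens)
  have RZ: "word_reach c Z = UNIV" using cyc by (simp add: FW.cyclic_rep_gens[OF Z])
  obtain W where W: "W.coinv c W" "W \<subseteq> V" "word_reach c W = UNIV"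
    "\<And>Z. W.coinv c Z \<Longrightarrow> word_reach c Z = UNIV \<Longrightarrow> W \<subseteq> Z"
    using FW.minimal_span[OF fin joint_word[OF joint_V] reach_V[OF c]] by metis
  have "joint W" by (rule least_cyclic_joint[OF c joint_V W])
  then have "Vhat \<subseteq> W" by (rule Vhat_subset_cyclic[OF c _ W(3)])
  also have "W \<subseteq> Z" by (rule W(4)[OF Z RZ])
  finally show "Vhat \<subseteq> Z" .
qed

text \<open>The projection onto the reducing subspace generated by \<open>N\<close> maps every minimal summand
  into \<open>N\<close>, since its image, if non-zero, meets \<open>N\<close>.\<close>

lemma joint_complement:
  assumes N: "joint N" "N \<subseteq> Vhat"
  shows "joint (Vhat \<inter> orth_compl N)"
proof -
  obtain c :: "'k list" where c: "set c = UNIV" by (rule generating_word)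
  let ?L = "word_reach c N"
  have L: "joint ?L" "joint (orth_compl ?L)" by (rule joint_orth_reach[OF c N(1)])+
  interpret L: closed_sub ?L by unfold_locales (rule joint_closed[OF L(1)])
  interpret N: closed_sub N by unfold_locales (rule joint_closed[OF N(1)])
  have Nfin: "fin_dim N" by (rule fin_dim_subspace[OF Vhat_fin N.sub(1) N(2)])
  have pre: "csubspace {x. proj ?L x \<in> N}"
    using N.sub(3-5) L.proj_id[OF L.sub(3)] unfolding csubspace_iff by (simp add: L.proj_add L.proj_scaleC)
  have "Vhat \<subseteq> {x. proj ?L x \<in> N}"
  proof (rule Vhat_minimal[OF _ pre])
    fix Y assume Y: "Y \<in> \<V>"
    let ?R = "proj ?L ` Y"
    note R = joint_proj_image[OF L familyD(6)[OF Y] familyD(2)[OF Y]]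
    \<comment> \<open>The part of Y sent into N. When the image of Y is non-zero, this part is
      jointly coinvariant and non-zero, so it is all of Y by minimality.\<close>
    let ?U = "Y \<inter> {x. proj ?L x \<in> N}"
    show "Y \<subseteq> {x. proj ?L x \<in> N}"
    proof (cases "?R = {0}")
      case True
      have "proj ?L x = 0" if "x \<in> Y" for x using imageI[OF that, of "proj ?L"] True by simp
      then show ?thesis using N.sub(3) by auto
    next
      case False
      have "?R \<subseteq> ?L" using L.proj_mem by blast
      then have "?R \<inter> N \<noteq> {0}"
        using FW.coinv_meets[of N c ?R] Nfin joint_word[OF N(1), of c] joint_word[OF R(2), of c] False
        by (simp add: W.coinv_def)
      then obtain y where y: "y \<in> Y" "proj ?L y \<in> N" "proj ?L y \<noteq> 0"
        using N.sub(3) closed_csubspaceD(3)[OF joint_closed[OF R(2)]] by auto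
      have "y \<noteq> 0" using y(3) L.proj_id[OF L.sub(3)] by auto
      then have ne: "?U \<noteq> {0}" using y by blast
      have sub: "csubspace ?U" using familyD(5)[OF Y] pre by (auto simp: csubspace_iff)
      have "joint ?U"
      proof (rule jointI)
        show "closed_csubspace ?U" by (rule fin_dim_closed[OF fin_dim_subspace[OF familyD(6)[OF Y] sub]]) blast
        show "adj_on UNIV Q x \<in> ?U" if "Q \<in> gen_alg gens_S" "x \<in> ?U" for Q x
          using that joint_adj[OF familyD(2)[OF Y]] joint_adj[OF N(1)] by (simp add: proj_adj[OF L])
      qed
      then have "?U = Y" using familyD(7)[OF Y _ ne] by blast
      then show ?thesis by blast
    qed
  qed
  then have PN: "proj ?L x \<in> N" if "x \<in> Vhat" for x using that by blast
  have "x \<in> orth_compl ?L" if x: "x \<in> Vhat" "x \<in> orth_compl N" for x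
  proof -
    have "cinner n (proj ?L x) = 0" if n: "n \<in> N" for n
      using L.cinner_proj_swap[of n x] L.proj_id[of n] FW.subset_reach[of N c] n orth_complD(1)[OF x(2) n] by auto
    then have "proj ?L x = 0" using orth_compl_Int[OF PN[OF x(1)]] by (simp add: orth_compl_def)
    then show ?thesis by (simp add: L.proj_zero_iff)
  qed
  \<comment> \<open>Within \<open>Vhat\<close> the complement of N is cut out by the complement of a
    reducing subspace, which is jointly coinvariant.\<close>
  then have "Vhat \<inter> orth_compl N = Vhat \<inter> orth_compl ?L"
    using orth_compl_antimono[OF FW.subset_reach[of N c]] by blast
  then show ?thesis using joint_inter[OF joint_Vhat L(2)] by simp
qed

section \<open>The C*-algebra of adjoints on \<open>Vhat\<close>\<close>

definition adj_alg :: "('h \<Rightarrow> 'h) set"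
  where "adj_alg = adj_on UNIV ` gen_alg gens_S"

lemma adj_gen_alg:
  assumes "Q \<in> gen_alg gens_S" shows "cinner (Q x) y = cinner x (adj_on UNIV Q y)"
  by (rule adj_on(2)[OF closed_csubspace_UNIV alg.gen_alg_bounded[OF assms] UNIV_I])

lemma adj_gen_alg_eqI:
  assumes "Q \<in> gen_alg gens_S" "\<And>x y. cinner (Q x) y = cinner x (B y)"
  shows "B \<in> adj_alg"
proof -
  have "adj_on UNIV Q y = B y" for y
    using assms(2) by (intro adj_on_eqI closed_csubspace_UNIV alg.gen_alg_bounded[OF assms(1)]) auto
  then have "adj_on UNIV Q = B" by blast
  then show ?thesis using assms(1) unfolding adj_alg_def by blast
qed

sublocale red: reductive_algebra Vhat adj_alg
proof
  show "fin_dim Vhat" by (rule Vhat_fin)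
  show "linear_within Vhat B" if "B \<in> adj_alg" for B
    using that joint_adj[OF joint_Vhat] adj_lin by (auto simp: adj_alg_def linear_within_def)
  show "id \<in> adj_alg" by (rule adj_gen_alg_eqI[OF gen_alg.gen_id]) simp
  show "(\<lambda>x. B x + C x) \<in> adj_alg" if BC: "B \<in> adj_alg" "C \<in> adj_alg" for B C
  proof -
    obtain Q R where "B = adj_on UNIV Q" "C = adj_on UNIV R" "Q \<in> gen_alg gens_S" "R \<in> gen_alg gens_S"
      using BC unfolding adj_alg_def by blast
    then show ?thesis
      by (intro adj_gen_alg_eqI[OF gen_alg.gen_add[of Q _ R]]) (simp_all add: cinner.add_left cinner.add_right adj_gen_alg)
  qed
  show "(\<lambda>x. c *\<^sub>C B x) \<in> adj_alg" if B: "B \<in> adj_alg" for B c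
  proof -
    obtain Q where "B = adj_on UNIV Q" "Q \<in> gen_alg gens_S" using B unfolding adj_alg_def by blast
    \<comment> \<open>Taking adjoints conjugates scalars, hence \<open>cnj c\<close>.\<close>
    then show ?thesis
      by (intro adj_gen_alg_eqI[OF gen_alg.gen_scaleC[of Q _ "cnj c"]]) (simp_all add: cinner_scaleC_left cinner_scaleC_right adj_gen_alg)
  qed
  show "B \<circ> C \<in> adj_alg" if BC: "B \<in> adj_alg" "C \<in> adj_alg" for B C
  proof -
    obtain Q R where "B = adj_on UNIV Q" "C = adj_on UNIV R" "Q \<in> gen_alg gens_S" "R \<in> gen_alg gens_S"
      using BC unfolding adj_alg_def by blast
    \<comment> \<open>Taking adjoints reverses products, hence R before Q.\<close>
    then show ?thesis
      by (intro adj_gen_alg_eqI[OF gen_alg.gen_comp[of R _ Q]]) (simp_all add: adj_gen_alg)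
  qed
  fix N B x
  assume N: "csubspace N" "N \<subseteq> Vhat" "\<And>B x. B \<in> adj_alg \<Longrightarrow> x \<in> N \<Longrightarrow> B x \<in> N"
    and B: "B \<in> adj_alg" and x: "x \<in> Vhat \<inter> orth_compl N"
  have "joint N"
    using N(3) by (intro jointI fin_dim_closed[OF fin_dim_subspace[OF Vhat_fin N(1,2)]]) (auto simp: adj_alg_def)
  from joint_complement[OF this N(2)] show "B x \<in> orth_compl N"
    using joint_adj[of "Vhat \<inter> orth_compl N" _ x] x B by (auto simp: adj_alg_def)
qed

text \<open>The weak closure adds nothing on \<open>Vhat\<close>: for Z in the commutant,
  commutation of Z with the adjoint of Q is an equality between two matrix coefficients of Q. These
  are approximated simultaneously from the generated algebra, where the equality holds, and
  \<open>bicommutant\<close> does the rest.\<close>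

lemma wot_adj_mem:
  assumes Q: "Q \<in> wot_closure UNIV (gen_alg gens_S)"
  shows "\<exists>B\<in>adj_alg. \<forall>x\<in>Vhat. B x = adj_on UNIV Q x"
proof (rule red.bicommutant)
  let ?D = "adj_on UNIV Q"
  have Qb: "bounded_op UNIV Q" by (rule wot.C_bounded[OF Q])
  have inv: "?D x \<in> Vhat" if "x \<in> Vhat" for x
    using coinvariant_wot[of Vhat] joint_Vhat Q that unfolding coinvariant_def by blast
  show "linear_within Vhat ?D"
    using linear_within_adj_on[OF closed_csubspace_UNIV Qb] inv by (simp add: linear_within_def)
  fix Z x assume Z: "red.comm Z" and x: "x \<in> Vhat"
  have Zlin: "linear_within Vhat Z" using Z by (simp add: red.comm_def)
  note Zb = fin_dim_bounded_op[OF Vhat_fin Zlin]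
  let ?A = "adj_on Vhat Z"
  have ZA: "cinner (Z u) y = cinner u (?A y)" if "u \<in> Vhat" for u y
    by (rule adj_on(2)[OF red.closed_csubspace Zb that])
  have D: "cinner (Q u) y = cinner u (?D y)" for u y
    by (rule adj_on(2)[OF closed_csubspace_UNIV Qb UNIV_I])
  have Zx: "Z x \<in> Vhat" by (rule linear_withinD(1)[OF Zlin x])
  have "cinner (?D (Z x)) y = cinner (Z (?D x)) y" if y: "y \<in> Vhat" for y
  proof -
    let ?d = "cinner (Z x) (Q y) - cinner x (Q (?A y))"
    have "cmod ?d \<le> 0"
    proof (rule field_le_epsilon)
      fix e :: real assume e: "e > 0"
      have "\<forall>F e. finite F \<and> F \<subseteq> UNIV \<times> UNIV \<and> 0 < e \<longrightarrow>
          (\<exists>R\<in>gen_alg gens_S. \<forall>(u, v)\<in>F. cmod (cinner v (Q u - R u)) < e)"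
        using Q unfolding wot_closure_def by blast
      \<comment> \<open>The two pairs are those occurring in \<open>?d\<close>; with R in place of Q
        the difference is 0, so half of e for each pair suffices.\<close>
      from this[rule_format, of "{(y, Z x), (?A y, x)}" "e / 2"] e
      have "\<exists>R\<in>gen_alg gens_S. \<forall>(u, v)\<in>{(y, Z x), (?A y, x)}. cmod (cinner v (Q u - R u)) < e / 2" by simp
      then obtain R where R: "R \<in> gen_alg gens_S" "cmod (cinner (Z x) (Q y - R y)) < e / 2"
        "cmod (cinner x (Q (?A y) - R (?A y))) < e / 2" by auto
      have adjR: "cinner u (R v) = cinner (adj_on UNIV R u) v" for u v
        using adj_gen_alg[OF R(1), of v u] cinner_commute[of u "R v"] cinner_commute[of "adj_on UNIV R u" v] by simp
      have R_mem: "adj_on UNIV R \<in> adj_alg" using R(1) by (simp add: adj_alg_def)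
      have "cinner (Z x) (R y) = cinner (Z (adj_on UNIV R x)) y"
        using Z R_mem x by (simp add: adjR red.comm_def)
      also have "\<dots> = cinner x (R (?A y))"
        using ZA[OF joint_adj[OF joint_Vhat R(1) x]] by (simp add: adjR)
      finally have "?d = cinner (Z x) (Q y - R y) - cinner x (Q (?A y) - R (?A y))"
        by (simp add: cinner.diff_right)
      also have "cmod \<dots> \<le> cmod (cinner (Z x) (Q y - R y)) + cmod (cinner x (Q (?A y) - R (?A y)))"
        by (rule norm_triangle_ineq4)
      finally show "cmod ?d \<le> 0 + e" using R(2,3) by simp
    qed
    then have "cinner (Z x) (Q y) = cinner x (Q (?A y))" by simp
    moreover have "cinner (?D (Z x)) y = cinner (Z x) (Q y)"
      using D[of y "Z x"] cinner_commute[of "Z x" "Q y"] cinner_commute[of "?D (Z x)" y] by simp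
    moreover have "cinner (Z (?D x)) y = cinner x (Q (?A y))"
      using ZA[OF inv[OF x], of y] D[of "?A y" x] cinner_commute[of x "Q (?A y)"] cinner_commute[of "?D x" "?A y"] by simp
    ultimately show ?thesis by simp
  qed
  moreover have "?D (Z x) \<in> Vhat" "Z (?D x) \<in> Vhat" using inv Zx linear_withinD(1)[OF Zlin] x by auto
  then have "?D (Z x) - Z (?D x) \<in> Vhat" by (rule red.sub(6))
  ultimately have "cinner (?D (Z x) - Z (?D x)) (?D (Z x) - Z (?D x)) = 0" by (simp add: cinner.diff_left)
  then show "?D (Z x) = Z (?D x)" by simp
qed

theorem cstar_restriction:
  "cstar_algebra_on Vhat {restrict (adj_on UNIV Q) Vhat | Q. Q \<in> wot_closure UNIV (gen_alg gens_S)}"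
proof -
  have "{restrict (adj_on UNIV Q) Vhat | Q. Q \<in> wot_closure UNIV (gen_alg gens_S)} = {restrict B Vhat | B. B \<in> adj_alg}"
  proof (intro equalityI subsetI)
    fix R assume "R \<in> {restrict (adj_on UNIV Q) Vhat | Q. Q \<in> wot_closure UNIV (gen_alg gens_S)}"
    then obtain Q where Q: "R = restrict (adj_on UNIV Q) Vhat" "Q \<in> wot_closure UNIV (gen_alg gens_S)" by blast
    then obtain B where "B \<in> adj_alg" "\<forall>x\<in>Vhat. B x = adj_on UNIV Q x" using wot_adj_mem by blast
    then show "R \<in> {restrict B Vhat | B. B \<in> adj_alg}" using Q(1) by (auto intro!: exI[of _ B])
  qed (use wot.gens_subset in \<open>auto simp: adj_alg_def\<close>)
  then show ?thesis using red.cstar by simp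
qed

end

theorem theorem3p19:
  fixes p :: "'e::semigroup_mult \<Rightarrow> (nat, 'k::{finite, linorder}) vec"
    and E :: "(nat, 'k) vec \<Rightarrow> ('a::unital_cstar_algebra, 'a, 'e) corr"
    and \<iota> :: "'a \<Rightarrow> 'e"
    and V :: "'h::chilbert_space set"
    and A S :: "'k \<Rightarrow> 'e \<Rightarrow> 'h \<Rightarrow> 'h"
    and \<sigma> \<rho> :: "'a \<Rightarrow> 'h \<Rightarrow> 'h"
    and \<AA> \<SS> :: "('h \<Rightarrow> 'h) set"
    and \<V> :: "'h set set"
    and Vhat :: "'h set"
  assumes "product_system p E \<iota>"
    and "closed_csubspace V" and "fin_dim V"
    and "ps_representation E V A \<sigma>" and "ps_fully_coisometric E V A \<sigma>"
    and "minimal_isometric_dilation E \<iota> S \<rho> V A \<sigma>"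
    and "\<AA> = gen_alg (ps_gens E A \<sigma>)"
    and "\<SS> = wot_closure UNIV (gen_alg (ps_gens E S \<rho>))"
    and "finite \<V>" and "maximal_orthogonal_minimal_family V \<AA> \<V>"
    and "Vhat = direct_sum \<V>"
  shows "(\<forall>Y. minimal_cyclic_coinvariant V \<AA> Y \<longleftrightarrow> Y = Vhat) \<and>
    (\<forall>T\<in>\<SS>. adj_on UNIV T ` Vhat \<subseteq> Vhat) \<and>
    cstar_algebra_on Vhat {restrict (adj_on UNIV T) Vhat | T. T \<in> \<SS>} \<and>
    (\<forall>m :: (nat, 'k) vec. (\<forall>i. m $ i \<noteq> 0) \<longrightarrow>
      (\<forall>W. minimal_cyclic_coinvariant UNIV
          (wot_closure UNIV (gen_alg (rep_gens (E m) (ps_rep_at E \<iota> UNIV S \<rho> m) \<rho>))) W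
        \<longleftrightarrow> W = Vhat))"
proof -
  have rep: "ps_representation E UNIV S \<rho>" and iso: "ps_isometric E UNIV S \<rho>"
    using assms(6) by (simp_all add: minimal_isometric_dilation_def)
  interpret prod_sys p E \<iota> by unfold_locales (rule assms(1))
  have act: "iso_action \<rho> (gen_fibre E i) (S i)" for i
    using ps_corr rep iso by (intro iso_action_of_isometric_rep) (auto simp: ps_representation_def ps_isometric_def)
  then interpret star_rep \<rho> by (simp add: iso_action_def)
  interpret ps_dilation_family p E \<iota> \<rho> S V A \<sigma> \<V>
    by (intro ps_dilation_family.intro ps_dilation_family_axioms.intro ps_dilation.intro ps_dilation_axioms.intro
      ps_iso_rep.intro ps_iso_rep_axioms.intro prod_sys_axioms star_rep_axioms act rep assms(3-6,9)
      assms(10)[unfolded assms(7)])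
  have Vh: "Vhat = direct_sum \<V>" by (rule assms(11))
  have "adj_on UNIV T ` direct_sum \<V> \<subseteq> direct_sum \<V>" if "T \<in> \<SS>" for T
    using coinvariant_wot[of "direct_sum \<V>"] joint_Vhat that unfolding assms(8) coinvariant_def by blast
  \<comment> \<open>The canonical word of m has degree m, and it contains every letter when no entry
    of m vanishes.\<close>
  moreover have "ps_rep_at E \<iota> UNIV S \<rho> m = word_op (canonical_word m)" for m
    by (simp add: fun_eq_iff ps_rep_at_def ps_tilde_def word_op_def word_deg_canonical_word)
  then have "minimal_cyclic_coinvariant UNIV
      (wot_closure UNIV (gen_alg (rep_gens (E m) (ps_rep_at E \<iota> UNIV S \<rho> m) \<rho>))) W \<longleftrightarrow> W = direct_sum \<V>"
    if "\<forall>i. m $ i \<noteq> 0" for m W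
    using minimal_cyclic_word[OF set_canonical_word[of m], of W] that by (simp add: word_deg_canonical_word)
  ultimately show ?thesis
    unfolding Vh assms(7) using minimal_cyclic_comp cstar_restriction by (simp add: assms(8))
qed

end
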